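(* Let $T\in(0,\infty)$, $\alpha\in(\frac13,\frac12]$, $\beta\in(0,\infty)$, $q\in(0,\infty]$, $m,n\in\mathbb N$, let $\mathbf X=(X,\mathbb X)\in\mathscr B^\alpha_{\Phi_\beta,q}([0,T];\mathbb R^n)$ and $(Y,Y')\in\mathscr D^{2\alpha;X}_{\Phi_{\beta/2},q/2}([0,T];\mathbb R^{m\times n})$, and set $\varXi_{s,t}=Y_s(X_t-X_s)+Y'_s\mathbb X_{s,t}$ for $(s,t)\in\triangle^2[0,T]$. Then the function $\mathcal I=\mathcal I_{\mathbf X}(Y,Y'):[0,T]\to\mathbb R^m$ obtained by sewing $\varXi$, i.e. the unique continuous function with $\mathcal I_0=0$ and $\delta\mathcal I-\varXi\in B^{3\alpha;2}_{\Phi_{\beta/3},q/3}([0,T];\mathbb R^m)$, is well-defined. Moreover, the map $(\bar Y,\bar Y')\mapsto(\mathcal I_{\mathbf X}(\bar Y,\bar Y'),\bar Y)$ is a linear map from $\mathscr D^{2\alpha;X}_{\Phi_{\beta/2},q/2}([0,T];\mathbb R^{m\times n})$ to $\mathscr D^{2\alpha;X}_{\Phi_{\beta/2},q/2}([0,T];\mathbb R^m)$; $$\lim_{N\to\infty}\|\delta\mathcal I-I^{\pi_N}\varXi\|_{B^{3\alpha;2}_{\Phi_{\beta/3},\bar q}}=0$$ for every $\bar q$ with $\bar q>\frac1{3\alpha}$, $\bar q\ge\frac q3$ and every sequence $\{\pi_N\}$ of partitions of $[0,1]$ with vanishing norms; and $$\|\delta\mathcal I-\varXi\|_{B^{3\alpha;2}_{\Phi_{\beta/3},q/3}}\le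 C\|\delta\varXi\|_{B^{3\alpha;3}_{\Phi_{\beta/3},q/3}}\le C'\Big(\|R^Y\|_{B^{2\alpha;2}_{\Phi_{\beta/2},q/2}}[X]_{B^\alpha_{\Phi_\beta,q}}+[Y']_{B^\alpha_{\Phi_\beta,q}}|||\mathbf X|||^2\Big),$$ $$[\mathcal I]_{B^\alpha_{\Phi_\beta,q}}\le C''\Big(\big(|Y_0|+[Y]_{B^\alpha_{\Phi_\beta,q}}+\|R^Y\|_{B^{2\alpha;2}_{\Phi_{\beta/2},q/2}}\big)[X]_{B^\alpha_{\Phi_\beta,q}}+\big(|Y'_0|+[Y']_{B^\alpha_{\Phi_\beta,q}}\big)|||\mathbf X|||^2\Big),$$ where $C,C',C''$ depend only on $\alpha,\beta,q,T$, and $C,C'$ are nondecreasing in $T$. Additionally, for every $p\in(\frac3\alpha,\infty)$, $$\|R^{\mathcal I}\|_{B^{2\alpha;2}_{\Phi_{\beta/2},q/2}}\le C\Big(|Y'_0|\,\|\mathbb X\|_{B^{2\alpha;2}_{\Phi_{\beta/2},q/2}}+T^{\alpha-\frac1p}\big(|||\mathbf X|||\vee|||\mathbf X|||^2\big)[(Y,Y')]_{\mathscr D^{2\alpha;X}_{\Phi_{\beta/2},q/2}}\Big),$$ where $R^{\mathcal I}_{s,t}=\delta\mathcal I_{s,t}-Y_s\delta X_{s,t}$ and $C$ depends only on $\alpha,\beta,p,q,T$ and is nondecreasing in $T$.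
   Context: **Orlicz norm.** For $\beta\in(0,\infty)$ put $x_\beta=((1-\beta)/\beta)^{1/\beta}$ if $\beta<1$, $x_\beta=0$ if $\beta\ge1$; $\Psi_\beta(x)=e^{x^\beta}-1$; $E_\beta(x)=\Psi_\beta(x)$ for $x\ge x_\beta$, $E_\beta(x)=\Psi_\beta(x_\beta)+\Psi_\beta'(x_\beta)(x-x_\beta)$ for $0\le x<x_\beta$; $\Phi_\beta(x)=E_\beta(x)-E_\beta(0)$. For a bounded interval $D$ and measurable $g$ on $D$ with values in a normed space, $\|g\|_{L^{\Phi_\beta}(D)}=\inf\{\lambda>0:\int_D\Phi_\beta(|g_r|/\lambda)\,\mathrm dr\le1\}$. **Besov-Orlicz spaces.** $\triangle^d[0,T]=\{(u_1,\dots,u_d)\in[0,T]^d:u_1\le\dots\le u_d\}$. For $f$ on $[0,T]$: $\delta f_{s,t}=f_t-f_s$; for $\varXi$ on $\triangle^2[0,T]$: $\delta\varXi_{s,u,t}=\varXi_{s,t}-\varXi_{s,u}-\varXi_{u,t}$. For measurable $\varXi$ on $\triangle^d[0,T]$ let $\omega^2_{\Phi_\beta}(\varXi,\tau)=\sup_{h\in[0,\tau]}\|\varXi_{\cdot,\cdot+h}\|_{L^{\Phi_\beta}([0,T-h])}$ ($d=2$), $\omega^3_{\Phi_\beta}(\varXi,\tau)=\sup_{\theta\in[0,1]}\sup_{h\in[0,\tau]}\|\varXi_{\cdot,\cdot+\theta h,\cdot+h}\|_{L^{\Phi_\beta}([0,T-h])}$ ($d=3$); $\|\varXi\|_{B^{\alpha;d}_{\Phi_\beta,q}}=\|\tau^{-\alpha}\omega^d_{\Phi_\beta}(\varXi,\tau)\|_{L^q([0,T],\mathrm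 d\tau/\tau)}$ for $\alpha\in(0,\infty)$, and $B^{\alpha;d}_{\Phi_\beta,q}$ is the space where it is finite (maps identified if for all $h$ (and all $\theta\in[0,1]$) they agree at $(r,r+h)$, resp. $(r,r+\theta h,r+h)$, for a.a. $r\in[0,T-h]$). For $\alpha\in(0,1)$: $[f]_{B^\alpha_{\Phi_\beta,q}}=\|\delta f\|_{B^{\alpha;2}_{\Phi_\beta,q}}$, and $B^\alpha_{\Phi_\beta,q}$ is the space of $f$ with $\|f\|_{L^{\Phi_\beta}([0,T])}+[f]_{B^\alpha_{\Phi_\beta,q}}<\infty$ (identified with their continuous representatives). Convention: $\infty/2=\infty/3=\infty$. **Rough paths.** $\mathscr B^\alpha_{\Phi_\beta,q}([0,T];\mathbb R^n)$ is the set of $\mathbf X=(X,\mathbb X)$ with $X\in B^\alpha_{\Phi_\beta,q}([0,T];\mathbb R^n)$, $\mathbb X\in B^{2\alpha;2}_{\Phi_{\beta/2},q/2}([0,T];\mathbb R^{n\times n})$ and Chen's relations $\delta\mathbb X_{s,u,t}=(\delta X_{s,u})(\delta X_{u,t})^\top$ for all $(s,u,t)\in\triangle^3[0,T]$ (continuous version of $\mathbb X$ used); $|||\mathbf X|||=[X]_{B^\alpha_{\Phi_\beta,q}}+\|\mathbb X\|^{1/2}_{B^{2\alpha;2}_{\Phi_{\beta/2},q/2}}$. **Controlled rough paths.** $\mathscr D^{2\alpha;X}_{\Phi_{\beta/2},q/2}([0,T];\mathbb V)$ is the set of pairs $(Y,Y')$ with $Y\in B^\alpha_{\Phi_\beta,q}([0,T];\mathbb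 V)$, $Y'\in B^\alpha_{\Phi_\beta,q}([0,T];\mathcal L(\mathbb R^n;\mathbb V))$ and $R^Y_{s,t}=\delta Y_{s,t}-Y'_s\delta X_{s,t}$ in $B^{2\alpha;2}_{\Phi_{\beta/2},q/2}$; $[(Y,Y')]_{\mathscr D^{2\alpha;X}_{\Phi_{\beta/2},q/2}}=[Y']_{B^\alpha_{\Phi_\beta,q}}+\|R^Y\|_{B^{2\alpha;2}_{\Phi_{\beta/2},q/2}}$. $\mathbb R^{m\times n}$ is identified with $\mathcal L(\mathbb R^n;\mathbb R^m)$, and $A\in\mathcal L(\mathbb R^n;\mathbb R^{m\times n})$ acts linearly on $\mathbb R^{n\times n}$ by $A(bc^\top)=(Ab)c$. Matrix spaces carry the Hilbert–Schmidt norm. **Partitions.** A partition of $[0,1]$ is $\pi=\{t_i\}_{i=0}^N$ with $0=t_0<\dots<t_N=1$, with norm $\max_i(t_{i+1}-t_i)$; vanishing norms means the norms tend to $0$. $(I^\pi\varXi)_{s,t}=\sum_{i=0}^{N-1}\varXi_{s+t_i(t-s),\,s+t_{i+1}(t-s)}$. *)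

theory Defs
  imports "HOL-Analysis.Analysis" "HOL-Probability.Essential_Supremum"
begin

section \<open>Euclidean spaces of arbitrary dimension inside one type\<close>

text \<open>
  The constants in the main theorem do not depend on the dimensions, so a single formula has to
  quantify first over the constants and then over the dimensions. Hence dimensions are values and
  not types: vectors are finitely supported families with the Euclidean norm, and the Euclidean
  space with coordinates indexed by a finite set \<open>J\<close> is the subspace \<open>euclid J\<close> of families that
  vanish outside \<open>J\<close>. With \<open>J = {..<n}\<close> this is \<open>\<real>\<^sup>n\<close>, with \<open>J = {..<m} \<times> {..<n}\<close> it is the
  space of \<open>m \<times> n\<close> matrices with the Hilbert--Schmidt norm.
\<close>

typedef 'i fvec = "{v :: 'i \<Rightarrow> real. finite {i. v i \<noteq> 0}}"
  morphisms coord Fvec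
  by (rule exI[of _ "\<lambda>_. 0"]) simp

setup_lifting type_definition_fvec

lemma finite_supp [simp]: "finite {i. coord v i \<noteq> 0}"
  using coord[of v] by simp

lemma fvec_eqI: "(\<And>i. coord v i = coord w i) \<Longrightarrow> v = w"
  by (simp add: coord_inject[symmetric] fun_eq_iff)

instantiation fvec :: (type) real_vector
begin

lift_definition zero_fvec :: "'a fvec" is "\<lambda>_. 0" by simp

lift_definition plus_fvec :: "'a fvec \<Rightarrow> 'a fvec \<Rightarrow> 'a fvec" is "\<lambda>v w i. v i + w i"
proof -
  fix v w :: "'a \<Rightarrow> real"
  assume "finite {i. v i \<noteq> 0}" "finite {i. w i \<noteq> 0}"
  then have "finite ({i. v i \<noteq> 0} \<union> {i. w i \<noteq> 0})" by blast
  then show "finite {i. v i + w i \<noteq> 0}"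
    by (rule rev_finite_subset) auto
qed

lift_definition minus_fvec :: "'a fvec \<Rightarrow> 'a fvec \<Rightarrow> 'a fvec" is "\<lambda>v w i. v i - w i"
proof -
  fix v w :: "'a \<Rightarrow> real"
  assume "finite {i. v i \<noteq> 0}" "finite {i. w i \<noteq> 0}"
  then have "finite ({i. v i \<noteq> 0} \<union> {i. w i \<noteq> 0})" by blast
  then show "finite {i. v i - w i \<noteq> 0}"
    by (rule rev_finite_subset) auto
qed

lift_definition uminus_fvec :: "'a fvec \<Rightarrow> 'a fvec" is "\<lambda>v i. - v i"
  by simp

lift_definition scaleR_fvec :: "real \<Rightarrow> 'a fvec \<Rightarrow> 'a fvec" is "\<lambda>r v i. r * v i"
  by (rule finite_subset) auto

instance
  by standard (transfer; simp add: fun_eq_iff algebra_simps)+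

end

lemma coord_simps [simp]:
  "coord 0 i = 0"
  "coord (v + w) i = coord v i + coord w i"
  "coord (v - w) i = coord v i - coord w i"
  "coord (- v) i = - coord v i"
  "coord (r *\<^sub>R v) i = r * coord v i"
  by (transfer; simp)+

instantiation fvec :: (type) real_inner
begin

definition inner_fvec :: "'a fvec \<Rightarrow> 'a fvec \<Rightarrow> real"
  where "inner_fvec v w = (\<Sum>i | coord v i \<noteq> 0. coord v i * coord w i)"

definition norm_fvec :: "'a fvec \<Rightarrow> real"
  where "norm_fvec v = sqrt (inner v v)"

definition dist_fvec :: "'a fvec \<Rightarrow> 'a fvec \<Rightarrow> real"
  where "dist_fvec v w = norm (v - w)"

definition sgn_fvec :: "'a fvec \<Rightarrow> 'a fvec"
  where "sgn_fvec v = v /\<^sub>R norm v"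

definition uniformity_fvec :: "('a fvec \<times> 'a fvec) filter"
  where "uniformity_fvec = (INF e\<in>{0<..}. principal {(v, w). dist v w < e})"

definition open_fvec :: "'a fvec set \<Rightarrow> bool"
  where "open_fvec U \<longleftrightarrow> (\<forall>v\<in>U. eventually (\<lambda>(v', w). v' = v \<longrightarrow> w \<in> U) uniformity)"

instance
proof
  fix u v w :: "'a fvec" and r :: real
  define A where "A = {i. coord u i \<noteq> 0} \<union> {i. coord v i \<noteq> 0} \<union> {i. coord w i \<noteq> 0}"
  have fin: "finite A" by (simp add: A_def)
  have eq: "x \<bullet> y = (\<Sum>i\<in>A. coord x i * coord y i)" if "{i. coord x i \<noteq> 0} \<subseteq> A" for x y
    unfolding inner_fvec_def using fin that by (intro sum.mono_neutral_left) auto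
  have sub: "{i. coord u i \<noteq> 0} \<subseteq> A" "{i. coord v i \<noteq> 0} \<subseteq> A" "{i. coord (u + v) i \<noteq> 0} \<subseteq> A"
    "{i. coord (r *\<^sub>R u) i \<noteq> 0} \<subseteq> A"
    by (auto simp: A_def)
  show "u \<bullet> v = v \<bullet> u"
    using sub by (simp add: eq mult.commute)
  show "(u + v) \<bullet> w = u \<bullet> w + v \<bullet> w"
    using sub by (simp add: eq algebra_simps sum.distrib)
  show "(r *\<^sub>R u) \<bullet> v = r * (u \<bullet> v)"
    using sub by (simp add: eq sum_distrib_left mult.assoc)
  show "0 \<le> u \<bullet> u"
    by (simp add: inner_fvec_def sum_nonneg)
  show "u \<bullet> u = 0 \<longleftrightarrow> u = 0"
    by (auto simp: inner_fvec_def sum_nonneg_eq_0_iff intro: fvec_eqI)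
qed (simp_all add: norm_fvec_def dist_fvec_def sgn_fvec_def uniformity_fvec_def open_fvec_def)

end

definition euclid :: "'i set \<Rightarrow> 'i fvec set"
  where "euclid J = {v. \<forall>i. i \<notin> J \<longrightarrow> coord v i = 0}"

text \<open>
  \<open>L(\<real>\<^sup>n; euclid J)\<close> is \<open>euclid (J \<times> {..<n})\<close> with the Hilbert--Schmidt norm; in particular
  \<open>L(\<real>\<^sup>n; \<real>\<^sup>m)\<close> is literally the space of \<open>m \<times> n\<close> matrices. \<open>app A b\<close> is \<open>A b\<close>, \<open>outer b c\<close> is
  \<open>b c\<^sup>T\<close>, and \<open>app2 A M\<close> is the linear action on matrices determined by \<open>A (b c\<^sup>T) = (A b) c\<close>,
  see \<open>app2_outer\<close>.
\<close>

lift_definition app :: "('i \<times> 'j) fvec \<Rightarrow> 'j fvec \<Rightarrow> 'i fvec"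
  is "\<lambda>A b i. \<Sum>j | b j \<noteq> 0. A (i, j) * b j"
proof -
  fix A :: "'i \<times> 'j \<Rightarrow> real" and b :: "'j \<Rightarrow> real"
  assume "finite {p. A p \<noteq> 0}"
  moreover have "{i. (\<Sum>j | b j \<noteq> 0. A (i, j) * b j) \<noteq> 0} \<subseteq> fst ` {p. A p \<noteq> 0}"
    by (force elim: sum.not_neutral_contains_not_neutral)
  ultimately show "finite {i. (\<Sum>j | b j \<noteq> 0. A (i, j) * b j) \<noteq> 0}"
    by (blast intro: finite_subset)
qed

lift_definition outer :: "'i fvec \<Rightarrow> 'j fvec \<Rightarrow> ('i \<times> 'j) fvec"
  is "\<lambda>b c (i, j). b i * c j"
proof -
  fix b :: "'i \<Rightarrow> real" and c :: "'j \<Rightarrow> real"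
  assume "finite {i. b i \<noteq> 0}" "finite {j. c j \<noteq> 0}"
  then have "finite ({i. b i \<noteq> 0} \<times> {j. c j \<noteq> 0})" by blast
  then show "finite {p. (case p of (i, j) \<Rightarrow> b i * c j) \<noteq> 0}"
    by (rule rev_finite_subset) auto
qed

lift_definition app2 :: "(('i \<times> 'k) \<times> 'j) fvec \<Rightarrow> ('j \<times> 'k) fvec \<Rightarrow> 'i fvec"
  is "\<lambda>A M i. \<Sum>(j, k) | M (j, k) \<noteq> 0. A ((i, k), j) * M (j, k)"
proof -
  fix A :: "('i \<times> 'k) \<times> 'j \<Rightarrow> real" and M :: "'j \<times> 'k \<Rightarrow> real"
  assume "finite {p. A p \<noteq> 0}"
  moreover have "{i. (\<Sum>(j, k) | M (j, k) \<noteq> 0. A ((i, k), j) * M (j, k)) \<noteq> 0}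
      \<subseteq> (fst \<circ> fst) ` {p. A p \<noteq> 0}"
    by (force elim: sum.not_neutral_contains_not_neutral)
  ultimately show "finite {i. (\<Sum>(j, k) | M (j, k) \<noteq> 0. A ((i, k), j) * M (j, k)) \<noteq> 0}"
    by (blast intro: finite_subset)
qed

lemma app2_outer: "app2 A (outer b c) = app (app A b) c"
proof (rule fvec_eqI)
  fix i
  have supp: "{(j, k). coord (outer b c) (j, k) \<noteq> 0} = {j. coord b j \<noteq> 0} \<times> {k. coord c k \<noteq> 0}"
    by (auto simp: outer.rep_eq)
  have "coord (app2 A (outer b c)) i =
      (\<Sum>(j, k) \<in> {j. coord b j \<noteq> 0} \<times> {k. coord c k \<noteq> 0}.
        coord A ((i, k), j) * (coord b j * coord c k))"
    unfolding app2.rep_eq supp by (simp add: outer.rep_eq)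
  also have "\<dots> = (\<Sum>j | coord b j \<noteq> 0. \<Sum>k | coord c k \<noteq> 0.
        coord A ((i, k), j) * (coord b j * coord c k))"
    by (rule sum.cartesian_product[symmetric])
  also have "\<dots> = (\<Sum>k | coord c k \<noteq> 0. \<Sum>j | coord b j \<noteq> 0.
        coord A ((i, k), j) * (coord b j * coord c k))"
    by (rule sum.swap)
  also have "\<dots> = coord (app (app A b) c) i"
    by (simp add: app.rep_eq sum_distrib_right mult.assoc)
  finally show "coord (app2 A (outer b c)) i = coord (app (app A b) c) i" .
qed

section \<open>Orlicz norms\<close>

definition orlicz_x :: "real \<Rightarrow> real"
  where "orlicz_x \<beta> = (if \<beta> < 1 then ((1 - \<beta>) / \<beta>) powr (1 / \<beta>) else 0)"

definition orlicz_Psi :: "real \<Rightarrow> real \<Rightarrow> real"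
  where "orlicz_Psi \<beta> x = exp (x powr \<beta>) - 1"

definition orlicz_E :: "real \<Rightarrow> real \<Rightarrow> real"
  where "orlicz_E \<beta> x =
    (if orlicz_x \<beta> \<le> x then orlicz_Psi \<beta> x
     else orlicz_Psi \<beta> (orlicz_x \<beta>) + deriv (orlicz_Psi \<beta>) (orlicz_x \<beta>) * (x - orlicz_x \<beta>))"

definition orlicz_Phi :: "real \<Rightarrow> real \<Rightarrow> real"
  where "orlicz_Phi \<beta> x = orlicz_E \<beta> x - orlicz_E \<beta> 0"

definition orlicz_norm :: "real \<Rightarrow> real set \<Rightarrow> (real \<Rightarrow> 'v::real_normed_vector) \<Rightarrow> ennreal"
  where "orlicz_norm \<beta> D g =
    (INF l\<in>{l::real. 0 < l \<and>
        (\<integral>\<^sup>+r\<in>D. ennreal (orlicz_Phi \<beta> (norm (g r) / l)) \<partial>lborel) \<le> 1}. ennreal l)"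

section \<open>Besov--Orlicz spaces\<close>

definition simplex2 :: "real \<Rightarrow> (real \<times> real) set"
  where "simplex2 T = {(s, t). 0 \<le> s \<and> s \<le> t \<and> t \<le> T}"

definition incr :: "(real \<Rightarrow> 'v::real_vector) \<Rightarrow> real \<Rightarrow> real \<Rightarrow> 'v"
  where "incr f s t = f t - f s"

definition incr2 :: "(real \<Rightarrow> real \<Rightarrow> 'v::real_vector) \<Rightarrow> real \<Rightarrow> real \<Rightarrow> real \<Rightarrow> 'v"
  where "incr2 \<Xi> s u t = \<Xi> s t - \<Xi> s u - \<Xi> u t"

definition modulus2 ::
    "real \<Rightarrow> real \<Rightarrow> (real \<Rightarrow> real \<Rightarrow> 'v::real_normed_vector) \<Rightarrow> real \<Rightarrow> ennreal"
  where "modulus2 T \<beta> \<Xi> \<tau> = (SUP h\<in>{0..\<tau>}. orlicz_norm \<beta> {0..T - h} (\<lambda>r. \<Xi> r (r + h)))"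

definition modulus3 ::
    "real \<Rightarrow> real \<Rightarrow> (real \<Rightarrow> real \<Rightarrow> real \<Rightarrow> 'v::real_normed_vector) \<Rightarrow> real \<Rightarrow> ennreal"
  where "modulus3 T \<beta> \<Xi> \<tau> =
    (SUP \<theta>\<in>{0..1}. SUP h\<in>{0..\<tau>}. orlicz_norm \<beta> {0..T - h} (\<lambda>r. \<Xi> r (r + \<theta> * h) (r + h)))"

text \<open>Power of an extended nonnegative real with exponent \<open>p > 0\<close>.\<close>

definition epowr :: "ennreal \<Rightarrow> real \<Rightarrow> ennreal"
  where "epowr x p = (if x = \<infinity> then \<infinity> else ennreal (enn2real x powr p))"

text \<open>The measure \<open>d\<tau>/\<tau>\<close> on \<open>[0,T]\<close>; the value of its density at the null set \<open>{0}\<close> is irrelevant.\<close>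

definition log_measure :: "real \<Rightarrow> real measure"
  where "log_measure T = density (restrict_space lborel {0..T}) (\<lambda>\<tau>. ennreal (1 / \<tau>))"

definition Lq_norm :: "real measure \<Rightarrow> ennreal \<Rightarrow> (real \<Rightarrow> ennreal) \<Rightarrow> ennreal"
  where "Lq_norm M q f =
    (if q = \<infinity> then esssup M f
     else epowr (\<integral>\<^sup>+\<tau>. epowr (f \<tau>) (enn2real q) \<partial>M) (1 / enn2real q))"

definition besov2_norm ::
    "real \<Rightarrow> real \<Rightarrow> real \<Rightarrow> ennreal \<Rightarrow> (real \<Rightarrow> real \<Rightarrow> 'v::real_normed_vector) \<Rightarrow> ennreal"
  where "besov2_norm T \<alpha> \<beta> q \<Xi> =
    Lq_norm (log_measure T) q (\<lambda>\<tau>. ennreal (\<tau> powr (-\<alpha>)) * modulus2 T \<beta> \<Xi> \<tau>)"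

definition besov3_norm ::
    "real \<Rightarrow> real \<Rightarrow> real \<Rightarrow> ennreal \<Rightarrow> (real \<Rightarrow> real \<Rightarrow> real \<Rightarrow> 'v::real_normed_vector) \<Rightarrow> ennreal"
  where "besov3_norm T \<alpha> \<beta> q \<Xi> =
    Lq_norm (log_measure T) q (\<lambda>\<tau>. ennreal (\<tau> powr (-\<alpha>)) * modulus3 T \<beta> \<Xi> \<tau>)"

text \<open>
  In the following spaces functions are constrained on \<open>[0,T]\<close>, respectively on the simplex, only.
  The argument \<open>V\<close> is the space of values. Elements of \<open>besov\<close> are the continuous representatives.
\<close>

definition besov2 ::
    "real \<Rightarrow> real \<Rightarrow> real \<Rightarrow> ennreal \<Rightarrow> 'v::real_normed_vector set \<Rightarrow> (real \<Rightarrow> real \<Rightarrow> 'v) set"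
  where "besov2 T \<alpha> \<beta> q V =
    {\<Xi>. (\<forall>(s, t)\<in>simplex2 T. \<Xi> s t \<in> V) \<and>
        (\<lambda>(s, t). \<Xi> s t) \<in> borel_measurable (restrict_space borel (simplex2 T)) \<and>
        besov2_norm T \<alpha> \<beta> q \<Xi> < \<infinity>}"

definition besov_seminorm ::
    "real \<Rightarrow> real \<Rightarrow> real \<Rightarrow> ennreal \<Rightarrow> (real \<Rightarrow> 'v::real_normed_vector) \<Rightarrow> ennreal"
  where "besov_seminorm T \<alpha> \<beta> q f = besov2_norm T \<alpha> \<beta> q (incr f)"

definition besov ::
    "real \<Rightarrow> real \<Rightarrow> real \<Rightarrow> ennreal \<Rightarrow> 'v::real_normed_vector set \<Rightarrow> (real \<Rightarrow> 'v) set"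
  where "besov T \<alpha> \<beta> q V =
    {f. f \<in> {0..T} \<rightarrow> V \<and> continuous_on {0..T} f \<and>
        orlicz_norm \<beta> {0..T} f + besov_seminorm T \<alpha> \<beta> q f < \<infinity>}"

section \<open>Rough paths and controlled rough paths\<close>

definition rough_paths ::
    "real \<Rightarrow> real \<Rightarrow> real \<Rightarrow> ennreal \<Rightarrow> nat
      \<Rightarrow> ((real \<Rightarrow> nat fvec) \<times> (real \<Rightarrow> real \<Rightarrow> (nat \<times> nat) fvec)) set"
  where "rough_paths T \<alpha> \<beta> q n =
    {(X, XX). X \<in> besov T \<alpha> \<beta> q (euclid {..<n}) \<and>
       XX \<in> besov2 T (2 * \<alpha>) (\<beta> / 2) (q / 2) (euclid ({..<n} \<times> {..<n})) \<and>
       continuous_on (simplex2 T) (\<lambda>(s, t). XX s t) \<and>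
       (\<forall>s u t. 0 \<le> s \<and> s \<le> u \<and> u \<le> t \<and> t \<le> T \<longrightarrow>
          incr2 XX s u t = outer (incr X s u) (incr X u t))}"

definition rough_path_norm ::
    "real \<Rightarrow> real \<Rightarrow> real \<Rightarrow> ennreal
      \<Rightarrow> (real \<Rightarrow> nat fvec) \<Rightarrow> (real \<Rightarrow> real \<Rightarrow> (nat \<times> nat) fvec) \<Rightarrow> ennreal"
  where "rough_path_norm T \<alpha> \<beta> q X XX =
    besov_seminorm T \<alpha> \<beta> q X + epowr (besov2_norm T (2 * \<alpha>) (\<beta> / 2) (q / 2) XX) (1 / 2)"

definition remainder ::
    "(real \<Rightarrow> nat fvec) \<Rightarrow> (real \<Rightarrow> 'i fvec) \<Rightarrow> (real \<Rightarrow> ('i \<times> nat) fvec)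
      \<Rightarrow> real \<Rightarrow> real \<Rightarrow> 'i fvec"
  where "remainder X Y Y' s t = incr Y s t - app (Y' s) (incr X s t)"

text \<open>\<open>controlled T \<alpha> \<beta> q n X J\<close> consists of the paths controlled by the \<open>\<real>\<^sup>n\<close>-valued path \<open>X\<close> with
  values in \<open>euclid J\<close>.\<close>

definition controlled ::
    "real \<Rightarrow> real \<Rightarrow> real \<Rightarrow> ennreal \<Rightarrow> nat \<Rightarrow> (real \<Rightarrow> nat fvec) \<Rightarrow> 'i set
      \<Rightarrow> ((real \<Rightarrow> 'i fvec) \<times> (real \<Rightarrow> ('i \<times> nat) fvec)) set"
  where "controlled T \<alpha> \<beta> q n X J =
    {(Y, Y'). Y \<in> besov T \<alpha> \<beta> q (euclid J) \<and>
       Y' \<in> besov T \<alpha> \<beta> q (euclid (J \<times> {..<n})) \<and>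
       remainder X Y Y' \<in> besov2 T (2 * \<alpha>) (\<beta> / 2) (q / 2) (euclid J)}"

definition controlled_seminorm ::
    "real \<Rightarrow> real \<Rightarrow> real \<Rightarrow> ennreal \<Rightarrow> (real \<Rightarrow> nat fvec)
      \<Rightarrow> (real \<Rightarrow> 'i fvec) \<Rightarrow> (real \<Rightarrow> ('i \<times> nat) fvec) \<Rightarrow> ennreal"
  where "controlled_seminorm T \<alpha> \<beta> q X Y Y' =
    besov_seminorm T \<alpha> \<beta> q Y' + besov2_norm T (2 * \<alpha>) (\<beta> / 2) (q / 2) (remainder X Y Y')"

section \<open>Sewing and the rough integral\<close>

text \<open>A partition \<open>0 = t\<^sub>0 < \<dots> < t\<^sub>N = 1\<close> is the list \<open>[t\<^sub>0, \<dots>, t\<^sub>N]\<close>.\<close>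

definition is_partition :: "real list \<Rightarrow> bool"
  where "is_partition \<pi> \<longleftrightarrow> \<pi> \<noteq> [] \<and> hd \<pi> = 0 \<and> last \<pi> = 1 \<and> sorted_wrt (<) \<pi>"

definition mesh :: "real list \<Rightarrow> real"
  where "mesh \<pi> = Max ((\<lambda>i. \<pi> ! Suc i - \<pi> ! i) ` {..<length \<pi> - 1})"

definition riemann_sum ::
    "real list \<Rightarrow> (real \<Rightarrow> real \<Rightarrow> 'v::real_vector) \<Rightarrow> real \<Rightarrow> real \<Rightarrow> 'v"
  where "riemann_sum \<pi> \<Xi> s t =
    (\<Sum>i<length \<pi> - 1. \<Xi> (s + \<pi> ! i * (t - s)) (s + \<pi> ! Suc i * (t - s)))"

definition germ ::
    "(real \<Rightarrow> nat fvec) \<Rightarrow> (real \<Rightarrow> real \<Rightarrow> (nat \<times> nat) fvec)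
      \<Rightarrow> (real \<Rightarrow> (nat \<times> nat) fvec) \<Rightarrow> (real \<Rightarrow> ((nat \<times> nat) \<times> nat) fvec)
      \<Rightarrow> real \<Rightarrow> real \<Rightarrow> nat fvec"
  where "germ X XX Y Y' s t = app (Y s) (X t - X s) + app2 (Y' s) (XX s t)"

text \<open>\<open>I\<close> is obtained by sewing \<open>\<Xi>\<close>. Functions on \<open>[0,T]\<close> are taken as extensional functions, so that
  they are determined by their values on \<open>[0,T]\<close>.\<close>

definition is_sewing ::
    "real \<Rightarrow> real \<Rightarrow> real \<Rightarrow> ennreal \<Rightarrow> 'v::real_normed_vector set
      \<Rightarrow> (real \<Rightarrow> real \<Rightarrow> 'v) \<Rightarrow> (real \<Rightarrow> 'v) \<Rightarrow> bool"
  where "is_sewing T \<alpha> \<beta> q V \<Xi> I \<longleftrightarrow>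
    I \<in> {0..T} \<rightarrow>\<^sub>E V \<and> continuous_on {0..T} I \<and> I 0 = 0 \<and>
    (\<lambda>s t. incr I s t - \<Xi> s t) \<in> besov2 T (3 * \<alpha>) (\<beta> / 3) (q / 3) V"

definition rough_integral ::
    "real \<Rightarrow> real \<Rightarrow> real \<Rightarrow> ennreal \<Rightarrow> nat
      \<Rightarrow> (real \<Rightarrow> nat fvec) \<Rightarrow> (real \<Rightarrow> real \<Rightarrow> (nat \<times> nat) fvec)
      \<Rightarrow> (real \<Rightarrow> (nat \<times> nat) fvec) \<Rightarrow> (real \<Rightarrow> ((nat \<times> nat) \<times> nat) fvec)
      \<Rightarrow> real \<Rightarrow> nat fvec"
  where "rough_integral T \<alpha> \<beta> q m X XX Y Y' =
    (THE I. is_sewing T \<alpha> \<beta> q (euclid {..<m}) (germ X XX Y Y') I)"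

end

theory Submission
  imports Defs
begin

text \<open>
  Since \<open>\<Phi>\<^bsub>\<beta>\<^esub>\<close> dominates every power \<open>x powr p\<close> with \<open>p = k * \<beta>\<close>, \<open>k\<close> a positive integer, the paths in question
  are Hoelder continuous with an exponent \<open>\<eta> = \<alpha> - 1 / p > 1 / 3\<close>. Chen's relation turns the defect of
  the germ into \<open>\<delta>\<Xi> = - R \<delta>X - \<delta>Y' XX\<close>, so \<open>\<Xi>\<close> can be sewn pointwise. The difference \<open>D = \<delta>I - \<Xi>\<close> satisfies
  \<open>\<omega>\<^sub>D(\<tau>) \<le> 2 \<omega>\<^sub>D(\<tau>/2) + \<omega>\<^bsub>\<delta>\<Xi>\<^esub>(\<tau>)\<close> for the moduli of smoothness; iterating this, with the pointwise bound
  making the remainder vanish, estimates \<open>D\<close> by \<open>\<delta>\<Xi>\<close> in every Besov--Orlicz scale of regularity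
  greater than 1. Hoelder's inequality bounds \<open>\<delta>\<Xi>\<close> in the scale \<open>(3\<alpha>, \<beta>/3)\<close>, and using the pointwise
  bound for the first order or for the second order factor bounds it in the scales \<open>(2\<alpha> + \<eta>, \<beta>/2)\<close> and \<open>(\<alpha> + 2\<eta>, \<beta>)\<close>; the latter two
  give the estimates of the remainder and of the seminorm of the integral. The error of a Riemann
  sum is the sum of \<open>D\<close> over the pieces of the partition, which is small because \<open>3\<alpha> > 1\<close>.
\<close>

section \<open>Finitely supported vectors\<close>

text \<open>Two requirements shape the proof. First, q may be smaller than 1, so the norms over
  d\<tau>/\<tau> are only quasi-norms. The halving inequality is therefore iterated under the
  integral, where one step contracts by a power of 2 because d\<tau>/\<tau> is invariant under
  scaling. Second, the constants must not depend on dimensions or data, and mostly not on T. So the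
  existence proof, which works coordinate by coordinate, contributes no quantitative bound: it only
  makes a remainder vanish. The bounds on the factors come from averages over shrinking intervals,
  projected onto a single direction, and see neither the dimension nor T. Explicit T-dependence
  enters when an exponent of \<tau> is lowered or a path is bounded by its initial value, and in C''
  also through the passage from \<beta>/2 to \<beta>, which is not possible near 0 without an
  additive constant. Exponents p = k\<beta> arise because the k-th term of the exponential series
  gives x^p \<le> k! \<Psi>(x); the same k serves index \<beta>/2 with exponent p/2, so that
  second-order objects receive exactly the exponent 2\<eta>. Measurability comes from the continuity
  of the functions and the monotonicity of the moduli.\<close>

lemma inner_fvec_eq:
  assumes "finite A" "{i. coord v i \<noteq> 0} \<subseteq> A"
  shows "v \<bullet> w = (\<Sum>i\<in>A. coord v i * coord w i)"
  unfolding inner_fvec_def using assms by (intro sum.mono_neutral_left) auto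

lemma norm_fvec_eq:
  assumes "finite A" "{i. coord v i \<noteq> 0} \<subseteq> A"
  shows "norm v = L2_set (coord v) A"
  using inner_fvec_eq[OF assms, of v] by (simp add: norm_eq_sqrt_inner L2_set_def power2_eq_square)

lemma L2_set_coord_le_norm:
  assumes "finite A"
  shows "L2_set (coord v) A \<le> norm v"
proof -
  have "norm v = L2_set (coord v) (A \<union> {i. coord v i \<noteq> 0})"
    by (rule norm_fvec_eq) (auto simp: assms)
  then show ?thesis
    unfolding L2_set_def using assms by (auto intro!: real_sqrt_le_mono sum_mono2)
qed

lemma abs_coord_le_norm: "\<bar>coord v i\<bar> \<le> norm v"
  using L2_set_coord_le_norm[of "{i}" v] by (simp add: L2_set_def)

lemma norm_le_sum_coord:
  assumes "finite J" "v \<in> euclid J"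
  shows "norm v \<le> (\<Sum>i\<in>J. \<bar>coord v i\<bar>)"
proof -
  have "norm v = L2_set (coord v) J"
    using assms by (intro norm_fvec_eq) (auto simp: euclid_def)
  also have "\<dots> \<le> (\<Sum>i\<in>J. \<bar>coord v i\<bar>)"
    by (rule L2_set_le_sum_abs)
  finally show ?thesis .
qed

lemma coord_app:
  assumes "finite J" "{j. coord b j \<noteq> 0} \<subseteq> J"
  shows "coord (app A b) i = (\<Sum>j\<in>J. coord A (i, j) * coord b j)"
  unfolding app.rep_eq using assms by (intro sum.mono_neutral_left) auto

lemma coord_app2:
  assumes "finite S" "{p. coord M p \<noteq> 0} \<subseteq> S"
  shows "coord (app2 A M) i = (\<Sum>p\<in>S. coord A ((i, snd p), fst p) * coord M p)"
proof -
  have "coord (app2 A M) i = (\<Sum>p | coord M p \<noteq> 0. coord A ((i, snd p), fst p) * coord M p)"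
    unfolding app2.rep_eq by (rule sum.cong) auto
  also have "\<dots> = (\<Sum>p\<in>S. coord A ((i, snd p), fst p) * coord M p)"
    using assms by (intro sum.mono_neutral_left) auto
  finally show ?thesis .
qed

text \<open>Cauchy-Schwarz in each row. The constant 1 for the Hilbert-Schmidt norm is one of the
  reasons why later constants do not depend on the dimensions.\<close>

lemma norm_app_le: "norm (app A b) \<le> norm A * norm b"
proof -
  define J where "J = {j. coord b j \<noteq> 0}"
  define I where "I = {i. coord (app A b) i \<noteq> 0}"
  have fin: "finite I" "finite J" by (auto simp: I_def J_def)
  have "norm (app A b) = L2_set (coord (app A b)) I"
    by (rule norm_fvec_eq) (auto simp: I_def)
  also have "\<dots> \<le> L2_set (\<lambda>i. norm b * L2_set (\<lambda>j. coord A (i, j)) J) I"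
  proof -
    have "\<bar>coord (app A b) i\<bar> \<le> norm b * L2_set (\<lambda>j. coord A (i, j)) J" for i
    proof -
      have "\<bar>coord (app A b) i\<bar> \<le> (\<Sum>j\<in>J. \<bar>coord A (i, j)\<bar> * \<bar>coord b j\<bar>)"
        unfolding coord_app[OF finite_supp order.refl, where b=b, folded J_def]
        by (rule order.trans[OF sum_abs]) (simp add: abs_mult)
      also have "\<dots> \<le> L2_set (\<lambda>j. coord A (i, j)) J * L2_set (coord b) J"
        by (rule L2_set_mult_ineq)
      also have "L2_set (coord b) J = norm b"
        by (rule norm_fvec_eq[symmetric]) (auto simp: J_def)
      finally show ?thesis by (simp add: mult.commute)
    qed
    then have "L2_set (\<lambda>i. \<bar>coord (app A b) i\<bar>) I \<le> L2_set (\<lambda>i. norm b * L2_set (\<lambda>j. coord A (i, j)) J) I"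
      by (intro L2_set_mono) auto
    then show ?thesis by (simp add: L2_set_def)
  qed
  also have "\<dots> = norm b * L2_set (coord A) (I \<times> J)"
    by (simp add: L2_set_def power_mult_distrib sum_distrib_left[symmetric] real_sqrt_mult
        sum_nonneg sum.cartesian_product case_prod_unfold)
  also have "\<dots> \<le> norm b * norm A"
    using fin by (intro mult_left_mono L2_set_coord_le_norm) auto
  finally show ?thesis by (simp add: mult.commute)
qed

text \<open>Cauchy-Schwarz again, with A read as a matrix whose columns are indexed by the pairs p =
  (j, k). The storage order ((i, k), j) of its coordinates is undone at the end by an injective
  reindexing.\<close>

lemma norm_app2_le: "norm (app2 A M) \<le> norm A * norm M"
proof -
  define S where "S = {p. coord M p \<noteq> 0}"
  define I where "I = {i. coord (app2 A M) i \<noteq> 0}"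
  have fin: "finite I" "finite S" by (auto simp: I_def S_def)
  let ?A = "\<lambda>i p. coord A ((i, snd p), fst p)"
  have "norm (app2 A M) = L2_set (coord (app2 A M)) I"
    by (rule norm_fvec_eq) (auto simp: I_def)
  also have "\<dots> \<le> L2_set (\<lambda>i. norm M * L2_set (?A i) S) I"
  proof -
    have "\<bar>coord (app2 A M) i\<bar> \<le> norm M * L2_set (?A i) S" for i
    proof -
      have "\<bar>coord (app2 A M) i\<bar> \<le> (\<Sum>p\<in>S. \<bar>?A i p\<bar> * \<bar>coord M p\<bar>)"
        unfolding coord_app2[OF finite_supp order.refl, where M=M, folded S_def]
        by (rule order.trans[OF sum_abs]) (simp add: abs_mult)
      also have "\<dots> \<le> L2_set (?A i) S * L2_set (coord M) S"
        by (rule L2_set_mult_ineq)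
      also have "L2_set (coord M) S = norm M"
        by (rule norm_fvec_eq[symmetric]) (auto simp: S_def)
      finally show ?thesis by (simp add: mult.commute)
    qed
    then have "L2_set (\<lambda>i. \<bar>coord (app2 A M) i\<bar>) I \<le> L2_set (\<lambda>i. norm M * L2_set (?A i) S) I"
      by (intro L2_set_mono) auto
    then show ?thesis by (simp add: L2_set_def)
  qed
  also have "\<dots> = norm M * L2_set (\<lambda>(i, p). ?A i p) (I \<times> S)"
    by (simp add: L2_set_def power_mult_distrib sum_distrib_left[symmetric] real_sqrt_mult
        sum_nonneg sum.cartesian_product case_prod_unfold)
  also have "L2_set (\<lambda>(i, p). ?A i p) (I \<times> S) = L2_set (coord A) ((\<lambda>(i, p). ((i, snd p), fst p)) ` (I \<times> S))"
  proof -
    have "inj_on (\<lambda>(i, p). ((i, snd p), fst p)) (I \<times> S)"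
      by (auto simp: inj_on_def)
    then show ?thesis
      unfolding L2_set_def by (simp add: sum.reindex case_prod_unfold)
  qed
  also have "norm M * \<dots> \<le> norm M * norm A"
    using fin by (intro mult_left_mono L2_set_coord_le_norm) auto
  finally show ?thesis by (simp add: mult.commute)
qed

lemma norm_outer_le: "norm (outer b c) \<le> norm b * norm c"
proof -
  let ?B = "{i. coord b i \<noteq> 0}" and ?C = "{i. coord c i \<noteq> 0}"
  have "norm (outer b c) = L2_set (coord (outer b c)) (?B \<times> ?C)"
    by (rule norm_fvec_eq) (auto simp: outer.rep_eq)
  also have "\<dots> = L2_set (coord b) ?B * L2_set (coord c) ?C"
    unfolding L2_set_def outer.rep_eq
    by (simp add: case_prod_unfold power_mult_distrib real_sqrt_mult[symmetric] sum_product sum.cartesian_product)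
  also have "\<dots> = norm b * norm c"
    by (simp add: norm_fvec_eq[OF finite_supp order.refl])
  finally show ?thesis by simp
qed

lemma bounded_bilinear_app: "bounded_bilinear (app :: ('a \<times> 'b) fvec \<Rightarrow> _)"
proof
  show "app (A + A') b = app A b + app A' b" for A A' :: "('a \<times> 'b) fvec" and b
    by (rule fvec_eqI) (simp add: coord_app[OF finite_supp order.refl] sum.distrib distrib_right)
  show "app A (b + b') = app A b + app A b'" for A :: "('a \<times> 'b) fvec" and b b'
  proof (rule fvec_eqI)
    fix i
    \<comment> \<open>The supports of b, b' and b + b' differ; over the union of the first two all
      three sums can be compared termwise.\<close>
    have "finite ({i. coord b i \<noteq> 0} \<union> {i. coord b' i \<noteq> 0})" (is "finite ?J") by simp
    note * = coord_app[OF this]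
    have "coord (app A (b + b')) i = coord (app A b) i + coord (app A b') i"
      by (subst (1 2 3) *) (auto simp: distrib_left sum.distrib)
    then show "coord (app A (b + b')) i = coord (app A b + app A b') i" by simp
  qed
  show "app (r *\<^sub>R A) b = r *\<^sub>R app A b" for r and A :: "('a \<times> 'b) fvec" and b
    by (rule fvec_eqI) (simp add: coord_app[OF finite_supp order.refl] sum_distrib_left mult.assoc)
  show "app A (r *\<^sub>R b) = r *\<^sub>R app A b" for r and A :: "('a \<times> 'b) fvec" and b
  proof (rule fvec_eqI)
    fix i
    show "coord (app A (r *\<^sub>R b)) i = coord (r *\<^sub>R app A b) i"
      using coord_app[OF finite_supp[of b], where b="r *\<^sub>R b" and A=A and i=i] coord_app[OF finite_supp[of b] order.refl, of A i]
      by (auto simp: sum_distrib_left mult_ac)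
  qed
  show "\<exists>K. \<forall>A b. norm (app A b :: 'a fvec) \<le> norm (A :: ('a \<times> 'b) fvec) * norm b * K"
    by (rule exI[of _ 1]) (simp add: norm_app_le)
qed

lemma bounded_bilinear_app2: "bounded_bilinear (app2 :: (('a \<times> 'c) \<times> 'b) fvec \<Rightarrow> _)"
proof
  show "app2 (A + A') b = app2 A b + app2 A' b" for A A' :: "(('a \<times> 'c) \<times> 'b) fvec" and b
    by (rule fvec_eqI) (simp add: coord_app2[OF finite_supp order.refl] sum.distrib distrib_right)
  show "app2 A (b + b') = app2 A b + app2 A b'" for A :: "(('a \<times> 'c) \<times> 'b) fvec" and b b'
  proof (rule fvec_eqI)
    fix i
    have "finite ({i. coord b i \<noteq> 0} \<union> {i. coord b' i \<noteq> 0})" (is "finite ?J") by simp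
    note * = coord_app2[OF this]
    have "coord (app2 A (b + b')) i = coord (app2 A b) i + coord (app2 A b') i"
      by (subst (1 2 3) *) (auto simp: distrib_left sum.distrib)
    then show "coord (app2 A (b + b')) i = coord (app2 A b + app2 A b') i" by simp
  qed
  show "app2 (r *\<^sub>R A) b = r *\<^sub>R app2 A b" for r and A :: "(('a \<times> 'c) \<times> 'b) fvec" and b
    by (rule fvec_eqI) (simp add: coord_app2[OF finite_supp order.refl] sum_distrib_left mult.assoc)
  show "app2 A (r *\<^sub>R b) = r *\<^sub>R app2 A b" for r and A :: "(('a \<times> 'c) \<times> 'b) fvec" and b
  proof (rule fvec_eqI)
    fix i
    show "coord (app2 A (r *\<^sub>R b)) i = coord (r *\<^sub>R app2 A b) i"
      using coord_app2[OF finite_supp[of b], where M="r *\<^sub>R b" and A=A and i=i] coord_app2[OF finite_supp[of b] order.refl, of A i]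
      by (auto simp: sum_distrib_left mult_ac)
  qed
  show "\<exists>K. \<forall>A b. norm (app2 A b :: 'a fvec) \<le> norm (A :: (('a \<times> 'c) \<times> 'b) fvec) * norm b * K"
    by (rule exI[of _ 1]) (simp add: norm_app2_le)
qed

interpretation app: bounded_bilinear app by (rule bounded_bilinear_app)
interpretation app2: bounded_bilinear app2 by (rule bounded_bilinear_app2)

lemma euclid_closed:
  "0 \<in> euclid J"
  "v \<in> euclid J \<Longrightarrow> w \<in> euclid J \<Longrightarrow> v + w \<in> euclid J"
  "v \<in> euclid J \<Longrightarrow> w \<in> euclid J \<Longrightarrow> v - w \<in> euclid J"
  "v \<in> euclid J \<Longrightarrow> r *\<^sub>R v \<in> euclid J"
  by (auto simp: euclid_def)

lemma app_in_euclid: "A \<in> euclid (J \<times> L) \<Longrightarrow> app A b \<in> euclid J"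
  by (auto simp: euclid_def coord_app[OF finite_supp order.refl])

lemma app2_in_euclid: "A \<in> euclid ((J \<times> K) \<times> L) \<Longrightarrow> app2 A M \<in> euclid J"
  by (auto simp: euclid_def coord_app2[OF finite_supp order.refl])

section \<open>The Young functions\<close>

definition Psi' :: "real \<Rightarrow> real \<Rightarrow> real"
  where "Psi' \<beta> x = exp (x powr \<beta>) * (\<beta> * x powr (\<beta> - 1))"

lemma has_derivative_Psi:
  assumes "0 < x"
  shows "(orlicz_Psi \<beta> has_real_derivative Psi' \<beta> x) (at x)"
  unfolding orlicz_Psi_def[abs_def] Psi'_def
  by (auto intro!: derivative_eq_intros simp: assms)

lemma Psi_mono: "0 < \<beta> \<Longrightarrow> 0 \<le> x \<Longrightarrow> x \<le> y \<Longrightarrow> orlicz_Psi \<beta> x \<le> orlicz_Psi \<beta> y"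
  by (auto simp: orlicz_Psi_def intro!: powr_mono2)

lemma Psi_0 [simp]: "orlicz_Psi \<beta> 0 = 0"
  by (simp add: orlicz_Psi_def)

lemma Psi_nonneg [simp]: "0 \<le> orlicz_Psi \<beta> x"
  by (simp add: orlicz_Psi_def)

lemma orlicz_x_pos: "0 < \<beta> \<Longrightarrow> \<beta> < 1 \<Longrightarrow> 0 < orlicz_x \<beta>"
  by (simp add: orlicz_x_def)

lemma Phi_ge1: "1 \<le> \<beta> \<Longrightarrow> 0 \<le> x \<Longrightarrow> orlicz_Phi \<beta> x = orlicz_Psi \<beta> x"
  by (simp add: orlicz_Phi_def orlicz_E_def orlicz_x_def)

lemma Phi_less1_low:
  assumes "0 < \<beta>" "\<beta> < 1" "x \<le> orlicz_x \<beta>"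
  shows "orlicz_Phi \<beta> x = Psi' \<beta> (orlicz_x \<beta>) * x"
  using assms orlicz_x_pos[OF assms(1,2)] DERIV_imp_deriv[OF has_derivative_Psi[of "orlicz_x \<beta>" \<beta>]]
  by (auto simp: orlicz_Phi_def orlicz_E_def algebra_simps)

lemma Phi_less1_high:
  assumes "0 < \<beta>" "\<beta> < 1" "orlicz_x \<beta> \<le> x"
  shows "orlicz_Phi \<beta> x = orlicz_Psi \<beta> x - orlicz_Psi \<beta> (orlicz_x \<beta>) + Psi' \<beta> (orlicz_x \<beta>) * orlicz_x \<beta>"
  using assms orlicz_x_pos[OF assms(1,2)] DERIV_imp_deriv[OF has_derivative_Psi[of "orlicz_x \<beta>" \<beta>]]
  by (auto simp: orlicz_Phi_def orlicz_E_def algebra_simps)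

lemma Phi_0 [simp]: "orlicz_Phi \<beta> 0 = 0"
  by (simp add: orlicz_Phi_def)

lemma slope_pos: "0 < \<beta> \<Longrightarrow> \<beta> < 1 \<Longrightarrow> 0 < Psi' \<beta> (orlicz_x \<beta>)"
  using orlicz_x_pos[of \<beta>] by (simp add: Psi'_def)

text \<open>The logarithm of the derivative is, up to a constant, h z = z^\<beta> + (\<beta> - 1) ln
  z, and h is increasing where z^\<beta> \<ge> (1 - \<beta>)/\<beta>. Thus \<open>orlicz_x\<close>
  is the inflection point of \<open>orlicz_Psi\<close>, which explains why the function is replaced
  by a tangent to the left of it.\<close>

lemma Psi'_mono:
  assumes b: "0 < \<beta>" "\<beta> < 1" and xy: "orlicz_x \<beta> \<le> x" "x \<le> y"
  shows "Psi' \<beta> x \<le> Psi' \<beta> y"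
proof -
  define h where "h x = x powr \<beta> + (\<beta> - 1) * ln x" for x :: real
  have eq: "Psi' \<beta> z = \<beta> * exp (h z)" if "0 < z" for z
    using that by (simp add: Psi'_def h_def powr_def exp_add mult_ac)
  have x0: "0 < x" using orlicz_x_pos[OF b] xy by simp
  have "h x \<le> h y"
  proof (rule DERIV_nonneg_imp_nondecreasing[OF xy(2)])
    fix z assume z: "x \<le> z" "z \<le> y"
    then have z0: "0 < z" using x0 by simp
    have "(h has_real_derivative (\<beta> * z powr (\<beta> - 1) + (\<beta> - 1) / z)) (at z)"
      unfolding h_def[abs_def] using z0 by (auto intro!: derivative_eq_intros)
    moreover have "\<beta> * z powr (\<beta> - 1) + (\<beta> - 1) / z = (\<beta> * z powr \<beta> + (\<beta> - 1)) / z"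
      using z0 by (simp add: powr_diff add_divide_distrib)
    moreover have "(1 - \<beta>) / \<beta> \<le> z powr \<beta>"
    proof -
      have "(1 - \<beta>) / \<beta> = (((1 - \<beta>) / \<beta>) powr (1 / \<beta>)) powr \<beta>"
        using b by (simp add: powr_powr)
      also have "\<dots> \<le> z powr \<beta>"
        using b xy z by (intro powr_mono2) (auto simp: orlicz_x_def)
      finally show ?thesis .
    qed
    then have "0 \<le> (\<beta> * z powr \<beta> + (\<beta> - 1)) / z"
      using b z0 by (simp add: field_simps)
    ultimately show "\<exists>d. (h has_real_derivative d) (at z) \<and> 0 \<le> d" by metis
  qed
  then show ?thesis using eq[of x] eq[of y] x0 xy b by simp
qed

text \<open>The left piece is tangent to the right one, so no kink arises at
  \<open>orlicz_x\<close>; at that point the two one-sided derivatives are glued. The single formula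
  with \<open>max\<close> makes the monotonicity of the derivative immediate.\<close>

lemma has_derivative_Phi_less1:
  assumes b: "0 < \<beta>" "\<beta> < 1"
  shows "(orlicz_Phi \<beta> has_real_derivative Psi' \<beta> (max x (orlicz_x \<beta>))) (at x)"
proof -
  let ?x = "orlicz_x \<beta>" and ?s = "Psi' \<beta> (orlicz_x \<beta>)"
  note x0 = orlicz_x_pos[OF b]
  have low: "((\<lambda>x. ?s * x) has_real_derivative ?s) (at x)"
    by (auto intro!: derivative_eq_intros)
  have high: "((\<lambda>x. orlicz_Psi \<beta> x - orlicz_Psi \<beta> ?x + ?s * ?x) has_real_derivative Psi' \<beta> x) (at x)"
    if "?x \<le> x"
    using has_derivative_Psi[of x \<beta>] that x0 by (auto intro!: derivative_eq_intros)
  consider "x < ?x" | "?x < x" | "x = ?x" by linarith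
  then show ?thesis
  proof cases
    case 1
    have "(orlicz_Phi \<beta> has_real_derivative ?s) (at x)"
    proof (rule has_field_derivative_transform_within_open[OF low, of "{..<?x}"])
      show "?s * z = orlicz_Phi \<beta> z" if "z \<in> {..<?x}" for z
        using that Phi_less1_low[OF b, of z] by simp
    qed (use 1 in auto)
    then show ?thesis using 1 by (simp add: max_def)
  next
    case 2
    have "(orlicz_Phi \<beta> has_real_derivative Psi' \<beta> x) (at x)"
    proof (rule has_field_derivative_transform_within_open[OF high, of "{?x<..}"])
      show "orlicz_Psi \<beta> z - orlicz_Psi \<beta> ?x + ?s * ?x = orlicz_Phi \<beta> z" if "z \<in> {?x<..}" for z
        using that Phi_less1_high[OF b, of z] by simp
    qed (use 2 in auto)
    then show ?thesis using 2 by (simp add: max_def)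
  next
    case 3
    have l: "(orlicz_Phi \<beta> has_real_derivative ?s) (at x within {..x})"
    proof (rule has_field_derivative_transform_within[OF has_field_derivative_at_within[OF low], of 1])
      show "?s * z = orlicz_Phi \<beta> z" if "z \<in> {..x}" for z
        using that Phi_less1_low[OF b, of z] 3 by simp
    qed auto
    have high3: "((\<lambda>x. orlicz_Psi \<beta> x - orlicz_Psi \<beta> ?x + ?s * ?x) has_real_derivative ?s) (at x)"
      using high 3 by simp
    have r: "(orlicz_Phi \<beta> has_real_derivative ?s) (at x within {x..})"
    proof (rule has_field_derivative_transform_within[OF has_field_derivative_at_within[OF high3], of 1])
      show "orlicz_Psi \<beta> z - orlicz_Psi \<beta> ?x + ?s * ?x = orlicz_Phi \<beta> z" if "z \<in> {x..}" for z
        using that Phi_less1_high[OF b, of z] 3 by simp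
    qed auto
    have "(orlicz_Phi \<beta> has_real_derivative ?s) (at x within {..x} \<union> {x..})"
      using l r by (simp only: has_field_derivative_iff Lim_within_Un)
    moreover have "{..x} \<union> {x..} = UNIV" by auto
    ultimately have "(orlicz_Phi \<beta> has_real_derivative ?s) (at x)" by simp
    then show ?thesis using 3 by simp
  qed
qed

section \<open>Convexity and monotonicity of the Young functions\<close>

lemma convex_on_powr_nonneg:
  assumes "1 \<le> p" shows "convex_on {0..} (\<lambda>x::real. x powr p)"
proof (rule convex_onI)
  fix t x y :: real assume t: "0 < t" "t < 1" and xy: "x \<in> {0..}" "y \<in> {0..}"
  show "((1 - t) *\<^sub>R x + t *\<^sub>R y) powr p \<le> (1 - t) * x powr p + t * y powr p"
  proof (cases "x = 0 \<or> y = 0")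
    case True
    \<comment> \<open>If one endpoint is 0, the convexity inequality reduces to u^p \<le> u on (0,
      1).\<close>
    have "u powr p \<le> u" if "0 < u" "u < 1" for u :: real
      using powr_mono'[of 1 p u] that assms by simp
    then show ?thesis
      using True t xy by (auto simp: powr_mult intro!: mult_right_mono)
  next
    case False
    from convex_onD[OF powr_convex[OF assms], of t x y] show ?thesis
      using False t xy by simp
  qed
qed simp

text \<open>For \<beta> < 1 the derivative is increasing; for \<beta> \<ge> 1 the increasing convex
  exponential is composed with the convex power.\<close>

lemma Phi_convex:
  assumes b: "0 < \<beta>"
  shows "convex_on {0..} (orlicz_Phi \<beta>)"
proof (cases "\<beta> < 1")
  case True
  show ?thesis
    by (rule convex_on_realI[OF _ has_derivative_Phi_less1[OF b True]])
       (auto intro!: Psi'_mono[OF b True])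
next
  case False
  show ?thesis
  proof (rule convex_onI)
    fix t x y :: real assume t: "0 < t" "t < 1" and xy: "x \<in> {0..}" "y \<in> {0..}"
    have "exp (((1 - t) * x + t * y) powr \<beta>) \<le> exp ((1 - t) * x powr \<beta> + t * y powr \<beta>)"
      using convex_onD[OF convex_on_powr_nonneg[of \<beta>], of t x y] t xy False by simp
    also have "\<dots> \<le> (1 - t) * exp (x powr \<beta>) + t * exp (y powr \<beta>)"
      using convex_onD[OF exp_convex, of t "x powr \<beta>" "y powr \<beta>"] t by simp
    finally have "orlicz_Psi \<beta> ((1 - t) * x + t * y) \<le> (1 - t) * orlicz_Psi \<beta> x + t * orlicz_Psi \<beta> y"
      by (simp add: orlicz_Psi_def algebra_simps)
    moreover have "0 \<le> (1 - t) * x + t * y" using t xy by simp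
    ultimately show "orlicz_Phi \<beta> ((1 - t) *\<^sub>R x + t *\<^sub>R y) \<le> (1 - t) * orlicz_Phi \<beta> x + t * orlicz_Phi \<beta> y"
      using xy False by (simp add: Phi_ge1)
  qed simp
qed

lemma Phi_nonneg:
  assumes "0 < \<beta>" "0 \<le> x" shows "0 \<le> orlicz_Phi \<beta> x"
proof (cases "1 \<le> \<beta>")
  case False
  then show ?thesis
    using assms orlicz_x_pos[of \<beta>] slope_pos[of \<beta>] Phi_less1_low[of \<beta> x] Phi_less1_high[of \<beta> x]
      Psi_mono[of \<beta> "orlicz_x \<beta>" x]
    by (cases "x \<le> orlicz_x \<beta>") auto
qed (use assms in \<open>simp add: Phi_ge1\<close>)

text \<open>Convexity together with the value 0 at 0. This turns a constant in front of a Young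
  function into a factor in front of the norm; exponential Young functions satisfy no doubling
  condition that could do the same.\<close>

lemma Phi_scale_le:
  assumes "0 < \<beta>" "0 \<le> x" "0 \<le> c" "c \<le> 1"
  shows "orlicz_Phi \<beta> (c * x) \<le> c * orlicz_Phi \<beta> x"
  using convex_onD[OF Phi_convex[OF assms(1)], of c 0 x] assms by simp

lemma Phi_mono:
  assumes "0 < \<beta>" "0 \<le> x" "x \<le> y"
  shows "orlicz_Phi \<beta> x \<le> orlicz_Phi \<beta> y"
proof (cases "y = 0")
  case False
  then have "orlicz_Phi \<beta> x \<le> (x / y) * orlicz_Phi \<beta> y"
    using Phi_scale_le[of \<beta> y "x / y"] assms by simp
  also have "\<dots> \<le> 1 * orlicz_Phi \<beta> y"
    using assms False by (intro mult_right_mono Phi_nonneg) auto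
  finally show ?thesis by simp
qed (use assms in simp)

lemma Phi_continuous:
  assumes "0 < \<beta>" shows "continuous_on {0..} (orlicz_Phi \<beta>)"
proof (cases "\<beta> < 1")
  case True
  show ?thesis
    by (intro continuous_at_imp_continuous_on ballI DERIV_isCont[OF has_derivative_Phi_less1[OF assms True]])
next
  case False
  have "continuous_on {0..} (orlicz_Psi \<beta>)"
    unfolding orlicz_Psi_def[abs_def] using assms
    by (intro continuous_on_diff continuous_on_exp continuous_on_powr' continuous_on_id continuous_on_const) auto
  then show ?thesis
    by (rule continuous_on_eq) (use False in \<open>auto simp: Phi_ge1\<close>)
qed

section \<open>Comparison of the Young functions with each other and with powers\<close>

text \<open>To the right of \<open>orlicz_x\<close> the two functions differ by a constant, to the
  left both are bounded. For large arguments one may therefore compute with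
  \<open>orlicz_Psi\<close>; the shape of \<open>orlicz_Phi\<close> matters near 0 only.\<close>

lemma Phi_Psi_diff:
  assumes "0 < \<beta>"
  obtains K where "0 \<le> K"
    "\<And>x. 0 \<le> x \<Longrightarrow> orlicz_Phi \<beta> x \<le> orlicz_Psi \<beta> x + K"
    "\<And>x. 0 \<le> x \<Longrightarrow> orlicz_Psi \<beta> x \<le> orlicz_Phi \<beta> x + K"
proof (cases "\<beta> < 1")
  case True
  let ?x = "orlicz_x \<beta>" and ?s = "Psi' \<beta> (orlicz_x \<beta>)"
  define K where "K = ?s * ?x + orlicz_Psi \<beta> ?x"
  have pos: "0 < ?x" "0 < ?s" "0 < ?s * ?x" using assms True by (simp_all add: orlicz_x_pos slope_pos)
  have "orlicz_Phi \<beta> x \<le> orlicz_Psi \<beta> x + K \<and> orlicz_Psi \<beta> x \<le> orlicz_Phi \<beta> x + K" if "0 \<le> x" for x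
  proof (cases "x \<le> ?x")
    case le: True
    have "?s * x \<le> ?s * ?x" "0 \<le> ?s * x" using pos le that by (simp_all)
    then show ?thesis
      using le Psi_mono[OF assms that le] pos Psi_nonneg[of \<beta> x] Psi_nonneg[of \<beta> ?x]
      unfolding Phi_less1_low[OF assms True le] K_def by linarith
  next
    case False
    then show ?thesis
      using pos Psi_nonneg[of \<beta> ?x] Phi_less1_high[OF assms True, of x] unfolding K_def by linarith
  qed
  moreover have "0 \<le> K" using pos by (simp add: K_def)
  ultimately show ?thesis by (intro that[of K]) auto
next
  case False
  then show ?thesis by (intro that[of 0]) (auto simp: Phi_ge1)
qed

lemma Phi_ge_linear:
  assumes "0 < \<beta>" "\<beta> < 1"
  obtains c where "0 < c" "\<And>x. 0 \<le> x \<Longrightarrow> x \<le> 1 \<Longrightarrow> c * x \<le> orlicz_Phi \<beta> x"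
proof
  let ?x = "orlicz_x \<beta>" and ?s = "Psi' \<beta> (orlicz_x \<beta>)"
  have pos: "0 < ?x" "0 < ?s" using assms by (simp_all add: orlicz_x_pos slope_pos)
  show "0 < ?s * min 1 ?x" using pos by simp
  fix x :: real assume x: "0 \<le> x" "x \<le> 1"
  have "?s * (min 1 ?x * x) \<le> ?s * min x ?x"
    using pos x mult_left_le[of x ?x] mult_right_le_one_le[of x ?x] mult_right_le_one_le[of x ?x]
    by (intro mult_left_mono) (auto simp: min_def mult.commute)
  also have "\<dots> = orlicz_Phi \<beta> (min x ?x)"
    by (rule Phi_less1_low[OF assms, symmetric]) simp
  also have "\<dots> \<le> orlicz_Phi \<beta> x"
    using x pos assms by (intro Phi_mono) auto
  finally show "?s * min 1 ?x * x \<le> orlicz_Phi \<beta> x" by (simp add: mult.assoc)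
qed

lemma Phi_1_pos:
  assumes "0 < \<beta>" shows "0 < orlicz_Phi \<beta> 1"
proof (cases "\<beta> < 1")
  case True
  obtain c where "0 < c" "\<And>x. 0 \<le> x \<Longrightarrow> x \<le> 1 \<Longrightarrow> c * x \<le> orlicz_Phi \<beta> x"
    by (rule Phi_ge_linear[OF assms True]) (rule that; blast)
  then show ?thesis by (metis less_le_trans mult.right_neutral order.refl zero_le_one)
next
  case False
  then show ?thesis by (simp add: Phi_ge1 orlicz_Psi_def)
qed

text \<open>For x \<ge> 1 any additive constant is at most a multiple of the positive number
  \<open>orlicz_Phi \<beta> 1\<close>. The summand 1 allows further additive constants to be
  absorbed.\<close>

lemma Phi_dominates_Psi:
  assumes "0 < \<beta>"
  obtains C where "0 < C" "\<And>x. 1 \<le> x \<Longrightarrow> orlicz_Psi \<beta> x + 1 \<le> C * orlicz_Phi \<beta> x"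
proof -
  obtain K where K: "0 \<le> K" "\<And>x. 0 \<le> x \<Longrightarrow> orlicz_Phi \<beta> x \<le> orlicz_Psi \<beta> x + K"
    "\<And>x. 0 \<le> x \<Longrightarrow> orlicz_Psi \<beta> x \<le> orlicz_Phi \<beta> x + K"
    by (rule Phi_Psi_diff[OF assms]) (rule that; blast)
  note pos = Phi_1_pos[OF assms]
  show ?thesis
  proof
    show "0 < 1 + (K + 1) / orlicz_Phi \<beta> 1" using K pos by (simp add: add_pos_nonneg)
    fix x :: real assume x: "1 \<le> x"
    have "orlicz_Psi \<beta> x + 1 \<le> orlicz_Phi \<beta> x + (K + 1)" using K(3)[of x] x by simp
    also have "(K + 1) \<le> (K + 1) / orlicz_Phi \<beta> 1 * orlicz_Phi \<beta> x"
    proof -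
      have "(K + 1) / orlicz_Phi \<beta> 1 * orlicz_Phi \<beta> 1 \<le> (K + 1) / orlicz_Phi \<beta> 1 * orlicz_Phi \<beta> x"
        using K pos Phi_mono[OF assms, of 1 x] x by (intro mult_left_mono) auto
      then show ?thesis using pos by simp
    qed
    finally show "orlicz_Psi \<beta> x + 1 \<le> (1 + (K + 1) / orlicz_Phi \<beta> 1) * orlicz_Phi \<beta> x"
      by (simp add: distrib_right)
  qed
qed

text \<open>For \<open>orlicz_Psi\<close> this is an equality, so for large x only bounded
  differences are absorbed. The content lies near 0, where a function of index below 1 has been
  replaced by a line. The three cases are: no replacement, replacement on the left-hand side only,
  replacement on both sides.\<close>

lemma Phi_powr_le:
  assumes "0 < \<gamma>" "1 \<le> \<rho>"
  obtains C where "0 < C" "\<And>x. 0 \<le> x \<Longrightarrow> orlicz_Phi \<gamma> (x powr \<rho>) \<le> C * orlicz_Phi (\<gamma> * \<rho>) x"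
proof -
  have pos: "0 < \<gamma> * \<rho>" using assms by simp
  obtain K where K: "0 \<le> K" "\<And>x. 0 \<le> x \<Longrightarrow> orlicz_Phi \<gamma> x \<le> orlicz_Psi \<gamma> x + K"
    "\<And>x. 0 \<le> x \<Longrightarrow> orlicz_Psi \<gamma> x \<le> orlicz_Phi \<gamma> x + K"
    by (rule Phi_Psi_diff[OF assms(1)]) (rule that; blast)
  obtain C1 where C1: "0 < C1" "\<And>x. 1 \<le> x \<Longrightarrow> orlicz_Psi (\<gamma> * \<rho>) x + 1 \<le> C1 * orlicz_Phi (\<gamma> * \<rho>) x"
    by (rule Phi_dominates_Psi[OF pos]) (rule that; blast)
  have Psi_eq: "orlicz_Psi \<gamma> (x powr \<rho>) = orlicz_Psi (\<gamma> * \<rho>) x" for x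
    by (simp add: orlicz_Psi_def powr_powr mult.commute)
  have big: "orlicz_Phi \<gamma> (x powr \<rho>) \<le> (1 + K) * C1 * orlicz_Phi (\<gamma> * \<rho>) x" if x: "1 \<le> x" for x
  proof -
    have "orlicz_Phi \<gamma> (x powr \<rho>) \<le> orlicz_Psi (\<gamma> * \<rho>) x + K"
      using K(2)[of "x powr \<rho>"] by (simp add: Psi_eq)
    also have "\<dots> \<le> (1 + K) * (orlicz_Psi (\<gamma> * \<rho>) x + 1)"
      using mult_nonneg_nonneg[OF K(1) Psi_nonneg[of "\<gamma> * \<rho>" x]] by (simp add: distrib_left distrib_right)
    also have "\<dots> \<le> (1 + K) * (C1 * orlicz_Phi (\<gamma> * \<rho>) x)"
      using K C1(2)[OF x] by (intro mult_left_mono) auto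
    finally show ?thesis by (simp add: mult.assoc)
  qed
  have small: "\<exists>C>0. \<forall>x. 0 \<le> x \<and> x \<le> 1 \<longrightarrow> orlicz_Phi \<gamma> (x powr \<rho>) \<le> C * orlicz_Phi (\<gamma> * \<rho>) x"
  proof -
    have le1: "orlicz_Phi \<gamma> (x powr \<rho>) \<le> x powr \<rho> * orlicz_Phi \<gamma> 1" if "0 \<le> x" "x \<le> 1" for x
      using Phi_scale_le[OF assms(1), of 1 "x powr \<rho>"] that assms powr_mono2[of \<rho> x 1] by simp
    consider "1 \<le> \<gamma>" | "\<gamma> < 1" "1 \<le> \<gamma> * \<rho>" | "\<gamma> * \<rho> < 1" by linarith
    then show ?thesis
    proof cases
      case 1
      then have "1 \<le> \<gamma> * \<rho>" using assms mult_mono[of 1 \<gamma> 1 \<rho>] by simp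
      then show ?thesis using 1 by (intro exI[of _ 1]) (simp add: Phi_ge1 Psi_eq)
    next
      case 2
      have "x powr \<rho> \<le> orlicz_Phi (\<gamma> * \<rho>) x" if "0 \<le> x" "x \<le> 1" for x
      proof -
        have "x powr \<rho> \<le> x powr (\<gamma> * \<rho>)"
          using that 2 assms by (intro powr_mono') auto
        also have "\<dots> \<le> orlicz_Psi (\<gamma> * \<rho>) x"
          unfolding orlicz_Psi_def using exp_ge_add_one_self[of "x powr (\<gamma> * \<rho>)"] by linarith
        finally show ?thesis using 2 that by (simp add: Phi_ge1)
      qed
      then have "x powr \<rho> * orlicz_Phi \<gamma> 1 \<le> orlicz_Phi \<gamma> 1 * orlicz_Phi (\<gamma> * \<rho>) x" if "0 \<le> x" "x \<le> 1" for x
        using that Phi_1_pos[OF assms(1)] by (simp add: mult.commute)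
      then show ?thesis using le1 Phi_1_pos[OF assms(1)] by (meson order.trans)
    next
      case 3
      obtain c where c: "0 < c" "\<And>x. 0 \<le> x \<Longrightarrow> x \<le> 1 \<Longrightarrow> c * x \<le> orlicz_Phi (\<gamma> * \<rho>) x"
        by (rule Phi_ge_linear[OF pos 3]) (rule that; blast)
      have "x powr \<rho> * orlicz_Phi \<gamma> 1 \<le> orlicz_Phi \<gamma> 1 / c * orlicz_Phi (\<gamma> * \<rho>) x" if x: "0 \<le> x" "x \<le> 1" for x
      proof -
        have "x powr \<rho> \<le> x powr 1" using x assms by (intro powr_mono')
        then have "c * (x powr \<rho>) \<le> orlicz_Phi (\<gamma> * \<rho>) x"
          using c(1) x by (intro order.trans[OF mult_left_mono c(2)[OF x]]) auto
        then have "x powr \<rho> \<le> orlicz_Phi (\<gamma> * \<rho>) x / c" using c by (simp add: field_simps)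
        then have "x powr \<rho> * orlicz_Phi \<gamma> 1 \<le> orlicz_Phi (\<gamma> * \<rho>) x / c * orlicz_Phi \<gamma> 1"
          using Phi_1_pos[OF assms(1)] by (intro mult_right_mono) auto
        then show ?thesis by (simp add: mult_ac)
      qed
      then show ?thesis
        using le1 Phi_1_pos[OF assms(1)] c by (intro exI[of _ "orlicz_Phi \<gamma> 1 / c"]) (auto intro: order.trans)
    qed
  qed
  then obtain C2 where C2: "0 < C2"
    "\<And>x. 0 \<le> x \<Longrightarrow> x \<le> 1 \<Longrightarrow> orlicz_Phi \<gamma> (x powr \<rho>) \<le> C2 * orlicz_Phi (\<gamma> * \<rho>) x"
    by blast
  define C where "C = max ((1 + K) * C1) C2"
  show ?thesis
  proof
    show "0 < C" using C2 by (simp add: C_def)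
    fix x :: real assume x: "0 \<le> x"
    have "(1 + K) * C1 * orlicz_Phi (\<gamma> * \<rho>) x \<le> C * orlicz_Phi (\<gamma> * \<rho>) x"
      "C2 * orlicz_Phi (\<gamma> * \<rho>) x \<le> C * orlicz_Phi (\<gamma> * \<rho>) x"
      using Phi_nonneg[OF pos x] by (auto intro!: mult_right_mono simp: C_def)
    then show "orlicz_Phi \<gamma> (x powr \<rho>) \<le> C * orlicz_Phi (\<gamma> * \<rho>) x"
      using big[of x] C2(2)[of x] x by (cases "x \<le> 1") auto
  qed
qed

text \<open>Keeping the terms 0 and k of the exponential series bounds x^(k\<beta>) by k!
  \<open>orlicz_Psi\<close>. If \<beta> < 1 and x \<le> 1, the linear lower bound takes over, and
  x^(k\<beta>) \<le> x because k\<beta> \<ge> 1.\<close>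

lemma powr_le_Phi:
  assumes "0 < \<beta>" "1 \<le> real k * \<beta>"
  obtains C where "0 < C" "\<And>x. 0 \<le> x \<Longrightarrow> x powr (real k * \<beta>) \<le> C * orlicz_Phi \<beta> x"
proof -
  have k: "0 < k" using assms by (cases k) auto
  have Psi: "x powr (real k * \<beta>) \<le> fact k * orlicz_Psi \<beta> x" if "0 \<le> x" for x
  proof -
    let ?y = "x powr \<beta>"
    have "1 + ?y ^ k / fact k \<le> exp ?y"
    proof -
      have "(\<Sum>i\<in>{0, k}. ?y ^ i /\<^sub>R fact i) \<le> exp ?y"
        unfolding exp_def by (rule sum_le_suminf[OF summable_exp_generic]) auto
      then show ?thesis using k by (simp add: divide_inverse_commute)
    qed
    moreover have "?y ^ k = x powr (real k * \<beta>)"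
      using k that by (cases "x = 0") (simp_all add: powr_powr powr_realpow[symmetric] mult.commute)
    ultimately show ?thesis by (simp add: orlicz_Psi_def field_simps)
  qed
  show ?thesis
  proof (cases "\<beta> < 1")
    case True
    obtain C1 where C1: "0 < C1" "\<And>x. 1 \<le> x \<Longrightarrow> orlicz_Psi \<beta> x + 1 \<le> C1 * orlicz_Phi \<beta> x"
      by (rule Phi_dominates_Psi[OF assms(1)]) (rule that; blast)
    obtain c where c: "0 < c" "\<And>x. 0 \<le> x \<Longrightarrow> x \<le> 1 \<Longrightarrow> c * x \<le> orlicz_Phi \<beta> x"
      by (rule Phi_ge_linear[OF assms(1) True]) (rule that; blast)
    show ?thesis
    proof
      show "0 < fact k * C1 + 1 / c" using C1 c by (simp add: add_pos_pos)
      fix x :: real assume x: "0 \<le> x"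
      note nn = Phi_nonneg[OF assms(1) x]
      show "x powr (real k * \<beta>) \<le> (fact k * C1 + 1 / c) * orlicz_Phi \<beta> x"
      proof (cases "x \<le> 1")
        case le: True
        have "x powr (real k * \<beta>) \<le> x powr 1" using x le assms by (intro powr_mono')
        also have "\<dots> \<le> 1 / c * orlicz_Phi \<beta> x" using c(2)[OF x le] c(1) x by (simp add: field_simps)
        also have "\<dots> \<le> (fact k * C1 + 1 / c) * orlicz_Phi \<beta> x"
          using nn C1 by (intro mult_right_mono) auto
        finally show ?thesis .
      next
        case False
        then have "orlicz_Psi \<beta> x \<le> C1 * orlicz_Phi \<beta> x" using C1(2)[of x] by simp
        then have "fact k * orlicz_Psi \<beta> x \<le> fact k * (C1 * orlicz_Phi \<beta> x)" by simp
        also have "\<dots> \<le> (fact k * C1 + 1 / c) * orlicz_Phi \<beta> x"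
          using nn c by (simp add: distrib_right)
        finally show ?thesis using Psi[OF x] by simp
      qed
    qed
  next
    case False
    then show ?thesis using Psi that[of "fact k"] by (simp add: Phi_ge1)
  qed
qed

text \<open>A multiplicative constant would not do: for \<beta> = 1 and x near 0 the left-hand side
  behaves like the square root of x, while the Young function on the right is linear. The additive
  constant makes the resulting norm estimate depend on the length of the interval.\<close>

lemma Phi_sqrt_le:
  assumes "0 < \<beta>"
  obtains A where "0 < A" "\<And>x. 0 \<le> x \<Longrightarrow> orlicz_Phi \<beta> (sqrt x) \<le> A + orlicz_Phi (\<beta> / 2) x"
proof -
  obtain K1 where K1: "0 \<le> K1" "\<And>x. 0 \<le> x \<Longrightarrow> orlicz_Phi \<beta> x \<le> orlicz_Psi \<beta> x + K1"
    "\<And>x. 0 \<le> x \<Longrightarrow> orlicz_Psi \<beta> x \<le> orlicz_Phi \<beta> x + K1"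
    by (rule Phi_Psi_diff[OF assms]) (rule that; blast)
  have b2: "0 < \<beta> / 2" using assms by simp
  obtain K2 where K2: "0 \<le> K2" "\<And>x. 0 \<le> x \<Longrightarrow> orlicz_Phi (\<beta> / 2) x \<le> orlicz_Psi (\<beta> / 2) x + K2"
    "\<And>x. 0 \<le> x \<Longrightarrow> orlicz_Psi (\<beta> / 2) x \<le> orlicz_Phi (\<beta> / 2) x + K2"
    by (rule Phi_Psi_diff[OF b2]) (rule that; blast)
  have "orlicz_Phi \<beta> (sqrt x) \<le> (1 + K1 + K2) + orlicz_Phi (\<beta> / 2) x" if "0 \<le> x" for x
  proof -
    have "orlicz_Psi \<beta> (sqrt x) = orlicz_Psi (\<beta> / 2) x"
      using that by (simp add: orlicz_Psi_def powr_half_sqrt[symmetric] powr_powr)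
    then show ?thesis using K1(2)[of "sqrt x"] K2(3)[of x] that by simp
  qed
  then show ?thesis using that[of "1 + K1 + K2"] K1 K2 by simp
qed

section \<open>Orlicz norms\<close>

text \<open>Orlicz norms are approached from above: a modular is known to be at most 1 only at
  numbers strictly larger than the norm. Estimates are proved for such l and m, and this lemma takes
  the limit.\<close>

lemma ennreal_le_add_lim:
  fixes A B B' :: ennreal
  assumes "\<And>l m. 0 < l \<Longrightarrow> 0 < m \<Longrightarrow> B < ennreal l \<Longrightarrow> B' < ennreal m \<Longrightarrow> A \<le> ennreal (l + m)"
  shows "A \<le> B + B'"
proof (cases "B = \<infinity> \<or> B' = \<infinity>")
  case False
  then obtain b b' where b: "B = ennreal b" "0 \<le> b" "B' = ennreal b'" "0 \<le> b'"
    by (cases B; cases B') auto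
  have "((\<lambda>e. ennreal ((b + e) + (b' + e))) \<longlongrightarrow> ennreal ((b + 0) + (b' + 0))) (at_right 0)"
    by (intro tendsto_intros)
  moreover have "eventually (\<lambda>e. A \<le> ennreal ((b + e) + (b' + e))) (at_right 0)"
    unfolding eventually_at_right_field
    by (intro exI[of _ 1] conjI allI impI, simp, rule assms(1)) (auto simp: b ennreal_less_iff add_nonneg_pos)
  ultimately have "A \<le> ennreal ((b + 0) + (b' + 0))"
    by (rule tendsto_lowerbound) simp
  then show ?thesis using b by (simp add: ennreal_plus)
qed auto

text \<open>Finiteness matters here: for B = 0 and B' = \<infinity> the first premise is vacuous
  while the product on the right is 0.\<close>

lemma ennreal_le_mult_lim:
  fixes A B B' :: ennreal
  assumes "\<And>l m. 0 < l \<Longrightarrow> 0 < m \<Longrightarrow> B < ennreal l \<Longrightarrow> B' < ennreal m \<Longrightarrow> A \<le> ennreal (c * (l * m))"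
    and "0 \<le> c" "B < \<infinity>" "B' < \<infinity>"
  shows "A \<le> ennreal c * (B * B')"
proof -
  obtain b b' where b: "B = ennreal b" "0 \<le> b" "B' = ennreal b'" "0 \<le> b'"
    using assms(3,4) by (cases B; cases B') auto
  have "((\<lambda>e. ennreal (c * ((b + e) * (b' + e)))) \<longlongrightarrow> ennreal (c * ((b + 0) * (b' + 0)))) (at_right 0)"
    by (intro tendsto_intros)
  moreover have "eventually (\<lambda>e. A \<le> ennreal (c * ((b + e) * (b' + e)))) (at_right 0)"
    unfolding eventually_at_right_field
    by (intro exI[of _ 1] conjI allI impI, simp, rule assms(1)) (auto simp: b ennreal_less_iff add_nonneg_pos)
  ultimately have "A \<le> ennreal (c * ((b + 0) * (b' + 0)))"
    by (rule tendsto_lowerbound) simp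
  then show ?thesis using b assms(2) by (simp add: ennreal_mult)
qed

lemma ennreal_le_lim:
  fixes A B :: ennreal
  assumes "\<And>l. 0 < l \<Longrightarrow> B < ennreal l \<Longrightarrow> A \<le> ennreal (c * l)" and "0 \<le> c" "B < \<infinity>"
  shows "A \<le> ennreal c * B"
proof -
  have "A \<le> ennreal c * (B * 1)"
  proof (rule ennreal_le_mult_lim)
    fix l m :: real assume *: "0 < l" "0 < m" "B < ennreal l" "1 < ennreal m"
    have "1 \<le> m" using *(4) by simp
    then have "c * l \<le> c * (l * m)"
      using *(1) assms(2) by (intro mult_left_mono) auto
    then show "A \<le> ennreal (c * (l * m))"
      using assms(1)[OF *(1,3)] by (meson ennreal_leI order.trans)
  qed (use assms in auto)
  then show ?thesis by simp
qed

text \<open>The modular of the Orlicz space at scale l; the norm is the infimum of the scales at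
  which it is at most 1.\<close>

definition orlicz_int :: "real \<Rightarrow> real set \<Rightarrow> (real \<Rightarrow> 'v::real_normed_vector) \<Rightarrow> real \<Rightarrow> ennreal"
  where "orlicz_int \<beta> D g l = (\<integral>\<^sup>+r. ennreal (orlicz_Phi \<beta> (norm (g r) / l)) * indicator D r \<partial>lborel)"

lemma continuous_Phi_norm:
  assumes "0 < \<beta>" "continuous_on D g" "0 < l"
  shows "continuous_on D (\<lambda>r. orlicz_Phi \<beta> (norm (g r) / l))"
  by (rule continuous_on_compose2[OF Phi_continuous[OF assms(1)]])
     (use assms in \<open>auto intro!: continuous_intros\<close>)

lemma measurable_Phi_norm:
  assumes "0 < \<beta>" "continuous_on D g" "0 < l" "D \<in> sets borel"
  shows "(\<lambda>r. ennreal (orlicz_Phi \<beta> (norm (g r) / l)) * indicator D r) \<in> borel_measurable lborel"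
proof -
  have "(\<lambda>r. ennreal (indicator D r *\<^sub>R orlicz_Phi \<beta> (norm (g r) / l))) \<in> borel_measurable lborel"
    using borel_measurable_continuous_on_indicator[OF assms(4) continuous_Phi_norm[OF assms(1-3)]]
    by (intro measurable_compose[OF _ measurable_ennreal]) simp
  also have "(\<lambda>r. ennreal (indicator D r *\<^sub>R orlicz_Phi \<beta> (norm (g r) / l))) =
      (\<lambda>r. ennreal (orlicz_Phi \<beta> (norm (g r) / l)) * indicator D r)"
    by (auto simp: indicator_def fun_eq_iff)
  finally show ?thesis .
qed

lemma orlicz_norm_le: "0 < l \<Longrightarrow> orlicz_int \<beta> D g l \<le> 1 \<Longrightarrow> orlicz_norm \<beta> D g \<le> ennreal l"
  unfolding orlicz_norm_def orlicz_int_def by (rule INF_lower) simp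

lemma orlicz_int_mono_l:
  assumes "0 < \<beta>" "0 < l" "l \<le> m"
  shows "orlicz_int \<beta> D g m \<le> orlicz_int \<beta> D g l"
  unfolding orlicz_int_def using assms
  by (intro nn_integral_mono mult_right_mono ennreal_leI Phi_mono) (auto intro!: divide_left_mono)

lemma orlicz_int_le_1:
  assumes "0 < \<beta>" "orlicz_norm \<beta> D g < ennreal l"
  shows "orlicz_int \<beta> D g l \<le> 1"
proof -
  obtain m where m: "0 < m" "orlicz_int \<beta> D g m \<le> 1" "ennreal m < ennreal l"
    using assms(2) unfolding orlicz_norm_def INF_less_iff orlicz_int_def by auto
  then have "m \<le> l" by (simp add: ennreal_less_iff)
  then show ?thesis using orlicz_int_mono_l[OF assms(1) m(1), of l D g] m(2) by simp
qed

lemma orlicz_norm_dominated: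
  assumes "0 < \<beta>" "0 \<le> c" "\<And>r. r \<in> D \<Longrightarrow> norm (f r) \<le> c * norm (g r)" "orlicz_norm \<beta> D g < \<infinity> \<or> c = 0"
  shows "orlicz_norm \<beta> D f \<le> ennreal c * orlicz_norm \<beta> D g"
proof (cases "c = 0")
  case True
  have *: "orlicz_norm \<beta> D f \<le> ennreal l" if "0 < l" for l
  proof (rule orlicz_norm_le[OF that])
    have "orlicz_int \<beta> D f l \<le> (\<integral>\<^sup>+r. 0 \<partial>(lborel::real measure))"
      unfolding orlicz_int_def using assms(3) True
      by (intro nn_integral_mono) (auto simp: indicator_def)
    then show "orlicz_int \<beta> D f l \<le> 1" by simp
  qed
  have "orlicz_norm \<beta> D f \<le> 0 + 0"
    by (rule ennreal_le_add_lim) (rule *, simp)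
  then show ?thesis by (simp add: True)
next
  case False
  show ?thesis
  proof (rule ennreal_le_lim)
    fix l :: real assume l: "0 < l" "orlicz_norm \<beta> D g < ennreal l"
    show "orlicz_norm \<beta> D f \<le> ennreal (c * l)"
    proof (rule orlicz_norm_le)
      have "orlicz_int \<beta> D f (c * l) \<le> orlicz_int \<beta> D g l"
        unfolding orlicz_int_def
      proof (intro nn_integral_mono)
        fix r
        show "ennreal (orlicz_Phi \<beta> (norm (f r) / (c * l))) * indicator D r
            \<le> ennreal (orlicz_Phi \<beta> (norm (g r) / l)) * indicator D r"
        proof (cases "r \<in> D")
          case True
          have "norm (f r) / (c * l) \<le> norm (g r) / l"
            using assms(2) assms(3)[OF True] False l by (simp add: field_simps)
          then show ?thesis
            using assms(1,2) l by (intro mult_right_mono ennreal_leI Phi_mono) auto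
        qed simp
      qed
      also have "\<dots> \<le> 1" by (rule orlicz_int_le_1[OF assms(1) l(2)])
      finally show "orlicz_int \<beta> D f (c * l) \<le> 1" .
    qed (use l assms False in simp)
  qed (use assms False in auto)
qed

lemma orlicz_norm_mono:
  assumes "0 < \<beta>" "\<And>r. r \<in> D \<Longrightarrow> norm (f r) \<le> norm (g r)"
  shows "orlicz_norm \<beta> D f \<le> orlicz_norm \<beta> D g"
proof (cases "orlicz_norm \<beta> D g = \<infinity>")
  case False
  then show ?thesis
    using orlicz_norm_dominated[of \<beta> 1 D f g] assms by (simp add: less_top)
qed simp

text \<open>The usual argument for a Minkowski functional: (f + g)/(l + m) is the convex combination
  of f/l and g/m with weights l/(l + m) and m/(l + m). Continuity supplies the measurability needed
  to split the integral.\<close>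

lemma orlicz_norm_triangle:
  assumes "0 < \<beta>" "D \<in> sets borel" "continuous_on D f" "continuous_on D g"
  shows "orlicz_norm \<beta> D (\<lambda>r. f r + g r) \<le> orlicz_norm \<beta> D f + orlicz_norm \<beta> D g"
proof (rule ennreal_le_add_lim)
  fix l m :: real
  assume lm: "0 < l" "0 < m" "orlicz_norm \<beta> D f < ennreal l" "orlicz_norm \<beta> D g < ennreal m"
  let ?F = "\<lambda>r. ennreal (orlicz_Phi \<beta> (norm (f r) / l)) * indicator D r"
  let ?G = "\<lambda>r. ennreal (orlicz_Phi \<beta> (norm (g r) / m)) * indicator D r"
  define u where "u = m / (l + m)"
  have u: "0 \<le> u" "u \<le> 1" "1 - u = l / (l + m)" using lm by (auto simp: u_def field_simps)
  have "orlicz_int \<beta> D (\<lambda>r. f r + g r) (l + m) \<le>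
      (\<integral>\<^sup>+r. ennreal (1 - u) * ?F r + ennreal u * ?G r \<partial>lborel)"
    unfolding orlicz_int_def
  proof (rule nn_integral_mono)
    fix r
    let ?x = "norm (f r) / l" and ?y = "norm (g r) / m"
    have "orlicz_Phi \<beta> (norm (f r + g r) / (l + m)) \<le> orlicz_Phi \<beta> ((1 - u) * ?x + u * ?y)"
    proof (intro Phi_mono[OF assms(1)])
      have "norm (f r + g r) / (l + m) \<le> (norm (f r) + norm (g r)) / (l + m)"
        using lm by (intro divide_right_mono norm_triangle_ineq) auto
      also have "\<dots> = (1 - u) * ?x + u * ?y"
        using lm unfolding u(3) by (simp add: u_def add_divide_distrib)
      finally show "norm (f r + g r) / (l + m) \<le> (1 - u) * ?x + u * ?y" .
    qed (use lm in auto)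
    also have "\<dots> \<le> (1 - u) * orlicz_Phi \<beta> ?x + u * orlicz_Phi \<beta> ?y"
      using convex_onD[OF Phi_convex[OF assms(1)], of u ?x ?y] u lm by simp
    finally have "ennreal (orlicz_Phi \<beta> (norm (f r + g r) / (l + m))) \<le>
        ennreal (1 - u) * ennreal (orlicz_Phi \<beta> ?x) + ennreal u * ennreal (orlicz_Phi \<beta> ?y)"
      using u lm Phi_nonneg[OF assms(1)]
      by (simp add: ennreal_leI flip: ennreal_mult ennreal_plus)
    then show "ennreal (orlicz_Phi \<beta> (norm (f r + g r) / (l + m))) * indicator D r
        \<le> ennreal (1 - u) * ?F r + ennreal u * ?G r"
      by (auto simp: indicator_def)
  qed
  also have "\<dots> = ennreal (1 - u) * orlicz_int \<beta> D f l + ennreal u * orlicz_int \<beta> D g m"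
    unfolding orlicz_int_def
    using measurable_Phi_norm[OF assms(1,3) lm(1) assms(2)] measurable_Phi_norm[OF assms(1,4) lm(2) assms(2)]
    by (simp add: nn_integral_add nn_integral_cmult)
  also have "\<dots> \<le> ennreal (1 - u) * 1 + ennreal u * 1"
    using orlicz_int_le_1[OF assms(1) lm(3)] orlicz_int_le_1[OF assms(1) lm(4)]
    by (intro add_mono mult_left_mono) auto
  also have "\<dots> = 1" using u by (simp flip: ennreal_plus)
  finally show "orlicz_norm \<beta> D (\<lambda>r. f r + g r) \<le> ennreal (l + m)"
    using lm by (intro orlicz_norm_le) auto
qed

lemma orlicz_norm_zero: "0 < \<beta> \<Longrightarrow> orlicz_norm \<beta> D (\<lambda>r. 0) = 0"
  using orlicz_norm_dominated[of \<beta> 0 D "\<lambda>_. 0" "\<lambda>_. 0 :: real"] by simp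

lemma orlicz_norm_sum:
  assumes "0 < \<beta>" "D \<in> sets borel" "finite I" "\<And>i. i \<in> I \<Longrightarrow> continuous_on D (f i)"
  shows "orlicz_norm \<beta> D (\<lambda>r. \<Sum>i\<in>I. f i r) \<le> (\<Sum>i\<in>I. orlicz_norm \<beta> D (f i))"
  using assms(3,4)
proof (induction I)
  case empty
  then show ?case by (simp add: orlicz_norm_zero assms(1))
next
  case (insert i I)
  have "orlicz_norm \<beta> D (\<lambda>r. f i r + (\<Sum>i\<in>I. f i r)) \<le>
      orlicz_norm \<beta> D (f i) + orlicz_norm \<beta> D (\<lambda>r. \<Sum>i\<in>I. f i r)"
    by (intro orlicz_norm_triangle assms(1,2) continuous_on_sum insert.prems) auto
  also have "\<dots> \<le> orlicz_norm \<beta> D (f i) + (\<Sum>i\<in>I. orlicz_norm \<beta> D (f i))"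
    using insert by (intro add_left_mono) auto
  finally show ?case using insert by simp
qed

text \<open>Translation invariance of Lebesgue measure and monotonicity in the domain. The
  artificial summand 0 in the proof makes \<open>ennreal_le_add_lim\<close> applicable to a single
  norm.\<close>

lemma orlicz_norm_shift:
  assumes "0 < \<beta>" "0 \<le> a" "b + a \<le> b'" "continuous_on {0..b'} g"
  shows "orlicz_norm \<beta> {0..b} (\<lambda>r. g (r + a)) \<le> orlicz_norm \<beta> {0..b'} g"
proof -
  have "orlicz_norm \<beta> {0..b} (\<lambda>r. g (r + a)) \<le> orlicz_norm \<beta> {0..b'} g + 0"
  proof (rule ennreal_le_add_lim)
    fix l m :: real assume l: "0 < l" "0 < m" "orlicz_norm \<beta> {0..b'} g < ennreal l"
    have cont: "continuous_on {a..b+a} g"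
      using assms by (auto intro: continuous_on_subset)
    have "orlicz_int \<beta> {0..b} (\<lambda>r. g (r + a)) l =
        (\<integral>\<^sup>+r. ennreal (orlicz_Phi \<beta> (norm (g (a + 1 * r)) / l)) * indicator {a..b+a} (a + 1 * r) \<partial>lborel)"
      unfolding orlicz_int_def by (intro nn_integral_cong) (auto simp: indicator_def add.commute)
    also have "\<dots> = orlicz_int \<beta> {a..b+a} g l"
      unfolding orlicz_int_def
      using nn_integral_real_affine[of "\<lambda>r. ennreal (orlicz_Phi \<beta> (norm (g r) / l)) * indicator {a..b+a} r" 1 a]
        measurable_Phi_norm[OF assms(1) cont l(1)] by simp
    also have "\<dots> \<le> orlicz_int \<beta> {0..b'} g l"
      unfolding orlicz_int_def using assms
      by (intro nn_integral_mono) (auto simp: indicator_def)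
    also have "\<dots> \<le> 1" by (rule orlicz_int_le_1[OF assms(1) l(3)])
    finally have "orlicz_norm \<beta> {0..b} (\<lambda>r. g (r + a)) \<le> ennreal l"
      using l by (intro orlicz_norm_le) auto
    also have "\<dots> \<le> ennreal (l + m)" using l by (intro ennreal_leI) auto
    finally show "orlicz_norm \<beta> {0..b} (\<lambda>r. g (r + a)) \<le> ennreal (l + m)" .
  qed
  then show ?thesis by simp
qed

section \<open>Bounded functions, products, square roots and averages in Orlicz spaces\<close>

lemma orlicz_norm_bounded:
  assumes "0 < \<beta>" "0 < T"
  shows "\<exists>C>0. \<forall>b\<le>T. \<forall>(g :: real \<Rightarrow> 'v::real_normed_vector) K.
    0 \<le> K \<longrightarrow> (\<forall>r\<in>{0..b}. norm (g r) \<le> K) \<longrightarrow> orlicz_norm \<beta> {0..b} g \<le> ennreal (C * K)"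
proof -
  note pos = Phi_1_pos[OF assms(1)]
  \<comment> \<open>The constant will be 1/x, with x so small that T times the Young function at x
    is at most 1. The minimum with 1 makes \<open>Phi_scale_le\<close> applicable; T instead of b
    makes the constant uniform in b.\<close>
  define x where "x = min 1 (1 / (T * orlicz_Phi \<beta> 1))"
  have x: "0 < x" "x \<le> 1" using pos assms by (auto simp: x_def)
  have Phix: "orlicz_Phi \<beta> x \<le> 1 / T"
  proof -
    have "orlicz_Phi \<beta> x \<le> x * orlicz_Phi \<beta> 1"
      using Phi_scale_le[OF assms(1), of 1 x] x by simp
    also have "\<dots> \<le> 1 / (T * orlicz_Phi \<beta> 1) * orlicz_Phi \<beta> 1"
      using pos by (intro mult_right_mono) (auto simp: x_def)
    finally show ?thesis using pos by simp
  qed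
  have "orlicz_norm \<beta> {0..b} g \<le> ennreal (1 / x * K)"
    if b: "b \<le> T" and K: "0 \<le> K" and g: "\<forall>r\<in>{0..b}. norm (g r) \<le> K"
    for b K and g :: "real \<Rightarrow> 'v"
  proof (cases "K = 0")
    case True
    then have "orlicz_norm \<beta> {0..b} g \<le> ennreal 0 * orlicz_norm \<beta> {0..b} g"
      using g by (intro orlicz_norm_dominated assms) auto
    then show ?thesis using True by simp
  next
    case False
    have "orlicz_int \<beta> {0..b} g (1 / x * K) \<le> (\<integral>\<^sup>+r. ennreal (1 / T) * indicator {0..T} r \<partial>lborel)"
      unfolding orlicz_int_def
    proof (intro nn_integral_mono)
      fix r
      have "ennreal (orlicz_Phi \<beta> (norm (g r) / (1 / x * K))) \<le> ennreal (1 / T)" if "r \<in> {0..b}"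
      proof -
        have "norm (g r) / (1 / x * K) \<le> x"
          using g that K False x by (auto simp: field_simps)
        then have "orlicz_Phi \<beta> (norm (g r) / (1 / x * K)) \<le> orlicz_Phi \<beta> x"
          using K x assms by (intro Phi_mono) auto
        then show ?thesis using Phix by (intro ennreal_leI) auto
      qed
      then show "ennreal (orlicz_Phi \<beta> (norm (g r) / (1 / x * K))) * indicator {0..b} r
          \<le> ennreal (1 / T) * indicator {0..T} r"
        using b by (auto simp: indicator_def)
    qed
    also have "\<dots> = 1"
      using assms by (simp add: nn_integral_cmult_indicator flip: ennreal_mult)
    finally show ?thesis using K False x by (intro orlicz_norm_le) auto
  qed
  then show ?thesis using x by (intro exI[of _ "1 / x"]) auto
qed

text \<open>Young's inequality with the conjugate exponents 3/2 and 3: by \<open>Phi_powr_le\<close>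
  the power 3/2 turns the index \<beta>/3 into \<beta>/2, and the power 3 turns it into
  \<beta>.\<close>

lemma orlicz_norm_Hoelder:
  assumes "0 < \<beta>"
  shows "\<exists>C>0. \<forall>(b::real) (f :: real \<Rightarrow> 'v::real_normed_vector) (g :: real \<Rightarrow> 'w::real_normed_vector) (h :: real \<Rightarrow> real).
    continuous_on {0..b} f \<longrightarrow> continuous_on {0..b} g \<longrightarrow>
    orlicz_norm (\<beta> / 2) {0..b} f < \<infinity> \<longrightarrow> orlicz_norm \<beta> {0..b} g < \<infinity> \<longrightarrow>
    (\<forall>r\<in>{0..b}. \<bar>h r\<bar> \<le> norm (f r) * norm (g r)) \<longrightarrow>
    orlicz_norm (\<beta> / 3) {0..b} h \<le> ennreal C * (orlicz_norm (\<beta> / 2) {0..b} f * orlicz_norm \<beta> {0..b} g)"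
proof -
  have b3: "0 < \<beta> / 3" "0 < \<beta> / 2" using assms by auto
  have ge1: "(1::real) \<le> 3 / 2" "(1::real) \<le> 3" by simp_all
  obtain C1 where C1: "0 < C1" "\<And>x. 0 \<le> x \<Longrightarrow> orlicz_Phi (\<beta> / 3) (x powr (3/2)) \<le> C1 * orlicz_Phi (\<beta> / 3 * (3/2)) x"
    by (rule Phi_powr_le[OF b3(1) ge1(1)]) (rule that; blast)
  obtain C2 where C2: "0 < C2" "\<And>x. 0 \<le> x \<Longrightarrow> orlicz_Phi (\<beta> / 3) (x powr 3) \<le> C2 * orlicz_Phi (\<beta> / 3 * 3) x"
    by (rule Phi_powr_le[OF b3(1) ge1(2)]) (rule that; blast)
  \<comment> \<open>Enlarging the scale by c makes the two weights C1/c and C2/c add up to at most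
    1, so the modular of the product stays below 1.\<close>
  define c where "c = C1 + C2 + 1"
  have c: "1 \<le> c" "0 < c" "C1 / c + C2 / c \<le> 1"
    using C1(1) C2(1) by (auto simp: c_def add_divide_distrib[symmetric])
  have point: "orlicz_Phi (\<beta> / 3) (x * y / c) \<le> C1 / c * orlicz_Phi (\<beta> / 2) x + C2 / c * orlicz_Phi \<beta> y"
    if xy: "0 \<le> x" "0 \<le> y" for x y
  proof -
    \<comment> \<open>The larger power controls the other factor: x^(3/2) \<le> y^3 gives x \<le>
      y^2 and hence x y \<le> y^3; otherwise y \<le> x^(1/2) and x y \<le> x^(3/2).\<close>
    have "x * y \<le> max (x powr (3/2)) (y powr 3)"
    proof (cases "x powr (3/2) \<le> y powr 3")
      case True
      then have "(x powr (3/2)) powr (2/3) \<le> (y powr 3) powr (2/3)" by (intro powr_mono2) auto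
      then have "x \<le> y powr 2" using xy by (simp add: powr_powr del: powr_numeral)
      then have "x * y \<le> y powr 2 * y powr 1" using xy by (intro mult_mono) auto
      also have "\<dots> = y powr 3" by (simp only: powr_add[symmetric]) simp
      finally show ?thesis using True by simp
    next
      case False
      then have "(y powr 3) powr (1/3) \<le> (x powr (3/2)) powr (1/3)" by (intro powr_mono2) auto
      then have "y \<le> x powr (1/2)" using xy by (simp add: powr_powr del: powr_numeral)
      then have "x * y \<le> x powr 1 * x powr (1/2)" using xy by (intro mult_mono) auto
      also have "\<dots> = x powr (3/2)" by (simp only: powr_add[symmetric]) simp
      finally show ?thesis using False by simp
    qed
    then have "orlicz_Phi (\<beta> / 3) (x * y) \<le> orlicz_Phi (\<beta> / 3) (max (x powr (3/2)) (y powr 3))"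
      using xy b3 by (intro Phi_mono) auto
    also have "\<dots> \<le> orlicz_Phi (\<beta> / 3) (x powr (3/2)) + orlicz_Phi (\<beta> / 3) (y powr 3)"
      using Phi_nonneg[OF b3(1), of "x powr (3/2)"] Phi_nonneg[OF b3(1), of "y powr 3"] by (simp add: max_def)
    also have "\<dots> \<le> C1 * orlicz_Phi (\<beta> / 2) x + C2 * orlicz_Phi \<beta> y"
      using C1(2)[OF xy(1)] C2(2)[OF xy(2)] by simp
    finally have 1: "orlicz_Phi (\<beta> / 3) (x * y) \<le> C1 * orlicz_Phi (\<beta> / 2) x + C2 * orlicz_Phi \<beta> y" .
    have "orlicz_Phi (\<beta> / 3) (x * y / c) \<le> 1 / c * orlicz_Phi (\<beta> / 3) (x * y)"
      using Phi_scale_le[OF b3(1), of "x * y" "1 / c"] xy c by simp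
    also have "\<dots> \<le> 1 / c * (C1 * orlicz_Phi (\<beta> / 2) x + C2 * orlicz_Phi \<beta> y)"
      using 1 c by (intro mult_left_mono) auto
    finally show ?thesis by (simp add: distrib_left)
  qed
  show ?thesis
  proof (intro exI[of _ c] conjI allI impI)
    fix b :: real and f :: "real \<Rightarrow> 'v" and g :: "real \<Rightarrow> 'w" and h :: "real \<Rightarrow> real"
    let ?D = "{0..b}"
    assume f: "continuous_on ?D f" and g: "continuous_on ?D g"
      and fin: "orlicz_norm (\<beta> / 2) ?D f < \<infinity>" "orlicz_norm \<beta> ?D g < \<infinity>"
      and h: "\<forall>r\<in>?D. \<bar>h r\<bar> \<le> norm (f r) * norm (g r)"
    show "orlicz_norm (\<beta> / 3) ?D h \<le> ennreal c * (orlicz_norm (\<beta> / 2) ?D f * orlicz_norm \<beta> ?D g)"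
    proof (rule ennreal_le_mult_lim[OF _ _ fin])
      fix l m :: real
      assume lm: "0 < l" "0 < m" "orlicz_norm (\<beta> / 2) ?D f < ennreal l" "orlicz_norm \<beta> ?D g < ennreal m"
      let ?F = "\<lambda>r. ennreal (orlicz_Phi (\<beta> / 2) (norm (f r) / l)) * indicator ?D r"
      let ?G = "\<lambda>r. ennreal (orlicz_Phi \<beta> (norm (g r) / m)) * indicator ?D r"
      have "orlicz_int (\<beta> / 3) ?D h (c * (l * m)) \<le>
          (\<integral>\<^sup>+r. ennreal (C1 / c) * ?F r + ennreal (C2 / c) * ?G r \<partial>lborel)"
        unfolding orlicz_int_def
      proof (rule nn_integral_mono)
        fix r
        let ?x = "norm (f r) / l" and ?y = "norm (g r) / m"
        show "ennreal (orlicz_Phi (\<beta> / 3) (norm (h r) / (c * (l * m)))) * indicator ?D r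
          \<le> ennreal (C1 / c) * ?F r + ennreal (C2 / c) * ?G r"
        proof (cases "r \<in> ?D")
          case True
          have "orlicz_Phi (\<beta> / 3) (norm (h r) / (c * (l * m))) \<le> orlicz_Phi (\<beta> / 3) (?x * ?y / c)"
          proof (rule Phi_mono[OF b3(1)])
            have "norm (h r) / (c * (l * m)) \<le> norm (f r) * norm (g r) / (c * (l * m))"
              using h True lm c by (intro divide_right_mono) auto
            then show "norm (h r) / (c * (l * m)) \<le> ?x * ?y / c" by (simp add: mult_ac)
          qed (use lm c in auto)
          also have "\<dots> \<le> C1 / c * orlicz_Phi (\<beta> / 2) ?x + C2 / c * orlicz_Phi \<beta> ?y"
            using lm by (intro point) auto
          finally have "ennreal (orlicz_Phi (\<beta> / 3) (norm (h r) / (c * (l * m)))) \<le>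
              ennreal (C1 / c) * ennreal (orlicz_Phi (\<beta> / 2) ?x) + ennreal (C2 / c) * ennreal (orlicz_Phi \<beta> ?y)"
            using lm Phi_nonneg[OF assms] Phi_nonneg[OF b3(2)] c C1 C2
            by (simp add: ennreal_leI flip: ennreal_mult ennreal_plus)
          then show ?thesis using True by simp
        qed simp
      qed
      also have "\<dots> = ennreal (C1 / c) * orlicz_int (\<beta> / 2) ?D f l + ennreal (C2 / c) * orlicz_int \<beta> ?D g m"
        unfolding orlicz_int_def
        using measurable_Phi_norm[OF b3(2) f lm(1)] measurable_Phi_norm[OF assms g lm(2)]
        by (simp add: nn_integral_add nn_integral_cmult)
      also have "\<dots> \<le> ennreal (C1 / c) * 1 + ennreal (C2 / c) * 1"
        using orlicz_int_le_1[OF b3(2) lm(3)] orlicz_int_le_1[OF assms lm(4)]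
        by (intro add_mono mult_left_mono) auto
      also have "\<dots> \<le> 1" using c C1 C2 by (simp flip: ennreal_plus)
      finally show "orlicz_norm (\<beta> / 3) ?D h \<le> ennreal (c * (l * m))"
        using lm c by (intro orlicz_norm_le) auto
    qed (use c in auto)
  qed (use c in auto)
qed

text \<open>By \<open>Phi_sqrt_le\<close> the modular of the root at scale sqrt l is at most A T
  plus the modular of g at scale l, that is, at most B = A T + 1. Enlarging the scale by B brings it
  down to 1.\<close>

lemma orlicz_norm_sqrt:
  assumes "0 < \<beta>" "0 < T"
  shows "\<exists>C>0. \<forall>b\<le>T. \<forall>(g :: real \<Rightarrow> 'v::real_normed_vector) l.
    continuous_on {0..b} g \<longrightarrow> 0 < l \<longrightarrow> orlicz_norm (\<beta> / 2) {0..b} g < ennreal l \<longrightarrow>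
    orlicz_norm \<beta> {0..b} (\<lambda>r. sqrt (norm (g r))) \<le> ennreal (C * sqrt l)"
proof -
  obtain A where A: "0 < A" "\<And>x. 0 \<le> x \<Longrightarrow> orlicz_Phi \<beta> (sqrt x) \<le> A + orlicz_Phi (\<beta> / 2) x"
    by (rule Phi_sqrt_le[OF assms(1)]) (rule that; blast)
  define B where "B = A * T + 1"
  have B: "1 \<le> B" "0 < B" using A assms by (auto simp: B_def add_nonneg_pos)
  have b2: "0 < \<beta> / 2" using assms by simp
  show ?thesis
  proof (intro exI[of _ B] conjI allI impI)
    fix b l :: real and g :: "real \<Rightarrow> 'v"
    let ?D = "{0..b}"
    assume b: "b \<le> T" and g: "continuous_on ?D g" and l: "0 < l" "orlicz_norm (\<beta> / 2) ?D g < ennreal l"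
    let ?G = "\<lambda>r. ennreal (orlicz_Phi (\<beta> / 2) (norm (g r) / l)) * indicator ?D r"
    have "orlicz_int \<beta> ?D (\<lambda>r. sqrt (norm (g r))) (B * sqrt l) \<le>
        (\<integral>\<^sup>+r. ennreal (1 / B) * (ennreal A * indicator {0..T} r + ?G r) \<partial>lborel)"
      unfolding orlicz_int_def
    proof (rule nn_integral_mono)
      fix r
      show "ennreal (orlicz_Phi \<beta> (norm (sqrt (norm (g r))) / (B * sqrt l))) * indicator ?D r
          \<le> ennreal (1 / B) * (ennreal A * indicator {0..T} r + ?G r)"
      proof (cases "r \<in> ?D")
        case True
        have "orlicz_Phi \<beta> (norm (sqrt (norm (g r))) / (B * sqrt l)) =
            orlicz_Phi \<beta> (1 / B * sqrt (norm (g r) / l))"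
          by (simp add: real_sqrt_divide)
        also have "\<dots> \<le> 1 / B * orlicz_Phi \<beta> (sqrt (norm (g r) / l))"
          using B l by (intro Phi_scale_le assms) auto
        also have "\<dots> \<le> 1 / B * (A + orlicz_Phi (\<beta> / 2) (norm (g r) / l))"
          using B l A(2)[of "norm (g r) / l"] by (intro mult_left_mono) auto
        finally have "ennreal (orlicz_Phi \<beta> (norm (sqrt (norm (g r))) / (B * sqrt l))) \<le>
            ennreal (1 / B) * (ennreal A + ennreal (orlicz_Phi (\<beta> / 2) (norm (g r) / l)))"
          using B A l Phi_nonneg[OF b2] by (simp add: ennreal_leI flip: ennreal_mult ennreal_plus)
        then show ?thesis using True b by simp
      qed simp
    qed
    also have "\<dots> = ennreal (1 / B) * (ennreal A * ennreal T + orlicz_int (\<beta> / 2) ?D g l)"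
      unfolding orlicz_int_def using measurable_Phi_norm[OF b2 g l(1)] assms
      by (simp add: nn_integral_add nn_integral_cmult nn_integral_cmult_indicator)
    also have "\<dots> \<le> ennreal (1 / B) * (ennreal A * ennreal T + 1)"
      using orlicz_int_le_1[OF b2 l(2)] by (intro mult_left_mono add_left_mono) auto
    also have "\<dots> = ennreal (1 / B * (A * T + 1))"
      using A(1) assms(2) B(2) by (simp flip: ennreal_mult ennreal_plus ennreal_1)
    also have "\<dots> = 1" using B by (simp add: B_def)
    finally show "orlicz_norm \<beta> ?D (\<lambda>r. sqrt (norm (g r))) \<le> ennreal (B * sqrt l)"
      using l B by (intro orlicz_norm_le) auto
  qed (use B in auto)
qed

text \<open>Splitting at height \<open>\<kappa> = (b - a) powr (- 1 / p)\<close> gives \<open>x \<le> \<kappa> + \<kappa> powr (1 - p) * x powr p\<close>.\<close>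

lemma orlicz_norm_integral_bound:
  fixes g :: "real \<Rightarrow> 'v::real_normed_vector"
  assumes "0 < \<beta>" "1 \<le> p" "0 < C" "\<And>x. 0 \<le> x \<Longrightarrow> x powr p \<le> C * orlicz_Phi \<beta> x"
    and "a < b" "{a..b} \<subseteq> D" "continuous_on {a..b} g" "orlicz_norm \<beta> D g \<le> ennreal N" "0 \<le> N"
  shows "integral {a..b} (\<lambda>r. norm (g r)) \<le> N * (1 + C) * (b - a) powr (1 - 1 / p)"
proof -
  define \<kappa> where "\<kappa> = (b - a) powr (- 1 / p)"
  define Q where "Q = (1 + C) * (b - a) powr (1 - 1 / p)"
  have pos: "0 < \<kappa>" "0 < Q" using assms by (auto simp: \<kappa>_def Q_def intro!: mult_pos_pos)
  have bound: "integral {a..b} (\<lambda>r. norm (g r)) \<le> l * Q" if l: "N < l" for l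
  proof -
    have l0: "0 < l" using l assms by simp
    let ?F = "\<lambda>r. orlicz_Phi \<beta> (norm (g r) / l)"
    have cF: "continuous_on {a..b} ?F" by (rule continuous_Phi_norm[OF assms(1,7) l0])
    have F0: "0 \<le> ?F r" for r using l0 by (intro Phi_nonneg assms) auto
    have "ennreal (integral {a..b} ?F) = (\<integral>\<^sup>+r. ennreal (indicator {a..b} r *\<^sub>R ?F r) \<partial>lborel)"
    proof (rule nn_integral_has_integral_lborel[symmetric])
      show "(\<lambda>r. indicator {a..b} r *\<^sub>R ?F r) \<in> borel_measurable borel"
        by (rule borel_measurable_continuous_on_indicator[OF _ cF]) simp
      have "(?F has_integral integral {a..b} ?F) {a..b}"
        using cF by (intro integrable_integral integrable_continuous_interval)
      moreover have "(\<lambda>r. if r \<in> {a..b} then ?F r else 0) = (\<lambda>r. indicator {a..b} r *\<^sub>R ?F r)"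
        by (auto simp: indicator_def)
      ultimately show "((\<lambda>r. indicator {a..b} r *\<^sub>R ?F r) has_integral integral {a..b} ?F) UNIV"
        using has_integral_restrict_UNIV[of "{a..b}" ?F] by simp
    qed (use F0 in auto)
    also have "\<dots> \<le> orlicz_int \<beta> D g l"
      unfolding orlicz_int_def using assms(6) by (intro nn_integral_mono) (auto simp: indicator_def)
    also have "\<dots> \<le> 1"
      using assms(8,9) l by (intro orlicz_int_le_1 assms) (auto simp: ennreal_less_iff intro: le_less_trans)
    finally have F1: "integral {a..b} ?F \<le> 1" by simp
    have point: "norm (g r) \<le> l * \<kappa> + l * \<kappa> powr (1 - p) * C * ?F r" for r
    proof -
      let ?x = "norm (g r) / l"
      have x0: "0 \<le> ?x" using l0 by simp
      have "?x \<le> \<kappa> + \<kappa> powr (1 - p) * ?x powr p"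
      proof (cases "?x \<le> \<kappa>")
        case False
        then have "?x = ?x powr (1 - p) * ?x powr p"
          using pos l0 by (simp flip: powr_add)
        also have "\<dots> \<le> \<kappa> powr (1 - p) * ?x powr p"
          using False pos assms(2) by (intro mult_right_mono powr_mono2') auto
        finally show ?thesis using pos by simp
      qed (auto intro: order.trans)
      also have "\<dots> \<le> \<kappa> + \<kappa> powr (1 - p) * (C * ?F r)"
        using assms(4)[OF x0] by (intro add_left_mono mult_left_mono) auto
      finally have "l * ?x \<le> l * (\<kappa> + \<kappa> powr (1 - p) * (C * ?F r))"
        using l0 by (intro mult_left_mono) auto
      then show ?thesis using l0 by (simp add: algebra_simps)
    qed
    have "integral {a..b} (\<lambda>r. norm (g r)) \<le> integral {a..b} (\<lambda>r. l * \<kappa> + l * \<kappa> powr (1 - p) * C * ?F r)"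
      using point by (intro integral_le integrable_continuous_interval continuous_intros cF assms) auto
    also have "\<dots> = (b - a) * (l * \<kappa>) + l * \<kappa> powr (1 - p) * C * integral {a..b} ?F"
      using assms(5) by (subst integral_add) (auto intro!: integrable_continuous_interval continuous_intros cF)
    also have "\<dots> \<le> (b - a) * (l * \<kappa>) + l * \<kappa> powr (1 - p) * C * 1"
      using F1 l0 assms by (intro add_left_mono mult_left_mono) auto
    also have "(b - a) * (l * \<kappa>) = l * (b - a) powr (1 - 1 / p)"
    proof -
      have "(b - a) powr (1 - 1 / p) = (b - a) powr (1 + (- 1 / p))" by simp
      also have "\<dots> = (b - a) * \<kappa>" using assms(5) unfolding powr_add \<kappa>_def by simp
      finally show ?thesis by simp
    qed
    also have "\<kappa> powr (1 - p) = (b - a) powr (1 - 1 / p)"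
      using assms(2) by (simp add: \<kappa>_def powr_powr diff_divide_distrib)
    finally show ?thesis by (simp add: Q_def algebra_simps)
  qed
  have "integral {a..b} (\<lambda>r. norm (g r)) \<le> N * Q"
  proof (rule ccontr)
    assume *: "\<not> ?thesis"
    let ?I = "integral {a..b} (\<lambda>r. norm (g r))"
    \<comment> \<open>The estimate \<open>bound\<close> is available for l > N only. If the claim
      failed, the midpoint of N and ?I / Q would contradict it.\<close>
    have "N < (?I / Q + N) / 2" using * pos by (simp add: field_simps)
    from bound[OF this] show False using * pos by (simp add: field_simps)
  qed
  then show ?thesis by (simp add: Q_def mult.assoc)
qed

section \<open>Norms with respect to the logarithmic measure\<close>

lemma epowr_ennreal: "0 \<le> x \<Longrightarrow> epowr (ennreal x) p = ennreal (x powr p)"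
  by (simp add: epowr_def)

lemma epowr_top [simp]: "epowr \<infinity> p = \<infinity>" "epowr top p = top"
  by (simp_all add: epowr_def infinity_ennreal_def)

lemma epowr_0 [simp]: "epowr 0 p = 0"
  by (simp add: epowr_def)

lemma epowr_mono: "0 < p \<Longrightarrow> x \<le> y \<Longrightarrow> epowr x p \<le> epowr y p"
  by (cases x; cases y) (auto simp: epowr_ennreal top_unique intro!: ennreal_leI powr_mono2)

lemma epowr_inverse: "0 < p \<Longrightarrow> epowr (epowr x p) (1 / p) = x"
  by (cases x) (auto simp: epowr_ennreal powr_powr)

lemma epowr_inverse': "0 < p \<Longrightarrow> epowr (epowr x (1 / p)) p = x"
  by (cases x) (auto simp: epowr_ennreal powr_powr)

lemma epowr_mult: "0 < p \<Longrightarrow> epowr (x * y) p = epowr x p * epowr y p"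
  by (cases x; cases y) (auto simp: epowr_ennreal powr_mult ennreal_mult_top ennreal_top_mult simp flip: ennreal_mult)

lemma epowr_epowr: "epowr (epowr x p) r = epowr x (p * r)"
  by (cases x) (auto simp: epowr_ennreal powr_powr)

lemma epowr_less_top_iff: "epowr x p < \<infinity> \<longleftrightarrow> x < \<infinity>"
  by (cases x) (auto simp: epowr_ennreal)

lemma epowr_measurable [measurable]: "(\<lambda>x. epowr x p) \<in> borel_measurable borel"
  unfolding epowr_def by measurable

lemma epowr_le_swap: "0 < p \<Longrightarrow> epowr x p \<le> y \<Longrightarrow> x \<le> epowr y (1 / p)"
  using epowr_mono[of "1 / p" "epowr x p" y] by (simp add: epowr_inverse)

lemma epowr_le_swap2: "0 < p \<Longrightarrow> epowr x (1 / p) \<le> y \<Longrightarrow> x \<le> epowr y p"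
  using epowr_mono[of p "epowr x (1 / p)" y] by (simp add: epowr_inverse')

lemma epowr_le_swap': "0 < p \<Longrightarrow> x \<le> epowr y (1 / p) \<Longrightarrow> epowr x p \<le> y"
  using epowr_mono[of p x "epowr y (1 / p)"] by (simp add: epowr_inverse')

lemma epowr_SUP_le:
  assumes "0 < p"
  shows "epowr (SUP n\<in>A. x n) p \<le> (SUP n\<in>A. epowr (x n) p)"
proof (rule epowr_le_swap'[OF assms], rule SUP_least)
  fix n assume "n \<in> A"
  then show "x n \<le> epowr (SUP n\<in>A. epowr (x n) p) (1 / p)"
    by (intro epowr_le_swap[OF assms] SUP_upper)
qed

lemma epowr_add_le:
  assumes "0 < p"
  shows "epowr (x + y) p \<le> ennreal (2 powr p) * (epowr x p + epowr y p)"
proof -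
  have "epowr (x + y) p \<le> epowr (2 * max x y) p"
    by (intro epowr_mono assms) (simp add: mult_2 add_mono)
  also have "\<dots> = ennreal (2 powr p) * epowr (max x y) p"
    using epowr_ennreal[of 2 p] by (simp add: epowr_mult assms)
  also have "\<dots> \<le> ennreal (2 powr p) * (epowr x p + epowr y p)"
    by (intro mult_left_mono) (auto simp: max_def)
  finally show ?thesis .
qed

text \<open>A substitute for the triangle inequality valid for every p > 0: the factor of the first
  term is as close to 1 as desired, which leaves room for a contraction. With (1 + k)^p = \<theta>,
  either y \<le> k x and x + y \<le> (1 + k) x, or x + y \<le> (1 + 1/k) y.\<close>

lemma epowr_add_split:
  assumes "0 < p" "1 < \<theta>"
  obtains K :: real where "0 < K" "\<And>x y. epowr (x + y) p \<le> ennreal \<theta> * epowr x p + ennreal K * epowr y p"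
proof -
  define k where "k = \<theta> powr (1 / p) - 1"
  have "1 < \<theta> powr (1 / p)" using assms by simp
  then have k: "0 < k" by (simp add: k_def)
  have kp: "(1 + k) powr p = \<theta>" using assms by (simp add: k_def powr_powr)
  define K where "K = (1 + 1 / k) powr p"
  have "0 < K" using k by (auto simp: K_def add_pos_pos intro!: powr_gt_zero[THEN iffD2] less_imp_neq[symmetric])
  moreover have "epowr (x + y) p \<le> ennreal \<theta> * epowr x p + ennreal K * epowr y p" for x y
  proof (cases "x = \<infinity> \<or> y = \<infinity>")
    case True
    then show ?thesis using \<open>0 < K\<close> assms by (auto simp: ennreal_mult_top)
  next
    case False
    then obtain a b where ab: "x = ennreal a" "0 \<le> a" "y = ennreal b" "0 \<le> b"
      by (cases x; cases y) auto
    have "(a + b) powr p \<le> \<theta> * a powr p + K * b powr p"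
    proof (cases "b \<le> k * a")
      case True
      have "(a + b) powr p \<le> ((1 + k) * a) powr p"
        using True ab assms by (intro powr_mono2) (auto simp: algebra_simps)
      also have "\<dots> = \<theta> * a powr p" using ab k kp by (simp add: powr_mult)
      finally show ?thesis using \<open>0 < K\<close> by (simp add: add_increasing2)
    next
      case False
      have "(a + b) powr p \<le> ((1 + 1 / k) * b) powr p"
        using False ab assms k by (intro powr_mono2) (auto simp: field_simps)
      also have "\<dots> = K * b powr p" using ab k by (simp add: powr_mult K_def)
      finally show ?thesis using assms by (simp add: add_increasing)
    qed
    then show ?thesis
      using ab assms \<open>0 < K\<close> by (simp add: epowr_ennreal ennreal_leI flip: ennreal_plus ennreal_mult)
  qed
  ultimately show ?thesis by (rule that)
qed

lemma ennreal_divide_numeral: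
  "q / numeral k = top \<longleftrightarrow> q = (top :: ennreal)"
  "enn2real (q / numeral k) = enn2real q / numeral k"
proof -
  have "ennreal s / numeral k = ennreal (s / numeral k)" if "0 \<le> s" for s
    using that divide_ennreal[of s "numeral k"] by simp
  then show "q / numeral k = top \<longleftrightarrow> q = (top :: ennreal)" "enn2real (q / numeral k) = enn2real q / numeral k"
    by (cases q; auto simp: ennreal_top_divide)+
qed

lemma enn2real_pos: "0 < q \<Longrightarrow> q \<noteq> \<infinity> \<Longrightarrow> 0 < enn2real q"
  by (cases q) (auto simp: ennreal_less_iff)

text \<open>Superlevel sets are intervals. This settles the measurability of the moduli of
  smoothness, which are monotone in \<tau>.\<close>

lemma mono_borel_measurable:
  fixes w :: "real \<Rightarrow> ennreal"
  assumes "mono w"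
  shows "w \<in> borel_measurable borel"
proof (rule borel_measurableI_greater)
  fix y
  have "is_interval {x. y < w x}"
    unfolding is_interval_1 using monoD[OF assms] by (auto intro: less_le_trans)
  then show "{x \<in> space borel. y < w x} \<in> sets borel"
    by (simp add: real_interval_borel_measurable)
qed

lemma nn_integral_log_measure:
  assumes [measurable]: "f \<in> borel_measurable borel"
  shows "(\<integral>\<^sup>+\<tau>. f \<tau> \<partial>log_measure T) = (\<integral>\<^sup>+\<tau>. ennreal (1 / \<tau>) * f \<tau> * indicator {0..T} \<tau> \<partial>lborel)"
proof -
  have m: "(\<lambda>\<tau>. ennreal (1 / \<tau>)) \<in> borel_measurable (restrict_space lborel {0..T})"
    "f \<in> borel_measurable (restrict_space lborel {0..T})"
    by (intro measurable_restrict_space1; simp)+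
  show ?thesis
    unfolding log_measure_def
    by (subst nn_integral_density[OF m], subst nn_integral_restrict_space) simp_all
qed

lemma measurable_log_measure:
  "f \<in> borel_measurable borel \<Longrightarrow> f \<in> borel_measurable (log_measure T)"
  unfolding log_measure_def by (simp add: measurable_restrict_space1)

text \<open>Both endpoints are negligible: T is a null set, and at 0 the density has the value 1 / 0
  = 0.\<close>

lemma AE_log_measureI:
  assumes "\<And>\<tau>. 0 < \<tau> \<Longrightarrow> \<tau> < T \<Longrightarrow> P \<tau>"
  shows "AE \<tau> in log_measure T. P \<tau>"
proof -
  have m: "(\<lambda>\<tau>. ennreal (1 / \<tau>)) \<in> borel_measurable (restrict_space lborel {0..T})"
    by (intro measurable_restrict_space1) simp
  have "AE \<tau> in lborel. \<tau> \<noteq> T" by (rule AE_lborel_singleton)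
  then have "AE \<tau> in lborel. \<tau> \<in> {0..T} \<longrightarrow> 0 < ennreal (1 / \<tau>) \<longrightarrow> P \<tau>"
    by eventually_elim (auto simp: less_le assms)
  then show ?thesis
    unfolding log_measure_def by (subst AE_density[OF m], subst AE_restrict_space_iff) simp_all
qed

text \<open>The density is positive on (a, b), so an exceptional null set cannot contain this
  interval. Combined with \<open>esssup_AE\<close> this yields points at which an essential supremum
  is a genuine bound.\<close>

lemma AE_log_measureD:
  assumes "AE \<tau> in log_measure T. P \<tau>" "0 < a" "a < b" "b \<le> T"
  obtains \<tau> where "a < \<tau>" "\<tau> < b" "P \<tau>"
proof -
  have m: "(\<lambda>\<tau>. ennreal (1 / \<tau>)) \<in> borel_measurable (restrict_space lborel {0..T})"
    by (intro measurable_restrict_space1) simp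
  have ae: "AE \<tau> in lborel. \<tau> \<in> {0..T} \<longrightarrow> 0 < ennreal (1 / \<tau>) \<longrightarrow> P \<tau>"
    using assms(1) unfolding log_measure_def
    by (subst (asm) AE_density[OF m], subst (asm) AE_restrict_space_iff) simp_all
  have "\<exists>\<tau>\<in>{a<..<b}. P \<tau>"
  proof (rule ccontr)
    assume *: "\<not> ?thesis"
    have "AE \<tau> in lborel. \<tau> \<notin> {a<..<b}"
      using ae by eventually_elim (use * assms in auto)
    then have "emeasure lborel {a<..<b} = 0"
      by (subst (asm) AE_iff_null_sets[symmetric]) (auto simp: null_sets_def)
    then show False using assms by simp
  qed
  then show ?thesis using that by auto
qed

text \<open>Scale invariance of d\<tau>/\<tau>. There is an inequality because the image [0, cT] of
  the interval is only part of [0, T].\<close>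

lemma nn_integral_log_measure_scale:
  assumes [measurable]: "f \<in> borel_measurable borel" and c: "0 < c" "c \<le> 1"
  shows "(\<integral>\<^sup>+\<tau>. f (c * \<tau>) \<partial>log_measure T) \<le> (\<integral>\<^sup>+\<tau>. f \<tau> \<partial>log_measure T)"
proof -
  have "(\<integral>\<^sup>+\<tau>. f (c * \<tau>) \<partial>log_measure T) =
      (\<integral>\<^sup>+\<tau>. ennreal (1 / \<tau>) * f (c * \<tau>) * indicator {0..T} \<tau> \<partial>lborel)"
    by (rule nn_integral_log_measure) simp
  also have "\<dots> = (\<integral>\<^sup>+\<tau>. ennreal c * (ennreal (1 / (c * \<tau>)) * f (c * \<tau>) * indicator {0..c*T} (c * \<tau>)) \<partial>lborel)"
  proof (rule nn_integral_cong)
    fix \<tau> :: real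
    have "ennreal (1 / \<tau>) = ennreal c * ennreal (1 / (c * \<tau>))" if "0 \<le> \<tau>"
      using c that by (simp flip: ennreal_mult)
    then show "ennreal (1 / \<tau>) * f (c * \<tau>) * indicator {0..T} \<tau> =
        ennreal c * (ennreal (1 / (c * \<tau>)) * f (c * \<tau>) * indicator {0..c*T} (c * \<tau>))"
      using c by (auto simp: indicator_def mult_ac zero_le_mult_iff)
  qed
  also have "\<dots> = ennreal c * (\<integral>\<^sup>+\<tau>. ennreal (1 / (c * \<tau>)) * f (c * \<tau>) * indicator {0..c*T} (c * \<tau>) \<partial>lborel)"
    by (rule nn_integral_cmult) simp
  also have "\<dots> = (\<integral>\<^sup>+\<tau>. ennreal (1 / \<tau>) * f \<tau> * indicator {0..c*T} \<tau> \<partial>lborel)"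
    using nn_integral_real_affine[of "\<lambda>\<tau>. ennreal (1 / \<tau>) * f \<tau> * indicator {0..c*T} \<tau>" c 0] c by simp
  also have "\<dots> \<le> (\<integral>\<^sup>+\<tau>. ennreal (1 / \<tau>) * f \<tau> * indicator {0..T} \<tau> \<partial>lborel)"
  proof (rule nn_integral_mono)
    fix \<tau> :: real
    have "\<tau> \<le> T" if "0 \<le> \<tau>" "\<tau> \<le> c * T"
    proof -
      have "0 \<le> T" using that c by (smt (verit) mult_pos_neg)
      then show ?thesis using that c mult_left_le_one_le[of T c] by simp
    qed
    then show "ennreal (1 / \<tau>) * f \<tau> * indicator {0..c*T} \<tau> \<le> ennreal (1 / \<tau>) * f \<tau> * indicator {0..T} \<tau>"
      by (auto simp: indicator_def)
  qed
  also have "\<dots> = (\<integral>\<^sup>+\<tau>. f \<tau> \<partial>log_measure T)"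
    by (rule nn_integral_log_measure[symmetric]) simp
  finally show ?thesis .
qed

section \<open>The quasi-norm of L^q for d\<tau>/\<tau>\<close>

abbreviation log_norm :: "real \<Rightarrow> ennreal \<Rightarrow> (real \<Rightarrow> ennreal) \<Rightarrow> ennreal"
  where "log_norm T q f \<equiv> Lq_norm (log_measure T) q f"

lemma log_norm_finite:
  "q \<noteq> \<infinity> \<Longrightarrow> log_norm T q f = epowr (\<integral>\<^sup>+\<tau>. epowr (f \<tau>) (enn2real q) \<partial>log_measure T) (1 / enn2real q)"
  by (simp add: Lq_norm_def)

lemma log_norm_infinity:
  "log_norm T \<infinity> f = esssup (log_measure T) f" "log_norm T top f = esssup (log_measure T) f"
  by (simp_all add: Lq_norm_def)

lemma log_norm_infinity_le:
  assumes "f \<in> borel_measurable borel" "\<And>\<tau>. 0 < \<tau> \<Longrightarrow> \<tau> < T \<Longrightarrow> f \<tau> \<le> K"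
  shows "log_norm T \<infinity> f \<le> K"
  unfolding log_norm_infinity
  by (intro esssup_I measurable_log_measure assms AE_log_measureI)

lemma log_norm_mono:
  assumes "f \<in> borel_measurable borel" "0 < q" "\<And>\<tau>. 0 < \<tau> \<Longrightarrow> \<tau> < T \<Longrightarrow> f \<tau> \<le> g \<tau>"
  shows "log_norm T q f \<le> log_norm T q g"
proof (cases "q = \<infinity>")
  case True
  then show ?thesis
    unfolding True log_norm_infinity using assms
    by (intro esssup_AE_mono measurable_log_measure AE_log_measureI)
next
  case False
  note s = enn2real_pos[OF assms(2) False]
  have "(\<integral>\<^sup>+\<tau>. epowr (f \<tau>) (enn2real q) \<partial>log_measure T) \<le> (\<integral>\<^sup>+\<tau>. epowr (g \<tau>) (enn2real q) \<partial>log_measure T)"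
    by (intro nn_integral_mono_AE AE_log_measureI epowr_mono s assms)
  then show ?thesis
    unfolding log_norm_finite[OF False] using s by (intro epowr_mono) auto
qed

lemma log_norm_cmult:
  assumes [measurable]: "f \<in> borel_measurable borel" and "0 < q" "0 \<le> c"
  shows "log_norm T q (\<lambda>\<tau>. ennreal c * f \<tau>) \<le> ennreal c * log_norm T q f"
proof (cases "q = \<infinity>")
  case True
  have "AE \<tau> in log_measure T. f \<tau> \<le> esssup (log_measure T) f" by (rule esssup_AE)
  then have "AE \<tau> in log_measure T. ennreal c * f \<tau> \<le> ennreal c * esssup (log_measure T) f"
    by eventually_elim (rule mult_left_mono, auto)
  then show ?thesis
    unfolding True log_norm_infinity by (intro esssup_I measurable_log_measure) auto
next
  case False
  note s = enn2real_pos[OF assms(2) False]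
  have [measurable]: "f \<in> borel_measurable (log_measure T)" by (simp add: measurable_log_measure)
  show ?thesis
    unfolding log_norm_finite[OF False] using s
    by (simp add: epowr_mult nn_integral_cmult epowr_inverse)
qed

text \<open>For q < 1 this is a quasi-triangle inequality. The constant collects the crude bound
  \<open>epowr_add_le\<close> for the integrand and again for the outer power 1/s.\<close>

lemma log_norm_add:
  assumes "0 < q"
  shows "\<exists>C>0. \<forall>T f g. f \<in> borel_measurable borel \<longrightarrow> g \<in> borel_measurable borel \<longrightarrow>
    log_norm T q (\<lambda>\<tau>. f \<tau> + g \<tau>) \<le> ennreal C * (log_norm T q f + log_norm T q g)"
proof (cases "q = \<infinity>")
  case True
  have "log_norm T q (\<lambda>\<tau>. f \<tau> + g \<tau>) \<le> log_norm T q f + log_norm T q g"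
    if [measurable]: "f \<in> borel_measurable borel" "g \<in> borel_measurable borel" for T f g
  proof -
    have "AE \<tau> in log_measure T. f \<tau> \<le> esssup (log_measure T) f"
      "AE \<tau> in log_measure T. g \<tau> \<le> esssup (log_measure T) g" by (rule esssup_AE)+
    then have "AE \<tau> in log_measure T. f \<tau> + g \<tau> \<le> esssup (log_measure T) f + esssup (log_measure T) g"
      by eventually_elim (rule add_mono)
    then show ?thesis
      unfolding True log_norm_infinity by (intro esssup_I measurable_log_measure) auto
  qed
  then show ?thesis by (intro exI[of _ 1]) auto
next
  case False
  define s where "s = enn2real q"
  have s: "0 < s" using enn2real_pos[OF assms False] by (simp add: s_def)
  have "log_norm T q (\<lambda>\<tau>. f \<tau> + g \<tau>) \<le> ennreal (2 * 2 powr (1 / s)) * (log_norm T q f + log_norm T q g)"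
    if [measurable]: "f \<in> borel_measurable borel" "g \<in> borel_measurable borel" for T f g
  proof -
    have [measurable]: "f \<in> borel_measurable (log_measure T)" "g \<in> borel_measurable (log_measure T)"
      by (simp_all add: measurable_log_measure)
    let ?A = "\<integral>\<^sup>+\<tau>. epowr (f \<tau>) s \<partial>log_measure T" and ?B = "\<integral>\<^sup>+\<tau>. epowr (g \<tau>) s \<partial>log_measure T"
    have "(\<integral>\<^sup>+\<tau>. epowr (f \<tau> + g \<tau>) s \<partial>log_measure T) \<le>
        (\<integral>\<^sup>+\<tau>. ennreal (2 powr s) * (epowr (f \<tau>) s + epowr (g \<tau>) s) \<partial>log_measure T)"
      by (intro nn_integral_mono epowr_add_le s)
    also have "\<dots> = ennreal (2 powr s) * (?A + ?B)"
      by (simp add: nn_integral_cmult nn_integral_add)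
    finally have "epowr (\<integral>\<^sup>+\<tau>. epowr (f \<tau> + g \<tau>) s \<partial>log_measure T) (1 / s) \<le> epowr (ennreal (2 powr s) * (?A + ?B)) (1 / s)"
      using s by (intro epowr_mono) auto
    also have "\<dots> = ennreal 2 * epowr (?A + ?B) (1 / s)"
      using s by (simp add: epowr_mult epowr_ennreal powr_powr)
    also have "\<dots> \<le> ennreal 2 * (ennreal (2 powr (1 / s)) * (epowr ?A (1 / s) + epowr ?B (1 / s)))"
      using s by (intro mult_left_mono epowr_add_le) auto
    finally show ?thesis
      unfolding log_norm_finite[OF False] s_def[symmetric] by (simp add: ennreal_mult mult.assoc)
  qed
  then show ?thesis by (intro exI[of _ "2 * 2 powr (1 / s)"]) auto
qed

text \<open>Hoelder's inequality for 3/q = 2/q + 1/q, proved like its Orlicz counterpart: after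
  normalisation by l and m both integrals are at most 1, and their sum 2 is the origin of
  2^(3/s).\<close>

lemma log_norm_Hoelder:
  assumes "0 < q"
  shows "\<exists>C>0. \<forall>T f g. f \<in> borel_measurable borel \<longrightarrow> g \<in> borel_measurable borel \<longrightarrow>
    log_norm T (q / 2) f < \<infinity> \<longrightarrow> log_norm T q g < \<infinity> \<longrightarrow>
    log_norm T (q / 3) (\<lambda>\<tau>. f \<tau> * g \<tau>) \<le> ennreal C * (log_norm T (q / 2) f * log_norm T q g)"
proof (cases "q = \<infinity>")
  case True
  have "log_norm T \<infinity> (\<lambda>\<tau>. f \<tau> * g \<tau>) \<le> log_norm T \<infinity> f * log_norm T \<infinity> g"
    if [measurable]: "f \<in> borel_measurable borel" "g \<in> borel_measurable borel" for T f g
  proof -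
    have "AE \<tau> in log_measure T. f \<tau> \<le> esssup (log_measure T) f"
      "AE \<tau> in log_measure T. g \<tau> \<le> esssup (log_measure T) g" by (rule esssup_AE)+
    then have "AE \<tau> in log_measure T. f \<tau> * g \<tau> \<le> esssup (log_measure T) f * esssup (log_measure T) g"
      by eventually_elim (rule mult_mono, auto)
    then show ?thesis
      unfolding log_norm_infinity by (intro esssup_I measurable_log_measure) auto
  qed
  moreover have "q / 2 = \<infinity>" "q / 3 = \<infinity>" by (simp_all add: True ennreal_top_divide)
  ultimately show ?thesis by (intro exI[of _ 1]) (simp add: True)
next
  case False
  define s where "s = enn2real q"
  have s: "0 < s" using enn2real_pos[OF assms False] by (simp add: s_def)
  have q2: "q / 2 \<noteq> \<infinity>" "enn2real (q / 2) = s / 2" and q3: "q / 3 \<noteq> \<infinity>" "enn2real (q / 3) = s / 3"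
    using False by (simp_all add: ennreal_divide_numeral s_def)
  show ?thesis
  proof (intro exI[of _ "2 powr (3 / s)"] conjI allI impI)
    fix T and f g :: "real \<Rightarrow> ennreal"
    assume [measurable]: "f \<in> borel_measurable borel" "g \<in> borel_measurable borel"
      and fin: "log_norm T (q / 2) f < \<infinity>" "log_norm T q g < \<infinity>"
    have [measurable]: "f \<in> borel_measurable (log_measure T)" "g \<in> borel_measurable (log_measure T)"
      by (simp_all add: measurable_log_measure)
    show "log_norm T (q / 3) (\<lambda>\<tau>. f \<tau> * g \<tau>) \<le> ennreal (2 powr (3 / s)) * (log_norm T (q / 2) f * log_norm T q g)"
    proof (rule ennreal_le_mult_lim[OF _ _ fin])
      fix l m :: real
      assume lm: "0 < l" "0 < m" "log_norm T (q / 2) f < ennreal l" "log_norm T q g < ennreal m"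
      let ?A = "\<integral>\<^sup>+\<tau>. epowr (f \<tau>) (s / 2) \<partial>log_measure T" and ?B = "\<integral>\<^sup>+\<tau>. epowr (g \<tau>) s \<partial>log_measure T"
      have "?A \<le> epowr (ennreal l) (s / 2)"
        using lm(3) s unfolding log_norm_finite[OF q2(1)] q2(2)
        by (intro epowr_le_swap2) auto
      then have A: "?A \<le> ennreal (l powr (s / 2))" using lm by (simp add: epowr_ennreal)
      have "?B \<le> epowr (ennreal m) s"
        using lm(4) s unfolding log_norm_finite[OF False] s_def[symmetric]
        by (intro epowr_le_swap2) auto
      then have B: "?B \<le> ennreal (m powr s)" using lm by (simp add: epowr_ennreal)
      \<comment> \<open>The weights that undo the normalisation x = l u, y = m v.\<close>
      define c1 where "c1 = (l * m) powr (s / 3) * l powr (- s / 2)"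
      define c2 where "c2 = (l * m) powr (s / 3) * m powr (- s)"
      have c: "0 < c1" "0 < c2" using lm by (auto simp: c1_def c2_def)
      have real_point: "(x * y) powr (s / 3) \<le> c1 * x powr (s / 2) + c2 * y powr s" if xy: "0 \<le> x" "0 \<le> y" for x y
      proof -
        define u where "u = x / l" define v where "v = y / m"
        have uv: "0 \<le> u" "0 \<le> v" "x = l * u" "y = m * v" using xy lm by (auto simp: u_def v_def)
        have "u * v \<le> max (u powr (3/2)) (v powr 3)"
        proof (cases "u powr (3/2) \<le> v powr 3")
          case True
          then have "(u powr (3/2)) powr (2/3) \<le> (v powr 3) powr (2/3)" by (intro powr_mono2) auto
          then have "u \<le> v powr 2" using uv by (simp add: powr_powr del: powr_numeral)
          then have "u * v \<le> v powr 2 * v powr 1" using uv by (intro mult_mono) auto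
          also have "\<dots> = v powr 3" by (simp only: powr_add[symmetric]) simp
          finally show ?thesis using True by simp
        next
          case False
          then have "(v powr 3) powr (1/3) \<le> (u powr (3/2)) powr (1/3)" by (intro powr_mono2) auto
          then have "v \<le> u powr (1/2)" using uv by (simp add: powr_powr del: powr_numeral)
          then have "u * v \<le> u powr 1 * u powr (1/2)" using uv by (intro mult_mono) auto
          also have "\<dots> = u powr (3/2)" by (simp only: powr_add[symmetric]) simp
          finally show ?thesis using False by simp
        qed
        then have "(u * v) powr (s / 3) \<le> max (u powr (3/2)) (v powr 3) powr (s / 3)"
          using uv s by (intro powr_mono2) auto
        also have "\<dots> \<le> (u powr (3/2)) powr (s / 3) + (v powr 3) powr (s / 3)"
          by (simp add: max_def del: powr_numeral)
        also have "\<dots> = u powr (s / 2) + v powr s" by (simp add: powr_powr del: powr_numeral)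
        finally have "(l * m) powr (s / 3) * (u * v) powr (s / 3) \<le> (l * m) powr (s / 3) * (u powr (s / 2) + v powr s)"
          by (intro mult_left_mono) auto
        also have "(l * m) powr (s / 3) * (u * v) powr (s / 3) = (x * y) powr (s / 3)"
          using uv lm by (simp add: powr_mult mult_ac)
        also have "u powr (s / 2) = l powr (- s / 2) * x powr (s / 2)"
          using xy lm by (simp add: u_def powr_divide powr_minus_divide)
        also have "v powr s = m powr (- s) * y powr s"
          using xy lm by (simp add: v_def powr_divide powr_minus_divide)
        finally show ?thesis by (simp add: c1_def c2_def distrib_left mult.assoc)
      qed
      have point: "epowr (x * y) (s / 3) \<le> ennreal c1 * epowr x (s / 2) + ennreal c2 * epowr y s" for x y
      proof (cases "x = \<infinity> \<or> y = \<infinity>")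
        case True
        then show ?thesis using c by (auto simp: ennreal_mult_top)
      next
        case False
        then obtain a b where "x = ennreal a" "0 \<le> a" "y = ennreal b" "0 \<le> b" by (cases x; cases y) auto
        then show ?thesis
          using c real_point[of a b] by (simp add: epowr_ennreal ennreal_leI flip: ennreal_mult ennreal_plus)
      qed
      have "(\<integral>\<^sup>+\<tau>. epowr (f \<tau> * g \<tau>) (s / 3) \<partial>log_measure T) \<le>
          (\<integral>\<^sup>+\<tau>. ennreal c1 * epowr (f \<tau>) (s / 2) + ennreal c2 * epowr (g \<tau>) s \<partial>log_measure T)"
        by (intro nn_integral_mono point)
      also have "\<dots> = ennreal c1 * ?A + ennreal c2 * ?B"
        by (simp add: nn_integral_cmult nn_integral_add)
      also have "\<dots> \<le> ennreal c1 * ennreal (l powr (s / 2)) + ennreal c2 * ennreal (m powr s)"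
        by (intro add_mono mult_left_mono A B) auto
      also have "\<dots> = ennreal (2 * (l * m) powr (s / 3))"
      proof -
        have "c1 * l powr (s / 2) = (l * m) powr (s / 3)" "c2 * m powr s = (l * m) powr (s / 3)"
          using lm by (simp_all add: c1_def c2_def mult.assoc flip: powr_add)
        then show ?thesis using c by (simp flip: ennreal_mult ennreal_plus)
      qed
      finally have "epowr (\<integral>\<^sup>+\<tau>. epowr (f \<tau> * g \<tau>) (s / 3) \<partial>log_measure T) (1 / (s / 3)) \<le>
          epowr (ennreal (2 * (l * m) powr (s / 3))) (1 / (s / 3))"
        using s by (intro epowr_mono) auto
      also have "\<dots> = ennreal (2 powr (3 / s) * (l * m))"
        using s lm by (simp add: epowr_ennreal powr_mult powr_powr)
      finally show "log_norm T (q / 3) (\<lambda>\<tau>. f \<tau> * g \<tau>) \<le> ennreal (2 powr (3 / s) * (l * m))"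
        unfolding log_norm_finite[OF q3(1)] q3(2) .
    qed simp
  qed simp
qed

lemma log_norm_sqrt:
  assumes [measurable]: "f \<in> borel_measurable borel" and "0 < q"
  shows "log_norm T q (\<lambda>\<tau>. epowr (f \<tau>) (1 / 2)) \<le> epowr (log_norm T (q / 2) f) (1 / 2)"
proof (cases "q = \<infinity>")
  case True
  have "AE \<tau> in log_measure T. f \<tau> \<le> esssup (log_measure T) f" by (rule esssup_AE)
  then have "AE \<tau> in log_measure T. epowr (f \<tau>) (1 / 2) \<le> epowr (esssup (log_measure T) f) (1 / 2)"
    by eventually_elim (rule epowr_mono, auto)
  moreover have "log_norm T (q / 2) f = esssup (log_measure T) f"
    by (simp add: Lq_norm_def True ennreal_top_divide)
  ultimately show ?thesis
    unfolding True by (simp only: log_norm_infinity) (intro esssup_I measurable_log_measure, auto)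
next
  case False
  have q2: "q / 2 \<noteq> \<infinity>" "enn2real (q / 2) = enn2real q / 2"
    using False by (simp_all add: ennreal_divide_numeral)
  show ?thesis
    unfolding log_norm_finite[OF False] log_norm_finite[OF q2(1)] q2(2) by (simp add: epowr_epowr)
qed

section \<open>Weighted norms of nondecreasing functions\<close>

lemma weighted_measurable:
  assumes "mono w"
  shows "(\<lambda>\<tau>. ennreal (\<tau> powr b) * w \<tau>) \<in> borel_measurable borel"
proof -
  have [measurable]: "w \<in> borel_measurable borel" by (rule mono_borel_measurable[OF assms])
  show ?thesis by measurable
qed

lemma powr_cancel_ennreal: "0 < x \<Longrightarrow> ennreal (x powr a) * (ennreal (x powr - a) * w) = w"
  by (simp add: mult.assoc[symmetric] flip: ennreal_mult powr_add)

lemma ennreal_affine: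
  "0 \<le> r \<Longrightarrow> 0 \<le> c \<Longrightarrow> 0 \<le> k \<Longrightarrow>
    ennreal (k + r * c) * J = ennreal k * J + ennreal r * (ennreal c * J)"
  by (simp add: ennreal_plus ennreal_mult distrib_right mult.assoc)

text \<open>On (\<tau>, 2\<tau>) the monotone w is at least w \<tau>, and for d\<tau>/\<tau> this
  interval has mass at least 1/2, since the density exceeds 1/(2\<tau>). It lies in [0, T] because
  \<tau> \<le> T/2. A finite weighted norm therefore gives decay of order \<tau>^a at each such
  scale.\<close>

lemma log_norm_lower:
  assumes "0 < q" "0 < a"
  shows "\<exists>C>0. \<forall>T w \<tau>. mono w \<longrightarrow> 0 < \<tau> \<longrightarrow> \<tau> \<le> T / 2 \<longrightarrow>
    w \<tau> \<le> ennreal (C * \<tau> powr a) * log_norm T q (\<lambda>\<tau>. ennreal (\<tau> powr - a) * w \<tau>)"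
proof -
  define c where "c = (if q = \<infinity> then 1 else 2 powr (1 / enn2real q))"
  have c: "0 < c" by (simp add: c_def)
  have "w \<tau> \<le> ennreal (2 powr a * c * \<tau> powr a) * log_norm T q (\<lambda>\<tau>. ennreal (\<tau> powr - a) * w \<tau>)"
    if w: "mono w" and \<tau>: "0 < \<tau>" "\<tau> \<le> T / 2" for T w \<tau>
  proof -
    let ?f = "\<lambda>\<tau>. ennreal (\<tau> powr - a) * w \<tau>"
    define b where "b = ennreal ((2 * \<tau>) powr - a) * w \<tau>"
    have ge: "b \<le> ?f x" if "\<tau> < x" "x < 2 * \<tau>" for x
      unfolding b_def using that \<tau> assms
      by (intro mult_mono ennreal_leI powr_mono2' monoD[OF w]) auto
    have "b \<le> ennreal c * log_norm T q ?f"
    proof (cases "q = \<infinity>")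
      case True
      obtain x where "\<tau> < x" "x < 2 * \<tau>" "?f x \<le> esssup (log_measure T) ?f"
        by (rule AE_log_measureD[OF esssup_AE[where M = "log_measure T" and f = ?f], of \<tau> "2 * \<tau>"]) (use \<tau> in auto)
      then show ?thesis using ge[of x] True by (auto simp: c_def log_norm_infinity)
    next
      case False
      define s where "s = enn2real q"
      have s: "0 < s" using enn2real_pos[OF assms(1) False] by (simp add: s_def)
      have "ennreal (1 / 2) * epowr b s = epowr b s * ennreal (1 / (2 * \<tau>)) * emeasure lborel {\<tau><..<2 * \<tau>}"
      proof -
        have "ennreal (1 / (2 * \<tau>)) * emeasure lborel {\<tau><..<2 * \<tau>} = ennreal (1 / 2)"
          using \<tau> by (simp flip: ennreal_mult)
        then show ?thesis by (simp only: mult.assoc) (simp only: mult.commute)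
      qed
      also have "\<dots> = (\<integral>\<^sup>+x. epowr b s * ennreal (1 / (2 * \<tau>)) * indicator {\<tau><..<2 * \<tau>} x \<partial>lborel)"
        by (simp add: nn_integral_cmult_indicator)
      also have "\<dots> \<le> (\<integral>\<^sup>+x. ennreal (1 / x) * epowr (?f x) s * indicator {0..T} x \<partial>lborel)"
      proof (rule nn_integral_mono)
        fix x
        show "epowr b s * ennreal (1 / (2 * \<tau>)) * indicator {\<tau><..<2 * \<tau>} x
            \<le> ennreal (1 / x) * epowr (?f x) s * indicator {0..T} x"
        proof (cases "x \<in> {\<tau><..<2 * \<tau>}")
          case True
          then have "epowr b s * ennreal (1 / (2 * \<tau>)) \<le> epowr (?f x) s * ennreal (1 / x)"
            using \<tau> s ge[of x] by (intro mult_mono epowr_mono ennreal_leI divide_left_mono) auto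
          then show ?thesis using True \<tau> by (simp add: mult.commute)
        qed simp
      qed
      also have "\<dots> = (\<integral>\<^sup>+x. epowr (?f x) s \<partial>log_measure T)"
        using measurable_compose[OF weighted_measurable[OF w] epowr_measurable]
        by (intro nn_integral_log_measure[symmetric]) simp
      finally have "epowr (ennreal (1 / 2) * epowr b s) (1 / s) \<le> log_norm T q ?f"
        unfolding log_norm_finite[OF False] s_def[symmetric] using s by (intro epowr_mono) auto
      also have "epowr (ennreal (1 / 2) * epowr b s) (1 / s) = ennreal ((1 / 2) powr (1 / s)) * b"
        using s epowr_ennreal[of "1/2" "1/s"] by (simp add: epowr_mult epowr_inverse)
      finally have "ennreal c * (ennreal ((1 / 2) powr (1 / s)) * b) \<le> ennreal c * log_norm T q ?f"
        by (rule mult_left_mono) simp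
      moreover have "c * (1 / 2) powr (1 / s) = 1"
        using False by (simp add: c_def s_def powr_divide)
      ultimately show ?thesis using c by (simp add: mult.assoc[symmetric] flip: ennreal_mult)
    qed
    then have "ennreal ((2 * \<tau>) powr a) * b \<le> ennreal ((2 * \<tau>) powr a) * (ennreal c * log_norm T q ?f)"
      by (rule mult_left_mono) simp
    moreover have "ennreal ((2 * \<tau>) powr a) * b = w \<tau>"
      unfolding b_def using \<tau> by (intro powr_cancel_ennreal) simp
    moreover have "ennreal ((2 * \<tau>) powr a) * (ennreal c * log_norm T q ?f) = ennreal (2 powr a * c * \<tau> powr a) * log_norm T q ?f"
      using c \<tau> by (simp add: powr_mult mult_ac flip: ennreal_mult mult.assoc)
    ultimately show ?thesis by simp
  qed
  then show ?thesis using c by (intro exI[of _ "2 powr a * c"]) auto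
qed

text \<open>The essential bound holds at suitable points x just above \<tau>, where w x \<ge> w
  \<tau>; then x tends to \<tau>.\<close>

lemma log_norm_infinity_bound:
  assumes w: "mono w" and "0 \<le> a" "log_norm T \<infinity> (\<lambda>\<tau>. ennreal (\<tau> powr - a) * w \<tau>) \<le> K" and \<tau>: "0 < \<tau>" "\<tau> < T"
  shows "w \<tau> \<le> K * ennreal (\<tau> powr a)"
proof (cases "K = \<infinity>")
  case True
  then show ?thesis using \<tau> by (simp add: ennreal_top_mult)
next
  case False
  have "((\<lambda>x. K * ennreal (x powr a)) \<longlongrightarrow> K * ennreal (\<tau> powr a)) (at_right \<tau>)"
    using False \<tau> by (intro ennreal_tendsto_cmult tendsto_ennrealI tendsto_powr tendsto_ident_at tendsto_const)
      (auto simp: less_top)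
  moreover have "eventually (\<lambda>x. w \<tau> \<le> K * ennreal (x powr a)) (at_right \<tau>)"
    unfolding eventually_at_right_field
  proof (intro exI[of _ T] conjI allI impI)
    fix y assume y: "\<tau> < y" "y < T"
    have "AE x in log_measure T. ennreal (x powr - a) * w x \<le> K"
      using esssup_AE[where M = "log_measure T" and f = "\<lambda>\<tau>. ennreal (\<tau> powr - a) * w \<tau>"]
      by eventually_elim (use assms(3) in \<open>auto simp: log_norm_infinity intro: order.trans\<close>)
    then obtain x where x: "\<tau> < x" "x < y" "ennreal (x powr - a) * w x \<le> K"
      by (rule AE_log_measureD[where a = \<tau> and b = y]) (use \<tau> y in auto)
    have "w \<tau> \<le> w x" using x by (intro monoD[OF w]) auto
    also have "\<dots> = ennreal (x powr a) * (ennreal (x powr - a) * w x)"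
      using x \<tau> by (simp add: powr_cancel_ennreal)
    also have "\<dots> \<le> ennreal (y powr a) * K"
      using x \<tau> assms(2) by (intro mult_mono ennreal_leI powr_mono2) auto
    finally show "w \<tau> \<le> K * ennreal (y powr a)" by (simp add: mult.commute)
  qed (use \<tau> in simp)
  ultimately show ?thesis by (rule tendsto_lowerbound) simp
qed

section \<open>Dyadic iteration of the halving inequality\<close>

text \<open>The sum of 2^i G(\<tau>/2^i) over i < n, written as the recursion obtained by unfolding
  the halving inequality from outside. In this form each induction step uses scale invariance
  exactly once.\<close>

primrec dyadic_sum :: "(real \<Rightarrow> ennreal) \<Rightarrow> nat \<Rightarrow> real \<Rightarrow> ennreal"
  where "dyadic_sum G 0 \<tau> = 0"
  | "dyadic_sum G (Suc n) \<tau> = G \<tau> + 2 * dyadic_sum G n (\<tau> / 2)"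

lemma dyadic_sum_mono: "mono G \<Longrightarrow> mono (dyadic_sum G n)"
proof (induction n)
  case (Suc n)
  then have "mono (dyadic_sum G n)" by simp
  then show ?case
    by (auto intro!: monoI add_mono mult_left_mono monoD[OF Suc.prems] elim: monoD)
qed (simp add: mono_def)

lemma dyadic_sum_incseq: "dyadic_sum G n \<tau> \<le> dyadic_sum G (Suc n) \<tau>"
proof (induction n arbitrary: \<tau>)
  case (Suc n)
  have "G \<tau> + 2 * dyadic_sum G n (\<tau> / 2) \<le> G \<tau> + 2 * dyadic_sum G (Suc n) (\<tau> / 2)"
    by (intro add_left_mono mult_left_mono Suc) simp
  then show ?case by simp
qed simp

lemma dyadic_sum_bound:
  assumes "\<And>\<tau>. 0 < \<tau> \<Longrightarrow> \<tau> < T \<Longrightarrow> F \<tau> \<le> 2 * F (\<tau> / 2) + G \<tau>" "0 < \<tau>" "\<tau> < T"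
  shows "F \<tau> \<le> dyadic_sum G n \<tau> + 2 ^ n * F (\<tau> / 2 ^ n)"
  using assms(2,3)
proof (induction n arbitrary: \<tau>)
  case (Suc n)
  have "F (\<tau> / 2) \<le> dyadic_sum G n (\<tau> / 2) + 2 ^ n * F (\<tau> / 2 / 2 ^ n)"
    using Suc.prems by (intro Suc.IH) auto
  then have "2 * F (\<tau> / 2) + G \<tau> \<le> 2 * (dyadic_sum G n (\<tau> / 2) + 2 ^ n * F (\<tau> / 2 / 2 ^ n)) + G \<tau>"
    by (intro add_right_mono mult_left_mono) auto
  with assms(1)[OF Suc.prems] show ?case
    by (simp add: distrib_left add_ac mult_ac) (erule order.trans, simp)
qed simp

lemma two_pow_powr: "((2::real) ^ n) powr \<gamma> = (2 powr \<gamma>) ^ n"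
  by (induction n) (simp_all add: powr_mult)

text \<open>2^n (\<tau>/2^n)^\<gamma> is a geometric sequence with ratio 2^(1-\<gamma>) < 1.\<close>

lemma two_pow_tendsto_zero:
  assumes "1 < \<gamma>" "0 \<le> K" "0 < \<tau>" "\<And>x. 0 < x \<Longrightarrow> x \<le> \<tau> \<Longrightarrow> F x \<le> ennreal (K * x powr \<gamma>)"
  shows "(\<lambda>n. 2 ^ n * F (\<tau> / 2 ^ n)) \<longlonglongrightarrow> (0::ennreal)"
proof (rule tendsto_sandwich[where f = "\<lambda>_. 0" and h = "\<lambda>n. ennreal (K * \<tau> powr \<gamma> * (2 powr (1 - \<gamma>)) ^ n)"])
  have "2 ^ n * F (\<tau> / 2 ^ n) \<le> ennreal (K * \<tau> powr \<gamma> * (2 powr (1 - \<gamma>)) ^ n)" for n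
  proof -
    have "2 ^ n * F (\<tau> / 2 ^ n) \<le> ennreal (2 ^ n) * ennreal (K * (\<tau> / 2 ^ n) powr \<gamma>)"
      using assms by (intro mult_mono assms(4)) (auto simp: field_simps simp flip: ennreal_power)
    also have "2 ^ n * (K * (\<tau> / 2 ^ n) powr \<gamma>) = K * \<tau> powr \<gamma> * (2 powr (1 - \<gamma>)) ^ n"
    proof -
      have "(2 powr (1 - \<gamma>)) ^ n = 2 ^ n / (2 ^ n) powr \<gamma>"
        by (simp add: two_pow_powr powr_diff power_divide)
      then show ?thesis using assms by (simp add: powr_divide)
    qed
    then have "ennreal (2 ^ n) * ennreal (K * (\<tau> / 2 ^ n) powr \<gamma>) = ennreal (K * \<tau> powr \<gamma> * (2 powr (1 - \<gamma>)) ^ n)"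
      using assms by (subst ennreal_mult[symmetric]) auto
    finally show ?thesis .
  qed
  then show "eventually (\<lambda>n. 2 ^ n * F (\<tau> / 2 ^ n) \<le> ennreal (K * \<tau> powr \<gamma> * (2 powr (1 - \<gamma>)) ^ n)) sequentially"
    by simp
  have "2 powr (1 - \<gamma>) < 2 powr 0" using assms by (intro powr_less_mono) auto
  then have "(\<lambda>n. K * \<tau> powr \<gamma> * (2 powr (1 - \<gamma>)) ^ n) \<longlonglongrightarrow> K * \<tau> powr \<gamma> * 0"
    by (intro tendsto_mult tendsto_const LIMSEQ_realpow_zero) auto
  then show "(\<lambda>n. ennreal (K * \<tau> powr \<gamma> * (2 powr (1 - \<gamma>)) ^ n)) \<longlonglongrightarrow> 0"
    using tendsto_ennrealI by fastforce
qed auto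

text \<open>As 2 \<tau>^(-a) = \<rho> (\<tau>/2)^(-a) with \<rho> = 2^(1-a) < 1, a halving step
  contracts the weighted norm. The term with F cannot simply be absorbed into the left-hand side,
  since the norm of F might be infinite; instead the dyadic sums are bounded uniformly in n, and F
  lies below their supremum because the remainder vanishes.\<close>

lemma log_norm_iterate:
  assumes a: "1 < a" and q: "0 < q"
  shows "\<exists>C>0. \<forall>T F G. mono F \<longrightarrow> mono G \<longrightarrow>
    (\<forall>\<tau>. 0 < \<tau> \<longrightarrow> \<tau> < T \<longrightarrow> F \<tau> \<le> 2 * F (\<tau> / 2) + G \<tau>) \<longrightarrow>
    (\<forall>\<tau>. 0 < \<tau> \<longrightarrow> \<tau> < T \<longrightarrow> (\<lambda>n. 2 ^ n * F (\<tau> / 2 ^ n)) \<longlonglongrightarrow> 0) \<longrightarrow>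
    log_norm T q (\<lambda>\<tau>. ennreal (\<tau> powr - a) * F \<tau>) \<le>
      ennreal C * log_norm T q (\<lambda>\<tau>. ennreal (\<tau> powr - a) * G \<tau>)"
proof -
  define \<rho> where "\<rho> = 2 powr (1 - a)"
  have \<rho>: "0 < \<rho>" "\<rho> < 1"
    using a powr_less_mono[of "1 - a" 0 2] by (auto simp: \<rho>_def)
  have step: "ennreal (\<tau> powr - a) * (2 * w (\<tau> / 2)) = ennreal \<rho> * (ennreal ((1 / 2 * \<tau>) powr - a) * w (1 / 2 * \<tau>))"
    if "0 < \<tau>" for \<tau> and w :: "real \<Rightarrow> ennreal"
  proof -
    have "\<tau> powr - a * 2 = \<rho> * (1 / 2 * \<tau>) powr - a"
      using that by (simp add: \<rho>_def powr_diff powr_minus_divide powr_divide)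
    then have "ennreal (\<tau> powr - a) * ennreal 2 = ennreal \<rho> * ennreal ((1 / 2 * \<tau>) powr - a)"
      using \<rho> by (simp only: ennreal_mult[symmetric] powr_ge_zero less_imp_le)
    then show ?thesis by (simp add: mult.assoc[symmetric])
  qed
  have le_SUP: "F \<tau> \<le> (SUP n. dyadic_sum G n \<tau>)"
    if "\<forall>\<tau>. 0 < \<tau> \<longrightarrow> \<tau> < T \<longrightarrow> F \<tau> \<le> 2 * F (\<tau> / 2) + G \<tau>"
      "(\<lambda>n. 2 ^ n * F (\<tau> / 2 ^ n)) \<longlonglongrightarrow> 0" "0 < \<tau>" "\<tau> < T" for T F G \<tau>
  proof -
    have "(\<lambda>n. (SUP n. dyadic_sum G n \<tau>) + 2 ^ n * F (\<tau> / 2 ^ n)) \<longlonglongrightarrow> (SUP n. dyadic_sum G n \<tau>) + 0"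
      by (intro tendsto_add tendsto_const that)
    moreover have "F \<tau> \<le> (SUP n. dyadic_sum G n \<tau>) + 2 ^ n * F (\<tau> / 2 ^ n)" for n
      using dyadic_sum_bound[of T F G \<tau> n] that SUP_upper[of n UNIV "\<lambda>n. dyadic_sum G n \<tau>"]
      by (auto intro: order.trans add_right_mono)
    ultimately have "F \<tau> \<le> (SUP n. dyadic_sum G n \<tau>) + 0"
      by (intro LIMSEQ_le_const) auto
    then show ?thesis by simp
  qed
  show ?thesis
  proof (cases "q = \<infinity>")
    case True
    \<comment> \<open>1/(1 - \<rho>) solves c = 1 + \<rho> c, so the induction on n reproduces
      it.\<close>
    have "log_norm T q (\<lambda>\<tau>. ennreal (\<tau> powr - a) * F \<tau>) \<le>
        ennreal (1 / (1 - \<rho>)) * log_norm T q (\<lambda>\<tau>. ennreal (\<tau> powr - a) * G \<tau>)"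
      if mono: "mono F" "mono G" and F: "\<forall>\<tau>. 0 < \<tau> \<longrightarrow> \<tau> < T \<longrightarrow> F \<tau> \<le> 2 * F (\<tau> / 2) + G \<tau>"
        "\<forall>\<tau>. 0 < \<tau> \<longrightarrow> \<tau> < T \<longrightarrow> (\<lambda>n. 2 ^ n * F (\<tau> / 2 ^ n)) \<longlonglongrightarrow> 0" for T F G
    proof -
      define K where "K = log_norm T \<infinity> (\<lambda>\<tau>. ennreal (\<tau> powr - a) * G \<tau>)"
      have G: "ennreal (\<tau> powr - a) * G \<tau> \<le> K" if "0 < \<tau>" "\<tau> < T" for \<tau>
      proof -
        have "ennreal (\<tau> powr - a) * G \<tau> \<le> ennreal (\<tau> powr - a) * (K * ennreal (\<tau> powr a))"
          using log_norm_infinity_bound[OF mono(2), of a T K \<tau>] a that by (intro mult_left_mono) (auto simp: K_def)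
        also have "\<dots> = K"
          using powr_cancel_ennreal[of \<tau> "- a" K] that by (simp add: mult_ac)
        finally show ?thesis .
      qed
      have "ennreal (\<tau> powr - a) * dyadic_sum G n \<tau> \<le> ennreal (1 / (1 - \<rho>)) * K" if "0 < \<tau>" "\<tau> < T" for n \<tau>
        using that
      proof (induction n arbitrary: \<tau>)
        case (Suc n)
        have "ennreal (\<tau> powr - a) * dyadic_sum G (Suc n) \<tau> =
            ennreal (\<tau> powr - a) * G \<tau> + ennreal \<rho> * (ennreal ((1 / 2 * \<tau>) powr - a) * dyadic_sum G n (1 / 2 * \<tau>))"
          using step[OF Suc.prems(1), of "dyadic_sum G n"] by (simp add: distrib_left)
        also have "\<dots> \<le> K + ennreal \<rho> * (ennreal (1 / (1 - \<rho>)) * K)"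
          using Suc.prems by (intro add_mono G mult_left_mono Suc.IH) auto
        also have "\<dots> = ennreal (1 + \<rho> * (1 / (1 - \<rho>))) * K"
          using \<rho> by (subst ennreal_affine) auto
        also have "1 + \<rho> * (1 / (1 - \<rho>)) = 1 / (1 - \<rho>)" using \<rho> by (simp add: field_simps)
        finally show ?case .
      qed simp
      then have bound: "ennreal (\<tau> powr - a) * (SUP n. dyadic_sum G n \<tau>) \<le> ennreal (1 / (1 - \<rho>)) * K" if "0 < \<tau>" "\<tau> < T" for \<tau>
        using that by (simp add: SUP_mult_left_ennreal SUP_least)
      show ?thesis unfolding True K_def[symmetric]
      proof (rule log_norm_infinity_le)
        fix \<tau> assume \<tau>: "0 < \<tau>" "\<tau> < T"
        have "ennreal (\<tau> powr - a) * F \<tau> \<le> ennreal (\<tau> powr - a) * (SUP n. dyadic_sum G n \<tau>)"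
          using le_SUP[OF F(1) _ \<tau>] F(2) \<tau> by (intro mult_left_mono) auto
        also note bound[OF \<tau>]
        finally show "ennreal (\<tau> powr - a) * F \<tau> \<le> ennreal (1 / (1 - \<rho>)) * K" .
      qed (rule weighted_measurable[OF mono(1)])
    qed
    then show ?thesis using \<rho> by (intro exI[of _ "1 / (1 - \<rho>)"]) auto
  next
    case False
    define s where "s = enn2real q"
    have s: "0 < s" using enn2real_pos[OF q False] by (simp add: s_def)
    \<comment> \<open>Any \<theta> strictly between 1 and \<rho>^(-s) would leave a contraction;
      this one gives the factor r = \<rho>^(s/2).\<close>
    define \<theta> where "\<theta> = \<rho> powr (- s / 2)"
    have "1 < \<theta>"
    proof -
      have "(1::real) powr (- s / 2) < \<rho> powr (- s / 2)"
        using \<rho> s by (intro powr_less_mono2_neg) auto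
      then show ?thesis by (simp add: \<theta>_def)
    qed
    then obtain K where K: "0 < K" "\<And>x y. epowr (x + y) s \<le> ennreal \<theta> * epowr x s + ennreal K * epowr y s"
      using epowr_add_split[OF s] by metis
    define r where "r = \<theta> * \<rho> powr s"
    have "r = \<rho> powr (s / 2)" using \<rho> by (simp add: r_def \<theta>_def flip: powr_add)
    moreover have "\<rho> powr (s / 2) < 1 powr (s / 2)" using \<rho> s by (intro powr_less_mono2) auto
    ultimately have r: "0 < r" "r < 1" using \<rho> by auto
    have "log_norm T q (\<lambda>\<tau>. ennreal (\<tau> powr - a) * F \<tau>) \<le>
        ennreal ((K / (1 - r)) powr (1 / s)) * log_norm T q (\<lambda>\<tau>. ennreal (\<tau> powr - a) * G \<tau>)"
      if mono: "mono F" "mono G" and F: "\<forall>\<tau>. 0 < \<tau> \<longrightarrow> \<tau> < T \<longrightarrow> F \<tau> \<le> 2 * F (\<tau> / 2) + G \<tau>"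
        "\<forall>\<tau>. 0 < \<tau> \<longrightarrow> \<tau> < T \<longrightarrow> (\<lambda>n. 2 ^ n * F (\<tau> / 2 ^ n)) \<longlonglongrightarrow> 0" for T F G
    proof -
      define f where "f n \<tau> = epowr (ennreal (\<tau> powr - a) * dyadic_sum G n \<tau>) s" for n \<tau>
      define J where "J = (\<integral>\<^sup>+\<tau>. epowr (ennreal (\<tau> powr - a) * G \<tau>) s \<partial>log_measure T)"
      have mf [measurable]: "f n \<in> borel_measurable borel" for n
        unfolding f_def by (rule measurable_compose[OF weighted_measurable epowr_measurable]) (rule dyadic_sum_mono[OF mono(2)])
      have mG [measurable]: "(\<lambda>\<tau>. epowr (ennreal (\<tau> powr - a) * G \<tau>) s) \<in> borel_measurable borel"
        by (rule measurable_compose[OF weighted_measurable epowr_measurable]) (rule mono(2))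
      have mlog: "f n \<in> borel_measurable (log_measure T)"
          "(\<lambda>\<tau>. f n (1 / 2 * \<tau>)) \<in> borel_measurable (log_measure T)"
          "(\<lambda>\<tau>. epowr (ennreal (\<tau> powr - a) * G \<tau>) s) \<in> borel_measurable (log_measure T)" for n
        by (rule measurable_log_measure, measurable)+
      \<comment> \<open>K/(1 - r) solves c = r c + K. The bound is uniform in n, as monotone
        convergence requires.\<close>
      have I: "(\<integral>\<^sup>+\<tau>. f n \<tau> \<partial>log_measure T) \<le> ennreal (K / (1 - r)) * J" for n
      proof (induction n)
        case (Suc n)
        have "(\<integral>\<^sup>+\<tau>. f (Suc n) \<tau> \<partial>log_measure T) \<le>
          (\<integral>\<^sup>+\<tau>. ennreal r * f n (1 / 2 * \<tau>) + ennreal K * epowr (ennreal (\<tau> powr - a) * G \<tau>) s \<partial>log_measure T)"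
        proof (intro nn_integral_mono_AE AE_log_measureI)
          fix \<tau> :: real assume \<tau>: "0 < \<tau>"
          let ?y = "ennreal ((1 / 2 * \<tau>) powr - a) * dyadic_sum G n (1 / 2 * \<tau>)"
          have "f (Suc n) \<tau> = epowr (ennreal \<rho> * ?y + ennreal (\<tau> powr - a) * G \<tau>) s"
            using step[OF \<tau>, of "dyadic_sum G n"] by (simp add: f_def distrib_left add.commute)
          also have "\<dots> \<le> ennreal \<theta> * epowr (ennreal \<rho> * ?y) s + ennreal K * epowr (ennreal (\<tau> powr - a) * G \<tau>) s"
            by (rule K(2))
          also have "ennreal \<theta> * epowr (ennreal \<rho> * ?y) s = ennreal r * f n (1 / 2 * \<tau>)"
            using s \<rho> \<open>1 < \<theta>\<close>
            by (simp add: epowr_mult epowr_ennreal f_def r_def ennreal_mult mult.assoc)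
          finally show "f (Suc n) \<tau> \<le> ennreal r * f n (1 / 2 * \<tau>) + ennreal K * epowr (ennreal (\<tau> powr - a) * G \<tau>) s" .
        qed
        also have "\<dots> = ennreal r * (\<integral>\<^sup>+\<tau>. f n (1 / 2 * \<tau>) \<partial>log_measure T) + ennreal K * J"
          unfolding J_def using mlog by (simp add: nn_integral_add nn_integral_cmult)
        also have "\<dots> \<le> ennreal r * (ennreal (K / (1 - r)) * J) + ennreal K * J"
          by (intro add_right_mono mult_left_mono order.trans[OF nn_integral_log_measure_scale Suc.IH]) auto
        also have "\<dots> = ennreal (r * (K / (1 - r)) + K) * J"
          using r K by (simp only: add.commute[of "r * (K / (1 - r))"], subst ennreal_affine) (auto simp: add.commute)
        also have "r * (K / (1 - r)) + K = K / (1 - r)" using r by (simp add: field_simps)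
        finally show ?case .
      qed (simp add: f_def)
      have "(\<integral>\<^sup>+\<tau>. epowr (ennreal (\<tau> powr - a) * F \<tau>) s \<partial>log_measure T) \<le> (\<integral>\<^sup>+\<tau>. (SUP n. f n \<tau>) \<partial>log_measure T)"
      proof (intro nn_integral_mono_AE AE_log_measureI)
        fix \<tau> :: real assume \<tau>: "0 < \<tau>" "\<tau> < T"
        have "ennreal (\<tau> powr - a) * F \<tau> \<le> ennreal (\<tau> powr - a) * (SUP n. dyadic_sum G n \<tau>)"
          using le_SUP[OF F(1) _ \<tau>] F(2) \<tau> by (intro mult_left_mono) auto
        also have "\<dots> = (SUP n. ennreal (\<tau> powr - a) * dyadic_sum G n \<tau>)"
          by (rule SUP_mult_left_ennreal)
        finally have "epowr (ennreal (\<tau> powr - a) * F \<tau>) s \<le> epowr (SUP n. ennreal (\<tau> powr - a) * dyadic_sum G n \<tau>) s"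
          by (rule epowr_mono[OF s])
        also have "\<dots> \<le> (SUP n. f n \<tau>)"
          unfolding f_def by (rule epowr_SUP_le[OF s])
        finally show "epowr (ennreal (\<tau> powr - a) * F \<tau>) s \<le> (SUP n. f n \<tau>)" .
      qed
      also have "\<dots> = (SUP n. \<integral>\<^sup>+\<tau>. f n \<tau> \<partial>log_measure T)"
      proof (rule nn_integral_monotone_convergence_SUP)
        show "incseq f"
          unfolding f_def by (intro incseq_SucI le_funI epowr_mono s mult_left_mono dyadic_sum_incseq) simp
      qed (rule mlog)
      also have "\<dots> \<le> ennreal (K / (1 - r)) * J"
        by (intro SUP_least I)
      finally have "log_norm T q (\<lambda>\<tau>. ennreal (\<tau> powr - a) * F \<tau>) \<le> epowr (ennreal (K / (1 - r)) * J) (1 / s)"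
        unfolding log_norm_finite[OF False] s_def[symmetric] using s by (intro epowr_mono) auto
      also have "\<dots> = ennreal ((K / (1 - r)) powr (1 / s)) * epowr J (1 / s)"
        using s r K by (simp add: epowr_mult epowr_ennreal)
      also have "epowr J (1 / s) = log_norm T q (\<lambda>\<tau>. ennreal (\<tau> powr - a) * G \<tau>)"
        unfolding log_norm_finite[OF False] s_def[symmetric] J_def ..
      finally show ?thesis .
    qed
    then show ?thesis using r K by (intro exI[of _ "(K / (1 - r)) powr (1 / s)"]) auto
  qed
qed

text \<open>The analytic core of uniqueness: without an inhomogeneity F \<tau> \<le> 2^n
  F(\<tau>/2^n), and a finite norm forces F x \<le> C x^a with a > 1 by
  \<open>log_norm_lower\<close>, so the right-hand side tends to 0.\<close>

lemma halving_imp_zero: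
  assumes "1 < a" "0 < q" "mono F" "\<And>\<tau>. 0 < \<tau> \<Longrightarrow> \<tau> < T \<Longrightarrow> F \<tau> \<le> 2 * F (\<tau> / 2)"
    and "log_norm T q (\<lambda>\<tau>. ennreal (\<tau> powr - a) * F \<tau>) < \<infinity>" "0 < \<tau>" "\<tau> \<le> T / 2"
  shows "F \<tau> = 0"
proof -
  obtain C where C: "0 < C" "\<And>x. 0 < x \<Longrightarrow> x \<le> T / 2 \<Longrightarrow>
      F x \<le> ennreal (C * x powr a) * log_norm T q (\<lambda>\<tau>. ennreal (\<tau> powr - a) * F \<tau>)"
    using log_norm_lower[OF assms(2), of a] assms(1,3) by auto
  obtain k where k: "log_norm T q (\<lambda>\<tau>. ennreal (\<tau> powr - a) * F \<tau>) = ennreal k" "0 \<le> k"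
    using assms(5) by (cases "log_norm T q (\<lambda>\<tau>. ennreal (\<tau> powr - a) * F \<tau>)") auto
  have "(\<lambda>n. 2 ^ n * F (\<tau> / 2 ^ n)) \<longlonglongrightarrow> 0"
  proof (rule two_pow_tendsto_zero[OF assms(1) _ assms(6)])
    show "F x \<le> ennreal (C * k * x powr a)" if "0 < x" "x \<le> \<tau>" for x
      using C(2)[of x] that assms(7) C(1) k by (simp add: mult_ac flip: ennreal_mult)
  qed (use C k in simp)
  moreover have "F \<tau> \<le> 2 ^ n * F (\<tau> / 2 ^ n)" for n
  proof -
    have "dyadic_sum (\<lambda>_. 0) n x = 0" for x by (induction n arbitrary: x) auto
    then show ?thesis
      using dyadic_sum_bound[of T F "\<lambda>_. 0" \<tau> n] assms(4,6,7) by auto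
  qed
  ultimately have "F \<tau> \<le> 0" by (intro LIMSEQ_le_const) auto
  then show ?thesis by simp
qed

section \<open>Sums over the pieces of a partition\<close>

lemma powr_add_le:
  assumes "0 \<le> x" "0 \<le> y" "0 < \<rho>" "\<rho> \<le> (1::real)"
  shows "(x + y) powr \<rho> \<le> x powr \<rho> + y powr \<rho>"
proof (cases "x = 0 \<or> y = 0")
  case False
  then have xy: "0 < x" "0 < y" using assms by auto
  \<comment> \<open>Splitting off the exponent \<rho> - 1 \<le> 0 gives a factor that only grows
    when x + y is replaced by x or by y.\<close>
  have "(x + y) powr \<rho> = (x + y) powr (\<rho> - 1) * (x + y) powr 1"
    by (simp only: powr_add[symmetric]) simp
  also have "\<dots> = x powr 1 * (x + y) powr (\<rho> - 1) + y powr 1 * (x + y) powr (\<rho> - 1)"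
    using xy by (simp add: algebra_simps)
  also have "\<dots> \<le> x powr 1 * x powr (\<rho> - 1) + y powr 1 * y powr (\<rho> - 1)"
    using xy assms by (intro add_mono mult_left_mono powr_mono2') auto
  also have "\<dots> = x powr \<rho> + y powr \<rho>"
    by (simp only: powr_add[symmetric]) simp
  finally show ?thesis .
qed auto

lemma powr_sum_le:
  assumes "finite I" "\<And>i. i \<in> I \<Longrightarrow> 0 \<le> x i" "0 < \<rho>" "\<rho> \<le> (1::real)"
  shows "(\<Sum>i\<in>I. x i) powr \<rho> \<le> (\<Sum>i\<in>I. x i powr \<rho>)"
  using assms(1,2)
proof (induction I)
  case (insert i I)
  have "(x i + sum x I) powr \<rho> \<le> x i powr \<rho> + sum x I powr \<rho>"
    using insert.prems by (intro powr_add_le assms(3,4) sum_nonneg) auto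
  also have "sum x I powr \<rho> \<le> (\<Sum>i\<in>I. x i powr \<rho>)" using insert by auto
  finally show ?case using insert by simp
qed simp

text \<open>For \<rho> \<ge> 1 this is Jensen's inequality with weights d i, for \<rho> < 1
  subadditivity of the power. One factor d i is kept as a weight with total mass 1; the excess e is
  the gain in the mesh size. It is positive when a > 1, respectively a > 1/\<rho>; for a = 3\<alpha>
  this is the origin of the lower bound on the integrability exponent of the Riemann sums.\<close>

lemma powr_partition_sum_le:
  fixes d y :: "nat \<Rightarrow> real"
  assumes d: "\<And>i. i < L \<Longrightarrow> 0 < d i" "(\<Sum>i<L. d i) = 1" and y: "\<And>i. i < L \<Longrightarrow> 0 \<le> y i"
    and \<rho>: "0 < \<rho>" and e: "e = (if 1 \<le> \<rho> then a - 1 else a - 1 / \<rho>)"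
  shows "(\<Sum>i<L. d i powr a * y i) powr \<rho> \<le> (\<Sum>i<L. d i * d i powr (e * \<rho>) * y i powr \<rho>)"
proof (cases "1 \<le> \<rho>")
  case True
  have "(\<Sum>i<L. d i powr a * y i) = (\<Sum>i<L. d i *\<^sub>R (d i powr (a - 1) * y i))"
  proof (rule sum.cong)
    fix i assume "i \<in> {..<L}"
    then have "0 < d i" using d by simp
    then show "d i powr a * y i = d i *\<^sub>R (d i powr (a - 1) * y i)"
      by (simp add: powr_diff)
  qed simp
  also have "\<dots> powr \<rho> \<le> (\<Sum>i<L. d i * (d i powr (a - 1) * y i) powr \<rho>)"
    using d y True
    by (intro convex_on_sum[OF _ _ convex_on_powr_nonneg]) (auto simp: less_imp_le intro: Suc_leI)
  also have "\<dots> = (\<Sum>i<L. d i * d i powr (e * \<rho>) * y i powr \<rho>)"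
    using True y by (intro sum.cong) (auto simp: powr_mult powr_powr e)
  finally show ?thesis .
next
  case False
  have "(\<Sum>i<L. d i powr a * y i) powr \<rho> \<le> (\<Sum>i<L. (d i powr a * y i) powr \<rho>)"
    using y \<rho> False by (intro powr_sum_le) auto
  also have "\<dots> = (\<Sum>i<L. d i * d i powr (e * \<rho>) * y i powr \<rho>)"
  proof (rule sum.cong)
    fix i assume "i \<in> {..<L}"
    then have di: "0 < d i" "0 \<le> y i" using d y by auto
    have "d i powr (a * \<rho>) = d i powr 1 * d i powr (e * \<rho>)"
      using False \<rho> by (simp only: powr_add[symmetric] e) (simp add: left_diff_distrib)
    then show "(d i powr a * y i) powr \<rho> = d i * d i powr (e * \<rho>) * y i powr \<rho>"
      using di by (simp add: powr_mult powr_powr)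
  qed simp
  finally show ?thesis .
qed

text \<open>The weight turns w(d i * \<tau>) into (d i)^a times the rescaled weighted w, whose norm
  is controlled by scale invariance; \<open>powr_partition_sum_le\<close> then sums these terms with
  the gain \<eta>^e, where \<eta> bounds the mesh.\<close>

lemma log_norm_partition:
  assumes a: "1 < a" and q: "0 < q" and T: "0 < T" and w: "mono w" "w T < \<infinity>"
    and fin: "log_norm T q (\<lambda>\<tau>. ennreal (\<tau> powr - a) * w \<tau>) < \<infinity>"
    and r: "q \<le> r" "ennreal (1 / a) < r"
  shows "\<exists>C e. 0 < e \<and> 0 \<le> C \<and> (\<forall>(d :: nat \<Rightarrow> real) L \<eta>.
    (\<forall>i<L. 0 < d i \<and> d i \<le> \<eta>) \<longrightarrow> (\<Sum>i<L. d i) = 1 \<longrightarrow>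
    log_norm T r (\<lambda>\<tau>. ennreal (\<tau> powr - a) * (\<Sum>i<L. w (d i * \<tau>))) \<le> ennreal (C * \<eta> powr e))"
proof -
  obtain C where C: "0 < C" "\<And>x. 0 < x \<Longrightarrow> x \<le> T / 2 \<Longrightarrow>
      w x \<le> ennreal (C * x powr a) * log_norm T q (\<lambda>\<tau>. ennreal (\<tau> powr - a) * w \<tau>)"
    using log_norm_lower[OF q, of a] a w(1) by auto
  obtain k0 where k0: "log_norm T q (\<lambda>\<tau>. ennreal (\<tau> powr - a) * w \<tau>) = ennreal k0" "0 \<le> k0"
    using fin by (cases "log_norm T q (\<lambda>\<tau>. ennreal (\<tau> powr - a) * w \<tau>)") auto
  obtain k1 where k1: "w T = ennreal k1" "0 \<le> k1" using w(2) by (cases "w T") auto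
  \<comment> \<open>k bounds w x / x^a on all of (0, T]: up to T/2 by \<open>log_norm_lower\<close>,
    beyond by w T. The summand 1 makes it positive.\<close>
  define k where "k = C * k0 + k1 * (T / 2) powr - a + 1"
  have k: "0 < k" using C k0 k1 by (auto simp: k_def intro!: add_nonneg_pos)
  have wk: "w x \<le> ennreal (k * x powr a)" if x: "0 < x" "x \<le> T" for x
  proof (cases "x \<le> T / 2")
    case True
    have "w x \<le> ennreal (C * k0 * x powr a)"
      using C(2)[OF x(1) True] C(1) k0 by (simp add: mult_ac flip: ennreal_mult)
    also have "\<dots> \<le> ennreal (k * x powr a)"
      using k1 by (intro ennreal_leI mult_right_mono) (auto simp: k_def)
    finally show ?thesis .
  next
    case False
    have "w x \<le> ennreal k1" using monoD[OF w(1) x(2)] k1 by simp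
    also have "k1 * 1 \<le> k1 * ((T / 2) powr - a * x powr a)"
    proof (rule mult_left_mono[OF _ k1(2)])
      have "1 = (T / 2) powr - a * (T / 2) powr a" using T by (simp flip: powr_add)
      also have "\<dots> \<le> (T / 2) powr - a * x powr a"
        using False T a by (intro mult_left_mono powr_mono2) auto
      finally show "1 \<le> (T / 2) powr - a * x powr a" .
    qed
    then have "ennreal k1 \<le> ennreal (k1 * (T / 2) powr - a * x powr a)"
      by (intro ennreal_leI) (simp add: mult.assoc)
    also have "\<dots> \<le> ennreal (k * x powr a)"
      using C k0 by (intro ennreal_leI mult_right_mono) (auto simp: k_def)
    finally show ?thesis .
  qed
  have d_le_1: "d i \<le> 1" if "\<forall>i<L. 0 < d i \<and> d i \<le> \<eta>" "(\<Sum>i<L. d i) = 1" "i < L" for d :: "nat \<Rightarrow> real" and L i and \<eta> :: real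
    using member_le_sum[of i "{..<L}" d] that by (auto simp: less_imp_le)
  show ?thesis
  proof (cases "r = \<infinity>")
    case True
    show ?thesis
    proof (rule exI[of _ k], rule exI[of _ "a - 1"], intro conjI allI impI)
      fix d :: "nat \<Rightarrow> real" and L \<eta> assume d: "\<forall>i<L. 0 < d i \<and> d i \<le> \<eta>" "(\<Sum>i<L. d i) = 1"
      note d1 = d_le_1[OF d]
      have sum_le: "(\<Sum>i<L. d i powr a) \<le> \<eta> powr (a - 1)"
      proof -
        have "(\<Sum>i<L. d i powr a) \<le> (\<Sum>i<L. d i * \<eta> powr (a - 1))"
        proof (rule sum_mono)
          fix i assume "i \<in> {..<L}"
          then have i: "0 < d i" "d i \<le> \<eta>" using d by auto
          have "d i powr a = d i * d i powr (a - 1)" using i by (simp add: powr_diff)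
          also have "\<dots> \<le> d i * \<eta> powr (a - 1)"
            using i a by (intro mult_left_mono powr_mono2) auto
          finally show "d i powr a \<le> d i * \<eta> powr (a - 1)" .
        qed
        then show ?thesis using d(2) by (simp flip: sum_distrib_right)
      qed
      have "mono (\<lambda>\<tau>. \<Sum>i<L. w (d i * \<tau>))"
        using d by (intro monoI sum_mono monoD[OF w(1)] mult_left_mono) auto
      then show "log_norm T r (\<lambda>\<tau>. ennreal (\<tau> powr - a) * (\<Sum>i<L. w (d i * \<tau>))) \<le> ennreal (k * \<eta> powr (a - 1))"
        unfolding True
      proof (intro log_norm_infinity_le weighted_measurable)
        fix \<tau> assume \<tau>: "0 < \<tau>" "\<tau> < T"
        have "(\<Sum>i<L. w (d i * \<tau>)) \<le> (\<Sum>i<L. ennreal (k * (d i * \<tau>) powr a))"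
        proof (intro sum_mono wk)
          fix i assume "i \<in> {..<L}"
          then show "0 < d i * \<tau>" "d i * \<tau> \<le> T"
            using d d1[of i] \<tau> mult_mono[of "d i" 1 \<tau> T] by auto
        qed
        also have "\<dots> = ennreal (\<Sum>i<L. k * (d i * \<tau>) powr a)"
          using k by (intro sum_ennreal) auto
        also have "(\<Sum>i<L. k * (d i * \<tau>) powr a) = k * \<tau> powr a * (\<Sum>i<L. d i powr a)"
          using d \<tau> by (simp add: sum_distrib_left powr_mult mult_ac)
        also have "ennreal \<dots> \<le> ennreal (k * \<tau> powr a * \<eta> powr (a - 1))"
          using sum_le k by (intro ennreal_leI mult_left_mono) auto
        finally have "ennreal (\<tau> powr - a) * (\<Sum>i<L. w (d i * \<tau>)) \<le>
            ennreal (\<tau> powr - a) * ennreal (k * \<tau> powr a * \<eta> powr (a - 1))"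
          by (intro mult_left_mono) auto
        also have "\<dots> = ennreal (k * \<eta> powr (a - 1))"
          using \<tau> k by (simp add: powr_minus field_simps flip: ennreal_mult)
        finally show "ennreal (\<tau> powr - a) * (\<Sum>i<L. w (d i * \<tau>)) \<le> ennreal (k * \<eta> powr (a - 1))" .
      qed auto
    qed (use a k in auto)
  next
    case False
    define \<rho> where "\<rho> = enn2real r"
    have r_eq: "r = ennreal \<rho>" using False by (simp add: \<rho>_def less_top)
    have \<rho>: "0 < \<rho>" using enn2real_pos[of r] False q r(1) by (simp add: \<rho>_def)
    have "1 / a < \<rho>" using r(2) a unfolding r_eq by (simp add: ennreal_less_iff)
    then have a\<rho>: "1 / \<rho> < a" using a \<rho> by (simp add: field_simps)
    have qf: "q \<noteq> \<infinity>" using False r(1) by (auto simp: top_unique)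
    define s where "s = enn2real q"
    have s: "0 < s" "s \<le> \<rho>"
      using enn2real_pos[OF q qf] enn2real_mono[OF r(1)] False by (auto simp: s_def \<rho>_def less_top)
    define e where "e = (if 1 \<le> \<rho> then a - 1 else a - 1 / \<rho>)"
    have e: "0 < e" using a a\<rho> by (simp add: e_def)
    let ?\<phi> = "\<lambda>\<tau>. ennreal (\<tau> powr - a) * w \<tau>"
    define V where "V = (\<integral>\<^sup>+\<tau>. epowr (?\<phi> \<tau>) \<rho> \<partial>log_measure T)"
    have m\<phi> [measurable]: "(\<lambda>\<tau>. epowr (?\<phi> \<tau>) u) \<in> borel_measurable borel" for u
      by (rule measurable_compose[OF weighted_measurable[OF w(1)] epowr_measurable])
    have m\<phi>' [measurable]: "(\<lambda>\<tau>. epowr (?\<phi> \<tau>) u) \<in> borel_measurable (log_measure T)"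
      "(\<lambda>\<tau>. epowr (?\<phi> (c * \<tau>)) u) \<in> borel_measurable (log_measure T)" for u c
      by (rule measurable_log_measure, measurable)+
    have \<phi>: "\<exists>y\<ge>0. y \<le> k \<and> ?\<phi> x = ennreal y" if x: "0 < x" "x \<le> T" for x
    proof -
      have "?\<phi> x \<le> ennreal (x powr - a) * ennreal (k * x powr a)"
        by (intro mult_left_mono wk x) auto
      also have "\<dots> = ennreal k" using x k by (simp add: powr_minus field_simps flip: ennreal_mult)
      finally show ?thesis using k by (cases "?\<phi> x") (auto simp: top_unique)
    qed
    \<comment> \<open>Interpolation: the weighted w is bounded by k and has a finite norm for the
      exponent q, hence also for every r \<ge> q.\<close>
    have "V \<le> (\<integral>\<^sup>+\<tau>. ennreal (k powr (\<rho> - s)) * epowr (?\<phi> \<tau>) s \<partial>log_measure T)"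
      unfolding V_def
    proof (intro nn_integral_mono_AE AE_log_measureI)
      fix \<tau> assume "0 < \<tau>" "\<tau> < T"
      then obtain y where y: "0 \<le> y" "y \<le> k" "?\<phi> \<tau> = ennreal y" using \<phi>[of \<tau>] by auto
      have "y powr \<rho> = y powr (\<rho> - s) * y powr s" by (simp flip: powr_add)
      also have "\<dots> \<le> k powr (\<rho> - s) * y powr s"
        using y s by (intro mult_right_mono powr_mono2) auto
      finally show "epowr (?\<phi> \<tau>) \<rho> \<le> ennreal (k powr (\<rho> - s)) * epowr (?\<phi> \<tau>) s"
        using y by (simp add: epowr_ennreal ennreal_leI flip: ennreal_mult)
    qed
    also have "\<dots> = ennreal (k powr (\<rho> - s)) * (\<integral>\<^sup>+\<tau>. epowr (?\<phi> \<tau>) s \<partial>log_measure T)"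
      by (rule nn_integral_cmult) measurable
    also have "\<dots> < \<infinity>"
      using fin unfolding log_norm_finite[OF qf] s_def[symmetric] epowr_less_top_iff
      by (simp add: ennreal_mult_less_top)
    finally obtain v where v: "V = ennreal v" "0 \<le> v" by (cases V) auto
    show ?thesis
    proof (rule exI[of _ "v powr (1 / \<rho>)"], rule exI[of _ e], intro conjI allI impI)
      fix d :: "nat \<Rightarrow> real" and L \<eta> assume d: "\<forall>i<L. 0 < d i \<and> d i \<le> \<eta>" "(\<Sum>i<L. d i) = 1"
      note d1 = d_le_1[OF d]
      define \<kappa> where "\<kappa> i = d i * d i powr (e * \<rho>)" for i
      have \<kappa>: "0 \<le> \<kappa> i" if "i < L" for i using d that by (simp add: \<kappa>_def less_imp_le)
      have \<kappa>_sum: "(\<Sum>i<L. \<kappa> i) \<le> \<eta> powr (e * \<rho>)"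
      proof -
        have "(\<Sum>i<L. \<kappa> i) \<le> (\<Sum>i<L. d i * \<eta> powr (e * \<rho>))"
          unfolding \<kappa>_def using d e \<rho> by (intro sum_mono mult_left_mono powr_mono2) (auto simp: less_imp_le)
        then show ?thesis using d(2) by (simp flip: sum_distrib_right)
      qed
      have "(\<integral>\<^sup>+\<tau>. epowr (ennreal (\<tau> powr - a) * (\<Sum>i<L. w (d i * \<tau>))) \<rho> \<partial>log_measure T) \<le>
          (\<integral>\<^sup>+\<tau>. (\<Sum>i<L. ennreal (\<kappa> i) * epowr (?\<phi> (d i * \<tau>)) \<rho>) \<partial>log_measure T)"
      proof (intro nn_integral_mono_AE AE_log_measureI)
        fix \<tau> assume \<tau>: "0 < \<tau>" "\<tau> < T"
        have "\<forall>i\<in>{..<L}. \<exists>y\<ge>0. ?\<phi> (d i * \<tau>) = ennreal y"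
        proof
          fix i assume "i \<in> {..<L}"
          then have "0 < d i * \<tau>" "d i * \<tau> \<le> T"
            using d d1[of i] \<tau> mult_mono[of "d i" 1 \<tau> T] by auto
          then show "\<exists>y\<ge>0. ?\<phi> (d i * \<tau>) = ennreal y" using \<phi> by blast
        qed
        then obtain y where y: "\<And>i. i < L \<Longrightarrow> 0 \<le> y i" "\<And>i. i < L \<Longrightarrow> ?\<phi> (d i * \<tau>) = ennreal (y i)"
          by (metis lessThan_iff)
        have "ennreal (\<tau> powr - a) * (\<Sum>i<L. w (d i * \<tau>)) = (\<Sum>i<L. ennreal (d i powr a * y i))"
          unfolding sum_distrib_left
        proof (rule sum.cong)
          fix i assume "i \<in> {..<L}"
          then have i: "i < L" "0 < d i" using d by auto
          have "w (d i * \<tau>) = ennreal ((d i * \<tau>) powr a) * ennreal (y i)"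
            using powr_cancel_ennreal[of "d i * \<tau>" a "w (d i * \<tau>)"] y(2)[OF i(1)] i \<tau> by simp
          then show "ennreal (\<tau> powr - a) * w (d i * \<tau>) = ennreal (d i powr a * y i)"
            using i \<tau> y(1)[OF i(1)] by (simp add: powr_mult powr_minus field_simps flip: ennreal_mult)
        qed simp
        also have "\<dots> = ennreal (\<Sum>i<L. d i powr a * y i)"
          using y by (intro sum_ennreal) auto
        finally have eq: "ennreal (\<tau> powr - a) * (\<Sum>i<L. w (d i * \<tau>)) = ennreal (\<Sum>i<L. d i powr a * y i)" .
        have "0 \<le> (\<Sum>i<L. d i powr a * y i)" using y by (auto intro!: sum_nonneg)
        then have "epowr (ennreal (\<tau> powr - a) * (\<Sum>i<L. w (d i * \<tau>))) \<rho> = ennreal ((\<Sum>i<L. d i powr a * y i) powr \<rho>)"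
          unfolding eq by (rule epowr_ennreal)
        also have "\<dots> \<le> ennreal (\<Sum>i<L. \<kappa> i * y i powr \<rho>)"
          unfolding \<kappa>_def using d y \<rho>
          by (intro ennreal_leI powr_partition_sum_le) (auto simp: e_def)
        also have "\<dots> = (\<Sum>i<L. ennreal (\<kappa> i * y i powr \<rho>))"
          using \<kappa> by (intro sum_ennreal[symmetric]) auto
        also have "\<dots> = (\<Sum>i<L. ennreal (\<kappa> i) * epowr (?\<phi> (d i * \<tau>)) \<rho>)"
          using y \<kappa> by (intro sum.cong) (auto simp: epowr_ennreal ennreal_mult)
        finally show "epowr (ennreal (\<tau> powr - a) * (\<Sum>i<L. w (d i * \<tau>))) \<rho> \<le> (\<Sum>i<L. ennreal (\<kappa> i) * epowr (?\<phi> (d i * \<tau>)) \<rho>)" .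
      qed
      also have "\<dots> = (\<Sum>i<L. ennreal (\<kappa> i) * (\<integral>\<^sup>+\<tau>. epowr (?\<phi> (d i * \<tau>)) \<rho> \<partial>log_measure T))"
        using m\<phi>'(2) by (subst nn_integral_sum) (auto simp: nn_integral_cmult)
      also have "\<dots> \<le> (\<Sum>i<L. ennreal (\<kappa> i) * V)"
        unfolding V_def using d d1
        by (intro sum_mono mult_left_mono nn_integral_log_measure_scale[OF m\<phi>]) auto
      also have "\<dots> = ennreal (\<Sum>i<L. \<kappa> i) * V"
        using \<kappa> by (subst sum_distrib_right[symmetric], subst sum_ennreal) auto
      also have "\<dots> \<le> ennreal (\<eta> powr (e * \<rho>)) * V"
        using \<kappa>_sum by (intro mult_right_mono ennreal_leI) auto
      finally have "log_norm T r (\<lambda>\<tau>. ennreal (\<tau> powr - a) * (\<Sum>i<L. w (d i * \<tau>))) \<le> epowr (ennreal (\<eta> powr (e * \<rho>)) * V) (1 / \<rho>)"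
        unfolding log_norm_finite[OF False] \<rho>_def[symmetric] using \<rho> by (intro epowr_mono) auto
      also have "\<dots> = ennreal (v powr (1 / \<rho>) * \<eta> powr e)"
        using \<rho> v by (simp add: epowr_mult epowr_ennreal powr_powr powr_mult mult.commute flip: ennreal_mult)
      finally show "log_norm T r (\<lambda>\<tau>. ennreal (\<tau> powr - a) * (\<Sum>i<L. w (d i * \<tau>))) \<le> ennreal (v powr (1 / \<rho>) * \<eta> powr e)" .
    qed (use e in auto)
  qed
qed

section \<open>Pointwise bounds from averages\<close>

lemma integral_reflect_Icc:
  fixes f :: "real \<Rightarrow> real"
  shows "integral {0..h} (\<lambda>x. f (h - x)) = integral {0..h} f"
proof -
  have "integral {- 0..- (- h)} (\<lambda>x. (f \<circ> ((+) h)) (- x)) = integral {- h..0} (f \<circ> ((+) h))"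
    by (rule Henstock_Kurzweil_Integration.integral_reflect_real)
  also have "\<dots> = integral {- h + h..0 + h} f" by (rule integral_shift_Icc_real)
  finally show ?thesis by (simp add: o_def)
qed

lemma integral_shift_right:
  fixes f :: "real \<Rightarrow> real"
  shows "integral {a..b} (\<lambda>x. f (x + c)) = integral {a + c..b + c} f"
  using integral_shift_Icc_real[of a b f c] by (simp add: o_def add.commute)

lemma abs_integral_le:
  fixes f g :: "real \<Rightarrow> real"
  assumes "continuous_on {a..b} f" "continuous_on {a..b} g" "\<And>x. x \<in> {a..b} \<Longrightarrow> \<bar>f x\<bar> \<le> g x"
  shows "\<bar>integral {a..b} f\<bar> \<le> integral {a..b} g"
  using integral_norm_bound_integral[of f "{a..b}" g] assms
  by (simp add: integrable_continuous_interval)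

text \<open>A l is the average of f over [0, l]. Up to the factor 1/2, A l - A(l/2) is the mean of
  the increments f(x + l/2) - f x, so the averages telescope along L/2^n with ratio 2^(-\<gamma>)
  down to f 0 = 0.\<close>

lemma initial_average_bound:
  fixes f :: "real \<Rightarrow> real"
  assumes L: "0 < L" and f: "continuous_on {0..L} f" "f 0 = 0" and \<gamma>: "0 < \<gamma>" and K: "0 \<le> K"
    and step: "\<And>l. 0 < l \<Longrightarrow> l \<le> L \<Longrightarrow> \<bar>integral {0..l / 2} (\<lambda>x. f (x + l / 2) - f x)\<bar> \<le> K * l powr (1 + \<gamma>)"
  shows "\<bar>integral {0..L} f\<bar> \<le> K / (1 - 2 powr - \<gamma>) * L powr (1 + \<gamma>)"
proof -
  define A where "A l = integral {0..l} f / l" for l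
  have half: "\<bar>A l - A (l / 2)\<bar> \<le> K * l powr \<gamma>" if l: "0 < l" "l \<le> L" for l
  proof -
    have c: "continuous_on {a..b} f" if "0 \<le> a" "b \<le> l" for a b
      using l that by (intro continuous_on_subset[OF f(1)]) auto
    define P where "P = integral {0..l / 2} f"
    define Q where "Q = integral {0..l / 2} (\<lambda>x. f (x + l / 2))"
    have "integral {0..l} f = integral {0..l / 2} f + integral {l / 2..l} f"
      using l by (intro Henstock_Kurzweil_Integration.integral_combine[symmetric] integrable_continuous_interval c) auto
    moreover have "integral {l / 2..l} f = Q"
      using integral_shift_right[of 0 "l / 2" f "l / 2"] by (simp add: Q_def)
    ultimately have PQ: "integral {0..l} f = P + Q" by (simp add: P_def)
    have QP: "integral {0..l / 2} (\<lambda>x. f (x + l / 2) - f x) = Q - P"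
      unfolding P_def Q_def using l
      by (intro integral_diff integrable_continuous_interval continuous_on_compose2[OF c[of "l/2" l]] continuous_intros c) auto
    have "A l - A (l / 2) = (P + Q) / l - P / (l / 2)" by (simp only: A_def PQ P_def)
    also have "\<dots> = integral {0..l / 2} (\<lambda>x. f (x + l / 2) - f x) / l"
      unfolding QP using l by (simp add: field_simps)
    finally have "A l - A (l / 2) = integral {0..l / 2} (\<lambda>x. f (x + l / 2) - f x) / l" .
    then have "\<bar>A l - A (l / 2)\<bar> \<le> K * l powr (1 + \<gamma>) / l"
      using step[OF l] l by (simp add: divide_right_mono)
    also have "\<dots> = K * l powr \<gamma>" using l by (simp add: powr_add)
    finally show ?thesis .
  qed
  have r: "0 < 2 powr - \<gamma>" "2 powr - \<gamma> < 1" using \<gamma> powr_less_mono[of "- \<gamma>" 0 2] by auto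
  have bound: "\<bar>A L - A (L / 2 ^ n)\<bar> \<le> K * L powr \<gamma> / (1 - 2 powr - \<gamma>)" for n
  proof -
    have "\<bar>A L - A (L / 2 ^ n)\<bar> \<le> (\<Sum>i<n. K * L powr \<gamma> * (2 powr - \<gamma>) ^ i)"
    proof (induction n)
      case (Suc n)
      have "\<bar>A (L / 2 ^ n) - A (L / 2 ^ n / 2)\<bar> \<le> K * (L / 2 ^ n) powr \<gamma>"
        using L divide_left_mono[of 1 "2 ^ n" L] by (intro half) simp_all
      also have "(L / 2 ^ n) powr \<gamma> = L powr \<gamma> * (2 powr - \<gamma>) ^ n"
      proof -
        have "(2 powr - \<gamma>) ^ n = 1 / (2 ^ n) powr \<gamma>"
          by (simp add: two_pow_powr powr_minus_divide power_divide)
        then show ?thesis using L by (simp add: powr_divide)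
      qed
      finally show ?case using Suc by (simp add: mult_ac)
    qed simp
    also have "\<dots> = K * L powr \<gamma> * (\<Sum>i<n. (2 powr - \<gamma>) ^ i)" by (simp add: sum_distrib_left)
    also have "\<dots> \<le> K * L powr \<gamma> * (1 / (1 - 2 powr - \<gamma>))"
    proof (intro mult_left_mono)
      have "(\<Sum>i<n. (2 powr - \<gamma>) ^ i) = (1 - (2 powr - \<gamma>) ^ n) / (1 - 2 powr - \<gamma>)"
        using r \<gamma> by (simp add: sum_gp_strict)
      also have "\<dots> \<le> 1 / (1 - 2 powr - \<gamma>)" using r by (intro divide_right_mono) auto
      finally show "(\<Sum>i<n. (2 powr - \<gamma>) ^ i) \<le> 1 / (1 - 2 powr - \<gamma>)" .
    qed (use K in auto)
    finally show ?thesis by simp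
  qed
  \<comment> \<open>Averages over shrinking intervals tend to f 0: they are the difference quotients
    at 0 of the primitive of f.\<close>
  have "((\<lambda>x. integral {0..x} f) has_real_derivative f 0) (at 0 within {0..L})"
    using L by (intro integral_has_real_derivative f) auto
  then have "(A \<longlongrightarrow> 0) (at 0 within {0..L})"
    unfolding has_field_derivative_iff A_def[abs_def] using f(2) by simp
  moreover have "filterlim (\<lambda>n. L / 2 ^ n) (at 0 within {0..L}) sequentially"
  proof -
    have "(\<lambda>n. L / 2 ^ n) \<longlonglongrightarrow> 0" by (rule LIMSEQ_divide_realpow_zero) simp
    moreover have "L / 2 ^ n \<in> {0..L}" "L / 2 ^ n \<noteq> 0" for n
      using L divide_left_mono[of 1 "2 ^ n" L] by simp_all
    ultimately show ?thesis by (auto simp: filterlim_at)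
  qed
  ultimately have "(\<lambda>n. A (L / 2 ^ n)) \<longlonglongrightarrow> 0" by (rule filterlim_compose)
  then have "(\<lambda>n. \<bar>A L - A (L / 2 ^ n)\<bar>) \<longlonglongrightarrow> \<bar>A L - 0\<bar>" by (intro tendsto_intros)
  then have "\<bar>A L - 0\<bar> \<le> K * L powr \<gamma> / (1 - 2 powr - \<gamma>)"
    by (rule LIMSEQ_le_const2) (use bound in auto)
  then have "\<bar>integral {0..L} f\<bar> \<le> K * L powr \<gamma> / (1 - 2 powr - \<gamma>) * L"
    using L by (simp add: A_def divide_le_eq)
  also have "\<dots> = K / (1 - 2 powr - \<gamma>) * L powr (1 + \<gamma>)" using L by (simp add: powr_add)
  finally show ?thesis .
qed

text \<open>Continuity on the simplex passes to the one-parameter slices; it provides the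
  measurability in the Orlicz estimates.\<close>

lemma continuous_on_slice:
  fixes A :: "real \<Rightarrow> real \<Rightarrow> 'v::topological_space"
  assumes "continuous_on (simplex2 T) (\<lambda>(s, t). A s t)" "continuous_on D f" "continuous_on D g"
    and "\<And>x. x \<in> D \<Longrightarrow> 0 \<le> f x \<and> f x \<le> g x \<and> g x \<le> T"
  shows "continuous_on D (\<lambda>x. A (f x) (g x))"
proof -
  have "continuous_on D (\<lambda>x. (\<lambda>(s, t). A s t) (f x, g x))"
    by (rule continuous_on_compose2[OF assms(1) continuous_on_Pair[OF assms(2,3)]])
       (use assms(4) in \<open>auto simp: simplex2_def\<close>)
  then show ?thesis by simp
qed

text \<open>The fraction stems from two telescoping averages, one anchored at the left and one at
  the right endpoint; the summand 1 stems from the defect of additivity.\<close>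

definition embedding_const :: "real \<Rightarrow> real"
  where "embedding_const \<gamma> = 2 / (1 - 2 powr - \<gamma>) + 1"

lemma embedding_const_pos: "0 < \<gamma> \<Longrightarrow> 0 < embedding_const \<gamma>"
  using powr_less_mono[of "- \<gamma>" 0 2] by (simp add: embedding_const_def add_pos_pos)

text \<open>The increments of \<open>B s \<cdot>\<close> are increments of \<open>B\<close> up to the defect of additivity, so the averages
  of \<open>B s \<cdot>\<close> over dyadically shrinking intervals \<open>[s, s + l]\<close> telescope; likewise for \<open>B \<cdot> t\<close>.\<close>

lemma two_parameter_embedding_real:
  fixes B :: "real \<Rightarrow> real \<Rightarrow> real"
  assumes cont: "continuous_on (simplex2 T) (\<lambda>(s, t). B s t)" and \<gamma>: "0 < \<gamma>" and MN: "0 \<le> M" "0 \<le> N"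
    and defect: "\<And>s u t. 0 \<le> s \<Longrightarrow> s \<le> u \<Longrightarrow> u \<le> t \<Longrightarrow> t \<le> T \<Longrightarrow>
        \<bar>B s t - B s u - B u t\<bar> \<le> M * (t - s) powr \<gamma>"
    and avg: "\<And>a h. 0 \<le> a \<Longrightarrow> 0 < h \<Longrightarrow> a + 2 * h \<le> T \<Longrightarrow>
        integral {0..h} (\<lambda>x. \<bar>B (a + x) (a + x + h)\<bar>) \<le> N * h powr (1 + \<gamma>)"
    and st: "0 \<le> s" "s \<le> t" "t \<le> T"
  shows "\<bar>B s t\<bar> \<le> embedding_const \<gamma> * (N + M) * (t - s) powr \<gamma>"
proof (cases "s = t")
  case True
  then show ?thesis using defect[of s s s] st by simp
next
  case False
  define L where "L = t - s"
  have L: "0 < L" "s + L = t" using False st by (auto simp: L_def)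
  note cB = continuous_on_slice[OF cont]
  have diag: "B x x = 0" if "0 \<le> x" "x \<le> T" for x using defect[of x x x] that by simp
  \<comment> \<open>One estimate for both anchors: \<phi> is the identity for intervals growing from
    s to the right and the reflection for intervals growing from t to the left. Reflection does not
    change the integral.\<close>
  have half_bound: "\<bar>integral {0..l / 2} h\<bar> \<le> (N + M) * l powr (1 + \<gamma>)"
    if l: "0 < l" "l \<le> L" and h: "continuous_on {0..l / 2} h" and a: "0 \<le> a" "a + l \<le> T"
      and e: "\<And>x. x \<in> {0..l / 2} \<Longrightarrow> \<bar>h x\<bar> \<le> \<bar>B (a + \<phi> x) (a + \<phi> x + l / 2)\<bar> + M * l powr \<gamma>"
      and \<phi>: "\<phi> = (\<lambda>x. x) \<or> \<phi> = (\<lambda>x. l / 2 - x)" for l h a \<phi>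
  proof -
    have c: "continuous_on {0..l / 2} (\<lambda>x. \<bar>B (a + \<phi> x) (a + \<phi> x + l / 2)\<bar>)"
      using \<phi> a l by (auto intro!: continuous_intros cB)
    have "\<bar>integral {0..l / 2} h\<bar> \<le> integral {0..l / 2} (\<lambda>x. \<bar>B (a + \<phi> x) (a + \<phi> x + l / 2)\<bar> + M * l powr \<gamma>)"
      using e by (intro abs_integral_le h continuous_intros c) auto
    also have "\<dots> = integral {0..l / 2} (\<lambda>x. \<bar>B (a + \<phi> x) (a + \<phi> x + l / 2)\<bar>) + l / 2 * (M * l powr \<gamma>)"
      using l by (subst integral_add) (auto intro!: integrable_continuous_interval c)
    also have "integral {0..l / 2} (\<lambda>x. \<bar>B (a + \<phi> x) (a + \<phi> x + l / 2)\<bar>) =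
        integral {0..l / 2} (\<lambda>x. \<bar>B (a + x) (a + x + l / 2)\<bar>)"
      using \<phi> integral_reflect_Icc[of "l / 2" "\<lambda>x. \<bar>B (a + x) (a + x + l / 2)\<bar>"] by auto
    also have "\<dots> \<le> N * (l / 2) powr (1 + \<gamma>)"
      using l a by (intro avg) auto
    also have "N * (l / 2) powr (1 + \<gamma>) \<le> N * l powr (1 + \<gamma>)"
      using l \<gamma> MN by (intro mult_left_mono powr_mono2) auto
    also have "l / 2 * (M * l powr \<gamma>) \<le> M * l powr (1 + \<gamma>)"
      using l MN by (simp add: powr_add mult_left_mono)
    finally show ?thesis by (simp add: distrib_right)
  qed
  define f where "f x = B s (s + x)" for x
  define g where "g x = B (t - x) t" for x
  have cf: "continuous_on {0..L} f" and cg: "continuous_on {0..L} g"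
    unfolding f_def g_def using st L by (auto intro!: cB continuous_intros)
  have shifted: "continuous_on {0..l / 2} (\<lambda>x. \<phi> (x + l / 2) - \<phi> x)"
    if "continuous_on {0..L} \<phi>" "0 < l" "l \<le> L" for l and \<phi> :: "real \<Rightarrow> real"
    using that by (intro continuous_on_diff continuous_on_compose2[OF that(1)] continuous_intros continuous_on_subset[OF that(1)]) auto
  have If: "\<bar>integral {0..L} f\<bar> \<le> (N + M) / (1 - 2 powr - \<gamma>) * L powr (1 + \<gamma>)"
  proof (rule initial_average_bound[OF L(1) cf _ \<gamma>])
    fix l assume l: "0 < l" "l \<le> L"
    show "\<bar>integral {0..l / 2} (\<lambda>x. f (x + l / 2) - f x)\<bar> \<le> (N + M) * l powr (1 + \<gamma>)"
    proof (rule half_bound[OF l shifted[OF cf l], of s "\<lambda>x. x"])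
      fix x assume x: "x \<in> {0..l / 2}"
      have "\<bar>B s (s + x + l / 2) - B s (s + x) - B (s + x) (s + x + l / 2)\<bar> \<le> M * (s + x + l / 2 - s) powr \<gamma>"
        using x l L st by (intro defect) auto
      also have "\<dots> \<le> M * l powr \<gamma>" using x l MN \<gamma> by (intro mult_left_mono powr_mono2) auto
      finally show "\<bar>f (x + l / 2) - f x\<bar> \<le> \<bar>B (s + x) (s + x + l / 2)\<bar> + M * l powr \<gamma>"
        by (simp add: f_def add.assoc)
    qed (use st l L in auto)
  qed (use diag[of s] st MN in \<open>auto simp: f_def\<close>)
  have Ig: "\<bar>integral {0..L} g\<bar> \<le> (N + M) / (1 - 2 powr - \<gamma>) * L powr (1 + \<gamma>)"
  proof (rule initial_average_bound[OF L(1) cg _ \<gamma>])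
    fix l assume l: "0 < l" "l \<le> L"
    show "\<bar>integral {0..l / 2} (\<lambda>x. g (x + l / 2) - g x)\<bar> \<le> (N + M) * l powr (1 + \<gamma>)"
    proof (rule half_bound[OF l shifted[OF cg l], of "t - l" "\<lambda>x. l / 2 - x"])
      fix x assume x: "x \<in> {0..l / 2}"
      have "\<bar>B (t - x - l / 2) t - B (t - x - l / 2) (t - x) - B (t - x) t\<bar> \<le> M * (t - (t - x - l / 2)) powr \<gamma>"
        using x l L st by (intro defect) auto
      also have "\<dots> \<le> M * l powr \<gamma>" using x l MN \<gamma> by (intro mult_left_mono powr_mono2) auto
      finally have "\<bar>g (x + l / 2) - g x\<bar> \<le> \<bar>B (t - x - l / 2) (t - x)\<bar> + M * l powr \<gamma>"
        by (simp add: g_def algebra_simps)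
      moreover have "t - l + (l / 2 - x) = t - x - l / 2" "t - l + (l / 2 - x) + l / 2 = t - x" by auto
      ultimately show "\<bar>g (x + l / 2) - g x\<bar> \<le> \<bar>B (t - l + (l / 2 - x)) (t - l + (l / 2 - x) + l / 2)\<bar> + M * l powr \<gamma>"
        by presburger
    qed (use st l L in auto)
  qed (use diag[of t] st MN in \<open>auto simp: g_def\<close>)
  \<comment> \<open>For every x, B s t equals B s (s + x) + B (s + x) t up to the defect.
    Integration over x turns these terms into the integrals of f and of the reflected g, which are
    already estimated.\<close>
  have sum: "\<bar>integral {0..L} (\<lambda>x. B s t)\<bar> \<le> integral {0..L} (\<lambda>x. M * L powr \<gamma>) + (\<bar>integral {0..L} f\<bar> + \<bar>integral {0..L} g\<bar>)"
  proof -
    let ?h = "\<lambda>x. g (L - x)"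
    have ch: "continuous_on {0..L} ?h"
      by (rule continuous_on_compose2[OF cg]) (auto intro!: continuous_intros)
    have "\<bar>integral {0..L} (\<lambda>x. B s t - f x - ?h x)\<bar> \<le> integral {0..L} (\<lambda>x. M * L powr \<gamma>)"
    proof (intro abs_integral_le continuous_intros cf ch)
      fix x assume x: "x \<in> {0..L}"
      have "t - (L - x) = s + x" using L by simp
      then show "\<bar>B s t - f x - ?h x\<bar> \<le> M * L powr \<gamma>"
        using defect[of s "s + x" t] x L st by (simp add: f_def g_def L_def)
    qed
    moreover have "integral {0..L} (\<lambda>x. B s t - f x - ?h x) =
        integral {0..L} (\<lambda>x. B s t) - integral {0..L} f - integral {0..L} ?h"
      by (subst integral_diff, (intro integrable_continuous_interval continuous_intros cf ch)+,
          subst integral_diff) (auto intro!: integrable_continuous_interval cf)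
    moreover have "integral {0..L} ?h = integral {0..L} g" by (rule integral_reflect_Icc)
    ultimately show ?thesis by linarith
  qed
  have "\<bar>integral {0..L} (\<lambda>x. B s t)\<bar> = L * \<bar>B s t\<bar>" "integral {0..L} (\<lambda>x. M * L powr \<gamma>) = L * (M * L powr \<gamma>)"
    using L by (simp_all add: abs_mult)
  then have "L * \<bar>B s t\<bar> \<le> L * (M * L powr \<gamma>) + 2 * ((N + M) / (1 - 2 powr - \<gamma>) * L powr (1 + \<gamma>))"
    using If Ig sum by linarith
  also have "L * (M * L powr \<gamma>) \<le> L * ((N + M) * L powr \<gamma>)"
    using L MN by (intro mult_left_mono mult_right_mono) auto
  also have "L * ((N + M) * L powr \<gamma>) + 2 * ((N + M) / (1 - 2 powr - \<gamma>) * L powr (1 + \<gamma>)) =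
      L * (embedding_const \<gamma> * (N + M) * L powr \<gamma>)"
    using L by (simp add: embedding_const_def powr_add algebra_simps)
  finally show ?thesis using L by (simp add: L_def)
qed

text \<open>Pairing with the unit vector e in the direction of A s t reduces the claim to real
  functions without changing the constants, so the dimension never enters. The averages are bounded
  by h^a h^(1 - 1/p) = h^(1 + (a - 1/p)).\<close>

lemma two_parameter_embedding:
  fixes A :: "real \<Rightarrow> real \<Rightarrow> 'v::real_inner"
  assumes \<beta>: "0 < \<beta>" and p: "1 \<le> p" "0 < C" "\<And>x. 0 \<le> x \<Longrightarrow> x powr p \<le> C * orlicz_Phi \<beta> x"
    and cont: "continuous_on (simplex2 T) (\<lambda>(s, t). A s t)" and a: "0 < a - 1 / p" and MN: "0 \<le> M" "0 \<le> N"
    and defect: "\<And>s u t. 0 \<le> s \<Longrightarrow> s \<le> u \<Longrightarrow> u \<le> t \<Longrightarrow> t \<le> T \<Longrightarrow>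
        norm (incr2 A s u t) \<le> M * (t - s) powr (a - 1 / p)"
    and avg: "\<And>h. 0 < h \<Longrightarrow> h \<le> T / 2 \<Longrightarrow>
        orlicz_norm \<beta> {0..T - h} (\<lambda>r. A r (r + h)) \<le> ennreal (N * h powr a)"
    and st: "0 \<le> s" "s \<le> t" "t \<le> T"
  shows "norm (A s t) \<le> embedding_const (a - 1 / p) * (N * (1 + C) + M) * (t - s) powr (a - 1 / p)"
proof -
  define e where "e = A s t /\<^sub>R norm (A s t)"
  have e: "norm e \<le> 1" by (cases "A s t = 0") (simp_all add: e_def)
  have "norm (A s t) = A s t \<bullet> e"
    by (cases "A s t = 0") (simp_all add: e_def power2_norm_eq_inner[symmetric] power2_eq_square)
  then have "norm (A s t) = \<bar>A s t \<bullet> e\<bar>" by (metis abs_of_nonneg norm_ge_zero)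
  also have "\<dots> \<le> embedding_const (a - 1 / p) * (N * (1 + C) + M) * (t - s) powr (a - 1 / p)"
  proof (rule two_parameter_embedding_real[of T "\<lambda>s t. A s t \<bullet> e", OF _ a MN(1) _ _ _ st])
    have le: "\<bar>x \<bullet> e\<bar> \<le> norm x" for x
      using Cauchy_Schwarz_ineq2[of x e] mult_left_mono[OF e norm_ge_zero[of x]] by simp
    show "continuous_on (simplex2 T) (\<lambda>(s, t). A s t \<bullet> e)"
      using cont unfolding case_prod_unfold by (intro continuous_intros)
    show "\<bar>A s t \<bullet> e - A s u \<bullet> e - A u t \<bullet> e\<bar> \<le> M * (t - s) powr (a - 1 / p)"
      if "0 \<le> s" "s \<le> u" "u \<le> t" "t \<le> T" for s u t
      using le[of "incr2 A s u t"] defect[OF that] by (simp add: incr2_def inner_diff_left)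
    fix b h :: real assume bh: "0 \<le> b" "0 < h" "b + 2 * h \<le> T"
    have cA: "continuous_on {b..b + h} (\<lambda>x. A x (x + h))"
      using bh by (intro continuous_on_slice[OF cont] continuous_intros) auto
    have "integral {0..h} (\<lambda>x. \<bar>A (b + x) (b + x + h) \<bullet> e\<bar>) = integral {0 + b..h + b} (\<lambda>x. \<bar>A x (x + h) \<bullet> e\<bar>)"
      using integral_shift_right[of 0 h "\<lambda>x. \<bar>A x (x + h) \<bullet> e\<bar>" b] by (simp add: add.commute)
    also have "\<dots> \<le> integral {b..b + h} (\<lambda>x. norm (A x (x + h)))"
      by (simp add: add.commute) (intro integral_le integrable_continuous_interval continuous_intros cA le)
    also have "\<dots> \<le> N * h powr a * (1 + C) * (b + h - b) powr (1 - 1 / p)"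
    proof (rule orlicz_norm_integral_bound[OF \<beta> p _ _ cA avg])
      show "{b..b + h} \<subseteq> {0..T - h}" using bh by auto
    qed (use bh MN in auto)
    also have "\<dots> = N * (1 + C) * h powr (1 + (a - 1 / p))"
      by (simp add: powr_add[symmetric] algebra_simps)
    finally show "integral {0..h} (\<lambda>x. \<bar>A (b + x) (b + x + h) \<bullet> e\<bar>) \<le> N * (1 + C) * h powr (1 + (a - 1 / p))" .
  qed (use MN p in auto)
  finally show ?thesis .
qed

section \<open>Pointwise sewing\<close>

lemma compact_simplex2: "compact (simplex2 T)"
proof -
  have "simplex2 T = ({0..T} \<times> {0..T}) \<inter> {p. fst p \<le> snd p}"
    by (auto simp: simplex2_def)
  moreover have "closed {p::real \<times> real. fst p \<le> snd p}"
    by (intro closed_Collect_le continuous_intros)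
  ultimately show ?thesis by (simp add: compact_Int_closed compact_Times)
qed

text \<open>The solution K of K = 2 K 2^(-\<gamma>) + 2: two sums over intervals of at most half the
  length, and two defects.\<close>

definition young_const :: "real \<Rightarrow> real"
  where "young_const \<gamma> = 2 / (1 - 2 powr (1 - \<gamma>))"

lemma young_const:
  assumes "1 < \<gamma>"
  shows "0 < young_const \<gamma>" "2 * young_const \<gamma> * 2 powr - \<gamma> + 2 = young_const \<gamma>"
proof -
  have r: "2 powr (1 - \<gamma>) < 1" using assms powr_less_mono[of "1 - \<gamma>" 0 2] by simp
  then show "0 < young_const \<gamma>" by (simp add: young_const_def)
  have "2 * young_const \<gamma> * 2 powr - \<gamma> + 2 = young_const \<gamma> * 2 powr (1 - \<gamma>) + 2"
    by (simp add: powr_diff powr_minus_divide)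
  also have "\<dots> = young_const \<gamma>"
  proof -
    have "2 / (1 - x) * x + 2 = 2 / (1 - x)" if "x < 1" for x :: real
      using that by (simp add: field_simps)
    then show ?thesis using r by (simp add: young_const_def)
  qed
  finally show "2 * young_const \<gamma> * 2 powr - \<gamma> + 2 = young_const \<gamma>" .
qed

text \<open>The induction splits off the partition interval that contains the midpoint.\<close>

lemma partition_sum_bound:
  fixes \<Xi> :: "real \<Rightarrow> real \<Rightarrow> 'v::real_normed_vector"
  assumes \<gamma>: "1 < \<gamma>" and M: "0 \<le> M"
    and defect: "\<And>s u t. 0 \<le> s \<Longrightarrow> s \<le> u \<Longrightarrow> u \<le> t \<Longrightarrow> t \<le> T \<Longrightarrow>
        norm (incr2 \<Xi> s u t) \<le> M * (t - s) powr \<gamma>"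
    and t: "mono t" "0 \<le> t a" "t b \<le> T" and ab: "a \<le> b"
  shows "norm ((\<Sum>i=a..<b. \<Xi> (t i) (t (Suc i))) - \<Xi> (t a) (t b)) \<le> young_const \<gamma> * M * (t b - t a) powr \<gamma>"
  using t(2,3) ab
proof (induction "b - a" arbitrary: a b rule: less_induct)
  case less
  note K = young_const[OF \<gamma>]
  have ta: "t a \<le> t b" using monoD[OF t(1) less.prems(3)] .
  consider "b = a" | "b = Suc a" | "Suc a < b" using less.prems(3) by linarith
  then show ?case
  proof cases
    case 1
    have "norm (incr2 \<Xi> (t a) (t a) (t a)) \<le> M * (t a - t a) powr \<gamma>"
      using less.prems ta by (intro defect) auto
    then show ?thesis using 1 by (simp add: incr2_def)
  next
    case 2
    then show ?thesis using K M by simp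
  next
    case 3
    define L where "L = t b - t a"
    \<comment> \<open>The maximum of S is the last index whose point lies in the left half; the next
      point lies in the right half. Both remaining sums thus run over at most half the length,
      however uneven the spacing is.\<close>
    define S where "S = {j \<in> {a..<b}. t j - t a \<le> L / 2}"
    have "a \<in> S" using 3 ta by (simp add: S_def L_def)
    moreover have fin: "finite S" by (simp add: S_def)
    ultimately have "Max S \<in> S" using Max_in by blast
    define j where "j = Max S"
    have j: "a \<le> j" "j < b" "t j - t a \<le> L / 2" using \<open>Max S \<in> S\<close> by (auto simp: j_def S_def)
    have j': "t b - t (Suc j) \<le> L / 2"
    proof (cases "Suc j = b")
      case False
      then have "Suc j \<notin> S" using Max_ge[OF fin, of "Suc j"] by (auto simp: j_def)
      then show ?thesis using False j by (simp add: S_def L_def)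
    qed (use ta in \<open>simp add: L_def\<close>)
    have mon: "t a \<le> t j" "t j \<le> t (Suc j)" "t (Suc j) \<le> t b" using monoD[OF t(1)] j by auto
    have bnd: "young_const \<gamma> * M * d powr \<gamma> \<le> young_const \<gamma> * M * (L / 2) powr \<gamma>" if "0 \<le> d" "d \<le> L / 2" for d
      using that K M \<gamma> by (intro mult_left_mono powr_mono2) auto
    have 1: "norm ((\<Sum>i=a..<j. \<Xi> (t i) (t (Suc i))) - \<Xi> (t a) (t j)) \<le> young_const \<gamma> * M * (L / 2) powr \<gamma>"
      using j mon less.prems by (intro order.trans[OF less.hyps bnd]) auto
    have 2: "norm ((\<Sum>i=Suc j..<b. \<Xi> (t i) (t (Suc i))) - \<Xi> (t (Suc j)) (t b)) \<le> young_const \<gamma> * M * (L / 2) powr \<gamma>"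
      using j j' mon less.prems by (intro order.trans[OF less.hyps bnd]) auto
    have 3: "norm (incr2 \<Xi> (t a) (t j) (t b)) \<le> M * L powr \<gamma>"
      unfolding L_def using mon less.prems by (intro defect) auto
    have "norm (incr2 \<Xi> (t j) (t (Suc j)) (t b)) \<le> M * (t b - t j) powr \<gamma>"
      using mon less.prems by (intro defect) auto
    also have "\<dots> \<le> M * L powr \<gamma>"
      using mon M \<gamma> by (intro mult_left_mono powr_mono2) (auto simp: L_def)
    finally have 4: "norm (incr2 \<Xi> (t j) (t (Suc j)) (t b)) \<le> M * L powr \<gamma>" .
    have "(\<Sum>i=j..<b. \<Xi> (t i) (t (Suc i))) = \<Xi> (t j) (t (Suc j)) + (\<Sum>i=Suc j..<b. \<Xi> (t i) (t (Suc i)))"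
      using j by (intro sum.atLeast_Suc_lessThan)
    then have "(\<Sum>i=a..<b. \<Xi> (t i) (t (Suc i))) =
        (\<Sum>i=a..<j. \<Xi> (t i) (t (Suc i))) + (\<Xi> (t j) (t (Suc j)) + (\<Sum>i=Suc j..<b. \<Xi> (t i) (t (Suc i))))"
      using j sum.atLeastLessThan_concat[of a j b "\<lambda>i. \<Xi> (t i) (t (Suc i))"] by simp
    then have "(\<Sum>i=a..<b. \<Xi> (t i) (t (Suc i))) - \<Xi> (t a) (t b) =
        ((\<Sum>i=a..<j. \<Xi> (t i) (t (Suc i))) - \<Xi> (t a) (t j)) +
        ((\<Sum>i=Suc j..<b. \<Xi> (t i) (t (Suc i))) - \<Xi> (t (Suc j)) (t b)) -
        (incr2 \<Xi> (t a) (t j) (t b) + incr2 \<Xi> (t j) (t (Suc j)) (t b))"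
      by (simp add: incr2_def)
    also have "norm \<dots> \<le> (young_const \<gamma> * M * (L / 2) powr \<gamma> + young_const \<gamma> * M * (L / 2) powr \<gamma>) + (M * L powr \<gamma> + M * L powr \<gamma>)"
      by (intro order.trans[OF norm_triangle_ineq4] add_mono order.trans[OF norm_triangle_ineq] 1 2 3 4)
    also have "\<dots> = (2 * young_const \<gamma> * 2 powr - \<gamma> + 2) * (M * L powr \<gamma>)"
    proof -
      have "(L / 2) powr \<gamma> = L powr \<gamma> * 2 powr - \<gamma>"
        using ta by (simp add: L_def powr_divide powr_minus_divide)
      then show ?thesis by (simp add: algebra_simps)
    qed
    also have "\<dots> = young_const \<gamma> * M * (t b - t a) powr \<gamma>"
      unfolding K(2) by (simp add: L_def)
    finally show ?thesis .
  qed
qed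

lemma sum_even_odd: "(\<Sum>i<2 * m. f i) = (\<Sum>i<m. f (2 * i) + f (2 * i + 1))" for f :: "nat \<Rightarrow> 'a::comm_monoid_add"
  by (induction m) (simp_all add: add.assoc)

text \<open>I t - I s is the sum of I t - I s - \<Xi> s t and \<Xi> s t. The second term is small
  near the diagonal, because \<Xi> vanishes there and is uniformly continuous on the compact
  simplex.\<close>

lemma diagonal_continuity:
  fixes \<Xi> :: "real \<Rightarrow> real \<Rightarrow> 'v::real_normed_vector"
  assumes cont: "continuous_on (simplex2 T) (\<lambda>(s, t). \<Xi> s t)"
    and diag: "\<And>s. 0 \<le> s \<Longrightarrow> s \<le> T \<Longrightarrow> \<Xi> s s = 0" and \<gamma>: "0 < \<gamma>" and K: "0 \<le> K"
    and I: "\<And>s t. 0 \<le> s \<Longrightarrow> s \<le> t \<Longrightarrow> t \<le> T \<Longrightarrow> norm (I t - I s - \<Xi> s t) \<le> K * (t - s) powr \<gamma>"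
  shows "continuous_on {0..T} I"
proof -
  have uc: "uniformly_continuous_on (simplex2 T) (\<lambda>(s, t). \<Xi> s t)"
    by (rule compact_uniformly_continuous[OF cont compact_simplex2])
  show ?thesis
    unfolding continuous_on_iff
  proof (intro ballI allI impI)
    fix x e :: real assume x: "x \<in> {0..T}" and e: "0 < e"
    obtain d1 where d1: "0 < d1" "\<And>p p'. p \<in> simplex2 T \<Longrightarrow> p' \<in> simplex2 T \<Longrightarrow> dist p' p < d1 \<Longrightarrow>
        dist ((\<lambda>(s, t). \<Xi> s t) p') ((\<lambda>(s, t). \<Xi> s t) p) < e / 2"
      using uc e unfolding uniformly_continuous_on_def by (metis half_gt_zero)
    have "((\<lambda>z. K * z powr \<gamma>) \<longlongrightarrow> K * 0 powr \<gamma>) (at_right 0)"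
      using \<gamma> by (intro tendsto_intros tendsto_powr2) (auto simp: eventually_at_right_less intro: eventually_at_rightI[of 0 1])
    then have "eventually (\<lambda>z. K * z powr \<gamma> < e / 2) (at_right 0)"
      using e by (intro order_tendstoD) auto
    then obtain d2 where d2: "0 < d2" "\<And>z. 0 < z \<Longrightarrow> z < d2 \<Longrightarrow> K * z powr \<gamma> < e / 2"
      unfolding eventually_at_right_field by blast
    have main: "norm (I t - I s) < e" if st: "0 \<le> s" "s \<le> t" "t \<le> T" "t - s < min d1 d2" for s t
    proof -
      have "dist (s, t) (s, s) < d1" using st by (simp add: dist_Pair_Pair dist_real_def)
      then have "norm (\<Xi> s t) < e / 2"
        using d1(2)[of "(s, s)" "(s, t)"] st diag[of s] by (auto simp: simplex2_def dist_norm)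
      moreover have "norm (I t - I s - \<Xi> s t) < e / 2"
        using I[OF st(1-3)] d2(2)[of "t - s"] st e by (cases "s = t") (auto intro: le_less_trans)
      ultimately show ?thesis
        using norm_triangle_ineq[of "I t - I s - \<Xi> s t" "\<Xi> s t"] by simp
    qed
    show "\<exists>d>0. \<forall>x'\<in>{0..T}. dist x' x < d \<longrightarrow> dist (I x') (I x) < e"
    proof (intro exI[of _ "min d1 d2"] conjI ballI impI)
      fix x' assume x': "x' \<in> {0..T}" "dist x' x < min d1 d2"
      show "dist (I x') (I x) < e"
        using main[of x x'] main[of x' x] x x' by (cases "x \<le> x'") (auto simp: dist_norm dist_real_def norm_minus_commute)
    qed (use d1 d2 in auto)
  qed
qed

section \<open>Existence of the sewing\<close>

text \<open>I is the limit of germ sums over dyadic grids. One refinement changes a sum by at most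
  2^n defects of size (T/2^n)^\<gamma>, which is summable because \<gamma> > 1. The bound on
  increments survives the limit since the constant of \<open>partition_sum_bound\<close> does not
  depend on the number of points.\<close>

lemma sewing_real:
  fixes \<Xi> :: "real \<Rightarrow> real \<Rightarrow> real"
  assumes T: "0 < T" and \<gamma>: "1 < \<gamma>" and M: "0 \<le> M"
    and defect: "\<And>s u t. 0 \<le> s \<Longrightarrow> s \<le> u \<Longrightarrow> u \<le> t \<Longrightarrow> t \<le> T \<Longrightarrow>
        \<bar>incr2 \<Xi> s u t\<bar> \<le> M * (t - s) powr \<gamma>"
  shows "\<exists>I. I 0 = 0 \<and> (\<forall>s t. 0 \<le> s \<longrightarrow> s \<le> t \<longrightarrow> t \<le> T \<longrightarrow>
    \<bar>I t - I s - \<Xi> s t\<bar> \<le> young_const \<gamma> * M * (t - s) powr \<gamma>)"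
proof -
  have diag: "\<Xi> s s = 0" if "0 \<le> s" "s \<le> T" for s
    using defect[of s s s] that by (simp add: incr2_def)
  define g where "g n i = real i * T / 2 ^ n" for n i :: nat
  \<comment> \<open>Grid points beyond t collapse to t, where the germ vanishes; thus one grid
    serves all t.\<close>
  define J where "J n t = (\<Sum>i<2 ^ n. \<Xi> (min t (g n i)) (min t (g n (Suc i))))" for n t
  define \<delta> where "\<delta> n = M * (T / 2 ^ n) powr \<gamma>" for n :: nat
  have \<delta>0: "0 \<le> \<delta> n" for n using M by (simp add: \<delta>_def)
  have g_mono: "0 \<le> g n i" "g n i \<le> g n (Suc i)" "g n (Suc i) - g n i = T / 2 ^ n" for n i
    using T by (auto simp: g_def divide_right_mono algebra_simps diff_divide_distrib add_divide_distrib)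
  have pow: "2 ^ n * \<delta> n = M * T powr \<gamma> * (2 powr (1 - \<gamma>)) ^ n" for n
  proof -
    have "(2 powr (1 - \<gamma>)) ^ n = 2 ^ n / (2 ^ n) powr \<gamma>"
      by (simp add: two_pow_powr powr_diff power_divide)
    then show ?thesis using T by (simp add: \<delta>_def powr_divide)
  qed
  have r: "0 < 2 powr (1 - \<gamma>)" "2 powr (1 - \<gamma>) < 1" using \<gamma> powr_less_mono[of "1 - \<gamma>" 0 2] by auto
  have J_step: "\<bar>J (Suc n) t - J n t\<bar> \<le> 2 ^ n * \<delta> n" if t: "0 \<le> t" "t \<le> T" for n t
  proof -
    have "J (Suc n) t = (\<Sum>i<2 * 2 ^ n. \<Xi> (min t (g (Suc n) i)) (min t (g (Suc n) (Suc i))))"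
      by (simp add: J_def)
    also have "\<dots> = (\<Sum>i<2 ^ n. \<Xi> (min t (g (Suc n) (2 * i))) (min t (g (Suc n) (2 * i + 1))) +
        \<Xi> (min t (g (Suc n) (2 * i + 1))) (min t (g (Suc n) (2 * i + 2))))"
      by (subst sum_even_odd) simp
    \<comment> \<open>The refinement inserts the midpoint \<open>g (Suc n) (2 * i + 1)\<close>
      between two neighbouring grid points, at the cost of one defect per interval.\<close>
    finally have "J (Suc n) t - J n t = (\<Sum>i<2 ^ n. - incr2 \<Xi> (min t (g n i)) (min t (g (Suc n) (2 * i + 1))) (min t (g n (Suc i))))"
      by (simp add: J_def sum_subtractf[symmetric] incr2_def g_def algebra_simps add_divide_distrib)
    also have "\<bar>\<dots>\<bar> \<le> (\<Sum>i<(2::nat) ^ n. \<delta> n)"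
    proof (rule order.trans[OF sum_abs sum_mono])
      fix i
      have gg: "g n i \<le> g (Suc n) (2 * i + 1)" "g (Suc n) (2 * i + 1) \<le> g n (Suc i)"
        using T by (auto simp: g_def field_simps)
      have "\<bar>incr2 \<Xi> (min t (g n i)) (min t (g (Suc n) (2 * i + 1))) (min t (g n (Suc i)))\<bar>
          \<le> M * (min t (g n (Suc i)) - min t (g n i)) powr \<gamma>"
        using t gg g_mono[of n i] by (intro defect) auto
      also have "\<dots> \<le> \<delta> n"
        unfolding \<delta>_def g_mono(3)[of n i, symmetric]
        using g_mono[of n i] M \<gamma> by (intro mult_left_mono powr_mono2) auto
      finally show "\<bar>- incr2 \<Xi> (min t (g n i)) (min t (g (Suc n) (2 * i + 1))) (min t (g n (Suc i)))\<bar> \<le> \<delta> n"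
        by simp
    qed
    finally show ?thesis by simp
  qed
  define I where "I t = lim (\<lambda>n. J n t)" for t
  have J_lim: "(\<lambda>n. J n t) \<longlonglongrightarrow> I t" if t: "0 \<le> t" "t \<le> T" for t
  proof -
    have "summable (\<lambda>n. J (Suc n) t - J n t)"
    proof (rule summable_comparison_test)
      show "\<exists>N. \<forall>n\<ge>N. norm (J (Suc n) t - J n t) \<le> M * T powr \<gamma> * (2 powr (1 - \<gamma>)) ^ n"
        using J_step[OF t] by (auto simp: pow)
      show "summable (\<lambda>n. M * T powr \<gamma> * (2 powr (1 - \<gamma>)) ^ n)"
        using r by (intro summable_mult summable_geometric) auto
    qed
    then have "convergent (\<lambda>n. \<Sum>k<n. J (Suc k) t - J k t)" by (simp add: summable_iff_convergent)
    moreover have "(\<Sum>k<n. J (Suc k) t - J k t) = J n t - J 0 t" for n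
      by (induction n) simp_all
    ultimately have "convergent (\<lambda>n. J n t - J 0 t)" by simp
    then have "convergent (\<lambda>n. (J n t - J 0 t) + J 0 t)" by (intro convergent_add convergent_const)
    then show ?thesis by (simp add: I_def convergent_LIMSEQ_iff)
  qed
  have incr_bound: "\<bar>J n t - J n s - \<Xi> s t\<bar> \<le> young_const \<gamma> * M * (t - s) powr \<gamma> + 2 ^ n * \<delta> n"
    if st: "0 \<le> s" "s \<le> t" "t \<le> T" for n s t
  proof -
    \<comment> \<open>The grid clamped to [s, t]. The terms of J n t - J n s are those of this grid,
      except on a grid interval with s in its interior, where one defect remains. Bounding all 2^n
      differences by \<delta> n is crude, but the sum still tends to 0.\<close>
    define c where "c i = max s (min t (g n i))" for i
    have "mono c"
    proof (rule monoI)
      fix i j :: nat assume "i \<le> j"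
      then have "g n i \<le> g n j" using T by (simp add: g_def divide_right_mono mult_right_mono)
      then show "c i \<le> c j" by (auto simp: c_def)
    qed
    moreover have c_ends: "c 0 = s" "c (2 ^ n) = t" using st T by (auto simp: c_def g_def)
    ultimately have 1: "\<bar>(\<Sum>i=0..<2 ^ n. \<Xi> (c i) (c (Suc i))) - \<Xi> s t\<bar> \<le> young_const \<gamma> * M * (t - s) powr \<gamma>"
      using partition_sum_bound[OF \<gamma> M, of T \<Xi> c 0 "2 ^ n"] defect st by simp
    have "J n t - J n s - (\<Sum>i=0..<2 ^ n. \<Xi> (c i) (c (Suc i))) =
        (\<Sum>i<2 ^ n. \<Xi> (min t (g n i)) (min t (g n (Suc i))) - \<Xi> (min s (g n i)) (min s (g n (Suc i))) - \<Xi> (c i) (c (Suc i)))"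
      by (simp add: J_def sum_subtractf atLeast0LessThan)
    also have "\<bar>\<dots>\<bar> \<le> (\<Sum>i<(2::nat) ^ n. \<delta> n)"
    proof (rule order.trans[OF sum_abs sum_mono])
      fix i
      note gi = g_mono[of n i]
      consider "g n (Suc i) \<le> s" | "s \<le> g n i" | "g n i < s" "s < g n (Suc i)" by linarith
      then show "\<bar>\<Xi> (min t (g n i)) (min t (g n (Suc i))) - \<Xi> (min s (g n i)) (min s (g n (Suc i))) - \<Xi> (c i) (c (Suc i))\<bar> \<le> \<delta> n"
      proof cases
        case 1
        have "min t (g n i) = g n i" "min t (g n (Suc i)) = g n (Suc i)" "min s (g n i) = g n i"
          "min s (g n (Suc i)) = g n (Suc i)" "c i = s" "c (Suc i) = s"
          using 1 gi st by (auto simp: c_def)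
        then show ?thesis using st \<delta>0[of n] diag[of s] by simp
      next
        case 2
        have "min s (g n i) = s" "min s (g n (Suc i)) = s"
          "c i = min t (g n i)" "c (Suc i) = min t (g n (Suc i))"
          using 2 gi st by (auto simp: c_def)
        then show ?thesis using st \<delta>0[of n] diag[of s] by simp
      next
        case 3
        have "\<bar>incr2 \<Xi> (g n i) s (min t (g n (Suc i)))\<bar> \<le> M * (min t (g n (Suc i)) - g n i) powr \<gamma>"
          using 3 st gi by (intro defect) auto
        also have "\<dots> \<le> \<delta> n"
          unfolding \<delta>_def gi(3)[symmetric] using 3 st M \<gamma> by (intro mult_left_mono powr_mono2) auto
        finally have "\<bar>incr2 \<Xi> (g n i) s (min t (g n (Suc i)))\<bar> \<le> \<delta> n" .
        moreover have "min t (g n i) = g n i" "min s (g n i) = g n i" "min s (g n (Suc i)) = s"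
          "c i = s" "c (Suc i) = min t (g n (Suc i))"
          using 3 gi st by (auto simp: c_def)
        ultimately show ?thesis by (simp add: incr2_def)
      qed
    qed
    finally have "\<bar>J n t - J n s - (\<Sum>i=0..<2 ^ n. \<Xi> (c i) (c (Suc i)))\<bar> \<le> 2 ^ n * \<delta> n" by simp
    with 1 show ?thesis by linarith
  qed
  have bound: "\<bar>I t - I s - \<Xi> s t\<bar> \<le> young_const \<gamma> * M * (t - s) powr \<gamma>" if st: "0 \<le> s" "s \<le> t" "t \<le> T" for s t
  proof -
    have "(\<lambda>n. \<bar>J n t - J n s - \<Xi> s t\<bar>) \<longlonglongrightarrow> \<bar>I t - I s - \<Xi> s t\<bar>"
      using st by (intro tendsto_intros J_lim) auto
    moreover have "(\<lambda>n. young_const \<gamma> * M * (t - s) powr \<gamma> + 2 ^ n * \<delta> n) \<longlonglongrightarrow> young_const \<gamma> * M * (t - s) powr \<gamma> + M * T powr \<gamma> * 0"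
      unfolding pow using r by (intro tendsto_intros LIMSEQ_realpow_zero) auto
    ultimately show ?thesis
      using incr_bound[OF st] by (intro LIMSEQ_le[of _ _ "\<lambda>n. young_const \<gamma> * M * (t - s) powr \<gamma> + 2 ^ n * \<delta> n"]) auto
  qed
  have "J n 0 = 0" for n
    using T diag[of 0] by (simp add: J_def g_def min_def)
  then have "I 0 = 0" by (simp add: I_def)
  then show ?thesis using bound by blast
qed

lift_definition fvec_unit :: "'i \<Rightarrow> 'i fvec" is "\<lambda>i j. if j = i then 1 else 0" by simp

lemma coord_unit: "coord (fvec_unit i) j = (if j = i then 1 else 0)"
  by (simp add: fvec_unit.rep_eq)

lemma coord_sum: "coord (\<Sum>i\<in>A. f i) j = (\<Sum>i\<in>A. coord (f i) j)"
  by (induction A rule: infinite_finite_induct) simp_all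

text \<open>The space of finitely supported vectors is not complete, so limits are taken in each of
  the finitely many coordinates. The resulting K depends on the dimension, which is harmless: later
  it only serves to show that a remainder tends to 0.\<close>

lemma sewing_fvec:
  fixes \<Xi> :: "real \<Rightarrow> real \<Rightarrow> 'i fvec"
  assumes T: "0 < T" and \<gamma>: "1 < \<gamma>" and M: "0 \<le> M" and J: "finite J"
    and cont: "continuous_on (simplex2 T) (\<lambda>(s, t). \<Xi> s t)"
    and vals: "\<And>s t. 0 \<le> s \<Longrightarrow> s \<le> t \<Longrightarrow> t \<le> T \<Longrightarrow> \<Xi> s t \<in> euclid J"
    and defect: "\<And>s u t. 0 \<le> s \<Longrightarrow> s \<le> u \<Longrightarrow> u \<le> t \<Longrightarrow> t \<le> T \<Longrightarrow>
        norm (incr2 \<Xi> s u t) \<le> M * (t - s) powr \<gamma>"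
  shows "\<exists>I K. 0 \<le> K \<and> I 0 = 0 \<and> (\<forall>t. I t \<in> euclid J) \<and> continuous_on {0..T} I \<and>
    (\<forall>s t. 0 \<le> s \<longrightarrow> s \<le> t \<longrightarrow> t \<le> T \<longrightarrow> norm (I t - I s - \<Xi> s t) \<le> K * (t - s) powr \<gamma>)"
proof -
  have "\<exists>I. I 0 = 0 \<and> (\<forall>s t. 0 \<le> s \<longrightarrow> s \<le> t \<longrightarrow> t \<le> T \<longrightarrow>
    \<bar>I t - I s - coord (\<Xi> s t) i\<bar> \<le> young_const \<gamma> * M * (t - s) powr \<gamma>)" for i
  proof (rule sewing_real[OF T \<gamma> M])
    show "\<bar>incr2 (\<lambda>s t. coord (\<Xi> s t) i) s u t\<bar> \<le> M * (t - s) powr \<gamma>"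
      if "0 \<le> s" "s \<le> u" "u \<le> t" "t \<le> T" for s u t
      using defect[OF that] abs_coord_le_norm[of "incr2 \<Xi> s u t" i] by (simp add: incr2_def)
  qed
  then obtain I where I: "\<And>i. I i 0 = 0" "\<And>i s t. 0 \<le> s \<Longrightarrow> s \<le> t \<Longrightarrow> t \<le> T \<Longrightarrow>
    \<bar>I i t - I i s - coord (\<Xi> s t) i\<bar> \<le> young_const \<gamma> * M * (t - s) powr \<gamma>" by metis
  define F where "F t = (\<Sum>i\<in>J. I i t *\<^sub>R fvec_unit i)" for t
  define K where "K = real (card J) * (young_const \<gamma> * M)"
  have coordF: "coord (F t) i = (if i \<in> J then I i t else 0)" for t i
    using J by (simp add: F_def coord_sum coord_unit if_distrib[of "(*) _"] cong: if_cong)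
  have FJ: "F t \<in> euclid J" for t by (simp add: euclid_def coordF)
  have F0: "F 0 = 0" by (simp add: F_def I)
  have bound: "norm (F t - F s - \<Xi> s t) \<le> K * (t - s) powr \<gamma>" if st: "0 \<le> s" "s \<le> t" "t \<le> T" for s t
  proof -
    have "norm (F t - F s - \<Xi> s t) \<le> (\<Sum>i\<in>J. \<bar>coord (F t - F s - \<Xi> s t) i\<bar>)"
      using FJ vals[OF st] by (intro norm_le_sum_coord J euclid_closed)
    also have "\<dots> \<le> (\<Sum>i\<in>J. young_const \<gamma> * M * (t - s) powr \<gamma>)"
      using I(2)[OF st] by (intro sum_mono) (simp add: coordF)
    finally show ?thesis by (simp add: K_def)
  qed
  have K0: "0 \<le> K" using young_const[OF \<gamma>] M by (simp add: K_def)
  have "continuous_on {0..T} F"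
  proof (rule diagonal_continuity[OF cont _ _ K0 bound])
    show "\<Xi> s s = 0" if "0 \<le> s" "s \<le> T" for s
      using defect[of s s s] that by (simp add: incr2_def)
  qed (use \<gamma> in auto)
  then show ?thesis using K0 F0 FJ bound by blast
qed

section \<open>Moduli of smoothness\<close>

lemma orlicz_norm_scale:
  assumes "0 < \<beta>" "0 \<le> c" "\<And>r. r \<in> D \<Longrightarrow> norm (f r) \<le> c * norm (g r)"
  shows "orlicz_norm \<beta> D f \<le> ennreal c * orlicz_norm \<beta> D g"
proof (cases "orlicz_norm \<beta> D g < \<infinity> \<or> c = 0")
  case True
  then show ?thesis using assms by (intro orlicz_norm_dominated)
next
  case False
  then show ?thesis using assms(2) by (simp add: ennreal_mult_top less_top[symmetric])
qed

lemma orlicz_norm_norm: "orlicz_norm \<beta> D (\<lambda>r. norm (f r)) = orlicz_norm \<beta> D f"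
  by (simp add: orlicz_norm_def)

lemma orlicz_norm_empty: "0 < \<beta> \<Longrightarrow> orlicz_norm \<beta> {} f = 0"
  using orlicz_norm_scale[of \<beta> 0 "{}" f f] by simp

text \<open>Vector-valued factors may be replaced by their norms, so the product estimates need be
  available only for real factors.\<close>

lemma modulus2_norm: "modulus2 T \<beta> (\<lambda>s t. norm (\<Xi> s t)) = modulus2 T \<beta> \<Xi>"
  by (simp add: modulus2_def orlicz_norm_norm fun_eq_iff)

lemma besov2_norm_norm: "besov2_norm T a \<beta> q (\<lambda>s t. norm (\<Xi> s t)) = besov2_norm T a \<beta> q \<Xi>"
  by (simp add: besov2_norm_def modulus2_norm)

lemma mono_modulus2: "mono (modulus2 T \<beta> \<Xi>)"
  unfolding modulus2_def by (intro monoI SUP_subset_mono) auto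

lemma mono_modulus3: "mono (modulus3 T \<beta> E)"
  unfolding modulus3_def by (intro monoI SUP_mono bexI SUP_subset_mono) auto

lemma modulus2_upper:
  "0 \<le> h \<Longrightarrow> h \<le> \<tau> \<Longrightarrow> orlicz_norm \<beta> {0..T - h} (\<lambda>r. \<Xi> r (r + h)) \<le> modulus2 T \<beta> \<Xi> \<tau>"
  unfolding modulus2_def by (rule SUP_upper) simp

lemma modulus3_upper:
  "0 \<le> \<theta> \<Longrightarrow> \<theta> \<le> 1 \<Longrightarrow> 0 \<le> h \<Longrightarrow> h \<le> \<tau> \<Longrightarrow>
    orlicz_norm \<beta> {0..T - h} (\<lambda>r. E r (r + \<theta> * h) (r + h)) \<le> modulus3 T \<beta> E \<tau>"
  unfolding modulus3_def by (rule SUP_upper2[of \<theta>], simp, rule SUP_upper) simp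

text \<open>Shifts h > T lead to an empty interval and norm 0, so only h \<le> T has to be
  examined.\<close>

lemma modulus2_least:
  assumes "0 < \<beta>" "\<And>h. 0 \<le> h \<Longrightarrow> h \<le> \<tau> \<Longrightarrow> h \<le> T \<Longrightarrow> orlicz_norm \<beta> {0..T - h} (\<lambda>r. \<Xi> r (r + h)) \<le> K"
  shows "modulus2 T \<beta> \<Xi> \<tau> \<le> K"
  unfolding modulus2_def
proof (rule SUP_least)
  fix h assume "h \<in> {0..\<tau>}"
  then show "orlicz_norm \<beta> {0..T - h} (\<lambda>r. \<Xi> r (r + h)) \<le> K"
    using assms(2)[of h] by (cases "h \<le> T") (auto simp: orlicz_norm_empty assms(1))
qed

lemma modulus3_least:
  assumes "0 < \<beta>" "\<And>\<theta> h. 0 \<le> \<theta> \<Longrightarrow> \<theta> \<le> 1 \<Longrightarrow> 0 \<le> h \<Longrightarrow> h \<le> \<tau> \<Longrightarrow> h \<le> T \<Longrightarrow>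
      orlicz_norm \<beta> {0..T - h} (\<lambda>r. E r (r + \<theta> * h) (r + h)) \<le> K"
  shows "modulus3 T \<beta> E \<tau> \<le> K"
  unfolding modulus3_def
proof (intro SUP_least)
  fix \<theta> h assume "\<theta> \<in> {0..1::real}" "h \<in> {0..\<tau>}"
  then show "orlicz_norm \<beta> {0..T - h} (\<lambda>r. E r (r + \<theta> * h) (r + h)) \<le> K"
    using assms(2)[of \<theta> h] by (cases "h \<le> T") (auto simp: orlicz_norm_empty assms(1))
qed

lemma continuous_on_diagonal:
  fixes \<Xi> :: "real \<Rightarrow> real \<Rightarrow> 'v::topological_space"
  assumes "continuous_on (simplex2 T) (\<lambda>(s, t). \<Xi> s t)" "0 \<le> a" "0 \<le> h" "b + a + h \<le> T"
  shows "continuous_on {0..b} (\<lambda>r. \<Xi> (r + a) (r + a + h))"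
  using assms(2-) by (intro continuous_on_slice[OF assms(1)] continuous_intros) auto

lemma continuous_on_simplex_path:
  fixes f :: "real \<Rightarrow> 'v::topological_space"
  assumes "continuous_on {0..T} f"
  shows "continuous_on (simplex2 T) (\<lambda>p. f (fst p))" "continuous_on (simplex2 T) (\<lambda>p. f (snd p))"
  by (rule continuous_on_compose2[OF assms], auto intro!: continuous_intros simp: simplex2_def)+

lemma continuous_on_incr:
  fixes f :: "real \<Rightarrow> 'v::real_normed_vector"
  assumes "continuous_on {0..T} f"
  shows "continuous_on (simplex2 T) (\<lambda>(s, t). incr f s t)"
  unfolding incr_def case_prod_unfold
  by (intro continuous_on_diff continuous_on_simplex_path assms)

lemma shifted_le_modulus2:
  fixes \<Xi> :: "real \<Rightarrow> real \<Rightarrow> 'v::real_normed_vector"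
  assumes "0 < \<beta>" "continuous_on (simplex2 T) (\<lambda>(s, t). \<Xi> s t)" "0 \<le> a" "0 \<le> h" "h \<le> \<tau>" "b + a + h \<le> T"
  shows "orlicz_norm \<beta> {0..b} (\<lambda>r. \<Xi> (r + a) (r + a + h)) \<le> modulus2 T \<beta> \<Xi> \<tau>"
proof -
  have "orlicz_norm \<beta> {0..b} (\<lambda>r. \<Xi> (r + a) (r + a + h)) \<le> orlicz_norm \<beta> {0..T - h} (\<lambda>r. \<Xi> r (r + h))"
    using assms continuous_on_diagonal[OF assms(2), of 0 h "T - h"]
    by (intro orlicz_norm_shift[where g = "\<lambda>r. \<Xi> r (r + h)"]) auto
  also have "\<dots> \<le> modulus2 T \<beta> \<Xi> \<tau>" using assms by (intro modulus2_upper)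
  finally show ?thesis .
qed

lemma modulus2_triangle:
  fixes \<Xi> \<Xi>' :: "real \<Rightarrow> real \<Rightarrow> 'v::real_normed_vector"
  assumes "0 < \<beta>" "continuous_on (simplex2 T) (\<lambda>(s, t). \<Xi> s t)" "continuous_on (simplex2 T) (\<lambda>(s, t). \<Xi>' s t)"
  shows "modulus2 T \<beta> (\<lambda>s t. \<Xi> s t + \<Xi>' s t) \<tau> \<le> modulus2 T \<beta> \<Xi> \<tau> + modulus2 T \<beta> \<Xi>' \<tau>"
proof (rule modulus2_least[OF assms(1)])
  fix h assume h: "0 \<le> h" "h \<le> \<tau>" "h \<le> T"
  have "orlicz_norm \<beta> {0..T - h} (\<lambda>r. \<Xi> r (r + h) + \<Xi>' r (r + h)) \<le>
      orlicz_norm \<beta> {0..T - h} (\<lambda>r. \<Xi> r (r + h)) + orlicz_norm \<beta> {0..T - h} (\<lambda>r. \<Xi>' r (r + h))"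
    using continuous_on_diagonal[OF assms(2), of 0 h "T - h"] continuous_on_diagonal[OF assms(3), of 0 h "T - h"] h
    by (intro orlicz_norm_triangle assms(1)) auto
  also have "\<dots> \<le> modulus2 T \<beta> \<Xi> \<tau> + modulus2 T \<beta> \<Xi>' \<tau>"
    using h by (intro add_mono modulus2_upper)
  finally show "orlicz_norm \<beta> {0..T - h} (\<lambda>r. \<Xi> r (r + h) + \<Xi>' r (r + h)) \<le> modulus2 T \<beta> \<Xi> \<tau> + modulus2 T \<beta> \<Xi>' \<tau>" .
qed

lemma modulus2_dominated:
  assumes "0 < \<beta>" "0 \<le> c" "\<And>s t. 0 \<le> s \<Longrightarrow> s \<le> t \<Longrightarrow> t \<le> T \<Longrightarrow> norm (\<Xi> s t) \<le> c * norm (\<Xi>' s t)"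
  shows "modulus2 T \<beta> \<Xi> \<tau> \<le> ennreal c * modulus2 T \<beta> \<Xi>' \<tau>"
proof (rule modulus2_least[OF assms(1)])
  fix h assume h: "0 \<le> h" "h \<le> \<tau>" "h \<le> T"
  have "orlicz_norm \<beta> {0..T - h} (\<lambda>r. \<Xi> r (r + h)) \<le> ennreal c * orlicz_norm \<beta> {0..T - h} (\<lambda>r. \<Xi>' r (r + h))"
    using h by (intro orlicz_norm_scale assms) auto
  also have "\<dots> \<le> ennreal c * modulus2 T \<beta> \<Xi>' \<tau>"
    using h by (intro mult_left_mono modulus2_upper) auto
  finally show "orlicz_norm \<beta> {0..T - h} (\<lambda>r. \<Xi> r (r + h)) \<le> ennreal c * modulus2 T \<beta> \<Xi>' \<tau>" .
qed

lemma modulus2_pointwise: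
  assumes "0 < \<beta>" "0 < T" "0 \<le> \<gamma>"
  shows "\<exists>C>0. \<forall>(\<Xi> :: real \<Rightarrow> real \<Rightarrow> 'v::real_normed_vector) K \<tau>. 0 \<le> K \<longrightarrow> 0 < \<tau> \<longrightarrow>
    (\<forall>s t. 0 \<le> s \<longrightarrow> s \<le> t \<longrightarrow> t \<le> T \<longrightarrow> norm (\<Xi> s t) \<le> K * (t - s) powr \<gamma>) \<longrightarrow>
    modulus2 T \<beta> \<Xi> \<tau> \<le> ennreal (C * K * \<tau> powr \<gamma>)"
proof -
  obtain C where C: "0 < C" "\<And>b (g :: real \<Rightarrow> 'v) K. b \<le> T \<Longrightarrow> 0 \<le> K \<Longrightarrow>
      (\<And>r. r \<in> {0..b} \<Longrightarrow> norm (g r) \<le> K) \<Longrightarrow> orlicz_norm \<beta> {0..b} g \<le> ennreal (C * K)"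
    using orlicz_norm_bounded[OF assms(1,2), where 'v = 'v] by metis
  show ?thesis
  proof (intro exI[of _ C] conjI allI impI C(1))
    fix \<Xi> :: "real \<Rightarrow> real \<Rightarrow> 'v" and K \<tau> :: real
    assume K: "0 \<le> K" "0 < \<tau>"
      and \<Xi>: "\<forall>s t. 0 \<le> s \<longrightarrow> s \<le> t \<longrightarrow> t \<le> T \<longrightarrow> norm (\<Xi> s t) \<le> K * (t - s) powr \<gamma>"
    show "modulus2 T \<beta> \<Xi> \<tau> \<le> ennreal (C * K * \<tau> powr \<gamma>)"
    proof (rule modulus2_least[OF assms(1)])
      fix h assume h: "0 \<le> h" "h \<le> \<tau>" "h \<le> T"
      have "orlicz_norm \<beta> {0..T - h} (\<lambda>r. \<Xi> r (r + h)) \<le> ennreal (C * (K * \<tau> powr \<gamma>))"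
      proof (rule C(2))
        fix r assume r: "r \<in> {0..T - h}"
        have "norm (\<Xi> r (r + h)) \<le> K * (r + h - r) powr \<gamma>" using \<Xi>[rule_format, of r "r + h"] r h by auto
        also have "\<dots> \<le> K * \<tau> powr \<gamma>"
          using h K assms by (intro mult_left_mono powr_mono2) auto
        finally show "norm (\<Xi> r (r + h)) \<le> K * \<tau> powr \<gamma>" .
      qed (use h K in auto)
      then show "orlicz_norm \<beta> {0..T - h} (\<lambda>r. \<Xi> r (r + h)) \<le> ennreal (C * K * \<tau> powr \<gamma>)"
        by (simp add: mult.assoc)
    qed
  qed
qed

lemma simplex_bounded:
  fixes \<Xi> :: "real \<Rightarrow> real \<Rightarrow> 'v::real_normed_vector"
  assumes "continuous_on (simplex2 T) (\<lambda>(s, t). \<Xi> s t)"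
  obtains K where "0 \<le> K" "\<And>s t. 0 \<le> s \<Longrightarrow> s \<le> t \<Longrightarrow> t \<le> T \<Longrightarrow> norm (\<Xi> s t) \<le> K"
proof -
  have "bounded ((\<lambda>(s, t). \<Xi> s t) ` simplex2 T)"
    by (intro compact_imp_bounded compact_continuous_image assms compact_simplex2)
  then obtain K where K: "\<forall>x\<in>(\<lambda>(s, t). \<Xi> s t) ` simplex2 T. norm x \<le> K"
    by (auto simp: bounded_iff)
  have "norm (\<Xi> s t) \<le> max K 0" if "0 \<le> s" "s \<le> t" "t \<le> T" for s t
  proof -
    have "\<Xi> s t \<in> (\<lambda>(s, t). \<Xi> s t) ` simplex2 T"
      using that by (intro image_eqI[of _ _ "(s, t)"]) (auto simp: simplex2_def)
    then show ?thesis using K by auto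
  qed
  then show ?thesis by (intro that[of "max K 0"]) auto
qed

text \<open>Continuity on the compact simplex suffices. Finiteness of both factors is what the
  product estimates need, in view of 0 * \<infinity> = 0.\<close>

lemma modulus2_finite:
  fixes \<Xi> :: "real \<Rightarrow> real \<Rightarrow> 'v::real_normed_vector"
  assumes "0 < \<beta>" "0 < T" "continuous_on (simplex2 T) (\<lambda>(s, t). \<Xi> s t)"
  shows "modulus2 T \<beta> \<Xi> \<tau> < \<infinity>"
proof -
  obtain K where K: "0 \<le> K" "\<And>s t. 0 \<le> s \<Longrightarrow> s \<le> t \<Longrightarrow> t \<le> T \<Longrightarrow> norm (\<Xi> s t) \<le> K"
    using simplex_bounded[OF assms(3)] by blast
  obtain C where C: "0 < C" "\<And>b (g :: real \<Rightarrow> 'v) K. b \<le> T \<Longrightarrow> 0 \<le> K \<Longrightarrow>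
      (\<And>r. r \<in> {0..b} \<Longrightarrow> norm (g r) \<le> K) \<Longrightarrow> orlicz_norm \<beta> {0..b} g \<le> ennreal (C * K)"
    using orlicz_norm_bounded[OF assms(1,2), where 'v = 'v] by metis
  have "modulus2 T \<beta> \<Xi> \<tau> \<le> ennreal (C * K)"
    using K by (intro modulus2_least assms C(2)) auto
  also have "\<dots> < \<infinity>" by simp
  finally show ?thesis .
qed

text \<open>The interval [r, r + h] is split at its midpoint, which is \<theta> = 1/2 in
  \<open>modulus3\<close>. Both halves are increments of length h/2 \<le> \<tau>/2, the second one
  shifted by h/2.\<close>

lemma modulus2_halving:
  fixes D :: "real \<Rightarrow> real \<Rightarrow> 'v::real_normed_vector"
  assumes "0 < \<beta>" and D: "continuous_on (simplex2 T) (\<lambda>(s, t). D s t)"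
    and \<Xi>: "continuous_on (simplex2 T) (\<lambda>(s, t). \<Xi> s t)"
    and eq: "\<And>s u t. 0 \<le> s \<Longrightarrow> s \<le> u \<Longrightarrow> u \<le> t \<Longrightarrow> t \<le> T \<Longrightarrow> D s t = D s u + D u t - incr2 \<Xi> s u t"
  shows "modulus2 T \<beta> D \<tau> \<le> 2 * modulus2 T \<beta> D (\<tau> / 2) + modulus3 T \<beta> (incr2 \<Xi>) \<tau>"
proof (rule modulus2_least[OF assms(1)])
  fix h assume h: "0 \<le> h" "h \<le> \<tau>" "h \<le> T"
  let ?I = "{0..T - h}"
  let ?f = "\<lambda>r. D r (r + h / 2)" and ?g = "\<lambda>r. D (r + h / 2) (r + h / 2 + h / 2)"
    and ?e = "\<lambda>r. - incr2 \<Xi> r (r + 1 / 2 * h) (r + h)"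
  have c: "continuous_on ?I ?f" "continuous_on ?I ?g" "continuous_on ?I ?e"
    using h continuous_on_diagonal[OF D, of 0 "h / 2" "T - h"] continuous_on_diagonal[OF D, of "h / 2" "h / 2" "T - h"]
    unfolding incr2_def by (auto intro!: continuous_intros continuous_on_slice[OF \<Xi>])
  have "orlicz_norm \<beta> ?I (\<lambda>r. D r (r + h)) = orlicz_norm \<beta> ?I (\<lambda>r. norm (D r (r + h)))"
    by (simp add: orlicz_norm_norm)
  also have "\<dots> \<le> orlicz_norm \<beta> ?I (\<lambda>r. ?f r + ?g r + ?e r)"
  proof (intro orlicz_norm_mono assms)
    fix r assume r: "r \<in> ?I"
    have *: "r + h / 2 + h / 2 = r + h" by simp
    have "D r (r + h) = ?f r + ?g r + ?e r"
      unfolding * using eq[of r "r + h / 2" "r + h"] h r by simp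
    then show "norm (norm (D r (r + h))) \<le> norm (?f r + ?g r + ?e r)" by simp
  qed
  also have "\<dots> \<le> orlicz_norm \<beta> ?I (\<lambda>r. ?f r + ?g r) + orlicz_norm \<beta> ?I ?e"
    by (rule orlicz_norm_triangle[OF assms(1) _ continuous_on_add[OF c(1,2)] c(3)]) simp
  also have "\<dots> \<le> (orlicz_norm \<beta> ?I ?f + orlicz_norm \<beta> ?I ?g) + orlicz_norm \<beta> ?I ?e"
    by (intro add_right_mono orlicz_norm_triangle[OF assms(1) _ c(1,2)]) simp
  also have "orlicz_norm \<beta> ?I ?f \<le> modulus2 T \<beta> D (\<tau> / 2)"
    using shifted_le_modulus2[OF assms(1) D, of 0 "h / 2" "\<tau> / 2" "T - h"] h by simp
  also have "orlicz_norm \<beta> ?I ?g \<le> modulus2 T \<beta> D (\<tau> / 2)"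
    using h by (intro shifted_le_modulus2 assms D) auto
  also have "orlicz_norm \<beta> ?I ?e \<le> modulus3 T \<beta> (incr2 \<Xi>) \<tau>"
  proof -
    have "orlicz_norm \<beta> ?I ?e \<le> orlicz_norm \<beta> ?I (\<lambda>r. incr2 \<Xi> r (r + 1 / 2 * h) (r + h))"
      by (intro orlicz_norm_mono assms) simp
    also have "\<dots> \<le> modulus3 T \<beta> (incr2 \<Xi>) \<tau>" using h by (intro modulus3_upper) auto
    finally show ?thesis .
  qed
  finally show "orlicz_norm \<beta> ?I (\<lambda>r. D r (r + h)) \<le> 2 * modulus2 T \<beta> D (\<tau> / 2) + modulus3 T \<beta> (incr2 \<Xi>) \<tau>"
    by (simp add: mult_2 add_mono)
qed

text \<open>K and \<gamma> are quantified after C: the pointwise bound only makes 2^n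
  \<omega>(\<tau>/2^n) vanish, and C is the constant of \<open>log_norm_iterate\<close>. Hence C
  depends neither on T nor on \<beta>, and one sewing can be measured in several scales.\<close>

lemma besov_sewing:
  assumes "1 < a" "0 < q"
  shows "\<exists>C>0. \<forall>T \<beta> (\<Xi> :: real \<Rightarrow> real \<Rightarrow> 'v::real_normed_vector) I K \<gamma>. 0 < T \<longrightarrow> 0 < \<beta> \<longrightarrow>
    continuous_on (simplex2 T) (\<lambda>(s, t). \<Xi> s t) \<longrightarrow> continuous_on {0..T} I \<longrightarrow> 0 \<le> K \<longrightarrow> 1 < \<gamma> \<longrightarrow>
    (\<forall>s t. 0 \<le> s \<longrightarrow> s \<le> t \<longrightarrow> t \<le> T \<longrightarrow> norm (I t - I s - \<Xi> s t) \<le> K * (t - s) powr \<gamma>) \<longrightarrow>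
    besov2_norm T a \<beta> q (\<lambda>s t. incr I s t - \<Xi> s t) \<le> ennreal C * besov3_norm T a \<beta> q (incr2 \<Xi>)"
proof -
  obtain C where C_pos: "0 < C" and C_all: "\<forall>T F G. mono F \<longrightarrow> mono G \<longrightarrow>
    (\<forall>\<tau>. 0 < \<tau> \<longrightarrow> \<tau> < T \<longrightarrow> F \<tau> \<le> 2 * F (\<tau> / 2) + G \<tau>) \<longrightarrow>
    (\<forall>\<tau>. 0 < \<tau> \<longrightarrow> \<tau> < T \<longrightarrow> (\<lambda>n. 2 ^ n * F (\<tau> / 2 ^ n)) \<longlonglongrightarrow> 0) \<longrightarrow>
    log_norm T q (\<lambda>\<tau>. ennreal (\<tau> powr - a) * F \<tau>) \<le>
      ennreal C * log_norm T q (\<lambda>\<tau>. ennreal (\<tau> powr - a) * G \<tau>)"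
    using log_norm_iterate[OF assms] by (elim exE conjE)
  note C = C_pos C_all[rule_format]
  show ?thesis
  proof (intro exI[of _ C] conjI allI impI C(1))
    fix T \<beta> K \<gamma> :: real and \<Xi> :: "real \<Rightarrow> real \<Rightarrow> 'v" and I
    assume T: "0 < T" and \<beta>: "0 < \<beta>" and \<Xi>: "continuous_on (simplex2 T) (\<lambda>(s, t). \<Xi> s t)"
      and I: "continuous_on {0..T} I" and K: "0 \<le> K" "1 < \<gamma>"
      and bound: "\<forall>s t. 0 \<le> s \<longrightarrow> s \<le> t \<longrightarrow> t \<le> T \<longrightarrow> norm (I t - I s - \<Xi> s t) \<le> K * (t - s) powr \<gamma>"
    let ?D = "\<lambda>s t. incr I s t - \<Xi> s t"
    have D: "continuous_on (simplex2 T) (\<lambda>(s, t). ?D s t)"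
      using continuous_on_incr[OF I] \<Xi> unfolding case_prod_unfold by (intro continuous_intros)
    show "besov2_norm T a \<beta> q ?D \<le> ennreal C * besov3_norm T a \<beta> q (incr2 \<Xi>)"
      unfolding besov2_norm_def besov3_norm_def
    proof (rule C(2)[OF mono_modulus2 mono_modulus3])
      show "modulus2 T \<beta> ?D \<tau> \<le> 2 * modulus2 T \<beta> ?D (\<tau> / 2) + modulus3 T \<beta> (incr2 \<Xi>) \<tau>" for \<tau>
        by (rule modulus2_halving[OF \<beta> D \<Xi>]) (simp add: incr_def incr2_def)
      fix \<tau> :: real assume \<tau>: "0 < \<tau>"
      obtain C' where C': "0 < C'" "\<And>(\<Xi> :: real \<Rightarrow> real \<Rightarrow> 'v) K \<tau>. 0 \<le> K \<Longrightarrow> 0 < \<tau> \<Longrightarrow>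
          (\<forall>s t. 0 \<le> s \<longrightarrow> s \<le> t \<longrightarrow> t \<le> T \<longrightarrow> norm (\<Xi> s t) \<le> K * (t - s) powr \<gamma>) \<Longrightarrow>
          modulus2 T \<beta> \<Xi> \<tau> \<le> ennreal (C' * K * \<tau> powr \<gamma>)"
        using modulus2_pointwise[OF \<beta> T, of \<gamma>, where 'v = 'v] K by auto
      show "(\<lambda>n. 2 ^ n * modulus2 T \<beta> ?D (\<tau> / 2 ^ n)) \<longlonglongrightarrow> 0"
      proof (rule two_pow_tendsto_zero[OF K(2) _ \<tau>, of "C' * K"])
        show "modulus2 T \<beta> ?D x \<le> ennreal (C' * K * x powr \<gamma>)" if "0 < x" for x
          using bound by (intro C'(2) K that) (simp add: incr_def)
      qed (use C' K in simp)
    qed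
  qed
qed

section \<open>Products\<close>

text \<open>The hypothesis has the shape of the defect of the germ: f and g stand for R on [s, u]
  and \<delta>X on [u, t], g' and f' for \<delta>Y' on [s, u] and XX on [u, t]. The second-order
  factor is on the left in one product and on the right in the other.\<close>

lemma modulus3_Hoelder:
  assumes \<beta>: "0 < \<beta>"
  shows "\<exists>C>0. \<forall>T (E :: real \<Rightarrow> real \<Rightarrow> real \<Rightarrow> 'v::real_normed_vector)
      (f :: real \<Rightarrow> real \<Rightarrow> real) (g :: real \<Rightarrow> real \<Rightarrow> real)
      (f' :: real \<Rightarrow> real \<Rightarrow> real) (g' :: real \<Rightarrow> real \<Rightarrow> real) \<tau>. 0 < T \<longrightarrow>
    continuous_on (simplex2 T) (\<lambda>(s, t). f s t) \<longrightarrow> continuous_on (simplex2 T) (\<lambda>(s, t). g s t) \<longrightarrow>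
    continuous_on (simplex2 T) (\<lambda>(s, t). f' s t) \<longrightarrow> continuous_on (simplex2 T) (\<lambda>(s, t). g' s t) \<longrightarrow>
    (\<forall>s u t. 0 \<le> s \<longrightarrow> s \<le> u \<longrightarrow> u \<le> t \<longrightarrow> t \<le> T \<longrightarrow>
      norm (E s u t) \<le> \<bar>f s u\<bar> * \<bar>g u t\<bar> + \<bar>g' s u\<bar> * \<bar>f' u t\<bar>) \<longrightarrow>
    modulus3 T (\<beta> / 3) E \<tau> \<le> ennreal C * (modulus2 T (\<beta> / 2) f \<tau> * modulus2 T \<beta> g \<tau>
      + modulus2 T (\<beta> / 2) f' \<tau> * modulus2 T \<beta> g' \<tau>)"
proof -
  have \<beta>': "0 < \<beta> / 2" "0 < \<beta> / 3" using \<beta> by auto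
  obtain C where C: "0 < C" "\<And>b (f :: real \<Rightarrow> real) (g :: real \<Rightarrow> real) (h :: real \<Rightarrow> real).
    continuous_on {0..b} f \<Longrightarrow> continuous_on {0..b} g \<Longrightarrow>
    orlicz_norm (\<beta> / 2) {0..b} f < \<infinity> \<Longrightarrow> orlicz_norm \<beta> {0..b} g < \<infinity> \<Longrightarrow>
    (\<And>r. r \<in> {0..b} \<Longrightarrow> \<bar>h r\<bar> \<le> norm (f r) * norm (g r)) \<Longrightarrow>
    orlicz_norm (\<beta> / 3) {0..b} h \<le> ennreal C * (orlicz_norm (\<beta> / 2) {0..b} f * orlicz_norm \<beta> {0..b} g)"
    using orlicz_norm_Hoelder[OF \<beta>, where 'v = real and 'w = real] by metis
  show ?thesis
  proof (intro exI[of _ C] conjI allI impI C(1))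
    fix T \<tau> and E :: "real \<Rightarrow> real \<Rightarrow> real \<Rightarrow> 'v" and f g f' g' :: "real \<Rightarrow> real \<Rightarrow> real"
    assume T: "0 < T" and c: "continuous_on (simplex2 T) (\<lambda>(s, t). f s t)" "continuous_on (simplex2 T) (\<lambda>(s, t). g s t)"
      "continuous_on (simplex2 T) (\<lambda>(s, t). f' s t)" "continuous_on (simplex2 T) (\<lambda>(s, t). g' s t)"
      and E: "\<forall>s u t. 0 \<le> s \<longrightarrow> s \<le> u \<longrightarrow> u \<le> t \<longrightarrow> t \<le> T \<longrightarrow>
        norm (E s u t) \<le> \<bar>f s u\<bar> * \<bar>g u t\<bar> + \<bar>g' s u\<bar> * \<bar>f' u t\<bar>"
    show "modulus3 T (\<beta> / 3) E \<tau> \<le> ennreal C * (modulus2 T (\<beta> / 2) f \<tau> * modulus2 T \<beta> g \<tau>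
      + modulus2 T (\<beta> / 2) f' \<tau> * modulus2 T \<beta> g' \<tau>)"
    proof (rule modulus3_least[OF \<beta>'(2)])
      fix \<theta> h :: real assume \<theta>: "0 \<le> \<theta>" "\<theta> \<le> 1" and h: "0 \<le> h" "h \<le> \<tau>" "h \<le> T"
      let ?I = "{0..T - h}"
      define d where "d = \<theta> * h"
      have d: "0 \<le> d" "d \<le> h" using \<theta> h mult_left_le_one_le[of h \<theta>] by (auto simp: d_def)
      let ?l = "\<lambda>\<phi> r. \<phi> r (r + d)" and ?r = "\<lambda>\<phi> r. \<phi> (r + d) (r + h)"
      have cl: "continuous_on ?I (?l \<phi>)" and cr: "continuous_on ?I (?r \<phi>)"
        if "continuous_on (simplex2 T) (\<lambda>(s, t). \<phi> s t)" for \<phi> :: "real \<Rightarrow> real \<Rightarrow> real"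
        using continuous_on_diagonal[OF that, of 0 d "T - h"] continuous_on_diagonal[OF that, of d "h - d" "T - h"] d by auto
      have ml: "orlicz_norm \<beta>' ?I (?l \<phi>) \<le> modulus2 T \<beta>' \<phi> \<tau>" and mr: "orlicz_norm \<beta>' ?I (?r \<phi>) \<le> modulus2 T \<beta>' \<phi> \<tau>"
        if "continuous_on (simplex2 T) (\<lambda>(s, t). \<phi> s t)" "0 < \<beta>'" for \<beta>' and \<phi> :: "real \<Rightarrow> real \<Rightarrow> real"
        using shifted_le_modulus2[OF that(2,1), of 0 d \<tau> "T - h"] shifted_le_modulus2[OF that(2,1), of d "h - d" \<tau> "T - h"] d h by auto
      have fin: "orlicz_norm \<beta>' ?I (?l \<phi>) < \<infinity>" "orlicz_norm \<beta>' ?I (?r \<phi>) < \<infinity>"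
        if "continuous_on (simplex2 T) (\<lambda>(s, t). \<phi> s t)" "0 < \<beta>'" for \<beta>' and \<phi> :: "real \<Rightarrow> real \<Rightarrow> real"
        using ml[OF that] mr[OF that] modulus2_finite[OF that(2) T that(1), of \<tau>] by (auto intro: le_less_trans)
      let ?h1 = "\<lambda>r. \<bar>?l f r\<bar> * \<bar>?r g r\<bar>" and ?h2 = "\<lambda>r. \<bar>?l g' r\<bar> * \<bar>?r f' r\<bar>"
      have "orlicz_norm (\<beta> / 3) ?I (\<lambda>r. E r (r + \<theta> * h) (r + h)) \<le> orlicz_norm (\<beta> / 3) ?I (\<lambda>r. ?h1 r + ?h2 r)"
      proof (rule orlicz_norm_mono[OF \<beta>'(2)])
        fix r assume "r \<in> ?I"
        then have "norm (E r (r + d) (r + h)) \<le> \<bar>f r (r + d)\<bar> * \<bar>g (r + d) (r + h)\<bar> + \<bar>g' r (r + d)\<bar> * \<bar>f' (r + d) (r + h)\<bar>"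
          using E d by auto
        then show "norm (E r (r + \<theta> * h) (r + h)) \<le> norm (?h1 r + ?h2 r)"
          by (simp add: d_def)
      qed
      also have "\<dots> \<le> orlicz_norm (\<beta> / 3) ?I ?h1 + orlicz_norm (\<beta> / 3) ?I ?h2"
        by (intro orlicz_norm_triangle \<beta>' continuous_intros cl cr c) auto
      also have "orlicz_norm (\<beta> / 3) ?I ?h1 \<le> ennreal C * (modulus2 T (\<beta> / 2) f \<tau> * modulus2 T \<beta> g \<tau>)"
        by (rule order.trans[OF C(2)[OF cl[OF c(1)] cr[OF c(2)] fin(1)[OF c(1)] fin(2)[OF c(2)]]])
           (auto intro!: mult_left_mono mult_mono ml mr c \<beta> \<beta>' simp: abs_mult)
      also have "orlicz_norm (\<beta> / 3) ?I ?h2 \<le> ennreal C * (modulus2 T (\<beta> / 2) f' \<tau> * modulus2 T \<beta> g' \<tau>)"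
        by (rule order.trans[OF C(2)[OF cr[OF c(3)] cl[OF c(4)] fin(2)[OF c(3)] fin(1)[OF c(4)]]])
           (auto intro!: mult_left_mono mult_mono ml mr c \<beta> \<beta>' simp: abs_mult mult.commute)
      finally show "orlicz_norm (\<beta> / 3) ?I (\<lambda>r. E r (r + \<theta> * h) (r + h)) \<le>
          ennreal C * (modulus2 T (\<beta> / 2) f \<tau> * modulus2 T \<beta> g \<tau> + modulus2 T (\<beta> / 2) f' \<tau> * modulus2 T \<beta> g' \<tau>)"
        by (simp add: distrib_left add_mono)
    qed
  qed
qed

text \<open>One factor of each product has been bounded pointwise by a constant times (t - s)^\<mu>.
  The other keeps its own Orlicz scale, so no Hoelder inequality is needed and the index \<beta> is
  not lowered.\<close>

lemma modulus3_weighted: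
  fixes E :: "real \<Rightarrow> real \<Rightarrow> real \<Rightarrow> 'v::real_normed_vector" and f g :: "real \<Rightarrow> real \<Rightarrow> real"
  assumes \<beta>: "0 < \<beta>" and T: "0 < T" and \<mu>: "0 \<le> \<mu>" and c12: "0 \<le> c1" "0 \<le> c2" and \<tau>: "0 < \<tau>"
    and c: "continuous_on (simplex2 T) (\<lambda>(s, t). f s t)" "continuous_on (simplex2 T) (\<lambda>(s, t). g s t)"
    and E: "\<And>s u t. 0 \<le> s \<Longrightarrow> s \<le> u \<Longrightarrow> u \<le> t \<Longrightarrow> t \<le> T \<Longrightarrow>
        norm (E s u t) \<le> (t - s) powr \<mu> * (c1 * \<bar>f s u\<bar> + c2 * \<bar>g u t\<bar>)"
  shows "modulus3 T \<beta> E \<tau> \<le> ennreal (\<tau> powr \<mu>) * (ennreal c1 * modulus2 T \<beta> f \<tau> + ennreal c2 * modulus2 T \<beta> g \<tau>)"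
proof (rule modulus3_least[OF \<beta>])
  fix \<theta> h :: real assume \<theta>: "0 \<le> \<theta>" "\<theta> \<le> 1" and h: "0 \<le> h" "h \<le> \<tau>" "h \<le> T"
  let ?I = "{0..T - h}"
  define d where "d = \<theta> * h"
  have d: "0 \<le> d" "d \<le> h" using \<theta> h mult_left_le_one_le[of h \<theta>] by (auto simp: d_def)
  let ?f = "\<lambda>r. c1 * \<bar>f r (r + d)\<bar>" and ?g = "\<lambda>r. c2 * \<bar>g (r + d) (r + d + (h - d))\<bar>"
  have cont: "continuous_on ?I ?f" "continuous_on ?I ?g"
    using continuous_on_diagonal[OF c(1), of 0 d "T - h"] continuous_on_diagonal[OF c(2), of d "h - d" "T - h"] d
    by (auto intro!: continuous_intros)
  have "orlicz_norm \<beta> ?I (\<lambda>r. E r (r + \<theta> * h) (r + h)) \<le> ennreal (\<tau> powr \<mu>) * orlicz_norm \<beta> ?I (\<lambda>r. ?f r + ?g r)"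
  proof (rule orlicz_norm_scale[OF \<beta>])
    fix r assume "r \<in> ?I"
    then have "norm (E r (r + d) (r + h)) \<le> h powr \<mu> * (c1 * \<bar>f r (r + d)\<bar> + c2 * \<bar>g (r + d) (r + h)\<bar>)"
      using E[of r "r + d" "r + h"] d by auto
    also have "\<dots> \<le> \<tau> powr \<mu> * (c1 * \<bar>f r (r + d)\<bar> + c2 * \<bar>g (r + d) (r + h)\<bar>)"
      using h \<mu> c12 by (intro mult_right_mono powr_mono2) auto
    finally show "norm (E r (r + \<theta> * h) (r + h)) \<le> \<tau> powr \<mu> * norm (?f r + ?g r)"
      using c12 by (simp add: d_def)
  qed simp
  also have "\<dots> \<le> ennreal (\<tau> powr \<mu>) * (orlicz_norm \<beta> ?I ?f + orlicz_norm \<beta> ?I ?g)"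
    using cont by (intro mult_left_mono orlicz_norm_triangle \<beta>) auto
  also have "\<dots> \<le> ennreal (\<tau> powr \<mu>) * (ennreal c1 * modulus2 T \<beta> f \<tau> + ennreal c2 * modulus2 T \<beta> g \<tau>)"
  proof (intro mult_left_mono add_mono)
    have "orlicz_norm \<beta> ?I ?f \<le> ennreal c1 * orlicz_norm \<beta> ?I (\<lambda>r. f r (r + d))"
      using c12 by (intro orlicz_norm_scale \<beta>) (auto simp: abs_mult)
    also have "\<dots> \<le> ennreal c1 * modulus2 T \<beta> f \<tau>"
      using shifted_le_modulus2[OF \<beta> c(1), of 0 d \<tau> "T - h"] d h by (intro mult_left_mono) auto
    finally show "orlicz_norm \<beta> ?I ?f \<le> ennreal c1 * modulus2 T \<beta> f \<tau>" .
    have "orlicz_norm \<beta> ?I ?g \<le> ennreal c2 * orlicz_norm \<beta> ?I (\<lambda>r. g (r + d) (r + d + (h - d)))"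
      using c12 by (intro orlicz_norm_scale \<beta>) (auto simp: abs_mult)
    also have "\<dots> \<le> ennreal c2 * modulus2 T \<beta> g \<tau>"
      using shifted_le_modulus2[OF \<beta> c(2), of d "h - d" \<tau> "T - h"] d h by (intro mult_left_mono) auto
    finally show "orlicz_norm \<beta> ?I ?g \<le> ennreal c2 * modulus2 T \<beta> g \<tau>" .
  qed auto
  finally show "orlicz_norm \<beta> ?I (\<lambda>r. E r (r + \<theta> * h) (r + h)) \<le>
      ennreal (\<tau> powr \<mu>) * (ennreal c1 * modulus2 T \<beta> f \<tau> + ennreal c2 * modulus2 T \<beta> g \<tau>)" .
qed

text \<open>The weight splits as \<tau>^(-3\<alpha>) = \<tau>^(-2\<alpha>) \<tau>^(-\<alpha>),
  parallel to the two Hoelder inequalities in \<beta> and in q.\<close>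

lemma besov3_Hoelder:
  assumes \<alpha>: "0 < \<alpha>" and \<beta>: "0 < \<beta>" and q: "0 < q"
  shows "\<exists>C>0. \<forall>T (E :: real \<Rightarrow> real \<Rightarrow> real \<Rightarrow> 'v::real_normed_vector)
      (f :: real \<Rightarrow> real \<Rightarrow> real) (g :: real \<Rightarrow> real \<Rightarrow> real)
      (f' :: real \<Rightarrow> real \<Rightarrow> real) (g' :: real \<Rightarrow> real \<Rightarrow> real). 0 < T \<longrightarrow>
    continuous_on (simplex2 T) (\<lambda>(s, t). f s t) \<longrightarrow> continuous_on (simplex2 T) (\<lambda>(s, t). g s t) \<longrightarrow>
    continuous_on (simplex2 T) (\<lambda>(s, t). f' s t) \<longrightarrow> continuous_on (simplex2 T) (\<lambda>(s, t). g' s t) \<longrightarrow>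
    besov2_norm T (2 * \<alpha>) (\<beta> / 2) (q / 2) f < \<infinity> \<longrightarrow> besov2_norm T \<alpha> \<beta> q g < \<infinity> \<longrightarrow>
    besov2_norm T (2 * \<alpha>) (\<beta> / 2) (q / 2) f' < \<infinity> \<longrightarrow> besov2_norm T \<alpha> \<beta> q g' < \<infinity> \<longrightarrow>
    (\<forall>s u t. 0 \<le> s \<longrightarrow> s \<le> u \<longrightarrow> u \<le> t \<longrightarrow> t \<le> T \<longrightarrow>
      norm (E s u t) \<le> \<bar>f s u\<bar> * \<bar>g u t\<bar> + \<bar>g' s u\<bar> * \<bar>f' u t\<bar>) \<longrightarrow>
    besov3_norm T (3 * \<alpha>) (\<beta> / 3) (q / 3) E \<le> ennreal C *
      (besov2_norm T (2 * \<alpha>) (\<beta> / 2) (q / 2) f * besov2_norm T \<alpha> \<beta> q g +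
       besov2_norm T (2 * \<alpha>) (\<beta> / 2) (q / 2) f' * besov2_norm T \<alpha> \<beta> q g')"
proof -
  have q3: "0 < q / 3" using q by (simp add: ennreal_zero_less_divide)
  obtain C1 where C1: "0 < C1" and H1: "\<And>T (E :: real \<Rightarrow> real \<Rightarrow> real \<Rightarrow> 'v) f g f' g' \<tau>. 0 < T \<Longrightarrow>
    continuous_on (simplex2 T) (\<lambda>(s, t). f s t) \<Longrightarrow> continuous_on (simplex2 T) (\<lambda>(s, t). g s t) \<Longrightarrow>
    continuous_on (simplex2 T) (\<lambda>(s, t). f' s t) \<Longrightarrow> continuous_on (simplex2 T) (\<lambda>(s, t). g' s t) \<Longrightarrow>
    (\<forall>s u t. 0 \<le> s \<longrightarrow> s \<le> u \<longrightarrow> u \<le> t \<longrightarrow> t \<le> T \<longrightarrow>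
      norm (E s u t) \<le> \<bar>f s u\<bar> * \<bar>g u t\<bar> + \<bar>g' s u\<bar> * \<bar>f' u t\<bar>) \<Longrightarrow>
    modulus3 T (\<beta> / 3) E \<tau> \<le> ennreal C1 * (modulus2 T (\<beta> / 2) f \<tau> * modulus2 T \<beta> g \<tau>
      + modulus2 T (\<beta> / 2) f' \<tau> * modulus2 T \<beta> g' \<tau>)"
    using modulus3_Hoelder[OF \<beta>, where 'v = 'v] by blast
  obtain C2 where C2: "0 < C2" and H2: "\<And>T f g. f \<in> borel_measurable borel \<Longrightarrow> g \<in> borel_measurable borel \<Longrightarrow>
    log_norm T (q / 3) (\<lambda>\<tau>. f \<tau> + g \<tau>) \<le> ennreal C2 * (log_norm T (q / 3) f + log_norm T (q / 3) g)"
    using log_norm_add[OF q3] by blast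
  obtain C3 where C3: "0 < C3" and H3: "\<And>T f g. f \<in> borel_measurable borel \<Longrightarrow> g \<in> borel_measurable borel \<Longrightarrow>
    log_norm T (q / 2) f < \<infinity> \<Longrightarrow> log_norm T q g < \<infinity> \<Longrightarrow>
    log_norm T (q / 3) (\<lambda>\<tau>. f \<tau> * g \<tau>) \<le> ennreal C3 * (log_norm T (q / 2) f * log_norm T q g)"
    using log_norm_Hoelder[OF q] by blast
  show ?thesis
  proof (intro exI[of _ "C1 * C2 * C3"] conjI allI impI)
    fix T and E :: "real \<Rightarrow> real \<Rightarrow> real \<Rightarrow> 'v" and f g f' g' :: "real \<Rightarrow> real \<Rightarrow> real"
    assume T: "0 < T" and c: "continuous_on (simplex2 T) (\<lambda>(s, t). f s t)" "continuous_on (simplex2 T) (\<lambda>(s, t). g s t)"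
      "continuous_on (simplex2 T) (\<lambda>(s, t). f' s t)" "continuous_on (simplex2 T) (\<lambda>(s, t). g' s t)"
      and fin: "besov2_norm T (2 * \<alpha>) (\<beta> / 2) (q / 2) f < \<infinity>" "besov2_norm T \<alpha> \<beta> q g < \<infinity>"
        "besov2_norm T (2 * \<alpha>) (\<beta> / 2) (q / 2) f' < \<infinity>" "besov2_norm T \<alpha> \<beta> q g' < \<infinity>"
      and E: "\<forall>s u t. 0 \<le> s \<longrightarrow> s \<le> u \<longrightarrow> u \<le> t \<longrightarrow> t \<le> T \<longrightarrow>
        norm (E s u t) \<le> \<bar>f s u\<bar> * \<bar>g u t\<bar> + \<bar>g' s u\<bar> * \<bar>f' u t\<bar>"
    let ?w = "\<lambda>a b \<phi> \<tau>. ennreal (\<tau> powr - a) * modulus2 T b \<phi> \<tau>"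
    have [measurable]: "?w a b \<phi> \<in> borel_measurable borel" for a b and \<phi> :: "real \<Rightarrow> real \<Rightarrow> real"
      by (intro weighted_measurable mono_modulus2)
    let ?P = "\<lambda>\<tau>. ?w (2 * \<alpha>) (\<beta> / 2) f \<tau> * ?w \<alpha> \<beta> g \<tau>" and ?Q = "\<lambda>\<tau>. ?w (2 * \<alpha>) (\<beta> / 2) f' \<tau> * ?w \<alpha> \<beta> g' \<tau>"
    have "besov3_norm T (3 * \<alpha>) (\<beta> / 3) (q / 3) E \<le> log_norm T (q / 3) (\<lambda>\<tau>. ennreal C1 * (?P \<tau> + ?Q \<tau>))"
      unfolding besov3_norm_def
    proof (rule log_norm_mono[OF weighted_measurable[OF mono_modulus3] q3])
      fix \<tau> :: real assume \<tau>: "0 < \<tau>"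
      have split: "ennreal (\<tau> powr - (3 * \<alpha>)) = ennreal (\<tau> powr - (2 * \<alpha>)) * ennreal (\<tau> powr - \<alpha>)"
        by (simp add: ennreal_mult[symmetric] powr_add[symmetric])
      have "ennreal (\<tau> powr - (3 * \<alpha>)) * modulus3 T (\<beta> / 3) E \<tau> \<le> ennreal (\<tau> powr - (3 * \<alpha>)) *
          (ennreal C1 * (modulus2 T (\<beta> / 2) f \<tau> * modulus2 T \<beta> g \<tau> + modulus2 T (\<beta> / 2) f' \<tau> * modulus2 T \<beta> g' \<tau>))"
        by (intro mult_left_mono H1[OF T c E]) simp
      also have "\<dots> = ennreal C1 * (?P \<tau> + ?Q \<tau>)"
        unfolding split by (simp only: distrib_left mult_ac)
      finally show "ennreal (\<tau> powr - (3 * \<alpha>)) * modulus3 T (\<beta> / 3) E \<tau> \<le> ennreal C1 * (?P \<tau> + ?Q \<tau>)" .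
    qed
    also have "\<dots> \<le> ennreal C1 * log_norm T (q / 3) (\<lambda>\<tau>. ?P \<tau> + ?Q \<tau>)"
      using C1 by (intro log_norm_cmult q3) (auto simp: less_imp_le)
    also have "\<dots> \<le> ennreal C1 * (ennreal C2 * (log_norm T (q / 3) ?P + log_norm T (q / 3) ?Q))"
      by (intro mult_left_mono H2) auto
    also have "\<dots> \<le> ennreal C1 * (ennreal C2 *
        (ennreal C3 * (besov2_norm T (2 * \<alpha>) (\<beta> / 2) (q / 2) f * besov2_norm T \<alpha> \<beta> q g) +
         ennreal C3 * (besov2_norm T (2 * \<alpha>) (\<beta> / 2) (q / 2) f' * besov2_norm T \<alpha> \<beta> q g')))"
      using fin unfolding besov2_norm_def by (intro mult_left_mono add_mono H3) auto
    also have "\<dots> = ennreal (C1 * C2 * C3) *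
      (besov2_norm T (2 * \<alpha>) (\<beta> / 2) (q / 2) f * besov2_norm T \<alpha> \<beta> q g +
       besov2_norm T (2 * \<alpha>) (\<beta> / 2) (q / 2) f' * besov2_norm T \<alpha> \<beta> q g')"
      using C1 C2 C3 by (simp add: ennreal_mult distrib_left mult.assoc)
    finally show "besov3_norm T (3 * \<alpha>) (\<beta> / 3) (q / 3) E \<le> ennreal (C1 * C2 * C3) *
      (besov2_norm T (2 * \<alpha>) (\<beta> / 2) (q / 2) f * besov2_norm T \<alpha> \<beta> q g +
       besov2_norm T (2 * \<alpha>) (\<beta> / 2) (q / 2) f' * besov2_norm T \<alpha> \<beta> q g')" .
  qed (use C1 C2 C3 in simp)
qed

lemma besov3_weighted:
  assumes q: "0 < q"
  shows "\<exists>C>0. \<forall>T \<beta> \<mu> a c1 c2 (E :: real \<Rightarrow> real \<Rightarrow> real \<Rightarrow> 'v::real_normed_vector)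
      (f :: real \<Rightarrow> real \<Rightarrow> real) (g :: real \<Rightarrow> real \<Rightarrow> real). 0 < T \<longrightarrow> 0 < \<beta> \<longrightarrow> 0 \<le> \<mu> \<longrightarrow> 0 \<le> c1 \<longrightarrow> 0 \<le> c2 \<longrightarrow>
    continuous_on (simplex2 T) (\<lambda>(s, t). f s t) \<longrightarrow> continuous_on (simplex2 T) (\<lambda>(s, t). g s t) \<longrightarrow>
    (\<forall>s u t. 0 \<le> s \<longrightarrow> s \<le> u \<longrightarrow> u \<le> t \<longrightarrow> t \<le> T \<longrightarrow>
      norm (E s u t) \<le> (t - s) powr \<mu> * (c1 * \<bar>f s u\<bar> + c2 * \<bar>g u t\<bar>)) \<longrightarrow>
    besov3_norm T (a + \<mu>) \<beta> q E \<le> ennreal C *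
      (ennreal c1 * besov2_norm T a \<beta> q f + ennreal c2 * besov2_norm T a \<beta> q g)"
proof -
  obtain C where C: "0 < C" and H: "\<And>T f g. f \<in> borel_measurable borel \<Longrightarrow> g \<in> borel_measurable borel \<Longrightarrow>
    log_norm T q (\<lambda>\<tau>. f \<tau> + g \<tau>) \<le> ennreal C * (log_norm T q f + log_norm T q g)"
    using log_norm_add[OF q] by blast
  show ?thesis
  proof (intro exI[of _ C] conjI allI impI C)
    fix T \<beta> \<mu> a c1 c2 :: real and E :: "real \<Rightarrow> real \<Rightarrow> real \<Rightarrow> 'v" and f g :: "real \<Rightarrow> real \<Rightarrow> real"
    assume T: "0 < T" and \<beta>: "0 < \<beta>" and \<mu>: "0 \<le> \<mu>" and c12: "0 \<le> c1" "0 \<le> c2"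
      and c: "continuous_on (simplex2 T) (\<lambda>(s, t). f s t)" "continuous_on (simplex2 T) (\<lambda>(s, t). g s t)"
      and E: "\<forall>s u t. 0 \<le> s \<longrightarrow> s \<le> u \<longrightarrow> u \<le> t \<longrightarrow> t \<le> T \<longrightarrow>
        norm (E s u t) \<le> (t - s) powr \<mu> * (c1 * \<bar>f s u\<bar> + c2 * \<bar>g u t\<bar>)"
    let ?w = "\<lambda>\<phi> \<tau>. ennreal (\<tau> powr - a) * modulus2 T \<beta> \<phi> \<tau>"
    have [measurable]: "?w \<phi> \<in> borel_measurable borel" for \<phi> :: "real \<Rightarrow> real \<Rightarrow> real"
      by (intro weighted_measurable mono_modulus2)
    have "besov3_norm T (a + \<mu>) \<beta> q E \<le> log_norm T q (\<lambda>\<tau>. ennreal c1 * ?w f \<tau> + ennreal c2 * ?w g \<tau>)"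
      unfolding besov3_norm_def
    proof (rule log_norm_mono[OF weighted_measurable[OF mono_modulus3] q])
      fix \<tau> :: real assume \<tau>: "0 < \<tau>"
      have split: "ennreal (\<tau> powr - (a + \<mu>)) * ennreal (\<tau> powr \<mu>) = ennreal (\<tau> powr - a)"
        by (simp add: ennreal_mult[symmetric] powr_add[symmetric])
      have "ennreal (\<tau> powr - (a + \<mu>)) * modulus3 T \<beta> E \<tau> \<le> ennreal (\<tau> powr - (a + \<mu>)) *
          (ennreal (\<tau> powr \<mu>) * (ennreal c1 * modulus2 T \<beta> f \<tau> + ennreal c2 * modulus2 T \<beta> g \<tau>))"
        using E by (intro mult_left_mono modulus3_weighted \<beta> T \<mu> c12 c \<tau>) auto
      also have "\<dots> = ennreal (\<tau> powr - a) * (ennreal c1 * modulus2 T \<beta> f \<tau> + ennreal c2 * modulus2 T \<beta> g \<tau>)"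
        by (simp only: mult.assoc[symmetric] split)
      also have "\<dots> = ennreal c1 * ?w f \<tau> + ennreal c2 * ?w g \<tau>"
        by (simp only: distrib_left mult_ac)
      finally show "ennreal (\<tau> powr - (a + \<mu>)) * modulus3 T \<beta> E \<tau> \<le> ennreal c1 * ?w f \<tau> + ennreal c2 * ?w g \<tau>" .
    qed
    also have "\<dots> \<le> ennreal C * (log_norm T q (\<lambda>\<tau>. ennreal c1 * ?w f \<tau>) + log_norm T q (\<lambda>\<tau>. ennreal c2 * ?w g \<tau>))"
      by (rule H) auto
    also have "\<dots> \<le> ennreal C * (ennreal c1 * besov2_norm T a \<beta> q f + ennreal c2 * besov2_norm T a \<beta> q g)"
      unfolding besov2_norm_def by (intro mult_left_mono add_mono log_norm_cmult q c12) auto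
    finally show "besov3_norm T (a + \<mu>) \<beta> q E \<le> ennreal C *
      (ennreal c1 * besov2_norm T a \<beta> q f + ennreal c2 * besov2_norm T a \<beta> q g)" .
  qed
qed

lemma besov2_triangle:
  assumes q: "0 < q"
  shows "\<exists>C>0. \<forall>T \<beta> a (\<Xi> :: real \<Rightarrow> real \<Rightarrow> 'v::real_normed_vector) \<Xi>'. 0 < \<beta> \<longrightarrow>
    continuous_on (simplex2 T) (\<lambda>(s, t). \<Xi> s t) \<longrightarrow> continuous_on (simplex2 T) (\<lambda>(s, t). \<Xi>' s t) \<longrightarrow>
    besov2_norm T a \<beta> q (\<lambda>s t. \<Xi> s t + \<Xi>' s t) \<le> ennreal C * (besov2_norm T a \<beta> q \<Xi> + besov2_norm T a \<beta> q \<Xi>')"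
proof -
  obtain C where C: "0 < C" and H: "\<And>T f g. f \<in> borel_measurable borel \<Longrightarrow> g \<in> borel_measurable borel \<Longrightarrow>
    log_norm T q (\<lambda>\<tau>. f \<tau> + g \<tau>) \<le> ennreal C * (log_norm T q f + log_norm T q g)"
    using log_norm_add[OF q] by blast
  show ?thesis
  proof (intro exI[of _ C] conjI allI impI C)
    fix T \<beta> a :: real and \<Xi> \<Xi>' :: "real \<Rightarrow> real \<Rightarrow> 'v"
    assume \<beta>: "0 < \<beta>" and c: "continuous_on (simplex2 T) (\<lambda>(s, t). \<Xi> s t)" "continuous_on (simplex2 T) (\<lambda>(s, t). \<Xi>' s t)"
    have "besov2_norm T a \<beta> q (\<lambda>s t. \<Xi> s t + \<Xi>' s t) \<le>
        log_norm T q (\<lambda>\<tau>. ennreal (\<tau> powr - a) * modulus2 T \<beta> \<Xi> \<tau> + ennreal (\<tau> powr - a) * modulus2 T \<beta> \<Xi>' \<tau>)"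
      unfolding besov2_norm_def distrib_left[symmetric]
      by (intro log_norm_mono weighted_measurable mono_modulus2 q mult_left_mono modulus2_triangle \<beta> c) simp
    also have "\<dots> \<le> ennreal C * (besov2_norm T a \<beta> q \<Xi> + besov2_norm T a \<beta> q \<Xi>')"
      unfolding besov2_norm_def by (intro H weighted_measurable mono_modulus2)
    finally show "besov2_norm T a \<beta> q (\<lambda>s t. \<Xi> s t + \<Xi>' s t) \<le> ennreal C * (besov2_norm T a \<beta> q \<Xi> + besov2_norm T a \<beta> q \<Xi>')" .
  qed
qed

lemma besov2_dominated:
  assumes "0 < q" "0 < \<beta>" "0 \<le> c" "\<And>s t. 0 \<le> s \<Longrightarrow> s \<le> t \<Longrightarrow> t \<le> T \<Longrightarrow> norm (\<Xi> s t) \<le> c * norm (\<Xi>' s t)"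
  shows "besov2_norm T a \<beta> q \<Xi> \<le> ennreal c * besov2_norm T a \<beta> q \<Xi>'"
proof -
  have "besov2_norm T a \<beta> q \<Xi> \<le> log_norm T q (\<lambda>\<tau>. ennreal c * (ennreal (\<tau> powr - a) * modulus2 T \<beta> \<Xi>' \<tau>))"
    unfolding besov2_norm_def mult.left_commute[of "ennreal c"]
    by (intro log_norm_mono weighted_measurable mono_modulus2 mult_left_mono modulus2_dominated assms) auto
  also have "\<dots> \<le> ennreal c * besov2_norm T a \<beta> q \<Xi>'"
    unfolding besov2_norm_def by (intro log_norm_cmult weighted_measurable mono_modulus2 assms)
  finally show ?thesis .
qed

text \<open>\<tau>^(-a) \<le> T^\<mu> \<tau>^(-(a + \<mu>)) on (0, T). Surplus regularity becomes a
  positive power of T; this is how such powers enter the estimates of D.\<close>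

lemma besov2_lower_exponent:
  assumes "0 < q" "0 \<le> \<mu>"
  shows "besov2_norm T a \<beta> q \<Xi> \<le> ennreal (T powr \<mu>) * besov2_norm T (a + \<mu>) \<beta> q \<Xi>"
proof -
  have "besov2_norm T a \<beta> q \<Xi> \<le> log_norm T q (\<lambda>\<tau>. ennreal (T powr \<mu>) * (ennreal (\<tau> powr - (a + \<mu>)) * modulus2 T \<beta> \<Xi> \<tau>))"
    unfolding besov2_norm_def
  proof (intro log_norm_mono weighted_measurable mono_modulus2 assms)
    fix \<tau> assume \<tau>: "0 < \<tau>" "\<tau> < T"
    have "\<tau> powr - a = \<tau> powr \<mu> * \<tau> powr - (a + \<mu>)" by (simp flip: powr_add)
    also have "\<dots> \<le> T powr \<mu> * \<tau> powr - (a + \<mu>)"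
      using \<tau> assms by (intro mult_right_mono powr_mono2) auto
    finally have "ennreal (\<tau> powr - a) \<le> ennreal (T powr \<mu>) * ennreal (\<tau> powr - (a + \<mu>))"
      by (simp add: ennreal_leI flip: ennreal_mult)
    then show "ennreal (\<tau> powr - a) * modulus2 T \<beta> \<Xi> \<tau> \<le> ennreal (T powr \<mu>) * (ennreal (\<tau> powr - (a + \<mu>)) * modulus2 T \<beta> \<Xi> \<tau>)"
      by (simp add: mult.assoc[symmetric] mult_right_mono)
  qed
  also have "\<dots> \<le> ennreal (T powr \<mu>) * besov2_norm T (a + \<mu>) \<beta> q \<Xi>"
    unfolding besov2_norm_def by (intro log_norm_cmult weighted_measurable mono_modulus2 assms) simp
  finally show ?thesis .
qed

text \<open>A function of regularity \<open>2 \<mu>\<close> pointwise is the product of its square root with a bounded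
  factor, which trades \<open>\<Phi>\<^bsub>\<beta>/2\<^esub>\<close> for \<open>\<Phi>\<^bsub>\<beta>\<^esub>\<close> at the price of a constant that depends on \<open>T\<close>.\<close>

lemma besov2_sqrt:
  assumes q: "0 < q" and \<beta>: "0 < \<beta>" and T: "0 < T" and \<mu>: "0 \<le> \<mu>"
  shows "\<exists>C>0. \<forall>(\<Xi> :: real \<Rightarrow> real \<Rightarrow> 'v::real_normed_vector) K a x. 0 \<le> K \<longrightarrow> 0 \<le> x \<longrightarrow>
    continuous_on (simplex2 T) (\<lambda>(s, t). \<Xi> s t) \<longrightarrow>
    (\<forall>s t. 0 \<le> s \<longrightarrow> s \<le> t \<longrightarrow> t \<le> T \<longrightarrow> norm (\<Xi> s t) \<le> K * (t - s) powr (2 * \<mu>)) \<longrightarrow>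
    besov2_norm T (2 * a) (\<beta> / 2) (q / 2) \<Xi> \<le> ennreal x \<longrightarrow>
    besov2_norm T a \<beta> q \<Xi> \<le> ennreal (C * sqrt (K * x))"
proof -
  obtain C where C: "0 < C" and H: "\<And>b (g :: real \<Rightarrow> 'v) l. b \<le> T \<Longrightarrow>
    continuous_on {0..b} g \<Longrightarrow> 0 < l \<Longrightarrow> orlicz_norm (\<beta> / 2) {0..b} g < ennreal l \<Longrightarrow>
    orlicz_norm \<beta> {0..b} (\<lambda>r. sqrt (norm (g r))) \<le> ennreal (C * sqrt l)"
    using orlicz_norm_sqrt[OF \<beta> T, where 'v = 'v] by blast
  show ?thesis
  proof (intro exI[of _ "T powr \<mu> * C"] conjI allI impI)
    fix \<Xi> :: "real \<Rightarrow> real \<Rightarrow> 'v" and K a x :: real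
    assume K: "0 \<le> K" and x: "0 \<le> x" and c: "continuous_on (simplex2 T) (\<lambda>(s, t). \<Xi> s t)"
      and \<Xi>: "\<forall>s t. 0 \<le> s \<longrightarrow> s \<le> t \<longrightarrow> t \<le> T \<longrightarrow> norm (\<Xi> s t) \<le> K * (t - s) powr (2 * \<mu>)"
      and le: "besov2_norm T (2 * a) (\<beta> / 2) (q / 2) \<Xi> \<le> ennreal x"
    \<comment> \<open>The norm of \<Xi> is the square of its root; by the pointwise bound one of the
      two factors is at most L.\<close>
    define L where "L = T powr \<mu> * sqrt K"
    have L: "0 \<le> L" using K by (simp add: L_def)
    have mod: "modulus2 T \<beta> \<Xi> \<tau> \<le> ennreal (L * C) * epowr (modulus2 T (\<beta> / 2) \<Xi> \<tau>) (1 / 2)" for \<tau>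
    proof (rule modulus2_least[OF \<beta>])
      fix h assume h: "0 \<le> h" "h \<le> \<tau>" "h \<le> T"
      let ?I = "{0..T - h}" and ?g = "\<lambda>r. \<Xi> r (r + h)"
      have "orlicz_norm \<beta> ?I ?g \<le> ennreal L * orlicz_norm \<beta> ?I (\<lambda>r. sqrt (norm (?g r)))"
      proof (rule orlicz_norm_scale[OF \<beta> L])
        fix r assume r: "r \<in> ?I"
        have "norm (?g r) \<le> K * h powr (2 * \<mu>)" using \<Xi>[rule_format, of r "r + h"] r h by auto
        then have "sqrt (norm (?g r)) \<le> sqrt (K * h powr (2 * \<mu>))" by simp
        also have "\<dots> = sqrt K * h powr \<mu>"
        proof -
          have "h powr (2 * \<mu>) = (h powr \<mu>)\<^sup>2" by (simp add: power2_eq_square flip: powr_add)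
          then show ?thesis by (simp add: real_sqrt_mult)
        qed
        also have "\<dots> \<le> sqrt K * T powr \<mu>" using h K \<mu> by (intro mult_left_mono powr_mono2) auto
        finally have "sqrt (norm (?g r)) * sqrt (norm (?g r)) \<le> L * sqrt (norm (?g r))"
          by (intro mult_right_mono) (auto simp: L_def mult.commute)
        then show "norm (?g r) \<le> L * norm (sqrt (norm (?g r)))" by simp
      qed
      also have "\<dots> \<le> ennreal L * (ennreal C * epowr (modulus2 T (\<beta> / 2) \<Xi> \<tau>) (1 / 2))"
      proof (intro mult_left_mono)
        obtain w where w: "modulus2 T (\<beta> / 2) \<Xi> \<tau> = ennreal w" "0 \<le> w"
          using modulus2_finite[OF _ T c, of "\<beta> / 2" \<tau>] \<beta> by (cases "modulus2 T (\<beta> / 2) \<Xi> \<tau>") auto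
        \<comment> \<open>\<open>orlicz_norm_sqrt\<close> needs a number strictly above the norm, so
          w + e is inserted and e tends to 0.\<close>
        have "orlicz_norm \<beta> ?I (\<lambda>r. sqrt (norm (?g r))) \<le> ennreal (C * sqrt (w + 0))"
        proof (rule tendsto_lowerbound)
          show "((\<lambda>e. ennreal (C * sqrt (w + e))) \<longlongrightarrow> ennreal (C * sqrt (w + 0))) (at_right 0)"
            by (intro tendsto_intros)
          show "eventually (\<lambda>e. orlicz_norm \<beta> ?I (\<lambda>r. sqrt (norm (?g r))) \<le> ennreal (C * sqrt (w + e))) (at_right 0)"
            unfolding eventually_at_right_field
          proof (intro exI[of _ 1] conjI allI impI H)
            fix e :: real assume e: "0 < e"
            show "continuous_on ?I ?g" using continuous_on_diagonal[OF c, of 0 h "T - h"] h by simp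
            have "orlicz_norm (\<beta> / 2) ?I ?g \<le> ennreal w"
              using modulus2_upper[of h \<tau> "\<beta> / 2" T \<Xi>] h w by simp
            also have "\<dots> < ennreal (w + e)" using e w by (simp add: ennreal_less_iff)
            finally show "orlicz_norm (\<beta> / 2) ?I ?g < ennreal (w + e)" .
          qed (use w h in auto)
        qed simp
        then show "orlicz_norm \<beta> ?I (\<lambda>r. sqrt (norm (?g r))) \<le> ennreal C * epowr (modulus2 T (\<beta> / 2) \<Xi> \<tau>) (1 / 2)"
          using w C by (simp add: epowr_ennreal powr_half_sqrt flip: ennreal_mult)
      qed simp
      also have "\<dots> = ennreal (L * C) * epowr (modulus2 T (\<beta> / 2) \<Xi> \<tau>) (1 / 2)"
        using L C by (simp add: ennreal_mult mult.assoc)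
      finally show "orlicz_norm \<beta> ?I ?g \<le> ennreal (L * C) * epowr (modulus2 T (\<beta> / 2) \<Xi> \<tau>) (1 / 2)" .
    qed
    let ?w = "\<lambda>\<tau>. ennreal (\<tau> powr - (2 * a)) * modulus2 T (\<beta> / 2) \<Xi> \<tau>"
    have m: "?w \<in> borel_measurable borel" by (intro weighted_measurable mono_modulus2)
    have "besov2_norm T a \<beta> q \<Xi> \<le> log_norm T q (\<lambda>\<tau>. ennreal (L * C) * epowr (?w \<tau>) (1 / 2))"
      unfolding besov2_norm_def
    proof (intro log_norm_mono weighted_measurable mono_modulus2 q)
      fix \<tau> :: real assume \<tau>: "0 < \<tau>"
      have "ennreal (\<tau> powr - a) * modulus2 T \<beta> \<Xi> \<tau> \<le>
          ennreal (\<tau> powr - a) * (ennreal (L * C) * epowr (modulus2 T (\<beta> / 2) \<Xi> \<tau>) (1 / 2))"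
        by (intro mult_left_mono mod) simp
      also have "\<dots> = ennreal (L * C) * epowr (?w \<tau>) (1 / 2)"
        by (simp add: epowr_mult epowr_ennreal powr_powr mult_ac)
      finally show "ennreal (\<tau> powr - a) * modulus2 T \<beta> \<Xi> \<tau> \<le> ennreal (L * C) * epowr (?w \<tau>) (1 / 2)" .
    qed
    also have "\<dots> \<le> ennreal (L * C) * log_norm T q (\<lambda>\<tau>. epowr (?w \<tau>) (1 / 2))"
      using L C measurable_compose[OF m epowr_measurable] by (intro log_norm_cmult q) auto
    also have "\<dots> \<le> ennreal (L * C) * epowr (log_norm T (q / 2) ?w) (1 / 2)"
      by (intro mult_left_mono log_norm_sqrt m q) simp
    also have "\<dots> \<le> ennreal (L * C) * epowr (ennreal x) (1 / 2)"
      using le unfolding besov2_norm_def by (intro mult_left_mono epowr_mono) auto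
    also have "\<dots> = ennreal (T powr \<mu> * C * sqrt (K * x))"
      using L C x by (simp add: epowr_ennreal powr_half_sqrt L_def real_sqrt_mult mult_ac flip: ennreal_mult)
    finally show "besov2_norm T a \<beta> q \<Xi> \<le> ennreal (T powr \<mu> * C * sqrt (K * x))" .
  qed (use C T in simp)
qed

text \<open>\<open>log_norm_lower\<close> gives decay of the modulus at each scale, and averaging
  with p = k\<beta> makes it pointwise at the price of 1/p in the exponent. Increments of paths have
  M = 0; a genuine two-parameter function needs a defect of the matching order.\<close>

lemma besov2_embedding:
  assumes q: "0 < q" and \<beta>: "0 < \<beta>" and k: "1 \<le> real k * \<beta>" and a: "0 < a - 1 / (real k * \<beta>)"
  shows "\<exists>C>0. \<forall>T (A :: real \<Rightarrow> real \<Rightarrow> 'v::real_inner) x M. 0 < T \<longrightarrow> 0 \<le> x \<longrightarrow> 0 \<le> M \<longrightarrow>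
    continuous_on (simplex2 T) (\<lambda>(s, t). A s t) \<longrightarrow> besov2_norm T a \<beta> q A \<le> ennreal x \<longrightarrow>
    (\<forall>s u t. 0 \<le> s \<longrightarrow> s \<le> u \<longrightarrow> u \<le> t \<longrightarrow> t \<le> T \<longrightarrow>
      norm (incr2 A s u t) \<le> M * (t - s) powr (a - 1 / (real k * \<beta>))) \<longrightarrow>
    (\<forall>s t. 0 \<le> s \<longrightarrow> s \<le> t \<longrightarrow> t \<le> T \<longrightarrow> norm (A s t) \<le> C * (x + M) * (t - s) powr (a - 1 / (real k * \<beta>)))"
proof -
  define p where "p = real k * \<beta>"
  have p: "1 \<le> p" using k by (simp add: p_def)
  have "0 < 1 / (real k * \<beta>)" using k by simp
  then have a0: "0 < a" using a by linarith
  have "\<exists>c>0. \<forall>x\<ge>0. x powr (real k * \<beta>) \<le> c * orlicz_Phi \<beta> x"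
    by (rule powr_le_Phi[OF \<beta> k]) (intro exI conjI allI impI)
  then obtain c where c_pos: "0 < c" and c_all: "\<forall>x\<ge>0. x powr p \<le> c * orlicz_Phi \<beta> x"
    unfolding p_def by (elim exE conjE)
  note c = c_pos c_all[rule_format]
  obtain c' where c'_pos: "0 < c'" and c'_all: "\<forall>T w \<tau>. mono w \<longrightarrow> 0 < \<tau> \<longrightarrow> \<tau> \<le> T / 2 \<longrightarrow>
    w \<tau> \<le> ennreal (c' * \<tau> powr a) * log_norm T q (\<lambda>\<tau>. ennreal (\<tau> powr - a) * w \<tau>)"
    using log_norm_lower[OF q a0] by (elim exE conjE)
  note c' = c'_pos c'_all[rule_format]
  let ?e = "embedding_const (a - 1 / p)"
  have e: "0 < ?e" using a by (intro embedding_const_pos) (simp add: p_def)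
  define C where "C = ?e * (c' * (1 + c) + 1)"
  have C: "0 < C" using e c c' by (simp add: C_def add_pos_pos)
  have "norm (A s t) \<le> C * (x + M) * (t - s) powr (a - 1 / p)"
    if T: "0 < T" and x: "0 \<le> x" and M: "0 \<le> M" and cont: "continuous_on (simplex2 T) (\<lambda>(s, t). A s t)"
      and le: "besov2_norm T a \<beta> q A \<le> ennreal x"
      and defect: "\<And>s u t. 0 \<le> s \<Longrightarrow> s \<le> u \<Longrightarrow> u \<le> t \<Longrightarrow> t \<le> T \<Longrightarrow>
        norm (incr2 A s u t) \<le> M * (t - s) powr (a - 1 / p)"
      and st: "0 \<le> s" "s \<le> t" "t \<le> T" for T x M s t and A :: "real \<Rightarrow> real \<Rightarrow> 'v"
  proof -
    have "norm (A s t) \<le> ?e * (c' * x * (1 + c) + M) * (t - s) powr (a - 1 / p)"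
    proof (rule two_parameter_embedding[OF \<beta> p c cont _ M _ defect _ st])
      fix h assume h: "0 < h" "h \<le> T / 2"
      have "orlicz_norm \<beta> {0..T - h} (\<lambda>r. A r (r + h)) \<le> modulus2 T \<beta> A h"
        using h by (intro modulus2_upper) auto
      also have "\<dots> \<le> ennreal (c' * h powr a) * besov2_norm T a \<beta> q A"
        unfolding besov2_norm_def using h by (intro c'(2) mono_modulus2)
      also have "\<dots> \<le> ennreal (c' * h powr a) * ennreal x" by (intro mult_left_mono le) simp
      also have "\<dots> = ennreal (c' * x * h powr a)" using c' x by (simp add: mult_ac flip: ennreal_mult)
      finally show "orlicz_norm \<beta> {0..T - h} (\<lambda>r. A r (r + h)) \<le> ennreal (c' * x * h powr a)" .
    qed (use a c' x in \<open>auto simp: p_def\<close>)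
    also have "\<dots> \<le> C * (x + M) * (t - s) powr (a - 1 / p)"
    proof (intro mult_right_mono)
      have "c' * x * (1 + c) + M \<le> (c' * (1 + c) + 1) * (x + M)"
        using c c' x M by (simp add: distrib_left distrib_right mult_ac)
      then show "?e * (c' * x * (1 + c) + M) \<le> C * (x + M)"
        using e by (simp add: C_def mult.assoc)
    qed simp
    finally show ?thesis .
  qed
  then show ?thesis using C unfolding p_def by blast
qed

section \<open>Controlled rough paths\<close>

lemma incr2_incr: "incr2 (incr f) s u t = 0"
  by (simp add: incr2_def incr_def)

lemma powr_mult_le:
  fixes s u t :: real
  assumes "s \<le> u" "u \<le> t" "0 \<le> a"
  shows "(u - s) powr a * (t - u) powr a \<le> (t - s) powr (2 * a)"
proof -
  have "(u - s) powr a * (t - u) powr a \<le> (t - s) powr a * (t - s) powr a"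
    using assms by (intro mult_mono powr_mono2) auto
  also have "\<dots> = (t - s) powr (2 * a)" by (simp flip: powr_add)
  finally show ?thesis .
qed

lemma besov2_memI:
  assumes "continuous_on (simplex2 T) (\<lambda>(s, t). \<Xi> s t)"
    and "\<And>s t. 0 \<le> s \<Longrightarrow> s \<le> t \<Longrightarrow> t \<le> T \<Longrightarrow> \<Xi> s t \<in> V" "besov2_norm T a \<beta> q \<Xi> < \<infinity>"
  shows "\<Xi> \<in> besov2 T a \<beta> q V"
  using assms by (auto simp: besov2_def simplex2_def[of T] intro!: borel_measurable_continuous_on_restrict)

lemma besov2_combination_finite:
  fixes \<Xi> :: "real \<Rightarrow> real \<Rightarrow> 'v::real_normed_vector" and \<Xi>' :: "real \<Rightarrow> real \<Rightarrow> 'v"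
    and \<Theta> :: "real \<Rightarrow> real \<Rightarrow> 'w::real_normed_vector"
  assumes "0 < q" "0 < \<beta>" "0 \<le> c" "0 \<le> c'"
    and "continuous_on (simplex2 T) (\<lambda>(s, t). \<Xi> s t)" "continuous_on (simplex2 T) (\<lambda>(s, t). \<Xi>' s t)"
    and "besov2_norm T a \<beta> q \<Xi> < \<infinity>" "besov2_norm T a \<beta> q \<Xi>' < \<infinity>"
    and "\<And>s t. 0 \<le> s \<Longrightarrow> s \<le> t \<Longrightarrow> t \<le> T \<Longrightarrow> norm (\<Theta> s t) \<le> c * norm (\<Xi> s t) + c' * norm (\<Xi>' s t)"
  shows "besov2_norm T a \<beta> q \<Theta> < \<infinity>"
proof -
  let ?f = "\<lambda>s t. c * norm (\<Xi> s t)" and ?g = "\<lambda>s t. c' * norm (\<Xi>' s t)"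
  obtain C where H: "\<forall>T \<beta> a (\<Xi> :: real \<Rightarrow> real \<Rightarrow> real) \<Xi>'. 0 < \<beta> \<longrightarrow>
    continuous_on (simplex2 T) (\<lambda>(s, t). \<Xi> s t) \<longrightarrow> continuous_on (simplex2 T) (\<lambda>(s, t). \<Xi>' s t) \<longrightarrow>
    besov2_norm T a \<beta> q (\<lambda>s t. \<Xi> s t + \<Xi>' s t) \<le> ennreal C * (besov2_norm T a \<beta> q \<Xi> + besov2_norm T a \<beta> q \<Xi>')"
    using besov2_triangle[OF assms(1), where 'v = real] by (elim exE conjE)
  have "besov2_norm T a \<beta> q \<Theta> \<le> ennreal 1 * besov2_norm T a \<beta> q (\<lambda>s t. ?f s t + ?g s t)"
    using assms by (intro besov2_dominated) (auto intro: order.trans)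
  also have "\<dots> \<le> ennreal 1 * (ennreal C * (besov2_norm T a \<beta> q ?f + besov2_norm T a \<beta> q ?g))"
    using assms(5,6) by (intro mult_left_mono H[rule_format] assms) (auto simp: case_prod_unfold intro!: continuous_intros)
  also have "\<dots> \<le> ennreal 1 * (ennreal C * (ennreal c * besov2_norm T a \<beta> q \<Xi> + ennreal c' * besov2_norm T a \<beta> q \<Xi>'))"
    using assms by (intro mult_left_mono add_mono besov2_dominated) auto
  also have "\<dots> < \<infinity>"
    using assms(7,8) by (simp add: ennreal_mult_less_top)
  finally show ?thesis .
qed

text \<open>The finite extended norms are named by real numbers, which turns the estimates into real
  arithmetic. As a predicate the locale lets constants be chosen before all data, dimensions
  included.\<close>

locale rough_data =
  fixes \<alpha> \<beta> :: real and q :: ennreal and T :: real and m n :: nat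
    and X :: "real \<Rightarrow> nat fvec" and XX :: "real \<Rightarrow> real \<Rightarrow> (nat \<times> nat) fvec"
    and Y :: "real \<Rightarrow> (nat \<times> nat) fvec" and Y' :: "real \<Rightarrow> ((nat \<times> nat) \<times> nat) fvec"
    and x xx y y' r :: real
  assumes T: "0 < T" and nonneg: "0 \<le> x" "0 \<le> xx" "0 \<le> y" "0 \<le> y'" "0 \<le> r"
    and cX: "continuous_on {0..T} X" and cXX: "continuous_on (simplex2 T) (\<lambda>(s, t). XX s t)"
    and cY: "continuous_on {0..T} Y" and cY': "continuous_on {0..T} Y'"
    and chen: "\<And>s u t. 0 \<le> s \<Longrightarrow> s \<le> u \<Longrightarrow> u \<le> t \<Longrightarrow> t \<le> T \<Longrightarrow> incr2 XX s u t = outer (incr X s u) (incr X u t)"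
    and valY: "\<And>t. 0 \<le> t \<Longrightarrow> t \<le> T \<Longrightarrow> Y t \<in> euclid ({..<m} \<times> {..<n})"
    and valY': "\<And>t. 0 \<le> t \<Longrightarrow> t \<le> T \<Longrightarrow> Y' t \<in> euclid (({..<m} \<times> {..<n}) \<times> {..<n})"
    and nX: "besov_seminorm T \<alpha> \<beta> q X = ennreal x"
    and nXX: "besov2_norm T (2 * \<alpha>) (\<beta> / 2) (q / 2) XX = ennreal xx"
    and nY: "besov_seminorm T \<alpha> \<beta> q Y = ennreal y"
    and nY': "besov_seminorm T \<alpha> \<beta> q Y' = ennreal y'"
    and nR: "besov2_norm T (2 * \<alpha>) (\<beta> / 2) (q / 2) (remainder X Y Y') = ennreal r"
begin

abbreviation "\<Xi> \<equiv> germ X XX Y Y'"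
abbreviation "R \<equiv> remainder X Y Y'"

lemma cGerm: "continuous_on (simplex2 T) (\<lambda>(s, t). \<Xi> s t)"
  unfolding germ_def case_prod_unfold using cXX[unfolded case_prod_unfold]
  by (intro continuous_on_add app.continuous_on app2.continuous_on continuous_on_diff
      continuous_on_simplex_path cX cY cY')

lemma cR: "continuous_on (simplex2 T) (\<lambda>(s, t). R s t)"
  unfolding remainder_def incr_def case_prod_unfold
  by (intro continuous_on_diff app.continuous_on continuous_on_simplex_path cX cY cY')

lemma valGerm: "0 \<le> s \<Longrightarrow> s \<le> t \<Longrightarrow> t \<le> T \<Longrightarrow> \<Xi> s t \<in> euclid {..<m}"
  unfolding germ_def
  by (intro euclid_closed app_in_euclid[of _ _ "{..<n}"] app2_in_euclid[of _ _ "{..<n}" "{..<n}"] valY valY') auto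

text \<open>This product is the defect that \<open>second_order_embedding\<close> needs for the
  remainder; for XX the same role is played by Chen's relation.\<close>

lemma incr2_R: "incr2 R s u t = app (incr Y' s u) (incr X u t)"
proof -
  have "app (Y' s) (incr X s t) = app (Y' s) (incr X s u) + app (Y' s) (incr X u t)"
    by (simp add: incr_def app.add_right[symmetric])
  moreover have "app (incr Y' s u) (incr X u t) = app (Y' u) (incr X u t) - app (Y' s) (incr X u t)"
    by (simp add: incr_def app.diff_left)
  ultimately show ?thesis by (simp add: incr2_def remainder_def incr_def)
qed

text \<open>Chen's relation and \<open>app2_outer\<close> produce
  \<open>app (app (Y' s) (incr X s u)) (incr X u t)\<close>, which together with
  \<open>- app (incr Y s u) (incr X u t)\<close> forms the term with R.\<close>

lemma incr2_germ:
  assumes "0 \<le> s" "s \<le> u" "u \<le> t" "t \<le> T"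
  shows "incr2 \<Xi> s u t = - app (R s u) (incr X u t) - app2 (incr Y' s u) (XX u t)"
proof -
  have XX: "XX s t = XX s u + XX u t + outer (incr X s u) (incr X u t)"
    using chen[OF assms] by (simp add: incr2_def algebra_simps)
  have "X t - X s = incr X s u + incr X u t" by (simp add: incr_def)
  then show ?thesis
    unfolding incr2_def germ_def XX remainder_def
    by (simp add: incr_def[of X, symmetric] app.add_right app2.add_right app2_outer app.diff_left app2.diff_left incr_def[of Y] incr_def[of Y'])
qed

lemma defect_le:
  assumes "0 \<le> s" "s \<le> u" "u \<le> t" "t \<le> T"
  shows "norm (incr2 \<Xi> s u t) \<le> norm (R s u) * norm (incr X u t) + norm (incr Y' s u) * norm (XX u t)"
proof -
  have "norm (incr2 \<Xi> s u t) \<le> norm (app (R s u) (incr X u t)) + norm (app2 (incr Y' s u) (XX u t))"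
    unfolding incr2_germ[OF assms] using norm_triangle_ineq4[of "- app (R s u) (incr X u t)"] by simp
  then show ?thesis
    using norm_app_le[of "R s u" "incr X u t"] norm_app2_le[of "incr Y' s u" "XX u t"] by linarith
qed

end

section \<open>Estimates uniform in the data\<close>

text \<open>With p = k\<beta>, the last assumption says that \<eta> = \<alpha> - 1/p exceeds 1/3.
  The assumption p \<ge> 2 makes p/2 \<ge> 1 an admissible exponent for index \<beta>/2, and
  2\<alpha> - 1/(p/2) = 2\<eta>, so the exponents of first and second order match.\<close>

locale rough_setup =
  fixes \<alpha> \<beta> :: real and q :: ennreal and k :: nat
  assumes \<alpha>: "1 / 3 < \<alpha>" and \<beta>: "0 < \<beta>" and q: "0 < q"
    and k: "2 \<le> real k * \<beta>" and k\<alpha>: "1 < 3 * (\<alpha> - 1 / (real k * \<beta>))"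
begin

definition \<eta> :: real where "\<eta> = \<alpha> - 1 / (real k * \<beta>)"

lemma \<eta>: "1 / 3 < \<eta>" "1 < 3 * \<eta>" "0 < \<eta>"
  using k\<alpha> by (auto simp: \<eta>_def)

lemma q_pos: "0 < q / 2" "0 < q / 3"
  using q by (auto simp: ennreal_zero_less_divide)

lemma \<beta>_pos: "0 < \<beta> / 2" "0 < \<beta> / 3"
  using \<beta> by auto

lemma path_embedding:
  "\<exists>C>0. \<forall>T (f :: real \<Rightarrow> 'v::real_inner) x. 0 < T \<longrightarrow> 0 \<le> x \<longrightarrow> continuous_on {0..T} f \<longrightarrow>
    besov_seminorm T \<alpha> \<beta> q f = ennreal x \<longrightarrow>
    (\<forall>s t. 0 \<le> s \<longrightarrow> s \<le> t \<longrightarrow> t \<le> T \<longrightarrow> norm (incr f s t) \<le> C * x * (t - s) powr \<eta>)"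
proof -
  obtain C where C: "0 < C" and H: "\<forall>T (A :: real \<Rightarrow> real \<Rightarrow> 'v) x M. 0 < T \<longrightarrow> 0 \<le> x \<longrightarrow> 0 \<le> M \<longrightarrow>
    continuous_on (simplex2 T) (\<lambda>(s, t). A s t) \<longrightarrow> besov2_norm T \<alpha> \<beta> q A \<le> ennreal x \<longrightarrow>
    (\<forall>s u t. 0 \<le> s \<longrightarrow> s \<le> u \<longrightarrow> u \<le> t \<longrightarrow> t \<le> T \<longrightarrow>
      norm (incr2 A s u t) \<le> M * (t - s) powr (\<alpha> - 1 / (real k * \<beta>))) \<longrightarrow>
    (\<forall>s t. 0 \<le> s \<longrightarrow> s \<le> t \<longrightarrow> t \<le> T \<longrightarrow> norm (A s t) \<le> C * (x + M) * (t - s) powr (\<alpha> - 1 / (real k * \<beta>)))"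
    using besov2_embedding[OF q \<beta>, of k \<alpha>, where 'v = 'v] k \<eta> unfolding \<eta>_def by auto
  show ?thesis
  proof (intro exI[of _ C] conjI allI impI C)
    fix T x s t and f :: "real \<Rightarrow> 'v"
    assume *: "0 < T" "0 \<le> x" "continuous_on {0..T} f" "besov_seminorm T \<alpha> \<beta> q f = ennreal x"
      and st: "0 \<le> s" "s \<le> t" "t \<le> T"
    have "norm (incr f s t) \<le> C * (x + 0) * (t - s) powr (\<alpha> - 1 / (real k * \<beta>))"
      using * st by (intro H[rule_format, of T]) (auto simp: continuous_on_incr incr2_incr besov_seminorm_def)
    then show "norm (incr f s t) \<le> C * x * (t - s) powr \<eta>" by (simp add: \<eta>_def)
  qed
qed

lemma second_order_embedding:
  "\<exists>C>0. \<forall>T (A :: real \<Rightarrow> real \<Rightarrow> 'v::real_inner) x M. 0 < T \<longrightarrow> 0 \<le> x \<longrightarrow> 0 \<le> M \<longrightarrow>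
    continuous_on (simplex2 T) (\<lambda>(s, t). A s t) \<longrightarrow> besov2_norm T (2 * \<alpha>) (\<beta> / 2) (q / 2) A = ennreal x \<longrightarrow>
    (\<forall>s u t. 0 \<le> s \<longrightarrow> s \<le> u \<longrightarrow> u \<le> t \<longrightarrow> t \<le> T \<longrightarrow>
      norm (incr2 A s u t) \<le> M * (t - s) powr (2 * \<eta>)) \<longrightarrow>
    (\<forall>s t. 0 \<le> s \<longrightarrow> s \<le> t \<longrightarrow> t \<le> T \<longrightarrow> norm (A s t) \<le> C * (x + M) * (t - s) powr (2 * \<eta>))"
proof -
  have e: "2 * \<alpha> - 1 / (real k * (\<beta> / 2)) = 2 * \<eta>"
    using k by (simp add: \<eta>_def field_simps)
  have "1 \<le> real k * (\<beta> / 2)" "0 < 2 * \<alpha> - 1 / (real k * (\<beta> / 2))"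
    using k \<eta> unfolding e by auto
  from besov2_embedding[OF q_pos(1) \<beta>_pos(1) this, where 'v = 'v]
  obtain C where C: "0 < C" and H: "\<forall>T (A :: real \<Rightarrow> real \<Rightarrow> 'v) x M. 0 < T \<longrightarrow> 0 \<le> x \<longrightarrow> 0 \<le> M \<longrightarrow>
    continuous_on (simplex2 T) (\<lambda>(s, t). A s t) \<longrightarrow> besov2_norm T (2 * \<alpha>) (\<beta> / 2) (q / 2) A \<le> ennreal x \<longrightarrow>
    (\<forall>s u t. 0 \<le> s \<longrightarrow> s \<le> u \<longrightarrow> u \<le> t \<longrightarrow> t \<le> T \<longrightarrow>
      norm (incr2 A s u t) \<le> M * (t - s) powr (2 * \<eta>)) \<longrightarrow>
    (\<forall>s t. 0 \<le> s \<longrightarrow> s \<le> t \<longrightarrow> t \<le> T \<longrightarrow> norm (A s t) \<le> C * (x + M) * (t - s) powr (2 * \<eta>))"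
    unfolding e by (elim exE conjE)
  show ?thesis
  proof (intro exI[of _ C] conjI allI impI C)
    fix T x M s t and A :: "real \<Rightarrow> real \<Rightarrow> 'v"
    assume *: "0 < T" "0 \<le> x" "0 \<le> M" "continuous_on (simplex2 T) (\<lambda>(s, t). A s t)"
      "besov2_norm T (2 * \<alpha>) (\<beta> / 2) (q / 2) A = ennreal x"
      "\<forall>s u t. 0 \<le> s \<longrightarrow> s \<le> u \<longrightarrow> u \<le> t \<longrightarrow> t \<le> T \<longrightarrow> norm (incr2 A s u t) \<le> M * (t - s) powr (2 * \<eta>)"
      and st: "0 \<le> s" "s \<le> t" "t \<le> T"
    show "norm (A s t) \<le> C * (x + M) * (t - s) powr (2 * \<eta>)"
      by (rule H[rule_format, of T]) (use * st in auto)
  qed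
qed

text \<open>XX and the remainder are not additive: their defects are products of first-order
  increments, hence the summands x^2 and y' x next to their own norms.\<close>

lemma pointwise_bounds:
  "\<exists>C>0. \<forall>T m n X XX Y Y' x xx y y' r. rough_data \<alpha> \<beta> q T m n X XX Y Y' x xx y y' r \<longrightarrow>
    (\<forall>s t. 0 \<le> s \<longrightarrow> s \<le> t \<longrightarrow> t \<le> T \<longrightarrow>
      norm (incr X s t) \<le> C * x * (t - s) powr \<eta> \<and>
      norm (XX s t) \<le> C * (x\<^sup>2 + xx) * (t - s) powr (2 * \<eta>) \<and>
      norm (incr Y s t) \<le> C * y * (t - s) powr \<eta> \<and>
      norm (incr Y' s t) \<le> C * y' * (t - s) powr \<eta> \<and>
      norm (remainder X Y Y' s t) \<le> C * (r + y' * x) * (t - s) powr (2 * \<eta>))"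
proof -
  \<comment> \<open>The embedding constants are existential for each value type, so there is one
    instance per type; C dominates them all.\<close>
  obtain Ca where Ca: "0 < Ca" and Ha: "\<forall>T (f :: real \<Rightarrow> nat fvec) x. 0 < T \<longrightarrow> 0 \<le> x \<longrightarrow> continuous_on {0..T} f \<longrightarrow>
    besov_seminorm T \<alpha> \<beta> q f = ennreal x \<longrightarrow>
    (\<forall>s t. 0 \<le> s \<longrightarrow> s \<le> t \<longrightarrow> t \<le> T \<longrightarrow> norm (incr f s t) \<le> Ca * x * (t - s) powr \<eta>)"
    using path_embedding[where 'v = "nat fvec"] by (elim exE conjE)
  obtain Cb where Cb: "0 < Cb" and Hb: "\<forall>T (f :: real \<Rightarrow> (nat \<times> nat) fvec) x. 0 < T \<longrightarrow> 0 \<le> x \<longrightarrow> continuous_on {0..T} f \<longrightarrow>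
    besov_seminorm T \<alpha> \<beta> q f = ennreal x \<longrightarrow>
    (\<forall>s t. 0 \<le> s \<longrightarrow> s \<le> t \<longrightarrow> t \<le> T \<longrightarrow> norm (incr f s t) \<le> Cb * x * (t - s) powr \<eta>)"
    using path_embedding[where 'v = "(nat \<times> nat) fvec"] by (elim exE conjE)
  obtain Cc where Cc: "0 < Cc" and Hc: "\<forall>T (f :: real \<Rightarrow> ((nat \<times> nat) \<times> nat) fvec) x. 0 < T \<longrightarrow> 0 \<le> x \<longrightarrow> continuous_on {0..T} f \<longrightarrow>
    besov_seminorm T \<alpha> \<beta> q f = ennreal x \<longrightarrow>
    (\<forall>s t. 0 \<le> s \<longrightarrow> s \<le> t \<longrightarrow> t \<le> T \<longrightarrow> norm (incr f s t) \<le> Cc * x * (t - s) powr \<eta>)"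
    using path_embedding[where 'v = "((nat \<times> nat) \<times> nat) fvec"] by (elim exE conjE)
  obtain Cd where Cd: "0 < Cd" and Hd: "\<forall>T (A :: real \<Rightarrow> real \<Rightarrow> (nat \<times> nat) fvec) x M. 0 < T \<longrightarrow> 0 \<le> x \<longrightarrow> 0 \<le> M \<longrightarrow>
    continuous_on (simplex2 T) (\<lambda>(s, t). A s t) \<longrightarrow> besov2_norm T (2 * \<alpha>) (\<beta> / 2) (q / 2) A = ennreal x \<longrightarrow>
    (\<forall>s u t. 0 \<le> s \<longrightarrow> s \<le> u \<longrightarrow> u \<le> t \<longrightarrow> t \<le> T \<longrightarrow>
      norm (incr2 A s u t) \<le> M * (t - s) powr (2 * \<eta>)) \<longrightarrow>
    (\<forall>s t. 0 \<le> s \<longrightarrow> s \<le> t \<longrightarrow> t \<le> T \<longrightarrow> norm (A s t) \<le> Cd * (x + M) * (t - s) powr (2 * \<eta>))"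
    using second_order_embedding[where 'v = "(nat \<times> nat) fvec"] by (elim exE conjE)
  define C where "C = Ca + Cb + Cc + Cd * (1 + Ca\<^sup>2 + Cc * Ca)"
  have CdC: "Cd \<le> Cd * (1 + Ca\<^sup>2 + Cc * Ca)" "0 < Cd * (1 + Ca\<^sup>2 + Cc * Ca)"
    using Ca Cb Cc Cd by (auto simp: add_pos_nonneg)
  have CC: "Ca \<le> C" "Cb \<le> C" "Cc \<le> C" "Cd * (1 + Ca\<^sup>2 + Cc * Ca) \<le> C" "0 < C"
    using Ca Cb Cc CdC(2) unfolding C_def by linarith+
  show ?thesis
  proof (intro exI[of _ C] conjI allI impI CC(5))
    fix T m n X XX Y Y' x xx y y' r s t
    assume data: "rough_data \<alpha> \<beta> q T m n X XX Y Y' x xx y y' r" and st: "0 \<le> s" "s \<le> t" "t \<le> T"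
    interpret rough_data \<alpha> \<beta> q T m n X XX Y Y' x xx y y' r by (rule data)
    have bX: "norm (incr X s t) \<le> Ca * x * (t - s) powr \<eta>" if "0 \<le> s" "s \<le> t" "t \<le> T" for s t
      by (rule Ha[rule_format, of T]) (use T cX nX nonneg that in auto)
    have bY': "norm (incr Y' s t) \<le> Cc * y' * (t - s) powr \<eta>" if "0 \<le> s" "s \<le> t" "t \<le> T" for s t
      by (rule Hc[rule_format, of T]) (use T cY' nY' nonneg that in auto)
    have bY: "norm (incr Y s t) \<le> Cb * y * (t - s) powr \<eta>"
      by (rule Hb[rule_format, of T]) (use T cY nY nonneg st in auto)
    have "norm (XX s t) \<le> Cd * (xx + (Ca * x) * (Ca * x)) * (t - s) powr (2 * \<eta>)"
    proof (rule Hd[rule_format, of T])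
      fix s u t assume sut: "0 \<le> s" "s \<le> u" "u \<le> t" "t \<le> T"
      have "norm (incr2 XX s u t) \<le> norm (incr X s u) * norm (incr X u t)"
        unfolding chen[OF sut] by (rule norm_outer_le)
      also have "\<dots> \<le> (Ca * x * (u - s) powr \<eta>) * (Ca * x * (t - u) powr \<eta>)"
        using sut Ca nonneg by (intro mult_mono bX) auto
      also have "\<dots> = (Ca * x) * (Ca * x) * ((u - s) powr \<eta> * (t - u) powr \<eta>)" by simp
      also have "\<dots> \<le> (Ca * x) * (Ca * x) * (t - s) powr (2 * \<eta>)"
        using sut \<eta> Ca nonneg by (intro mult_left_mono powr_mult_le) auto
      finally show "norm (incr2 XX s u t) \<le> (Ca * x) * (Ca * x) * (t - s) powr (2 * \<eta>)" .
    qed (use T Ca cXX nXX nonneg st in auto)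
    also have "\<dots> \<le> (Cd * (1 + Ca\<^sup>2 + Cc * Ca)) * (x\<^sup>2 + xx) * (t - s) powr (2 * \<eta>)"
    proof (rule mult_right_mono)
      have "xx + (Ca * x) * (Ca * x) \<le> (1 + Ca\<^sup>2 + Cc * Ca) * (x\<^sup>2 + xx)"
        using Ca Cc nonneg by (simp add: algebra_simps power2_eq_square)
      then show "Cd * (xx + (Ca * x) * (Ca * x)) \<le> (Cd * (1 + Ca\<^sup>2 + Cc * Ca)) * (x\<^sup>2 + xx)"
        using Cd by (simp add: mult.assoc)
    qed simp
    also have "\<dots> \<le> C * (x\<^sup>2 + xx) * (t - s) powr (2 * \<eta>)"
      using CC nonneg by (intro mult_right_mono) auto
    finally show "norm (XX s t) \<le> C * (x\<^sup>2 + xx) * (t - s) powr (2 * \<eta>)" .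
    have "norm (remainder X Y Y' s t) \<le> Cd * (r + (Cc * y') * (Ca * x)) * (t - s) powr (2 * \<eta>)"
    proof (rule Hd[rule_format, of T])
      fix s u t assume sut: "0 \<le> s" "s \<le> u" "u \<le> t" "t \<le> T"
      have "norm (incr2 R s u t) \<le> norm (incr Y' s u) * norm (incr X u t)"
        unfolding incr2_R by (rule norm_app_le)
      also have "\<dots> \<le> (Cc * y' * (u - s) powr \<eta>) * (Ca * x * (t - u) powr \<eta>)"
        using sut Ca Cc nonneg by (intro mult_mono bX bY') auto
      also have "\<dots> = (Cc * y') * (Ca * x) * ((u - s) powr \<eta> * (t - u) powr \<eta>)" by simp
      also have "\<dots> \<le> (Cc * y') * (Ca * x) * (t - s) powr (2 * \<eta>)"
        using sut \<eta> Ca Cc nonneg by (intro mult_left_mono powr_mult_le) auto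
      finally show "norm (incr2 R s u t) \<le> (Cc * y') * (Ca * x) * (t - s) powr (2 * \<eta>)" .
    qed (use T Ca Cc cR nR nonneg st in auto)
    also have "\<dots> \<le> (Cd * (1 + Ca\<^sup>2 + Cc * Ca)) * (r + y' * x) * (t - s) powr (2 * \<eta>)"
    proof (rule mult_right_mono)
      have "0 \<le> Ca\<^sup>2 * r" "0 \<le> Ca\<^sup>2 * (y' * x)" "0 \<le> Cc * Ca * r" "0 \<le> y' * x"
        using Ca Cc nonneg by auto
      then have "r + (Cc * y') * (Ca * x) \<le> (1 + Ca\<^sup>2 + Cc * Ca) * (r + y' * x)"
        by (simp add: algebra_simps)
      then show "Cd * (r + (Cc * y') * (Ca * x)) \<le> (Cd * (1 + Ca\<^sup>2 + Cc * Ca)) * (r + y' * x)"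
        using Cd by (simp add: mult.assoc)
    qed simp
    also have "\<dots> \<le> C * (r + y' * x) * (t - s) powr (2 * \<eta>)"
      using CC nonneg by (intro mult_right_mono) auto
    finally show "norm (remainder X Y Y' s t) \<le> C * (r + y' * x) * (t - s) powr (2 * \<eta>)" .
    have mono: "c * z * (t - s) powr \<eta> \<le> C * z * (t - s) powr \<eta>" if "c \<le> C" "0 \<le> z" for c z
      using that by (intro mult_right_mono) auto
    show "norm (incr X s t) \<le> C * x * (t - s) powr \<eta>" "norm (incr Y s t) \<le> C * y * (t - s) powr \<eta>"
      "norm (incr Y' s t) \<le> C * y' * (t - s) powr \<eta>"
      using bX[OF st] bY bY'[OF st] mono[OF CC(1) nonneg(1)] mono[OF CC(2) nonneg(3)] mono[OF CC(3) nonneg(4)]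
      by linarith+
  qed
qed

text \<open>In the first scale both factors of each product are measured in their own norms. In the
  second the first-order factors \<delta>X and \<delta>Y' are bounded pointwise. In the third the
  second-order factors are, which brings in their extra summands y' x and x^2. No constant depends
  on T.\<close>

lemma defect_norms:
  "\<exists>C>0. \<forall>T m n X XX Y Y' x xx y y' r. rough_data \<alpha> \<beta> q T m n X XX Y Y' x xx y y' r \<longrightarrow>
    besov3_norm T (3 * \<alpha>) (\<beta> / 3) (q / 3) (incr2 (germ X XX Y Y')) \<le> ennreal (C * (r * x + y' * xx)) \<and>
    besov3_norm T (2 * \<alpha> + \<eta>) (\<beta> / 2) (q / 2) (incr2 (germ X XX Y Y')) \<le> ennreal (C * (r * x + y' * xx)) \<and>
    besov3_norm T (\<alpha> + 2 * \<eta>) \<beta> q (incr2 (germ X XX Y Y')) \<le> ennreal (C * ((r + y' * x) * x + (x\<^sup>2 + xx) * y'))"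
proof -
  obtain C0 where C0: "0 < C0" and H0: "\<forall>T m n X XX Y Y' x xx y y' r. rough_data \<alpha> \<beta> q T m n X XX Y Y' x xx y y' r \<longrightarrow>
    (\<forall>s t. 0 \<le> s \<longrightarrow> s \<le> t \<longrightarrow> t \<le> T \<longrightarrow>
      norm (incr X s t) \<le> C0 * x * (t - s) powr \<eta> \<and>
      norm (XX s t) \<le> C0 * (x\<^sup>2 + xx) * (t - s) powr (2 * \<eta>) \<and>
      norm (incr Y s t) \<le> C0 * y * (t - s) powr \<eta> \<and>
      norm (incr Y' s t) \<le> C0 * y' * (t - s) powr \<eta> \<and>
      norm (remainder X Y Y' s t) \<le> C0 * (r + y' * x) * (t - s) powr (2 * \<eta>))"
    using pointwise_bounds by (elim exE conjE)
  have a0: "0 < \<alpha>" using \<alpha> by simp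
  obtain C1 where C1: "0 < C1" and H1: "\<forall>T (E :: real \<Rightarrow> real \<Rightarrow> real \<Rightarrow> nat fvec)
      (f :: real \<Rightarrow> real \<Rightarrow> real) (g :: real \<Rightarrow> real \<Rightarrow> real)
      (f' :: real \<Rightarrow> real \<Rightarrow> real) (g' :: real \<Rightarrow> real \<Rightarrow> real). 0 < T \<longrightarrow>
    continuous_on (simplex2 T) (\<lambda>(s, t). f s t) \<longrightarrow> continuous_on (simplex2 T) (\<lambda>(s, t). g s t) \<longrightarrow>
    continuous_on (simplex2 T) (\<lambda>(s, t). f' s t) \<longrightarrow> continuous_on (simplex2 T) (\<lambda>(s, t). g' s t) \<longrightarrow>
    besov2_norm T (2 * \<alpha>) (\<beta> / 2) (q / 2) f < \<infinity> \<longrightarrow> besov2_norm T \<alpha> \<beta> q g < \<infinity> \<longrightarrow>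
    besov2_norm T (2 * \<alpha>) (\<beta> / 2) (q / 2) f' < \<infinity> \<longrightarrow> besov2_norm T \<alpha> \<beta> q g' < \<infinity> \<longrightarrow>
    (\<forall>s u t. 0 \<le> s \<longrightarrow> s \<le> u \<longrightarrow> u \<le> t \<longrightarrow> t \<le> T \<longrightarrow>
      norm (E s u t) \<le> \<bar>f s u\<bar> * \<bar>g u t\<bar> + \<bar>g' s u\<bar> * \<bar>f' u t\<bar>) \<longrightarrow>
    besov3_norm T (3 * \<alpha>) (\<beta> / 3) (q / 3) E \<le> ennreal C1 *
      (besov2_norm T (2 * \<alpha>) (\<beta> / 2) (q / 2) f * besov2_norm T \<alpha> \<beta> q g +
       besov2_norm T (2 * \<alpha>) (\<beta> / 2) (q / 2) f' * besov2_norm T \<alpha> \<beta> q g')"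
    using besov3_Hoelder[OF a0 \<beta> q, where 'v = "nat fvec"] by (elim exE conjE)
  obtain C2 where C2: "0 < C2" and H2: "\<forall>T \<beta> \<mu> a c1 c2 (E :: real \<Rightarrow> real \<Rightarrow> real \<Rightarrow> nat fvec)
      (f :: real \<Rightarrow> real \<Rightarrow> real) (g :: real \<Rightarrow> real \<Rightarrow> real). 0 < T \<longrightarrow> 0 < \<beta> \<longrightarrow> 0 \<le> \<mu> \<longrightarrow> 0 \<le> c1 \<longrightarrow> 0 \<le> c2 \<longrightarrow>
    continuous_on (simplex2 T) (\<lambda>(s, t). f s t) \<longrightarrow> continuous_on (simplex2 T) (\<lambda>(s, t). g s t) \<longrightarrow>
    (\<forall>s u t. 0 \<le> s \<longrightarrow> s \<le> u \<longrightarrow> u \<le> t \<longrightarrow> t \<le> T \<longrightarrow>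
      norm (E s u t) \<le> (t - s) powr \<mu> * (c1 * \<bar>f s u\<bar> + c2 * \<bar>g u t\<bar>)) \<longrightarrow>
    besov3_norm T (a + \<mu>) \<beta> (q / 2) E \<le> ennreal C2 *
      (ennreal c1 * besov2_norm T a \<beta> (q / 2) f + ennreal c2 * besov2_norm T a \<beta> (q / 2) g)"
    using besov3_weighted[OF q_pos(1), where 'v = "nat fvec"] by (elim exE conjE)
  obtain C3 where C3: "0 < C3" and H3: "\<forall>T \<beta> \<mu> a c1 c2 (E :: real \<Rightarrow> real \<Rightarrow> real \<Rightarrow> nat fvec)
      (f :: real \<Rightarrow> real \<Rightarrow> real) (g :: real \<Rightarrow> real \<Rightarrow> real). 0 < T \<longrightarrow> 0 < \<beta> \<longrightarrow> 0 \<le> \<mu> \<longrightarrow> 0 \<le> c1 \<longrightarrow> 0 \<le> c2 \<longrightarrow>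
    continuous_on (simplex2 T) (\<lambda>(s, t). f s t) \<longrightarrow> continuous_on (simplex2 T) (\<lambda>(s, t). g s t) \<longrightarrow>
    (\<forall>s u t. 0 \<le> s \<longrightarrow> s \<le> u \<longrightarrow> u \<le> t \<longrightarrow> t \<le> T \<longrightarrow>
      norm (E s u t) \<le> (t - s) powr \<mu> * (c1 * \<bar>f s u\<bar> + c2 * \<bar>g u t\<bar>)) \<longrightarrow>
    besov3_norm T (a + \<mu>) \<beta> q E \<le> ennreal C3 *
      (ennreal c1 * besov2_norm T a \<beta> q f + ennreal c2 * besov2_norm T a \<beta> q g)"
    using besov3_weighted[OF q, where 'v = "nat fvec"] by (elim exE conjE)
  define C where "C = C1 + C2 * C0 + C3 * C0"
  have CC: "C1 \<le> C" "C2 * C0 \<le> C" "C3 * C0 \<le> C" "0 < C"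
    using C0 C1 C2 C3 by (auto simp: C_def add_pos_pos)
  show ?thesis
  proof (intro exI[of _ C] conjI allI impI CC(4))
    fix T m n X XX Y Y' x xx y y' r
    assume data: "rough_data \<alpha> \<beta> q T m n X XX Y Y' x xx y y' r"
    interpret rough_data \<alpha> \<beta> q T m n X XX Y Y' x xx y y' r by (rule data)
    note pw = H0[rule_format, OF data]
    let ?R = "\<lambda>s t. norm (R s t)" and ?X = "\<lambda>s t. norm (incr X s t)"
      and ?XX = "\<lambda>s t. norm (XX s t)" and ?Y = "\<lambda>s t. norm (incr Y' s t)"
    have c: "continuous_on (simplex2 T) (\<lambda>(s, t). ?R s t)" "continuous_on (simplex2 T) (\<lambda>(s, t). ?X s t)"
      "continuous_on (simplex2 T) (\<lambda>(s, t). ?XX s t)" "continuous_on (simplex2 T) (\<lambda>(s, t). ?Y s t)"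
      using continuous_on_norm[OF cR] continuous_on_norm[OF continuous_on_incr[OF cX]]
        continuous_on_norm[OF cXX] continuous_on_norm[OF continuous_on_incr[OF cY']]
      by (simp_all add: case_prod_unfold)
    have n: "besov2_norm T (2 * \<alpha>) (\<beta> / 2) (q / 2) ?R = ennreal r" "besov2_norm T \<alpha> \<beta> q ?X = ennreal x"
      "besov2_norm T (2 * \<alpha>) (\<beta> / 2) (q / 2) ?XX = ennreal xx" "besov2_norm T \<alpha> \<beta> q ?Y = ennreal y'"
      using nR nX nXX nY' by (simp_all add: besov2_norm_norm besov_seminorm_def)
    have "besov3_norm T (3 * \<alpha>) (\<beta> / 3) (q / 3) (incr2 \<Xi>) \<le> ennreal C1 * (ennreal r * ennreal x + ennreal xx * ennreal y')"
      unfolding n[symmetric]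
      by (rule H1[rule_format, OF T c]) (use defect_le n in auto)
    also have "\<dots> = ennreal (C1 * (r * x + y' * xx))"
      using C1 nonneg by (simp add: mult.commute flip: ennreal_mult ennreal_plus)
    also have "\<dots> \<le> ennreal (C * (r * x + y' * xx))"
      using CC nonneg by (intro ennreal_leI mult_right_mono) auto
    finally show "besov3_norm T (3 * \<alpha>) (\<beta> / 3) (q / 3) (incr2 \<Xi>) \<le> ennreal (C * (r * x + y' * xx))" .
    have "besov3_norm T (2 * \<alpha> + \<eta>) (\<beta> / 2) (q / 2) (incr2 \<Xi>) \<le>
        ennreal C2 * (ennreal (C0 * x) * ennreal r + ennreal (C0 * y') * ennreal xx)"
      unfolding n[symmetric]
    proof (rule H2[rule_format, OF T \<beta>_pos(1) _ _ _ c(1,3)])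
      fix s u t assume sut: "0 \<le> s" "s \<le> u" "u \<le> t" "t \<le> T"
      have "norm (incr X u t) \<le> C0 * x * (t - u) powr \<eta>" using pw[of u t] sut by auto
      also have "\<dots> \<le> C0 * x * (t - s) powr \<eta>"
        using sut \<eta> C0 nonneg by (intro mult_left_mono powr_mono2) auto
      finally have 1: "norm (incr X u t) \<le> C0 * x * (t - s) powr \<eta>" .
      have "norm (incr Y' s u) \<le> C0 * y' * (u - s) powr \<eta>" using pw[of s u] sut by auto
      also have "\<dots> \<le> C0 * y' * (t - s) powr \<eta>"
        using sut \<eta> C0 nonneg by (intro mult_left_mono powr_mono2) auto
      finally have 2: "norm (incr Y' s u) \<le> C0 * y' * (t - s) powr \<eta>" .
      have "norm (incr2 \<Xi> s u t) \<le> norm (R s u) * norm (incr X u t) + norm (incr Y' s u) * norm (XX u t)"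
        by (rule defect_le[OF sut])
      also have "\<dots> \<le> norm (R s u) * (C0 * x * (t - s) powr \<eta>) + (C0 * y' * (t - s) powr \<eta>) * norm (XX u t)"
        by (intro add_mono mult_left_mono mult_right_mono 1 2) auto
      also have "\<dots> = (t - s) powr \<eta> * (C0 * x * \<bar>?R s u\<bar> + C0 * y' * \<bar>?XX u t\<bar>)"
        by (simp add: algebra_simps)
      finally show "norm (incr2 \<Xi> s u t) \<le> (t - s) powr \<eta> * (C0 * x * \<bar>?R s u\<bar> + C0 * y' * \<bar>?XX u t\<bar>)" .
    qed (use \<eta> C0 nonneg in auto)
    also have "\<dots> = ennreal (C2 * C0 * (r * x + y' * xx))"
      using C0 C2 nonneg by (simp add: algebra_simps flip: ennreal_mult ennreal_plus)
    also have "\<dots> \<le> ennreal (C * (r * x + y' * xx))"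
      using CC nonneg by (intro ennreal_leI mult_right_mono) auto
    finally show "besov3_norm T (2 * \<alpha> + \<eta>) (\<beta> / 2) (q / 2) (incr2 \<Xi>) \<le> ennreal (C * (r * x + y' * xx))" .
    have "besov3_norm T (\<alpha> + 2 * \<eta>) \<beta> q (incr2 \<Xi>) \<le>
        ennreal C3 * (ennreal (C0 * (x\<^sup>2 + xx)) * ennreal y' + ennreal (C0 * (r + y' * x)) * ennreal x)"
      unfolding n[symmetric]
    proof (rule H3[rule_format, OF T \<beta> _ _ _ c(4,2)])
      fix s u t assume sut: "0 \<le> s" "s \<le> u" "u \<le> t" "t \<le> T"
      have "norm (XX u t) \<le> C0 * (x\<^sup>2 + xx) * (t - u) powr (2 * \<eta>)" using pw[of u t] sut by auto
      also have "\<dots> \<le> C0 * (x\<^sup>2 + xx) * (t - s) powr (2 * \<eta>)"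
        using sut \<eta> C0 nonneg by (intro mult_left_mono powr_mono2) auto
      finally have 1: "norm (XX u t) \<le> C0 * (x\<^sup>2 + xx) * (t - s) powr (2 * \<eta>)" .
      have "norm (R s u) \<le> C0 * (r + y' * x) * (u - s) powr (2 * \<eta>)" using pw[of s u] sut by auto
      also have "\<dots> \<le> C0 * (r + y' * x) * (t - s) powr (2 * \<eta>)"
        using sut \<eta> C0 nonneg by (intro mult_left_mono powr_mono2) auto
      finally have 2: "norm (R s u) \<le> C0 * (r + y' * x) * (t - s) powr (2 * \<eta>)" .
      have "norm (incr2 \<Xi> s u t) \<le> norm (R s u) * norm (incr X u t) + norm (incr Y' s u) * norm (XX u t)"
        by (rule defect_le[OF sut])
      also have "\<dots> \<le> (C0 * (r + y' * x) * (t - s) powr (2 * \<eta>)) * norm (incr X u t) +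
          norm (incr Y' s u) * (C0 * (x\<^sup>2 + xx) * (t - s) powr (2 * \<eta>))"
        by (intro add_mono mult_left_mono mult_right_mono 1 2) auto
      also have "\<dots> = (t - s) powr (2 * \<eta>) * (C0 * (x\<^sup>2 + xx) * \<bar>?Y s u\<bar> + C0 * (r + y' * x) * \<bar>?X u t\<bar>)"
        by (simp add: algebra_simps)
      finally show "norm (incr2 \<Xi> s u t) \<le> (t - s) powr (2 * \<eta>) * (C0 * (x\<^sup>2 + xx) * \<bar>?Y s u\<bar> + C0 * (r + y' * x) * \<bar>?X u t\<bar>)" .
    qed (use \<eta> C0 nonneg in auto)
    also have "\<dots> = ennreal (C3 * C0 * ((r + y' * x) * x + (x\<^sup>2 + xx) * y'))"
      using C0 C3 nonneg by (simp add: algebra_simps flip: ennreal_mult ennreal_plus)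
    also have "\<dots> \<le> ennreal (C * ((r + y' * x) * x + (x\<^sup>2 + xx) * y'))"
      using CC nonneg by (intro ennreal_leI mult_right_mono) auto
    finally show "besov3_norm T (\<alpha> + 2 * \<eta>) \<beta> q (incr2 \<Xi>) \<le> ennreal (C * ((r + y' * x) * x + (x\<^sup>2 + xx) * y'))" .
  qed
qed

text \<open>A qualitative notion: K is existential because its value enters no estimate. Its
  exponent depends on k through \<eta>, unlike the condition in \<open>is_sewing\<close>.\<close>

definition sewn :: "real \<Rightarrow> (real \<Rightarrow> real \<Rightarrow> nat fvec) \<Rightarrow> (real \<Rightarrow> nat fvec) \<Rightarrow> bool"
  where "sewn T \<Xi> I \<longleftrightarrow> continuous_on {0..T} I \<and>
    (\<exists>K\<ge>0. \<forall>s t. 0 \<le> s \<longrightarrow> s \<le> t \<longrightarrow> t \<le> T \<longrightarrow> norm (I t - I s - \<Xi> s t) \<le> K * (t - s) powr (3 * \<eta>))"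

lemma sewn_exists:
  assumes data: "rough_data \<alpha> \<beta> q T m n X XX Y Y' x xx y y' r"
  shows "\<exists>I. sewn T (germ X XX Y Y') I \<and> I \<in> {0..T} \<rightarrow>\<^sub>E euclid {..<m} \<and> I 0 = 0"
proof -
  interpret rough_data \<alpha> \<beta> q T m n X XX Y Y' x xx y y' r by (rule data)
  obtain C0 where C0: "0 < C0" and pw: "\<forall>s t. 0 \<le> s \<longrightarrow> s \<le> t \<longrightarrow> t \<le> T \<longrightarrow>
      norm (incr X s t) \<le> C0 * x * (t - s) powr \<eta> \<and>
      norm (XX s t) \<le> C0 * (x\<^sup>2 + xx) * (t - s) powr (2 * \<eta>) \<and>
      norm (incr Y s t) \<le> C0 * y * (t - s) powr \<eta> \<and>
      norm (incr Y' s t) \<le> C0 * y' * (t - s) powr \<eta> \<and>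
      norm (remainder X Y Y' s t) \<le> C0 * (r + y' * x) * (t - s) powr (2 * \<eta>)"
    using pointwise_bounds data by meson
  define M where "M = (C0 * (r + y' * x)) * (C0 * x) + (C0 * y') * (C0 * (x\<^sup>2 + xx))"
  have M: "0 \<le> M" using C0 nonneg by (simp add: M_def)
  have "\<exists>I K. 0 \<le> K \<and> I 0 = 0 \<and> (\<forall>t. I t \<in> euclid {..<m}) \<and> continuous_on {0..T} I \<and>
    (\<forall>s t. 0 \<le> s \<longrightarrow> s \<le> t \<longrightarrow> t \<le> T \<longrightarrow> norm (I t - I s - \<Xi> s t) \<le> K * (t - s) powr (3 * \<eta>))"
  proof (rule sewing_fvec[OF T \<eta>(2) M _ cGerm valGerm])
    fix s u t assume sut: "0 \<le> s" "s \<le> u" "u \<le> t" "t \<le> T"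
    have e: "(t - s) powr (3 * \<eta>) = (t - s) powr (2 * \<eta>) * (t - s) powr \<eta>"
      by (simp flip: powr_add)
    have m2: "(b - a) powr \<mu> \<le> (t - s) powr \<mu>" if "s \<le> a" "a \<le> b" "b \<le> t" "0 \<le> \<mu>" for a b \<mu>
      using that by (intro powr_mono2) auto
    have "norm (incr2 \<Xi> s u t) \<le> norm (R s u) * norm (incr X u t) + norm (incr Y' s u) * norm (XX u t)"
      by (rule defect_le[OF sut])
    also have "\<dots> \<le> (C0 * (r + y' * x) * (u - s) powr (2 * \<eta>)) * (C0 * x * (t - u) powr \<eta>) +
        (C0 * y' * (u - s) powr \<eta>) * (C0 * (x\<^sup>2 + xx) * (t - u) powr (2 * \<eta>))"
      using pw[rule_format, of s u] pw[rule_format, of u t] sut C0 nonneg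
      by (intro add_mono mult_mono) auto
    also have "\<dots> \<le> (C0 * (r + y' * x) * (t - s) powr (2 * \<eta>)) * (C0 * x * (t - s) powr \<eta>) +
        (C0 * y' * (t - s) powr \<eta>) * (C0 * (x\<^sup>2 + xx) * (t - s) powr (2 * \<eta>))"
      using sut C0 nonneg \<eta> by (intro add_mono mult_mono m2) auto
    also have "\<dots> = M * (t - s) powr (3 * \<eta>)"
      unfolding e M_def by (simp add: algebra_simps)
    finally show "norm (incr2 \<Xi> s u t) \<le> M * (t - s) powr (3 * \<eta>)" .
  qed auto
  then obtain I K where I: "0 \<le> K" "I 0 = 0" "\<And>t. I t \<in> euclid {..<m}" "continuous_on {0..T} I"
    "\<And>s t. 0 \<le> s \<Longrightarrow> s \<le> t \<Longrightarrow> t \<le> T \<Longrightarrow> norm (I t - I s - \<Xi> s t) \<le> K * (t - s) powr (3 * \<eta>)"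
    by blast
  have "sewn T \<Xi> (restrict I {0..T})"
    unfolding sewn_def
  proof (intro conjI exI[of _ K] allI impI)
    show "continuous_on {0..T} (restrict I {0..T})"
      using I(4) by (rule continuous_on_eq) auto
  qed (use I in auto)
  moreover have "restrict I {0..T} \<in> {0..T} \<rightarrow>\<^sub>E euclid {..<m}" "restrict I {0..T} 0 = 0"
    using I T by auto
  ultimately show ?thesis by blast
qed

text \<open>As \<alpha> and \<eta> exceed 1/3, all three exponents exceed 1, and
  \<open>besov_sewing\<close> applies to the same function in each scale.\<close>

lemma sewn_estimates:
  "\<exists>C>0. \<forall>T m n X XX Y Y' x xx y y' r I. rough_data \<alpha> \<beta> q T m n X XX Y Y' x xx y y' r \<longrightarrow>
    sewn T (germ X XX Y Y') I \<longrightarrow>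
    besov2_norm T (3 * \<alpha>) (\<beta> / 3) (q / 3) (\<lambda>s t. incr I s t - germ X XX Y Y' s t) \<le>
      ennreal C * besov3_norm T (3 * \<alpha>) (\<beta> / 3) (q / 3) (incr2 (germ X XX Y Y')) \<and>
    besov2_norm T (2 * \<alpha> + \<eta>) (\<beta> / 2) (q / 2) (\<lambda>s t. incr I s t - germ X XX Y Y' s t) \<le>
      ennreal C * besov3_norm T (2 * \<alpha> + \<eta>) (\<beta> / 2) (q / 2) (incr2 (germ X XX Y Y')) \<and>
    besov2_norm T (\<alpha> + 2 * \<eta>) \<beta> q (\<lambda>s t. incr I s t - germ X XX Y Y' s t) \<le>
      ennreal C * besov3_norm T (\<alpha> + 2 * \<eta>) \<beta> q (incr2 (germ X XX Y Y'))"
proof -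
  have S: "\<exists>C>0. \<forall>T m n X XX Y Y' x xx y y' r I. rough_data \<alpha> \<beta> q T m n X XX Y Y' x xx y y' r \<longrightarrow>
    sewn T (germ X XX Y Y') I \<longrightarrow>
    besov2_norm T a \<beta>' q' (\<lambda>s t. incr I s t - germ X XX Y Y' s t) \<le>
      ennreal C * besov3_norm T a \<beta>' q' (incr2 (germ X XX Y Y'))"
    if a: "1 < a" and \<beta>': "0 < \<beta>'" and q': "0 < q'" for a \<beta>' q'
  proof -
    obtain C where C: "0 < C" and H: "\<forall>T \<beta> (\<Xi> :: real \<Rightarrow> real \<Rightarrow> nat fvec) I K \<gamma>. 0 < T \<longrightarrow> 0 < \<beta> \<longrightarrow>
      continuous_on (simplex2 T) (\<lambda>(s, t). \<Xi> s t) \<longrightarrow> continuous_on {0..T} I \<longrightarrow> 0 \<le> K \<longrightarrow> 1 < \<gamma> \<longrightarrow>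
      (\<forall>s t. 0 \<le> s \<longrightarrow> s \<le> t \<longrightarrow> t \<le> T \<longrightarrow> norm (I t - I s - \<Xi> s t) \<le> K * (t - s) powr \<gamma>) \<longrightarrow>
      besov2_norm T a \<beta> q' (\<lambda>s t. incr I s t - \<Xi> s t) \<le> ennreal C * besov3_norm T a \<beta> q' (incr2 \<Xi>)"
      using besov_sewing[OF a q', where 'v = "nat fvec"] by (elim exE conjE)
    show ?thesis
    proof (intro exI[of _ C] conjI allI impI C)
      fix T m n X XX Y Y' x xx y y' r I
      assume data: "rough_data \<alpha> \<beta> q T m n X XX Y Y' x xx y y' r" and I: "sewn T (germ X XX Y Y') I"
      interpret rough_data \<alpha> \<beta> q T m n X XX Y Y' x xx y y' r by (rule data)
      obtain K where "0 \<le> K" "\<forall>s t. 0 \<le> s \<longrightarrow> s \<le> t \<longrightarrow> t \<le> T \<longrightarrow> norm (I t - I s - \<Xi> s t) \<le> K * (t - s) powr (3 * \<eta>)"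
        using I by (auto simp: sewn_def)
      then show "besov2_norm T a \<beta>' q' (\<lambda>s t. incr I s t - \<Xi> s t) \<le> ennreal C * besov3_norm T a \<beta>' q' (incr2 \<Xi>)"
        using I by (intro H[rule_format, OF T \<beta>' cGerm _ _ \<eta>(2)]) (auto simp: sewn_def)
    qed
  qed
  have e: "1 < 3 * \<alpha>" "1 < 2 * \<alpha> + \<eta>" "1 < \<alpha> + 2 * \<eta>" using \<alpha> \<eta> by auto
  obtain C1 where C1: "0 < C1" and H1: "\<forall>T m n X XX Y Y' x xx y y' r I. rough_data \<alpha> \<beta> q T m n X XX Y Y' x xx y y' r \<longrightarrow>
    sewn T (germ X XX Y Y') I \<longrightarrow>
    besov2_norm T (3 * \<alpha>) (\<beta> / 3) (q / 3) (\<lambda>s t. incr I s t - germ X XX Y Y' s t) \<le>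
      ennreal C1 * besov3_norm T (3 * \<alpha>) (\<beta> / 3) (q / 3) (incr2 (germ X XX Y Y'))"
    using S[OF e(1) \<beta>_pos(2) q_pos(2)] by (elim exE conjE)
  obtain C2 where C2: "0 < C2" and H2: "\<forall>T m n X XX Y Y' x xx y y' r I. rough_data \<alpha> \<beta> q T m n X XX Y Y' x xx y y' r \<longrightarrow>
    sewn T (germ X XX Y Y') I \<longrightarrow>
    besov2_norm T (2 * \<alpha> + \<eta>) (\<beta> / 2) (q / 2) (\<lambda>s t. incr I s t - germ X XX Y Y' s t) \<le>
      ennreal C2 * besov3_norm T (2 * \<alpha> + \<eta>) (\<beta> / 2) (q / 2) (incr2 (germ X XX Y Y'))"
    using S[OF e(2) \<beta>_pos(1) q_pos(1)] by (elim exE conjE)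
  obtain C3 where C3: "0 < C3" and H3: "\<forall>T m n X XX Y Y' x xx y y' r I. rough_data \<alpha> \<beta> q T m n X XX Y Y' x xx y y' r \<longrightarrow>
    sewn T (germ X XX Y Y') I \<longrightarrow>
    besov2_norm T (\<alpha> + 2 * \<eta>) \<beta> q (\<lambda>s t. incr I s t - germ X XX Y Y' s t) \<le>
      ennreal C3 * besov3_norm T (\<alpha> + 2 * \<eta>) \<beta> q (incr2 (germ X XX Y Y'))"
    using S[OF e(3) \<beta> q] by (elim exE conjE)
  have mono: "A \<le> ennreal (C1 + C2 + C3) * B" if "A \<le> ennreal c * B" "c \<le> C1 + C2 + C3" for A B c
    by (rule order.trans[OF that(1)]) (intro mult_right_mono ennreal_leI that, simp)
  show ?thesis
  proof (intro exI[of _ "C1 + C2 + C3"] allI impI conjI)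
    fix T m n X XX Y Y' x xx y y' r I
    assume data: "rough_data \<alpha> \<beta> q T m n X XX Y Y' x xx y y' r" "sewn T (germ X XX Y Y') I"
    show "besov2_norm T (3 * \<alpha>) (\<beta> / 3) (q / 3) (\<lambda>s t. incr I s t - germ X XX Y Y' s t) \<le>
      ennreal (C1 + C2 + C3) * besov3_norm T (3 * \<alpha>) (\<beta> / 3) (q / 3) (incr2 (germ X XX Y Y'))"
      by (rule mono[OF H1[rule_format, OF data]]) (use C2 C3 in simp)
    show "besov2_norm T (2 * \<alpha> + \<eta>) (\<beta> / 2) (q / 2) (\<lambda>s t. incr I s t - germ X XX Y Y' s t) \<le>
      ennreal (C1 + C2 + C3) * besov3_norm T (2 * \<alpha> + \<eta>) (\<beta> / 2) (q / 2) (incr2 (germ X XX Y Y'))"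
      by (rule mono[OF H2[rule_format, OF data]]) (use C1 C3 in simp)
    show "besov2_norm T (\<alpha> + 2 * \<eta>) \<beta> q (\<lambda>s t. incr I s t - germ X XX Y Y' s t) \<le>
      ennreal (C1 + C2 + C3) * besov3_norm T (\<alpha> + 2 * \<eta>) \<beta> q (incr2 (germ X XX Y Y'))"
      by (rule mono[OF H3[rule_format, OF data]]) (use C1 C2 in simp)
  qed (use C1 C2 C3 in simp)
qed

end

section \<open>Riemann sums\<close>

lemma is_partition_facts:
  assumes "is_partition \<pi>"
  defines "L \<equiv> length \<pi> - 1" and "d \<equiv> \<lambda>i. \<pi> ! Suc i - \<pi> ! i"
  shows "\<pi> ! 0 = 0" "\<pi> ! L = 1" "\<And>i. i < L \<Longrightarrow> 0 < d i" "\<And>i. i < L \<Longrightarrow> d i \<le> mesh \<pi>" "(\<Sum>i<L. d i) = 1"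
    "\<And>i. i \<le> L \<Longrightarrow> 0 \<le> \<pi> ! i \<and> \<pi> ! i \<le> 1"
proof -
  have ne: "\<pi> \<noteq> []" and sorted: "sorted_wrt (<) \<pi>" using assms by (auto simp: is_partition_def)
  show 0: "\<pi> ! 0 = 0" and 1: "\<pi> ! L = 1"
    using assms by (auto simp: is_partition_def hd_conv_nth last_conv_nth L_def)
  show pos: "0 < d i" if "i < L" for i
    using sorted_wrt_nth_less[OF sorted, of i "Suc i"] that by (auto simp: d_def L_def)
  show "d i \<le> mesh \<pi>" if "i < L" for i
    using that by (auto simp: mesh_def d_def L_def intro!: Max_ge)
  have "(\<Sum>i<L. d i) = \<pi> ! L - \<pi> ! 0" unfolding d_def by (rule sum_lessThan_telescope)
  then show "(\<Sum>i<L. d i) = 1" using 0 1 by simp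
  show "0 \<le> \<pi> ! i \<and> \<pi> ! i \<le> 1" if "i \<le> L" for i
  proof -
    have len: "length \<pi> = Suc L" using ne by (cases \<pi>) (auto simp: L_def)
    have "\<pi> ! 0 \<le> \<pi> ! i" using sorted_wrt_nth_less[OF sorted, of 0 i] that len by (cases "i = 0") auto
    moreover have "\<pi> ! i \<le> \<pi> ! L"
      using sorted_wrt_nth_less[OF sorted, of i L] that len by (cases "i = L") auto
    ultimately show ?thesis using 0 1 by simp
  qed
qed

text \<open>The increments of I telescope over the partition, so the error is the sum of the errors
  on its pieces. On an interval of length h the i-th piece is a shifted increment of length
  \<open>(\<pi> ! Suc i - \<pi> ! i) * h\<close>.\<close>

lemma modulus2_riemann_sum:
  fixes I :: "real \<Rightarrow> 'v::real_normed_vector"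
  assumes \<beta>: "0 < \<beta>" and D: "continuous_on (simplex2 T) (\<lambda>(s, t). incr I s t - \<Xi> s t)" and \<pi>: "is_partition \<pi>"
  shows "modulus2 T \<beta> (\<lambda>s t. incr I s t - riemann_sum \<pi> \<Xi> s t) \<tau> \<le>
    (\<Sum>i<length \<pi> - 1. modulus2 T \<beta> (\<lambda>s t. incr I s t - \<Xi> s t) ((\<pi> ! Suc i - \<pi> ! i) * \<tau>))"
proof (rule modulus2_least[OF \<beta>])
  fix h assume h: "0 \<le> h" "h \<le> \<tau>" "h \<le> T"
  note p = is_partition_facts[OF \<pi>]
  let ?L = "length \<pi> - 1" and ?d = "\<lambda>i. \<pi> ! Suc i - \<pi> ! i" and ?D = "\<lambda>s t. incr I s t - \<Xi> s t"
  let ?f = "\<lambda>i r. ?D (r + \<pi> ! i * h) (r + \<pi> ! i * h + ?d i * h)"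
  have le: "T - h + \<pi> ! i * h + ?d i * h \<le> T" "0 \<le> \<pi> ! i * h" "0 \<le> ?d i * h" if "i < ?L" for i
  proof -
    have "\<pi> ! i * h + ?d i * h = \<pi> ! Suc i * h" by (simp add: algebra_simps)
    also have "\<dots> \<le> 1 * h" using p(6)[of "Suc i"] that h by (intro mult_right_mono) auto
    finally show "T - h + \<pi> ! i * h + ?d i * h \<le> T" by simp
    show "0 \<le> \<pi> ! i * h" "0 \<le> ?d i * h" using p(6)[of i] p(3)[of i] that h by auto
  qed
  have eq: "incr I r (r + h) - riemann_sum \<pi> \<Xi> r (r + h) = (\<Sum>i<?L. ?f i r)" for r
  proof -
    have "(\<Sum>i<?L. ?f i r) = (\<Sum>i<?L. I (r + \<pi> ! Suc i * h) - I (r + \<pi> ! i * h)) - riemann_sum \<pi> \<Xi> r (r + h)"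
      by (simp add: riemann_sum_def sum_subtractf[symmetric] incr_def algebra_simps)
    also have "(\<Sum>i<?L. I (r + \<pi> ! Suc i * h) - I (r + \<pi> ! i * h)) = I (r + \<pi> ! ?L * h) - I (r + \<pi> ! 0 * h)"
      by (rule sum_lessThan_telescope)
    also have "\<dots> = incr I r (r + h)" using p(1,2) by (simp add: incr_def)
    finally show ?thesis by simp
  qed
  have "orlicz_norm \<beta> {0..T - h} (\<lambda>r. incr I r (r + h) - riemann_sum \<pi> \<Xi> r (r + h)) \<le> (\<Sum>i<?L. orlicz_norm \<beta> {0..T - h} (?f i))"
    unfolding eq using continuous_on_diagonal[OF D] le by (intro orlicz_norm_sum \<beta>) auto
  also have "\<dots> \<le> (\<Sum>i<?L. modulus2 T \<beta> ?D (?d i * \<tau>))"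
    using le h p(3) by (intro sum_mono shifted_le_modulus2[OF \<beta> D]) (auto intro!: mult_left_mono simp: less_imp_le)
  finally show "orlicz_norm \<beta> {0..T - h} (\<lambda>r. incr I r (r + h) - riemann_sum \<pi> \<Xi> r (r + h)) \<le> (\<Sum>i<?L. modulus2 T \<beta> ?D (?d i * \<tau>))" .
qed

lemma riemann_sums_converge:
  fixes I :: "real \<Rightarrow> 'v::real_normed_vector"
  assumes T: "0 < T" and \<beta>: "0 < \<beta>" and a: "1 < a" and q: "0 < q"
    and D: "continuous_on (simplex2 T) (\<lambda>(s, t). incr I s t - \<Xi> s t)"
    and fin: "besov2_norm T a \<beta> q (\<lambda>s t. incr I s t - \<Xi> s t) < \<infinity>"
    and r: "ennreal (1 / a) < r" "q \<le> r" and \<pi>: "\<And>N. is_partition (\<pi> N)" "(\<lambda>N. mesh (\<pi> N)) \<longlonglongrightarrow> 0"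
  shows "(\<lambda>N. besov2_norm T a \<beta> r (\<lambda>s t. incr I s t - riemann_sum (\<pi> N) \<Xi> s t)) \<longlonglongrightarrow> 0"
proof -
  let ?w = "modulus2 T \<beta> (\<lambda>s t. incr I s t - \<Xi> s t)"
  have r0: "0 < r" using q r(2) by (rule less_le_trans)
  obtain C e where e: "0 < e" and C: "0 \<le> C" and H: "\<forall>(d :: nat \<Rightarrow> real) L \<eta>.
    (\<forall>i<L. 0 < d i \<and> d i \<le> \<eta>) \<longrightarrow> (\<Sum>i<L. d i) = 1 \<longrightarrow>
    log_norm T r (\<lambda>\<tau>. ennreal (\<tau> powr - a) * (\<Sum>i<L. ?w (d i * \<tau>))) \<le> ennreal (C * \<eta> powr e)"
    using log_norm_partition[OF a q T mono_modulus2 modulus2_finite[OF \<beta> T D] fin[unfolded besov2_norm_def] r(2,1)]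
    by (elim exE conjE)
  have bound: "besov2_norm T a \<beta> r (\<lambda>s t. incr I s t - riemann_sum (\<pi> N) \<Xi> s t) \<le> ennreal (C * mesh (\<pi> N) powr e)" for N
  proof -
    note p = is_partition_facts[OF \<pi>(1)[of N]]
    have "besov2_norm T a \<beta> r (\<lambda>s t. incr I s t - riemann_sum (\<pi> N) \<Xi> s t) \<le>
        log_norm T r (\<lambda>\<tau>. ennreal (\<tau> powr - a) * (\<Sum>i<length (\<pi> N) - 1. ?w ((\<pi> N ! Suc i - \<pi> N ! i) * \<tau>)))"
      unfolding besov2_norm_def
      by (intro log_norm_mono weighted_measurable mono_modulus2 r0 mult_left_mono modulus2_riemann_sum \<beta> D \<pi>) simp
    also have "\<dots> \<le> ennreal (C * mesh (\<pi> N) powr e)"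
      using p(3,4,5) by (intro H[rule_format]) auto
    finally show ?thesis .
  qed
  have pos: "0 \<le> mesh (\<pi> N)" for N
  proof -
    note p = is_partition_facts[OF \<pi>(1)[of N]]
    have "length (\<pi> N) - 1 \<noteq> 0" using p(1,2) by (metis zero_neq_one)
    then show ?thesis using p(3,4)[of 0] by simp
  qed
  have "(\<lambda>N. C * mesh (\<pi> N) powr e) \<longlonglongrightarrow> C * 0 powr e"
    using e pos by (intro tendsto_mult tendsto_const tendsto_powr2 \<pi>(2)) auto
  then have "(\<lambda>N. ennreal (C * mesh (\<pi> N) powr e)) \<longlonglongrightarrow> 0"
    using tendsto_ennrealI by fastforce
  from tendsto_sandwich[OF _ _ tendsto_const this] show ?thesis
    using bound by auto
qed

section \<open>The rough integral\<close>

lemma controlled_rough_data: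
  assumes T: "0 < T" and XX: "(X, XX) \<in> rough_paths T \<alpha> \<beta> q n"
    and Y: "(Y, Y') \<in> controlled T \<alpha> \<beta> q n X ({..<m} \<times> {..<n})"
  shows "rough_data \<alpha> \<beta> q T m n X XX Y Y'
    (enn2real (besov_seminorm T \<alpha> \<beta> q X)) (enn2real (besov2_norm T (2 * \<alpha>) (\<beta> / 2) (q / 2) XX))
    (enn2real (besov_seminorm T \<alpha> \<beta> q Y)) (enn2real (besov_seminorm T \<alpha> \<beta> q Y'))
    (enn2real (besov2_norm T (2 * \<alpha>) (\<beta> / 2) (q / 2) (remainder X Y Y')))"
proof -
  have "besov_seminorm T \<alpha> \<beta> q X < top" "besov_seminorm T \<alpha> \<beta> q Y < top" "besov_seminorm T \<alpha> \<beta> q Y' < top"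
    using XX Y by (auto simp: rough_paths_def controlled_def besov_def)
  moreover have "besov2_norm T (2 * \<alpha>) (\<beta> / 2) (q / 2) XX < top"
    "besov2_norm T (2 * \<alpha>) (\<beta> / 2) (q / 2) (remainder X Y Y') < top"
    using XX Y by (auto simp: rough_paths_def controlled_def besov2_def)
  ultimately show ?thesis
    using XX Y T by unfold_locales (auto simp: rough_paths_def controlled_def besov_def)
qed

section \<open>Existence and uniqueness of the sewing in the Besov-Orlicz sense\<close>

context rough_setup
begin

text \<open>\<delta>F is additive and of regularity 3\<alpha> > 1, so
  \<open>halving_imp_zero\<close> makes its modulus vanish on (0, T/2]. The embedding with N = M = 0
  turns this into vanishing at every point.\<close>

lemma is_sewing_unique:
  assumes T: "0 < T" and \<Xi>: "continuous_on (simplex2 T) (\<lambda>(s, t). \<Xi> s t)"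
    and I: "is_sewing T \<alpha> \<beta> q V \<Xi> I" and J: "is_sewing T \<alpha> \<beta> q V \<Xi> (J :: real \<Rightarrow> 'i fvec)"
  shows "I = J"
proof -
  define F where "F t = I t - J t" for t
  have cI: "continuous_on {0..T} I" and cJ: "continuous_on {0..T} J" using I J by (auto simp: is_sewing_def)
  have cF: "continuous_on (simplex2 T) (\<lambda>(s, t). incr F s t)"
    unfolding F_def by (intro continuous_on_incr continuous_on_diff cI cJ)
  have cD: "continuous_on (simplex2 T) (\<lambda>(s, t). incr I s t - \<Xi> s t)" "continuous_on (simplex2 T) (\<lambda>(s, t). incr J s t - \<Xi> s t)"
    using continuous_on_diff[OF continuous_on_incr[OF cI] \<Xi>] continuous_on_diff[OF continuous_on_incr[OF cJ] \<Xi>]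
    by (simp_all add: case_prod_unfold)
  have fin: "besov2_norm T (3 * \<alpha>) (\<beta> / 3) (q / 3) (incr F) < \<infinity>"
  proof (rule besov2_combination_finite[OF q_pos(2) \<beta>_pos(2) _ _ cD, of 1 1])
    show "norm (incr F s t) \<le> 1 * norm (incr I s t - \<Xi> s t) + 1 * norm (incr J s t - \<Xi> s t)" for s t
      using norm_triangle_ineq4[of "incr I s t - \<Xi> s t" "incr J s t - \<Xi> s t"]
      by (simp add: incr_def F_def algebra_simps)
  qed (use I J in \<open>auto simp: is_sewing_def besov2_def\<close>)
  have zero: "modulus2 T (\<beta> / 3) (incr F) \<tau> = 0" if "0 < \<tau>" "\<tau> \<le> T / 2" for \<tau>
  proof (rule halving_imp_zero[OF _ q_pos(2) mono_modulus2 _ fin[unfolded besov2_norm_def] that])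
    fix \<tau>
    have "modulus2 T (\<beta> / 3) (incr F) \<tau> \<le> 2 * modulus2 T (\<beta> / 3) (incr F) (\<tau> / 2) + modulus3 T (\<beta> / 3) (incr2 (incr F)) \<tau>"
      by (rule modulus2_halving[OF \<beta>_pos(2) cF cF]) (simp add: incr_def incr2_def)
    also have "modulus3 T (\<beta> / 3) (incr2 (incr F)) \<tau> \<le> 0"
      using \<beta>_pos by (intro modulus3_least) (auto simp: incr2_incr orlicz_norm_zero orlicz_norm_norm[symmetric, where f = "\<lambda>_. 0 :: 'i fvec"])
    finally show "modulus2 T (\<beta> / 3) (incr F) \<tau> \<le> 2 * modulus2 T (\<beta> / 3) (incr F) (\<tau> / 2)" by simp
  qed (use \<alpha> in simp)
  \<comment> \<open>The factor 3 compensates the index \<beta>/3, so the exponent is again k\<beta>.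
    Since N = 0, any regularity above 1/(k\<beta>) may be inserted below; it is taken to be
    1.\<close>
  have p: "1 \<le> real (3 * k) * (\<beta> / 3)" using k by simp
  have "\<exists>c>0. \<forall>x\<ge>0. x powr (real (3 * k) * (\<beta> / 3)) \<le> c * orlicz_Phi (\<beta> / 3) x"
    by (rule powr_le_Phi[OF \<beta>_pos(2) p]) (intro exI conjI allI impI)
  then obtain c where c: "0 < c" and c_all: "\<forall>x\<ge>0. x powr (real (3 * k) * (\<beta> / 3)) \<le> c * orlicz_Phi (\<beta> / 3) x"
    by (elim exE conjE)
  have "norm (incr F 0 t) \<le> embedding_const (1 - 1 / (real (3 * k) * (\<beta> / 3))) * (0 * (1 + c) + 0) * (t - 0) powr (1 - 1 / (real (3 * k) * (\<beta> / 3)))"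
    if t: "0 \<le> t" "t \<le> T" for t
  proof (rule two_parameter_embedding[OF \<beta>_pos(2) p c c_all[rule_format] cF])
    show "0 < 1 - 1 / (real (3 * k) * (\<beta> / 3))" using k by simp
    fix h assume h: "0 < h" "h \<le> T / 2"
    then have "orlicz_norm (\<beta> / 3) {0..T - h} (\<lambda>r. incr F r (r + h)) \<le> modulus2 T (\<beta> / 3) (incr F) h"
      by (intro modulus2_upper) auto
    then show "orlicz_norm (\<beta> / 3) {0..T - h} (\<lambda>r. incr F r (r + h)) \<le> ennreal (0 * h powr 1)"
      using zero[OF h] by simp
  qed (use t in \<open>auto simp: incr2_incr\<close>)
  then have "I t = J t" if "t \<in> {0..T}" for t
    using that I J by (auto simp: incr_def F_def is_sewing_def)
  moreover have "I \<in> extensional {0..T}" "J \<in> extensional {0..T}"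
    using I J by (auto simp: is_sewing_def PiE_def)
  ultimately show "I = J" by (rule extensionalityI[rotated 2])
qed

lemma sewn_is_sewing:
  assumes data: "rough_data \<alpha> \<beta> q T m n X XX Y Y' x xx y y' r"
    and I: "sewn T (germ X XX Y Y') I" "I \<in> {0..T} \<rightarrow>\<^sub>E euclid {..<m}" "I 0 = 0"
  shows "is_sewing T \<alpha> \<beta> q (euclid {..<m}) (germ X XX Y Y') I"
proof -
  interpret rough_data \<alpha> \<beta> q T m n X XX Y Y' x xx y y' r by (rule data)
  have cI: "continuous_on {0..T} I" using I by (simp add: sewn_def)
  have "\<exists>C. besov2_norm T (3 * \<alpha>) (\<beta> / 3) (q / 3) (\<lambda>s t. incr I s t - \<Xi> s t) \<le>
      ennreal C * besov3_norm T (3 * \<alpha>) (\<beta> / 3) (q / 3) (incr2 \<Xi>)"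
    using sewn_estimates data I(1) by meson
  moreover have "\<exists>C. besov3_norm T (3 * \<alpha>) (\<beta> / 3) (q / 3) (incr2 \<Xi>) \<le> ennreal C"
    using defect_norms data by meson
  ultimately obtain C C' where "besov2_norm T (3 * \<alpha>) (\<beta> / 3) (q / 3) (\<lambda>s t. incr I s t - \<Xi> s t) \<le>
      ennreal C * besov3_norm T (3 * \<alpha>) (\<beta> / 3) (q / 3) (incr2 \<Xi>)"
    "besov3_norm T (3 * \<alpha>) (\<beta> / 3) (q / 3) (incr2 \<Xi>) \<le> ennreal C'" by blast
  then have "besov2_norm T (3 * \<alpha>) (\<beta> / 3) (q / 3) (\<lambda>s t. incr I s t - \<Xi> s t) \<le> ennreal C * ennreal C'"
    by (meson mult_left_mono order.trans zero_le)
  also have "\<dots> < \<infinity>" by (simp add: ennreal_mult_less_top)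
  finally have fin: "besov2_norm T (3 * \<alpha>) (\<beta> / 3) (q / 3) (\<lambda>s t. incr I s t - \<Xi> s t) < \<infinity>" .
  have "(\<lambda>s t. incr I s t - \<Xi> s t) \<in> besov2 T (3 * \<alpha>) (\<beta> / 3) (q / 3) (euclid {..<m})"
  proof (rule besov2_memI[OF _ _ fin])
    show "continuous_on (simplex2 T) (\<lambda>(s, t). incr I s t - \<Xi> s t)"
      using continuous_on_diff[OF continuous_on_incr[OF cI] cGerm] by (simp add: case_prod_unfold)
    show "incr I s t - \<Xi> s t \<in> euclid {..<m}" if "0 \<le> s" "s \<le> t" "t \<le> T" for s t
      unfolding incr_def using that I(2) by (intro euclid_closed valGerm) auto
  qed
  then show ?thesis using I cI by (simp add: is_sewing_def)
qed

lemma is_sewing_ex1: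
  assumes "rough_data \<alpha> \<beta> q T m n X XX Y Y' x xx y y' r"
  shows "\<exists>!I. is_sewing T \<alpha> \<beta> q (euclid {..<m}) (germ X XX Y Y') I"
proof -
  interpret rough_data \<alpha> \<beta> q T m n X XX Y Y' x xx y y' r by (rule assms)
  obtain I where "sewn T \<Xi> I" "I \<in> {0..T} \<rightarrow>\<^sub>E euclid {..<m}" "I 0 = 0"
    using sewn_exists[OF assms] by blast
  then have "is_sewing T \<alpha> \<beta> q (euclid {..<m}) \<Xi> I" by (rule sewn_is_sewing[OF assms])
  then show ?thesis using is_sewing_unique[OF T cGerm] by blast
qed

text \<open>The pointwise bound is not extracted from the Besov-Orlicz condition but obtained from
  uniqueness: the function satisfying the condition is the constructed one.\<close>

lemma is_sewing_sewn:
  assumes data: "rough_data \<alpha> \<beta> q T m n X XX Y Y' x xx y y' r"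
    and I: "is_sewing T \<alpha> \<beta> q (euclid {..<m}) (germ X XX Y Y') I"
  shows "sewn T (germ X XX Y Y') I"
proof -
  obtain J where J: "sewn T (germ X XX Y Y') J" "J \<in> {0..T} \<rightarrow>\<^sub>E euclid {..<m}" "J 0 = 0"
    using sewn_exists[OF data] by blast
  then have "is_sewing T \<alpha> \<beta> q (euclid {..<m}) (germ X XX Y Y') J" by (rule sewn_is_sewing[OF data])
  then have "I = J" using is_sewing_ex1[OF data] I by blast
  then show ?thesis using J by simp
qed

section \<open>Estimates of the integral and of its remainder\<close>

lemma sup_bound:
  fixes f :: "real \<Rightarrow> 'v::real_normed_vector"
  assumes "norm (incr f 0 t) \<le> C * z * (t - 0) powr \<eta>" "0 \<le> t" "t \<le> T" "0 \<le> C" "0 \<le> z"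
  shows "norm (f t) \<le> norm (f 0) + C * z * T powr \<eta>"
proof -
  have "norm (f t) \<le> norm (f 0) + norm (incr f 0 t)"
    using norm_triangle_ineq[of "f 0" "incr f 0 t"] by (simp add: incr_def)
  also have "norm (incr f 0 t) \<le> C * z * T powr \<eta>"
    using assms \<eta> by (intro order.trans[OF assms(1)] mult_left_mono powr_mono2) auto
  finally show ?thesis by simp
qed

text \<open>The remainder is D + Y' XX with D = \<delta>I - \<Xi>. D has the surplus regularity
  \<eta>, which yields T^\<eta>; the supremum of Y' contributes its initial value and another
  T^\<eta>. All other constants are free of T, as needed for monotonicity in T.\<close>

lemma remainder_estimate:
  "\<exists>C>0. \<forall>T m n X XX Y Y' x xx y y' r I. rough_data \<alpha> \<beta> q T m n X XX Y Y' x xx y y' r \<longrightarrow>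
    sewn T (germ X XX Y Y') I \<longrightarrow>
    besov2_norm T (2 * \<alpha>) (\<beta> / 2) (q / 2) (remainder X I Y) \<le>
      ennreal (C * (norm (Y' 0) * xx + T powr \<eta> * (r * x + y' * xx)))"
proof -
  obtain C0 where C0: "0 < C0" and H0: "\<forall>T m n X XX Y Y' x xx y y' r. rough_data \<alpha> \<beta> q T m n X XX Y Y' x xx y y' r \<longrightarrow>
    (\<forall>s t. 0 \<le> s \<longrightarrow> s \<le> t \<longrightarrow> t \<le> T \<longrightarrow>
      norm (incr X s t) \<le> C0 * x * (t - s) powr \<eta> \<and>
      norm (XX s t) \<le> C0 * (x\<^sup>2 + xx) * (t - s) powr (2 * \<eta>) \<and>
      norm (incr Y s t) \<le> C0 * y * (t - s) powr \<eta> \<and>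
      norm (incr Y' s t) \<le> C0 * y' * (t - s) powr \<eta> \<and>
      norm (remainder X Y Y' s t) \<le> C0 * (r + y' * x) * (t - s) powr (2 * \<eta>))"
    using pointwise_bounds by (elim exE conjE)
  obtain C1 where C1: "0 < C1" and H1: "\<forall>T m n X XX Y Y' x xx y y' r. rough_data \<alpha> \<beta> q T m n X XX Y Y' x xx y y' r \<longrightarrow>
    besov3_norm T (3 * \<alpha>) (\<beta> / 3) (q / 3) (incr2 (germ X XX Y Y')) \<le> ennreal (C1 * (r * x + y' * xx)) \<and>
    besov3_norm T (2 * \<alpha> + \<eta>) (\<beta> / 2) (q / 2) (incr2 (germ X XX Y Y')) \<le> ennreal (C1 * (r * x + y' * xx)) \<and>
    besov3_norm T (\<alpha> + 2 * \<eta>) \<beta> q (incr2 (germ X XX Y Y')) \<le> ennreal (C1 * ((r + y' * x) * x + (x\<^sup>2 + xx) * y'))"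
    using defect_norms by (elim exE conjE)
  obtain C2 where C2: "0 < C2" and H2: "\<forall>T m n X XX Y Y' x xx y y' r I. rough_data \<alpha> \<beta> q T m n X XX Y Y' x xx y y' r \<longrightarrow>
    sewn T (germ X XX Y Y') I \<longrightarrow>
    besov2_norm T (3 * \<alpha>) (\<beta> / 3) (q / 3) (\<lambda>s t. incr I s t - germ X XX Y Y' s t) \<le>
      ennreal C2 * besov3_norm T (3 * \<alpha>) (\<beta> / 3) (q / 3) (incr2 (germ X XX Y Y')) \<and>
    besov2_norm T (2 * \<alpha> + \<eta>) (\<beta> / 2) (q / 2) (\<lambda>s t. incr I s t - germ X XX Y Y' s t) \<le>
      ennreal C2 * besov3_norm T (2 * \<alpha> + \<eta>) (\<beta> / 2) (q / 2) (incr2 (germ X XX Y Y')) \<and>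
    besov2_norm T (\<alpha> + 2 * \<eta>) \<beta> q (\<lambda>s t. incr I s t - germ X XX Y Y' s t) \<le>
      ennreal C2 * besov3_norm T (\<alpha> + 2 * \<eta>) \<beta> q (incr2 (germ X XX Y Y'))"
    using sewn_estimates by (elim exE conjE)
  obtain C3 where C3: "0 < C3" and H3: "\<forall>T \<beta> a (\<Xi> :: real \<Rightarrow> real \<Rightarrow> nat fvec) \<Xi>'. 0 < \<beta> \<longrightarrow>
    continuous_on (simplex2 T) (\<lambda>(s, t). \<Xi> s t) \<longrightarrow> continuous_on (simplex2 T) (\<lambda>(s, t). \<Xi>' s t) \<longrightarrow>
    besov2_norm T a \<beta> (q / 2) (\<lambda>s t. \<Xi> s t + \<Xi>' s t) \<le> ennreal C3 * (besov2_norm T a \<beta> (q / 2) \<Xi> + besov2_norm T a \<beta> (q / 2) \<Xi>')"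
    using besov2_triangle[OF q_pos(1), where 'v = "nat fvec"] by (elim exE conjE)
  show ?thesis
  proof (intro exI[of _ "C3 * (C2 * C1 + 1 + C0)"] conjI allI impI)
    fix T m n X XX Y Y' x xx y y' r I
    assume data: "rough_data \<alpha> \<beta> q T m n X XX Y Y' x xx y y' r" and I: "sewn T (germ X XX Y Y') I"
    interpret rough_data \<alpha> \<beta> q T m n X XX Y Y' x xx y y' r by (rule data)
    let ?D = "\<lambda>s t. incr I s t - \<Xi> s t" and ?P = "\<lambda>s t. app2 (Y' s) (XX s t)"
    define S where "S = r * x + y' * xx"
    have S: "0 \<le> S" "y' * xx \<le> S" using nonneg by (auto simp: S_def)
    have cI: "continuous_on {0..T} I" using I by (simp add: sewn_def)
    have cD: "continuous_on (simplex2 T) (\<lambda>(s, t). ?D s t)"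
      using continuous_on_diff[OF continuous_on_incr[OF cI] cGerm] by (simp add: case_prod_unfold)
    have cP: "continuous_on (simplex2 T) (\<lambda>(s, t). ?P s t)"
      unfolding case_prod_unfold using cXX[unfolded case_prod_unfold]
      by (intro app2.continuous_on continuous_on_simplex_path cY')
    have "remainder X I Y = (\<lambda>s t. ?D s t + ?P s t)"
      by (intro ext) (simp add: remainder_def germ_def incr_def)
    then have "besov2_norm T (2 * \<alpha>) (\<beta> / 2) (q / 2) (remainder X I Y) \<le>
        ennreal C3 * (besov2_norm T (2 * \<alpha>) (\<beta> / 2) (q / 2) ?D + besov2_norm T (2 * \<alpha>) (\<beta> / 2) (q / 2) ?P)"
      using H3[rule_format, OF \<beta>_pos(1) cD cP] by simp
    also have "\<dots> \<le> ennreal C3 * (ennreal (T powr \<eta>) * (ennreal C2 * ennreal (C1 * S)) +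
        ennreal (norm (Y' 0) + C0 * y' * T powr \<eta>) * ennreal xx)"
    proof (intro mult_left_mono add_mono)
      have "besov2_norm T (2 * \<alpha>) (\<beta> / 2) (q / 2) ?D \<le> ennreal (T powr \<eta>) * besov2_norm T (2 * \<alpha> + \<eta>) (\<beta> / 2) (q / 2) ?D"
        using \<eta> by (intro besov2_lower_exponent q_pos) auto
      also have "\<dots> \<le> ennreal (T powr \<eta>) * (ennreal C2 * besov3_norm T (2 * \<alpha> + \<eta>) (\<beta> / 2) (q / 2) (incr2 \<Xi>))"
        using H2[rule_format, OF data I] by (intro mult_left_mono) auto
      also have "\<dots> \<le> ennreal (T powr \<eta>) * (ennreal C2 * ennreal (C1 * S))"
        using H1[rule_format, OF data] by (intro mult_left_mono) (auto simp: S_def)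
      finally show "besov2_norm T (2 * \<alpha>) (\<beta> / 2) (q / 2) ?D \<le> ennreal (T powr \<eta>) * (ennreal C2 * ennreal (C1 * S))" .
      show "besov2_norm T (2 * \<alpha>) (\<beta> / 2) (q / 2) ?P \<le> ennreal (norm (Y' 0) + C0 * y' * T powr \<eta>) * ennreal xx"
        unfolding nXX[symmetric]
      proof (rule besov2_dominated[OF q_pos(1) \<beta>_pos(1)])
        fix s t assume st: "0 \<le> s" "s \<le> t" "t \<le> T"
        have "norm (Y' s) \<le> norm (Y' 0) + C0 * y' * T powr \<eta>"
          using H0[rule_format, OF data, of 0 s] st C0 nonneg by (intro sup_bound[of Y' s]) auto
        then show "norm (?P s t) \<le> (norm (Y' 0) + C0 * y' * T powr \<eta>) * norm (XX s t)"
          by (intro order.trans[OF norm_app2_le] mult_right_mono) auto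
      qed (use C0 nonneg in auto)
    qed auto
    also have "\<dots> = ennreal (C3 * (T powr \<eta> * (C2 * (C1 * S)) + (norm (Y' 0) + C0 * y' * T powr \<eta>) * xx))"
      using C0 C1 C2 C3 S nonneg by (simp flip: ennreal_mult ennreal_plus)
    also have "\<dots> \<le> ennreal (C3 * (C2 * C1 + 1 + C0) * (norm (Y' 0) * xx + T powr \<eta> * S))"
    proof (rule ennreal_leI)
      have 1: "C0 * T powr \<eta> * (y' * xx) \<le> C0 * T powr \<eta> * S"
        using C0 S by (intro mult_left_mono) auto
      have 2: "0 \<le> C2 * C1 * (norm (Y' 0) * xx)" "0 \<le> C0 * (norm (Y' 0) * xx)" "0 \<le> T powr \<eta> * S"
        using C0 C1 C2 S nonneg by auto
      have "T powr \<eta> * (C2 * (C1 * S)) + (norm (Y' 0) + C0 * y' * T powr \<eta>) * xx =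
          C2 * C1 * (T powr \<eta> * S) + norm (Y' 0) * xx + C0 * T powr \<eta> * (y' * xx)"
        by (simp add: algebra_simps)
      also have "\<dots> \<le> (C2 * C1 + 1 + C0) * (norm (Y' 0) * xx + T powr \<eta> * S)"
        using 1 2 by (simp add: distrib_left distrib_right)
      finally have "C3 * (T powr \<eta> * (C2 * (C1 * S)) + (norm (Y' 0) + C0 * y' * T powr \<eta>) * xx) \<le>
          C3 * ((C2 * C1 + 1 + C0) * (norm (Y' 0) * xx + T powr \<eta> * S))"
        using C3 by (intro mult_left_mono) auto
      then show "C3 * (T powr \<eta> * (C2 * (C1 * S)) + (norm (Y' 0) + C0 * y' * T powr \<eta>) * xx) \<le>
          C3 * (C2 * C1 + 1 + C0) * (norm (Y' 0) * xx + T powr \<eta> * S)" by (simp add: mult.assoc)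
    qed
    finally show "besov2_norm T (2 * \<alpha>) (\<beta> / 2) (q / 2) (remainder X I Y) \<le>
      ennreal (C3 * (C2 * C1 + 1 + C0) * (norm (Y' 0) * xx + T powr \<eta> * (r * x + y' * xx)))"
      by (simp add: S_def)
  qed (use C0 C1 C2 C3 in \<open>auto intro!: mult_pos_pos add_pos_pos\<close>)
qed

text \<open>Here \<delta>I = D + Y \<delta>X + Y' XX, and XX, controlled in index \<beta>/2, has to
  be measured in index \<beta>. \<open>besov2_sqrt\<close> does this with a constant depending on T,
  which is why T is fixed first.\<close>

lemma seminorm_estimate:
  assumes T: "0 < T"
  shows "\<exists>C>0. \<forall>m n X XX Y Y' x xx y y' r I. rough_data \<alpha> \<beta> q T m n X XX Y Y' x xx y y' r \<longrightarrow>
    sewn T (germ X XX Y Y') I \<longrightarrow>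
    besov_seminorm T \<alpha> \<beta> q I \<le>
      ennreal (C * ((norm (Y 0) + y + r) * x + (norm (Y' 0) + y') * (x\<^sup>2 + xx)))"
proof -
  obtain C0 where C0: "0 < C0" and H0: "\<forall>T m n X XX Y Y' x xx y y' r. rough_data \<alpha> \<beta> q T m n X XX Y Y' x xx y y' r \<longrightarrow>
    (\<forall>s t. 0 \<le> s \<longrightarrow> s \<le> t \<longrightarrow> t \<le> T \<longrightarrow>
      norm (incr X s t) \<le> C0 * x * (t - s) powr \<eta> \<and>
      norm (XX s t) \<le> C0 * (x\<^sup>2 + xx) * (t - s) powr (2 * \<eta>) \<and>
      norm (incr Y s t) \<le> C0 * y * (t - s) powr \<eta> \<and>
      norm (incr Y' s t) \<le> C0 * y' * (t - s) powr \<eta> \<and>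
      norm (remainder X Y Y' s t) \<le> C0 * (r + y' * x) * (t - s) powr (2 * \<eta>))"
    using pointwise_bounds by (elim exE conjE)
  obtain C1 where C1: "0 < C1" and H1: "\<forall>T m n X XX Y Y' x xx y y' r. rough_data \<alpha> \<beta> q T m n X XX Y Y' x xx y y' r \<longrightarrow>
    besov3_norm T (3 * \<alpha>) (\<beta> / 3) (q / 3) (incr2 (germ X XX Y Y')) \<le> ennreal (C1 * (r * x + y' * xx)) \<and>
    besov3_norm T (2 * \<alpha> + \<eta>) (\<beta> / 2) (q / 2) (incr2 (germ X XX Y Y')) \<le> ennreal (C1 * (r * x + y' * xx)) \<and>
    besov3_norm T (\<alpha> + 2 * \<eta>) \<beta> q (incr2 (germ X XX Y Y')) \<le> ennreal (C1 * ((r + y' * x) * x + (x\<^sup>2 + xx) * y'))"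
    using defect_norms by (elim exE conjE)
  obtain C2 where C2: "0 < C2" and H2: "\<forall>T m n X XX Y Y' x xx y y' r I. rough_data \<alpha> \<beta> q T m n X XX Y Y' x xx y y' r \<longrightarrow>
    sewn T (germ X XX Y Y') I \<longrightarrow>
    besov2_norm T (3 * \<alpha>) (\<beta> / 3) (q / 3) (\<lambda>s t. incr I s t - germ X XX Y Y' s t) \<le>
      ennreal C2 * besov3_norm T (3 * \<alpha>) (\<beta> / 3) (q / 3) (incr2 (germ X XX Y Y')) \<and>
    besov2_norm T (2 * \<alpha> + \<eta>) (\<beta> / 2) (q / 2) (\<lambda>s t. incr I s t - germ X XX Y Y' s t) \<le>
      ennreal C2 * besov3_norm T (2 * \<alpha> + \<eta>) (\<beta> / 2) (q / 2) (incr2 (germ X XX Y Y')) \<and>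
    besov2_norm T (\<alpha> + 2 * \<eta>) \<beta> q (\<lambda>s t. incr I s t - germ X XX Y Y' s t) \<le>
      ennreal C2 * besov3_norm T (\<alpha> + 2 * \<eta>) \<beta> q (incr2 (germ X XX Y Y'))"
    using sewn_estimates by (elim exE conjE)
  obtain C3 where C3: "0 < C3" and H3: "\<forall>T \<beta> a (\<Xi> :: real \<Rightarrow> real \<Rightarrow> nat fvec) \<Xi>'. 0 < \<beta> \<longrightarrow>
    continuous_on (simplex2 T) (\<lambda>(s, t). \<Xi> s t) \<longrightarrow> continuous_on (simplex2 T) (\<lambda>(s, t). \<Xi>' s t) \<longrightarrow>
    besov2_norm T a \<beta> q (\<lambda>s t. \<Xi> s t + \<Xi>' s t) \<le> ennreal C3 * (besov2_norm T a \<beta> q \<Xi> + besov2_norm T a \<beta> q \<Xi>')"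
    using besov2_triangle[OF q, where 'v = "nat fvec"] by (elim exE conjE)
  obtain C4 where C4: "0 < C4" and H4: "\<forall>(\<Xi> :: real \<Rightarrow> real \<Rightarrow> (nat \<times> nat) fvec) K a x. 0 \<le> K \<longrightarrow> 0 \<le> x \<longrightarrow>
    continuous_on (simplex2 T) (\<lambda>(s, t). \<Xi> s t) \<longrightarrow>
    (\<forall>s t. 0 \<le> s \<longrightarrow> s \<le> t \<longrightarrow> t \<le> T \<longrightarrow> norm (\<Xi> s t) \<le> K * (t - s) powr (2 * \<eta>)) \<longrightarrow>
    besov2_norm T (2 * a) (\<beta> / 2) (q / 2) \<Xi> \<le> ennreal x \<longrightarrow>
    besov2_norm T a \<beta> q \<Xi> \<le> ennreal (C4 * sqrt (K * x))"
    using besov2_sqrt[OF q \<beta> T less_imp_le[OF \<eta>(3)], where 'v = "(nat \<times> nat) fvec"] by (elim exE conjE)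
  \<comment> \<open>One summand for each of D, Y \<delta>X and Y' XX, in this order. The last two
    carry a further C3 because the quasi-triangle inequality is used twice.\<close>
  define c where "c = T powr (2 * \<eta>) * C2 * C1 * 2 + C3 * (1 + C0 * T powr \<eta>) + C3 * (1 + C0 * T powr \<eta>) * C4 * sqrt C0"
  have pieces: "0 \<le> T powr (2 * \<eta>) * C2 * C1 * 2" "0 < C3 * (1 + C0 * T powr \<eta>)" "0 \<le> C3 * (1 + C0 * T powr \<eta>) * C4 * sqrt C0"
    using C0 C1 C2 C3 C4 by (auto intro!: mult_pos_pos add_pos_nonneg mult_nonneg_nonneg add_nonneg_nonneg)
  then have c: "0 < c" unfolding c_def by linarith
  show ?thesis
  proof (intro exI[of _ "C3 * c"] conjI allI impI)
    fix m n X XX Y Y' x xx y y' r I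
    assume data: "rough_data \<alpha> \<beta> q T m n X XX Y Y' x xx y y' r" and I: "sewn T (germ X XX Y Y') I"
    interpret rough_data \<alpha> \<beta> q T m n X XX Y Y' x xx y y' r by (rule data)
    note pw = H0[rule_format, OF data]
    let ?D = "\<lambda>s t. incr I s t - \<Xi> s t" and ?P = "\<lambda>s t. app2 (Y' s) (XX s t)" and ?Q = "\<lambda>s t. app (Y s) (incr X s t)"
    define \<rho> where "\<rho> = x\<^sup>2 + xx"
    define B where "B = (norm (Y 0) + y + r) * x + (norm (Y' 0) + y') * \<rho>"
    have \<rho>: "0 \<le> \<rho>" "x * x \<le> \<rho>" "xx \<le> \<rho>" using nonneg by (auto simp: \<rho>_def power2_eq_square)
    have cI: "continuous_on {0..T} I" using I by (simp add: sewn_def)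
    have cD: "continuous_on (simplex2 T) (\<lambda>(s, t). ?D s t)"
      using continuous_on_diff[OF continuous_on_incr[OF cI] cGerm] by (simp add: case_prod_unfold)
    have cP: "continuous_on (simplex2 T) (\<lambda>(s, t). ?P s t)"
      unfolding case_prod_unfold using cXX[unfolded case_prod_unfold]
      by (intro app2.continuous_on continuous_on_simplex_path cY')
    have cQ: "continuous_on (simplex2 T) (\<lambda>(s, t). ?Q s t)"
      unfolding case_prod_unfold using continuous_on_incr[OF cX, unfolded case_prod_unfold]
      by (intro app.continuous_on continuous_on_simplex_path cY)
    have cQP: "continuous_on (simplex2 T) (\<lambda>(s, t). ?Q s t + ?P s t)"
      using continuous_on_add[OF cQ cP] by (simp add: case_prod_unfold)
    have nD: "besov2_norm T \<alpha> \<beta> q ?D \<le> ennreal (T powr (2 * \<eta>) * (C2 * (C1 * ((r + y' * x) * x + \<rho> * y'))))"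
    proof -
      have "besov2_norm T \<alpha> \<beta> q ?D \<le> ennreal (T powr (2 * \<eta>)) * besov2_norm T (\<alpha> + 2 * \<eta>) \<beta> q ?D"
        using \<eta> by (intro besov2_lower_exponent q) auto
      also have "\<dots> \<le> ennreal (T powr (2 * \<eta>)) * (ennreal C2 * besov3_norm T (\<alpha> + 2 * \<eta>) \<beta> q (incr2 \<Xi>))"
        using H2[rule_format, OF data I] by (intro mult_left_mono) auto
      also have "\<dots> \<le> ennreal (T powr (2 * \<eta>)) * (ennreal C2 * ennreal (C1 * ((r + y' * x) * x + \<rho> * y')))"
        using H1[rule_format, OF data] by (intro mult_left_mono) (auto simp: \<rho>_def)
      also have "\<dots> = ennreal (T powr (2 * \<eta>) * (C2 * (C1 * ((r + y' * x) * x + \<rho> * y'))))"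
        using C1 C2 nonneg \<rho> by (simp flip: ennreal_mult)
      finally show ?thesis .
    qed
    have nQ: "besov2_norm T \<alpha> \<beta> q ?Q \<le> ennreal ((norm (Y 0) + C0 * y * T powr \<eta>) * x)"
    proof -
      have "besov2_norm T \<alpha> \<beta> q ?Q \<le> ennreal (norm (Y 0) + C0 * y * T powr \<eta>) * besov2_norm T \<alpha> \<beta> q (incr X)"
      proof (rule besov2_dominated[OF q \<beta>])
        fix s t assume st: "0 \<le> s" "s \<le> t" "t \<le> T"
        have "norm (Y s) \<le> norm (Y 0) + C0 * y * T powr \<eta>"
          using pw[of 0 s] st C0 nonneg by (intro sup_bound[of Y s]) auto
        then show "norm (?Q s t) \<le> (norm (Y 0) + C0 * y * T powr \<eta>) * norm (incr X s t)"
          by (intro order.trans[OF norm_app_le] mult_right_mono) auto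
      qed (use C0 nonneg in auto)
      also have "\<dots> = ennreal ((norm (Y 0) + C0 * y * T powr \<eta>) * x)"
        using nX C0 nonneg unfolding besov_seminorm_def by (subst ennreal_mult) auto
      finally show ?thesis .
    qed
    have nP: "besov2_norm T \<alpha> \<beta> q ?P \<le> ennreal ((norm (Y' 0) + C0 * y' * T powr \<eta>) * (C4 * (sqrt C0 * \<rho>)))"
    proof -
      have "besov2_norm T \<alpha> \<beta> q ?P \<le> ennreal (norm (Y' 0) + C0 * y' * T powr \<eta>) * besov2_norm T \<alpha> \<beta> q XX"
      proof (rule besov2_dominated[OF q \<beta>])
        fix s t assume st: "0 \<le> s" "s \<le> t" "t \<le> T"
        have "norm (Y' s) \<le> norm (Y' 0) + C0 * y' * T powr \<eta>"
          using pw[of 0 s] st C0 nonneg by (intro sup_bound[of Y' s]) auto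
        then show "norm (?P s t) \<le> (norm (Y' 0) + C0 * y' * T powr \<eta>) * norm (XX s t)"
          by (intro order.trans[OF norm_app2_le] mult_right_mono) auto
      qed (use C0 nonneg in auto)
      also have "\<dots> \<le> ennreal (norm (Y' 0) + C0 * y' * T powr \<eta>) * ennreal (C4 * sqrt ((C0 * \<rho>) * xx))"
        using nXX pw nonneg C0 \<rho> by (intro mult_left_mono H4[rule_format] cXX) (auto simp: \<rho>_def)
      also have "\<dots> \<le> ennreal (norm (Y' 0) + C0 * y' * T powr \<eta>) * ennreal (C4 * (sqrt C0 * \<rho>))"
      proof (intro mult_left_mono ennreal_leI)
        \<comment> \<open>The geometric mean of the pointwise constant C0 \<rho> and the norm xx
          \<le> \<rho> is again of order \<rho>; the estimate keeps its homogeneity.\<close>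
        have "sqrt ((C0 * \<rho>) * xx) \<le> sqrt ((C0 * \<rho>) * \<rho>)"
          using \<rho> C0 by (intro real_sqrt_le_mono mult_left_mono) auto
        also have "\<dots> = sqrt C0 * \<rho>" using \<rho> by (simp add: real_sqrt_mult)
        finally show "sqrt ((C0 * \<rho>) * xx) \<le> sqrt C0 * \<rho>" .
      qed (use C4 in auto)
      also have "\<dots> = ennreal ((norm (Y' 0) + C0 * y' * T powr \<eta>) * (C4 * (sqrt C0 * \<rho>)))"
        using C0 C4 nonneg \<rho> by (simp flip: ennreal_mult ennreal_plus)
      finally show ?thesis .
    qed
    have "incr I = (\<lambda>s t. ?D s t + (?Q s t + ?P s t))"
      by (intro ext) (simp add: germ_def incr_def)
    then have "besov_seminorm T \<alpha> \<beta> q I \<le> ennreal C3 * (besov2_norm T \<alpha> \<beta> q ?D + besov2_norm T \<alpha> \<beta> q (\<lambda>s t. ?Q s t + ?P s t))"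
      using H3[rule_format, OF \<beta> cD cQP, of \<alpha>] by (simp add: besov_seminorm_def)
    also have "\<dots> \<le> ennreal C3 * (besov2_norm T \<alpha> \<beta> q ?D + ennreal C3 * (besov2_norm T \<alpha> \<beta> q ?Q + besov2_norm T \<alpha> \<beta> q ?P))"
      by (intro mult_left_mono add_left_mono H3[rule_format, OF \<beta> cQ cP]) simp
    also have "\<dots> \<le> ennreal C3 * (ennreal (T powr (2 * \<eta>) * (C2 * (C1 * ((r + y' * x) * x + \<rho> * y')))) +
        ennreal C3 * (ennreal ((norm (Y 0) + C0 * y * T powr \<eta>) * x) +
          ennreal ((norm (Y' 0) + C0 * y' * T powr \<eta>) * (C4 * (sqrt C0 * \<rho>)))))"
      by (intro mult_left_mono add_mono nD nQ nP) auto
    also have "\<dots> = ennreal (C3 * (T powr (2 * \<eta>) * (C2 * (C1 * ((r + y' * x) * x + \<rho> * y'))) +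
        C3 * ((norm (Y 0) + C0 * y * T powr \<eta>) * x + (norm (Y' 0) + C0 * y' * T powr \<eta>) * (C4 * (sqrt C0 * \<rho>)))))"
      using C0 C1 C2 C3 C4 nonneg \<rho> by (simp flip: ennreal_mult ennreal_plus)
    also have "\<dots> \<le> ennreal (C3 * c * B)"
    proof (rule ennreal_leI)
      have B0: "0 \<le> (norm (Y 0) + y + r) * x" "0 \<le> (norm (Y' 0) + y') * \<rho>" using nonneg \<rho> by auto
      have add: "u + v + w \<le> 2 * (a + b)" if "u \<le> a" "v \<le> w" "w \<le> b" "0 \<le> a" "0 \<le> b" for u v w a b :: real
        using that by simp
      have "(r + y' * x) * x + \<rho> * y' = r * x + y' * (x * x) + y' * \<rho>" by (simp add: algebra_simps)
      also have "\<dots> \<le> 2 * B"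
        unfolding B_def using nonneg \<rho> B0 by (intro add) (auto intro!: mult_right_mono mult_left_mono)
      finally have b1: "(r + y' * x) * x + \<rho> * y' \<le> 2 * B" .
      have gen: "u + C0 * v * T powr \<eta> \<le> (1 + C0 * T powr \<eta>) * (u + v)" if "0 \<le> u" "0 \<le> v" for u v
        using that C0 by (simp add: algebra_simps)
      have "(norm (Y 0) + C0 * y * T powr \<eta>) * x \<le> (1 + C0 * T powr \<eta>) * (norm (Y 0) + y) * x"
        using nonneg by (intro mult_right_mono gen) auto
      also have "\<dots> \<le> (1 + C0 * T powr \<eta>) * (norm (Y 0) + y + r) * x"
        using nonneg C0 by (intro mult_right_mono mult_left_mono) auto
      also have "\<dots> \<le> (1 + C0 * T powr \<eta>) * B"
        using B0 C0 unfolding B_def mult.assoc by (intro mult_left_mono) auto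
      finally have b2: "(norm (Y 0) + C0 * y * T powr \<eta>) * x \<le> (1 + C0 * T powr \<eta>) * B" .
      have "(norm (Y' 0) + C0 * y' * T powr \<eta>) * (C4 * (sqrt C0 * \<rho>)) \<le>
          (1 + C0 * T powr \<eta>) * (norm (Y' 0) + y') * (C4 * (sqrt C0 * \<rho>))"
        using nonneg C4 C0 \<rho> by (intro mult_right_mono gen) auto
      also have "\<dots> = (1 + C0 * T powr \<eta>) * (C4 * sqrt C0) * ((norm (Y' 0) + y') * \<rho>)" by simp
      also have "\<dots> \<le> (1 + C0 * T powr \<eta>) * (C4 * sqrt C0) * B"
        using B0 C0 C4 unfolding B_def by (intro mult_left_mono) auto
      finally have b3: "(norm (Y' 0) + C0 * y' * T powr \<eta>) * (C4 * (sqrt C0 * \<rho>)) \<le> (1 + C0 * T powr \<eta>) * (C4 * sqrt C0) * B" .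
      have "C3 * (T powr (2 * \<eta>) * (C2 * (C1 * ((r + y' * x) * x + \<rho> * y'))) +
          C3 * ((norm (Y 0) + C0 * y * T powr \<eta>) * x + (norm (Y' 0) + C0 * y' * T powr \<eta>) * (C4 * (sqrt C0 * \<rho>)))) \<le>
          C3 * (T powr (2 * \<eta>) * (C2 * (C1 * (2 * B))) + C3 * ((1 + C0 * T powr \<eta>) * B + (1 + C0 * T powr \<eta>) * (C4 * sqrt C0) * B))"
        using C1 C2 C3 by (intro mult_left_mono add_mono b1 b2 b3) auto
      also have "\<dots> = C3 * c * B" by (simp add: c_def algebra_simps)
      finally show "C3 * (T powr (2 * \<eta>) * (C2 * (C1 * ((r + y' * x) * x + \<rho> * y'))) +
          C3 * ((norm (Y 0) + C0 * y * T powr \<eta>) * x + (norm (Y' 0) + C0 * y' * T powr \<eta>) * (C4 * (sqrt C0 * \<rho>)))) \<le> C3 * c * B" .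
    qed
    finally show "besov_seminorm T \<alpha> \<beta> q I \<le> ennreal (C3 * c * ((norm (Y 0) + y + r) * x + (norm (Y' 0) + y') * (x\<^sup>2 + xx)))"
      by (simp add: B_def \<rho>_def)
  qed (use C3 c in simp)
qed

end

section \<open>Choice of the exponent; properties of the rough integral\<close>

lemma exists_rough_setup:
  assumes "1 / 3 < \<alpha>" "0 < \<beta>" "0 < q"
  shows "\<exists>k. rough_setup \<alpha> \<beta> q k \<and> B \<le> real k * \<beta>"
proof -
  \<comment> \<open>Lower bounds for k\<beta>: 2 for the index \<beta>/2, 1/(\<alpha> - 1/3) for
    \<eta> > 1/3, and the free bound B, which later brings \<eta> above \<alpha> - 1/p.\<close>
  define b where "b = max (max 2 B) (1 / (\<alpha> - 1 / 3))"
  obtain k where "b / \<beta> < real k" using reals_Archimedean2 by blast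
  then have k: "b < real k * \<beta>" using assms by (simp add: field_simps)
  then have "2 < real k * \<beta>" "B < real k * \<beta>" and k': "1 / (\<alpha> - 1 / 3) < real k * \<beta>"
    by (auto simp: b_def)
  moreover have "1 < real k * \<beta> * (\<alpha> - 1 / 3)"
    using k' assms(1) by (subst (asm) pos_divide_less_eq) auto
  then have "1 / (real k * \<beta>) < \<alpha> - 1 / 3"
    using calculation(1) by (subst pos_divide_less_eq) (auto simp: mult.commute)
  then have "1 < 3 * (\<alpha> - 1 / (real k * \<beta>))"
    unfolding right_diff_distrib by linarith
  ultimately show ?thesis
    unfolding rough_setup_def using assms by (intro exI[of _ k]) auto
qed

context rough_data
begin

lemma rough_path_norm_eq: "rough_path_norm T \<alpha> \<beta> q X XX = ennreal (x + sqrt xx)"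
  using nonneg by (simp add: rough_path_norm_def nX nXX epowr_ennreal powr_half_sqrt)

lemma controlled_seminorm_eq: "controlled_seminorm T \<alpha> \<beta> q X Y Y' = ennreal (y' + r)"
  using nonneg by (simp add: controlled_seminorm_def nY' nR)

lemma square_le: "x\<^sup>2 + xx \<le> (x + sqrt xx)\<^sup>2" "xx \<le> (x + sqrt xx)\<^sup>2"
  using nonneg by (auto simp: power2_sum)

end

context rough_setup
begin

lemma rough_integral_is_sewing:
  assumes "rough_data \<alpha> \<beta> q T m n X XX Y Y' x xx y y' r"
  shows "is_sewing T \<alpha> \<beta> q (euclid {..<m}) (germ X XX Y Y') (rough_integral T \<alpha> \<beta> q m X XX Y Y')"
  unfolding rough_integral_def by (rule theI'[OF is_sewing_ex1[OF assms]])

text \<open>The Orlicz norm of a continuous function on a compact interval is finite, so only the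
  seminorm has to be checked.\<close>

lemma besov_memI:
  fixes f :: "real \<Rightarrow> 'v::real_normed_vector"
  assumes T: "0 < T" and f: "continuous_on {0..T} f" "\<And>t. 0 \<le> t \<Longrightarrow> t \<le> T \<Longrightarrow> f t \<in> V" "besov_seminorm T \<alpha> \<beta> q f < \<infinity>"
  shows "f \<in> besov T \<alpha> \<beta> q V"
proof -
  have "bounded (f ` {0..T})" by (intro compact_imp_bounded compact_continuous_image f) simp
  then obtain K where K: "0 < K" "\<forall>t\<in>{0..T}. norm (f t) \<le> K" by (auto simp: bounded_pos)
  obtain C where "\<forall>b\<le>T. \<forall>(g :: real \<Rightarrow> 'v) K.
    0 \<le> K \<longrightarrow> (\<forall>r\<in>{0..b}. norm (g r) \<le> K) \<longrightarrow> orlicz_norm \<beta> {0..b} g \<le> ennreal (C * K)"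
    using orlicz_norm_bounded[OF \<beta> T, where 'v = 'v] by (elim exE conjE)
  then have "orlicz_norm \<beta> {0..T} f \<le> ennreal (C * K)" using K by simp
  also have "\<dots> < \<infinity>" by simp
  finally show ?thesis using f by (auto simp: besov_def)
qed

lemma rough_integral_controlled:
  assumes data: "rough_data \<alpha> \<beta> q T m n X XX Y Y' x xx y y' r"
    and Y: "Y \<in> besov T \<alpha> \<beta> q (euclid ({..<m} \<times> {..<n}))"
  shows "(rough_integral T \<alpha> \<beta> q m X XX Y Y', Y) \<in> controlled T \<alpha> \<beta> q n X {..<m}"
proof -
  interpret rough_data \<alpha> \<beta> q T m n X XX Y Y' x xx y y' r by (rule data)
  define I where "I = rough_integral T \<alpha> \<beta> q m X XX Y Y'"
  have I: "is_sewing T \<alpha> \<beta> q (euclid {..<m}) \<Xi> I"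
    unfolding I_def by (rule rough_integral_is_sewing[OF data])
  then have cI: "continuous_on {0..T} I" and vI: "\<And>t. 0 \<le> t \<Longrightarrow> t \<le> T \<Longrightarrow> I t \<in> euclid {..<m}"
    by (auto simp: is_sewing_def)
  note sewn = is_sewing_sewn[OF data I]
  obtain C where "besov_seminorm T \<alpha> \<beta> q I \<le>
      ennreal (C * ((norm (Y 0) + y + r) * x + (norm (Y' 0) + y') * (x\<^sup>2 + xx)))"
    using seminorm_estimate[OF T] data sewn by meson
  also have "\<dots> < \<infinity>" by simp
  finally have "I \<in> besov T \<alpha> \<beta> q (euclid {..<m})"
    using T cI vI by (intro besov_memI) auto
  moreover have "remainder X I Y \<in> besov2 T (2 * \<alpha>) (\<beta> / 2) (q / 2) (euclid {..<m})"
  proof (rule besov2_memI)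
    show "continuous_on (simplex2 T) (\<lambda>(s, t). remainder X I Y s t)"
      unfolding remainder_def incr_def case_prod_unfold
      by (intro continuous_on_diff app.continuous_on continuous_on_simplex_path cX cY cI)
    show "remainder X I Y s t \<in> euclid {..<m}" if "0 \<le> s" "s \<le> t" "t \<le> T" for s t
      unfolding remainder_def incr_def using that
      by (intro euclid_closed app_in_euclid[of _ _ "{..<n}"] vI valY) auto
    obtain C where "besov2_norm T (2 * \<alpha>) (\<beta> / 2) (q / 2) (remainder X I Y) \<le>
        ennreal (C * (norm (Y' 0) * xx + T powr \<eta> * (r * x + y' * xx)))"
      using remainder_estimate data sewn by meson
    also have "\<dots> < \<infinity>" by simp
    finally show "besov2_norm T (2 * \<alpha>) (\<beta> / 2) (q / 2) (remainder X I Y) < \<infinity>" .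
  qed
  ultimately show ?thesis using Y by (simp add: controlled_def I_def)
qed

section \<open>Linearity\<close>

lemma besov_combination:
  fixes f g :: "real \<Rightarrow> 'i fvec"
  assumes T: "0 < T" and f: "f \<in> besov T \<alpha> \<beta> q (euclid J)" and g: "g \<in> besov T \<alpha> \<beta> q (euclid J)"
  shows "(\<lambda>t. a *\<^sub>R f t + b *\<^sub>R g t) \<in> besov T \<alpha> \<beta> q (euclid J)"
proof (rule besov_memI[OF T])
  have c: "continuous_on {0..T} f" "continuous_on {0..T} g" using f g by (auto simp: besov_def)
  then show "continuous_on {0..T} (\<lambda>t. a *\<^sub>R f t + b *\<^sub>R g t)" by (intro continuous_intros)
  show "a *\<^sub>R f t + b *\<^sub>R g t \<in> euclid J" if "0 \<le> t" "t \<le> T" for t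
    using f g that by (intro euclid_closed) (auto simp: besov_def)
  have "besov2_norm T \<alpha> \<beta> q (incr (\<lambda>t. a *\<^sub>R f t + b *\<^sub>R g t)) < \<infinity>"
  proof (rule besov2_combination_finite[OF q \<beta> _ _ continuous_on_incr[OF c(1)] continuous_on_incr[OF c(2)], of "\<bar>a\<bar>" "\<bar>b\<bar>"])
    show "norm (incr (\<lambda>t. a *\<^sub>R f t + b *\<^sub>R g t) s t) \<le> \<bar>a\<bar> * norm (incr f s t) + \<bar>b\<bar> * norm (incr g s t)" for s t
    proof -
      have "incr (\<lambda>t. a *\<^sub>R f t + b *\<^sub>R g t) s t = a *\<^sub>R incr f s t + b *\<^sub>R incr g s t"
        by (simp add: incr_def algebra_simps)
      then show ?thesis using norm_triangle_ineq[of "a *\<^sub>R incr f s t" "b *\<^sub>R incr g s t"] by simp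
    qed
  qed (use f g in \<open>auto simp: besov_def besov_seminorm_def\<close>)
  then show "besov_seminorm T \<alpha> \<beta> q (\<lambda>t. a *\<^sub>R f t + b *\<^sub>R g t) < \<infinity>" by (simp add: besov_seminorm_def)
qed

lemma controlled_combination:
  fixes Y Z :: "real \<Rightarrow> 'i fvec"
  assumes T: "0 < T" and cX: "continuous_on {0..T} X"
    and Y: "(Y, Y') \<in> controlled T \<alpha> \<beta> q n X J" and Z: "(Z, Z') \<in> controlled T \<alpha> \<beta> q n X J"
  shows "(\<lambda>t. a *\<^sub>R Y t + b *\<^sub>R Z t, \<lambda>t. a *\<^sub>R Y' t + b *\<^sub>R Z' t) \<in> controlled T \<alpha> \<beta> q n X J"
proof -
  let ?RY = "remainder X Y Y'" and ?RZ = "remainder X Z Z'"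
  have cR: "continuous_on (simplex2 T) (\<lambda>(s, t). remainder X W W' s t)"
    if "(W, W') \<in> controlled T \<alpha> \<beta> q n X J" for W :: "real \<Rightarrow> 'i fvec" and W'
  proof -
    have "continuous_on {0..T} W" "continuous_on {0..T} W'" using that by (auto simp: controlled_def besov_def)
    then show ?thesis
      unfolding remainder_def incr_def case_prod_unfold
      by (intro continuous_on_diff app.continuous_on continuous_on_simplex_path cX)
  qed
  have R: "remainder X (\<lambda>t. a *\<^sub>R Y t + b *\<^sub>R Z t) (\<lambda>t. a *\<^sub>R Y' t + b *\<^sub>R Z' t) = (\<lambda>s t. a *\<^sub>R ?RY s t + b *\<^sub>R ?RZ s t)"
    by (intro ext) (simp add: remainder_def incr_def app.add_left app.scaleR_left algebra_simps)
  have "(\<lambda>s t. a *\<^sub>R ?RY s t + b *\<^sub>R ?RZ s t) \<in> besov2 T (2 * \<alpha>) (\<beta> / 2) (q / 2) (euclid J)"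
  proof (rule besov2_memI)
    show "continuous_on (simplex2 T) (\<lambda>(s, t). a *\<^sub>R ?RY s t + b *\<^sub>R ?RZ s t)"
      using cR[OF Y] cR[OF Z] unfolding case_prod_unfold by (intro continuous_intros)
    show "a *\<^sub>R ?RY s t + b *\<^sub>R ?RZ s t \<in> euclid J" if "0 \<le> s" "s \<le> t" "t \<le> T" for s t
      using Y Z that by (intro euclid_closed) (auto simp: controlled_def besov2_def simplex2_def)
    show "besov2_norm T (2 * \<alpha>) (\<beta> / 2) (q / 2) (\<lambda>s t. a *\<^sub>R ?RY s t + b *\<^sub>R ?RZ s t) < \<infinity>"
    proof (rule besov2_combination_finite[OF q_pos(1) \<beta>_pos(1) _ _ cR[OF Y] cR[OF Z], of "\<bar>a\<bar>" "\<bar>b\<bar>"])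
      show "norm (a *\<^sub>R ?RY s t + b *\<^sub>R ?RZ s t) \<le> \<bar>a\<bar> * norm (?RY s t) + \<bar>b\<bar> * norm (?RZ s t)" for s t
        using norm_triangle_ineq[of "a *\<^sub>R ?RY s t" "b *\<^sub>R ?RZ s t"] by simp
    qed (use Y Z in \<open>auto simp: controlled_def besov2_def\<close>)
  qed
  then show ?thesis
    using Y Z unfolding R[symmetric] by (auto simp: controlled_def intro: besov_combination[OF T])
qed

text \<open>The germ is linear in (Y, Y'), so the combination of two sewings is a sewing of the
  combined germ; uniqueness identifies it.\<close>

lemma rough_integral_combination:
  assumes T: "0 < T" and XX: "(X, XX) \<in> rough_paths T \<alpha> \<beta> q n"
    and Y: "(Y, Y') \<in> controlled T \<alpha> \<beta> q n X ({..<m} \<times> {..<n})"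
    and Z: "(Z, Z') \<in> controlled T \<alpha> \<beta> q n X ({..<m} \<times> {..<n})" and t: "t \<in> {0..T}"
  shows "rough_integral T \<alpha> \<beta> q m X XX (\<lambda>t. a *\<^sub>R Y t + b *\<^sub>R Z t) (\<lambda>t. a *\<^sub>R Y' t + b *\<^sub>R Z' t) t =
    a *\<^sub>R rough_integral T \<alpha> \<beta> q m X XX Y Y' t + b *\<^sub>R rough_integral T \<alpha> \<beta> q m X XX Z Z' t"
proof -
  let ?W = "\<lambda>t. a *\<^sub>R Y t + b *\<^sub>R Z t" and ?W' = "\<lambda>t. a *\<^sub>R Y' t + b *\<^sub>R Z' t"
  have "continuous_on {0..T} X" using XX by (auto simp: rough_paths_def besov_def)
  note dW = controlled_rough_data[OF T XX controlled_combination[OF T this Y Z, of a b]]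
  note dY = controlled_rough_data[OF T XX Y] and dZ = controlled_rough_data[OF T XX Z]
  define I where "I = rough_integral T \<alpha> \<beta> q m X XX Y Y'"
  define J where "J = rough_integral T \<alpha> \<beta> q m X XX Z Z'"
  \<comment> \<open>Restricting makes L extensional, as \<open>is_sewing\<close> requires.\<close>
  define L where "L = restrict (\<lambda>t. a *\<^sub>R I t + b *\<^sub>R J t) {0..T}"
  have I: "is_sewing T \<alpha> \<beta> q (euclid {..<m}) (germ X XX Y Y') I"
    and J: "is_sewing T \<alpha> \<beta> q (euclid {..<m}) (germ X XX Z Z') J"
    unfolding I_def J_def by (rule rough_integral_is_sewing[OF dY], rule rough_integral_is_sewing[OF dZ])
  have cI: "continuous_on {0..T} I" and cJ: "continuous_on {0..T} J" using I J by (auto simp: is_sewing_def)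
  have cL: "continuous_on {0..T} L"
    by (rule continuous_on_eq[of _ "\<lambda>t. a *\<^sub>R I t + b *\<^sub>R J t"]) (auto simp: L_def intro!: continuous_intros cI cJ)
  have eq: "incr L s t - germ X XX ?W ?W' s t =
      a *\<^sub>R (incr I s t - germ X XX Y Y' s t) + b *\<^sub>R (incr J s t - germ X XX Z Z' s t)"
    if "0 \<le> s" "s \<le> t" "t \<le> T" for s t
    using that by (simp add: L_def incr_def germ_def app.add_left app.scaleR_left app2.add_left app2.scaleR_left algebra_simps)
  have "is_sewing T \<alpha> \<beta> q (euclid {..<m}) (germ X XX ?W ?W') L"
    unfolding is_sewing_def
  proof (intro conjI cL besov2_memI)
    show "L \<in> {0..T} \<rightarrow>\<^sub>E euclid {..<m}"
      unfolding L_def using I J by (auto simp: is_sewing_def intro!: euclid_closed)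
    show "L 0 = 0" using I J T by (auto simp: is_sewing_def L_def)
    show "continuous_on (simplex2 T) (\<lambda>(s, t). incr L s t - germ X XX ?W ?W' s t)"
      using continuous_on_diff[OF continuous_on_incr[OF cL] rough_data.cGerm[OF dW]] by (simp add: case_prod_unfold)
    show "incr L s t - germ X XX ?W ?W' s t \<in> euclid {..<m}" if "0 \<le> s" "s \<le> t" "t \<le> T" for s t
      unfolding eq[OF that] using I J that
      by (intro euclid_closed(2,4)) (auto simp: is_sewing_def besov2_def simplex2_def)
    show "besov2_norm T (3 * \<alpha>) (\<beta> / 3) (q / 3) (\<lambda>s t. incr L s t - germ X XX ?W ?W' s t) < \<infinity>"
    proof (rule besov2_combination_finite[OF q_pos(2) \<beta>_pos(2), of "\<bar>a\<bar>" "\<bar>b\<bar>"])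
      show "continuous_on (simplex2 T) (\<lambda>(s, t). incr I s t - germ X XX Y Y' s t)"
        using continuous_on_diff[OF continuous_on_incr[OF cI] rough_data.cGerm[OF dY]] by (simp add: case_prod_unfold)
      show "continuous_on (simplex2 T) (\<lambda>(s, t). incr J s t - germ X XX Z Z' s t)"
        using continuous_on_diff[OF continuous_on_incr[OF cJ] rough_data.cGerm[OF dZ]] by (simp add: case_prod_unfold)
      show "norm (incr L s t - germ X XX ?W ?W' s t) \<le>
          \<bar>a\<bar> * norm (incr I s t - germ X XX Y Y' s t) + \<bar>b\<bar> * norm (incr J s t - germ X XX Z Z' s t)"
        if "0 \<le> s" "s \<le> t" "t \<le> T" for s t
        unfolding eq[OF that]
        using norm_triangle_ineq[of "a *\<^sub>R (incr I s t - germ X XX Y Y' s t)" "b *\<^sub>R (incr J s t - germ X XX Z Z' s t)"] by simp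
    qed (use I J in \<open>auto simp: is_sewing_def besov2_def\<close>)
  qed
  with rough_integral_is_sewing[OF dW] have "rough_integral T \<alpha> \<beta> q m X XX ?W ?W' = L"
    by (rule is_sewing_unique[OF T rough_data.cGerm[OF dW]])
  then show ?thesis using t by (simp add: L_def I_def J_def)
qed

end

text \<open>k is chosen afresh for each p with k\<beta> \<ge> p, so that \<eta> \<ge> \<alpha> -
  1/p. The surplus T^e joins the constant, which stays nondecreasing in T because e \<ge> 0. The
  statement uses \<open>is_sewing\<close>, since \<open>sewn\<close> depends on k.\<close>

lemma remainder_bound:
  assumes "1 / 3 < \<alpha>" "0 < \<beta>" "0 < q" "0 < p"
  shows "\<exists>C e. 0 < C \<and> 0 \<le> e \<and> (\<forall>T m n X XX Y Y' x xx y y' r I.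
    rough_data \<alpha> \<beta> q T m n X XX Y Y' x xx y y' r \<longrightarrow>
    is_sewing T \<alpha> \<beta> q (euclid {..<m}) (germ X XX Y Y') I \<longrightarrow>
    besov2_norm T (2 * \<alpha>) (\<beta> / 2) (q / 2) (remainder X I Y) \<le>
      ennreal (C * (1 + T powr e) * (norm (Y' 0) * xx + T powr (\<alpha> - 1 / p) * (r * x + y' * xx))))"
proof -
  obtain k where "rough_setup \<alpha> \<beta> q k" and p: "p \<le> real k * \<beta>"
    using exists_rough_setup[OF assms(1-3)] by blast
  then interpret rough_setup \<alpha> \<beta> q k by simp
  define e where "e = 1 / p - 1 / (real k * \<beta>)"
  have e: "0 \<le> e" "\<eta> = e + (\<alpha> - 1 / p)"
    using p assms(4) by (auto simp: e_def \<eta>_def intro!: divide_left_mono)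
  obtain C where C: "0 < C" and H: "\<forall>T m n X XX Y Y' x xx y y' r I. rough_data \<alpha> \<beta> q T m n X XX Y Y' x xx y y' r \<longrightarrow>
    sewn T (germ X XX Y Y') I \<longrightarrow>
    besov2_norm T (2 * \<alpha>) (\<beta> / 2) (q / 2) (remainder X I Y) \<le>
      ennreal (C * (norm (Y' 0) * xx + T powr \<eta> * (r * x + y' * xx)))"
    using remainder_estimate by (elim exE conjE)
  show ?thesis
  proof (rule exI[of _ C], rule exI[of _ e], intro conjI allI impI C e(1))
    fix T m n X XX Y Y' x xx y y' r I
    assume data: "rough_data \<alpha> \<beta> q T m n X XX Y Y' x xx y y' r"
      and I: "is_sewing T \<alpha> \<beta> q (euclid {..<m}) (germ X XX Y Y') I"
    interpret rough_data \<alpha> \<beta> q T m n X XX Y Y' x xx y y' r by (rule data)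
    define u v where "u = norm (Y' 0) * xx" and "v = r * x + y' * xx"
    have uv: "0 \<le> u" "0 \<le> v" using nonneg by (auto simp: u_def v_def)
    have pw: "T powr \<eta> = T powr e * T powr (\<alpha> - 1 / p)" unfolding e(2) by (rule powr_add)
    have "u + T powr \<eta> * v \<le> (1 + T powr e) * (u + T powr (\<alpha> - 1 / p) * v)"
      using uv by (simp add: pw algebra_simps)
    then have "C * (u + T powr \<eta> * v) \<le> C * ((1 + T powr e) * (u + T powr (\<alpha> - 1 / p) * v))"
      using C by (intro mult_left_mono) auto
    with H[rule_format, OF data is_sewing_sewn[OF data I]]
    show "besov2_norm T (2 * \<alpha>) (\<beta> / 2) (q / 2) (remainder X I Y) \<le>
      ennreal (C * (1 + T powr e) * (norm (Y' 0) * xx + T powr (\<alpha> - 1 / p) * (r * x + y' * xx)))"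
      unfolding u_def[symmetric] v_def[symmetric] mult.assoc by (rule order.trans[OF _ ennreal_leI])
  qed
qed

section \<open>From real estimates back to extended norms\<close>

context rough_data
begin

lemma defect_bound:
  assumes "0 < c" "0 < d"
    and "besov3_norm T (3 * \<alpha>) (\<beta> / 3) (q / 3) (incr2 \<Xi>) \<le> ennreal (d * (r * x + y' * xx))"
  shows "ennreal c * besov3_norm T (3 * \<alpha>) (\<beta> / 3) (q / 3) (incr2 \<Xi>) \<le>
    ennreal (c * d) * (besov2_norm T (2 * \<alpha>) (\<beta> / 2) (q / 2) R * besov_seminorm T \<alpha> \<beta> q X +
      besov_seminorm T \<alpha> \<beta> q Y' * rough_path_norm T \<alpha> \<beta> q X XX ^ 2)"
proof -
  define \<rho> where "\<rho> = x + sqrt xx"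
  have \<rho>: "0 \<le> \<rho>" "xx \<le> \<rho>\<^sup>2" using nonneg square_le by (auto simp: \<rho>_def)
  have "ennreal c * besov3_norm T (3 * \<alpha>) (\<beta> / 3) (q / 3) (incr2 \<Xi>) \<le> ennreal c * ennreal (d * (r * x + y' * xx))"
    by (intro mult_left_mono assms) simp
  also have "\<dots> \<le> ennreal c * ennreal (d * (r * x + y' * \<rho>\<^sup>2))"
    using \<rho> nonneg assms by (intro mult_left_mono ennreal_leI add_left_mono) auto
  also have "\<dots> = ennreal (c * d) * (ennreal r * ennreal x + ennreal y' * ennreal \<rho> ^ 2)"
    using \<rho> nonneg assms by (simp add: mult.assoc ennreal_power flip: ennreal_mult ennreal_plus)
  finally show ?thesis by (simp add: nR nX nY' rough_path_norm_eq \<rho>_def)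
qed

lemma seminorm_bound:
  assumes "0 < c"
    and "N \<le> ennreal (c * ((norm (Y 0) + y + r) * x + (norm (Y' 0) + y') * (x\<^sup>2 + xx)))"
  shows "N \<le> ennreal c * ((ennreal (norm (Y 0)) + besov_seminorm T \<alpha> \<beta> q Y +
        besov2_norm T (2 * \<alpha>) (\<beta> / 2) (q / 2) R) * besov_seminorm T \<alpha> \<beta> q X +
      (ennreal (norm (Y' 0)) + besov_seminorm T \<alpha> \<beta> q Y') * rough_path_norm T \<alpha> \<beta> q X XX ^ 2)"
proof -
  define \<rho> where "\<rho> = x + sqrt xx"
  have \<rho>: "0 \<le> \<rho>" "x\<^sup>2 + xx \<le> \<rho>\<^sup>2" using nonneg square_le by (auto simp: \<rho>_def)
  note assms(2)
  also have "ennreal (c * ((norm (Y 0) + y + r) * x + (norm (Y' 0) + y') * (x\<^sup>2 + xx))) \<le>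
      ennreal (c * ((norm (Y 0) + y + r) * x + (norm (Y' 0) + y') * \<rho>\<^sup>2))"
    using \<rho> nonneg assms by (intro ennreal_leI mult_left_mono add_left_mono) auto
  also have "\<dots> = ennreal c * ((ennreal (norm (Y 0)) + ennreal y + ennreal r) * ennreal x +
      (ennreal (norm (Y' 0)) + ennreal y') * ennreal \<rho> ^ 2)"
    using \<rho> nonneg assms(1) by (simp add: ennreal_power flip: ennreal_mult ennreal_plus)
  finally show ?thesis by (simp add: nR nX nY nY' rough_path_norm_eq \<rho>_def)
qed

lemma remainder_norm_bound:
  assumes "0 < c" and "N \<le> ennreal (c * (norm (Y' 0) * xx + b * (r * x + y' * xx)))" "0 \<le> b"
  shows "N \<le> ennreal c * (ennreal (norm (Y' 0)) * besov2_norm T (2 * \<alpha>) (\<beta> / 2) (q / 2) XX +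
      ennreal b * max (rough_path_norm T \<alpha> \<beta> q X XX) (rough_path_norm T \<alpha> \<beta> q X XX ^ 2) *
        controlled_seminorm T \<alpha> \<beta> q X Y Y')"
proof -
  define \<rho> where "\<rho> = x + sqrt xx"
  \<comment> \<open>x \<le> \<rho> and xx \<le> \<rho>^2, so the maximum covers the first-order and
    the second-order factor at once.\<close>
  define M where "M = max \<rho> (\<rho>\<^sup>2)"
  have \<rho>: "0 \<le> \<rho>" "x \<le> \<rho>" "xx \<le> \<rho>\<^sup>2" using nonneg square_le by (auto simp: \<rho>_def)
  then have M: "0 \<le> M" "x \<le> M" "xx \<le> M" by (auto simp: M_def)
  have m: "max (ennreal \<rho>) (ennreal \<rho> ^ 2) = ennreal M"
    using \<rho> by (simp add: M_def ennreal_power max_of_mono monoI ennreal_leI)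
  have "r * x + y' * xx \<le> r * M + y' * M"
    using nonneg M by (intro add_mono mult_left_mono) auto
  then have *: "r * x + y' * xx \<le> M * (y' + r)" by (simp add: algebra_simps)
  note assms(2)
  also have "ennreal (c * (norm (Y' 0) * xx + b * (r * x + y' * xx))) \<le>
      ennreal (c * (norm (Y' 0) * xx + b * (M * (y' + r))))"
    using nonneg assms by (intro ennreal_leI mult_left_mono add_left_mono *) auto
  also have "\<dots> = ennreal c * (ennreal (norm (Y' 0)) * ennreal xx + ennreal b * ennreal M * ennreal (y' + r))"
    using M nonneg assms(1,3) by (simp add: mult.assoc flip: ennreal_mult ennreal_plus)
  finally show ?thesis by (simp only: nXX rough_path_norm_eq controlled_seminorm_eq \<rho>_def[symmetric] m)
qed

end

section \<open>Choice of the constants and conclusion\<close>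

theorem theorem4p15:
  fixes \<alpha> \<beta> :: real and q :: ennreal
  assumes "1 / 3 < \<alpha>" and "\<alpha> \<le> 1 / 2" and "0 < \<beta>" and "0 < q"
  shows "\<exists>(C :: real \<Rightarrow> real) (C' :: real \<Rightarrow> real) (C'' :: real \<Rightarrow> real) (K :: real \<Rightarrow> real \<Rightarrow> real).
    (\<forall>T>0. 0 < C T \<and> 0 < C' T \<and> 0 < C'' T) \<and>
    (\<forall>p>3 / \<alpha>. \<forall>T>0. 0 < K p T) \<and>
    mono_on {0<..} C \<and> mono_on {0<..} C' \<and> (\<forall>p>3 / \<alpha>. mono_on {0<..} (K p)) \<and>
    (\<forall>T>0. \<forall>m\<ge>1. \<forall>n\<ge>1. \<forall>X XX. (X, XX) \<in> rough_paths T \<alpha> \<beta> q n \<longrightarrow>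
      (\<forall>Y Y'. (Y, Y') \<in> controlled T \<alpha> \<beta> q n X ({..<m} \<times> {..<n}) \<longrightarrow>
        (let \<Xi> = germ X XX Y Y';
             I = rough_integral T \<alpha> \<beta> q m X XX Y Y';
             nX = besov_seminorm T \<alpha> \<beta> q X;
             nXX = besov2_norm T (2 * \<alpha>) (\<beta> / 2) (q / 2) XX;
             nrp = rough_path_norm T \<alpha> \<beta> q X XX;
             nY = besov_seminorm T \<alpha> \<beta> q Y;
             nY' = besov_seminorm T \<alpha> \<beta> q Y';
             nR = besov2_norm T (2 * \<alpha>) (\<beta> / 2) (q / 2) (remainder X Y Y')
         in
          (\<exists>!J. is_sewing T \<alpha> \<beta> q (euclid {..<m}) \<Xi> J) \<and>
          is_sewing T \<alpha> \<beta> q (euclid {..<m}) \<Xi> I \<and>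
          (I, Y) \<in> controlled T \<alpha> \<beta> q n X {..<m} \<and>
          (\<forall>(r::ennreal) (\<pi> :: nat \<Rightarrow> real list).
             ennreal (1 / (3 * \<alpha>)) < r \<and> q / 3 \<le> r \<and>
             (\<forall>N. is_partition (\<pi> N)) \<and> (\<lambda>N. mesh (\<pi> N)) \<longlonglongrightarrow> 0 \<longrightarrow>
             (\<lambda>N. besov2_norm T (3 * \<alpha>) (\<beta> / 3) r
                (\<lambda>s t. incr I s t - riemann_sum (\<pi> N) \<Xi> s t)) \<longlonglongrightarrow> 0) \<and>
          besov2_norm T (3 * \<alpha>) (\<beta> / 3) (q / 3) (\<lambda>s t. incr I s t - \<Xi> s t)
            \<le> ennreal (C T) * besov3_norm T (3 * \<alpha>) (\<beta> / 3) (q / 3) (incr2 \<Xi>) \<and>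
          ennreal (C T) * besov3_norm T (3 * \<alpha>) (\<beta> / 3) (q / 3) (incr2 \<Xi>)
            \<le> ennreal (C' T) * (nR * nX + nY' * nrp ^ 2) \<and>
          besov_seminorm T \<alpha> \<beta> q I
            \<le> ennreal (C'' T) *
                ((ennreal (norm (Y 0)) + nY + nR) * nX + (ennreal (norm (Y' 0)) + nY') * nrp ^ 2) \<and>
          (\<forall>p>3 / \<alpha>.
             besov2_norm T (2 * \<alpha>) (\<beta> / 2) (q / 2) (remainder X I Y)
               \<le> ennreal (K p T) *
                   (ennreal (norm (Y' 0)) * nXX +
                    ennreal (T powr (\<alpha> - 1 / p)) * max nrp (nrp ^ 2) *
                      controlled_seminorm T \<alpha> \<beta> q X Y Y')))) \<and>
      (\<forall>Y Y' Z Z' a b.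
         (Y, Y') \<in> controlled T \<alpha> \<beta> q n X ({..<m} \<times> {..<n}) \<and>
         (Z, Z') \<in> controlled T \<alpha> \<beta> q n X ({..<m} \<times> {..<n}) \<longrightarrow>
         (\<lambda>t. a *\<^sub>R Y t + b *\<^sub>R Z t, \<lambda>t. a *\<^sub>R Y' t + b *\<^sub>R Z' t)
           \<in> controlled T \<alpha> \<beta> q n X ({..<m} \<times> {..<n}) \<and>
         (\<forall>t\<in>{0..T}.
            rough_integral T \<alpha> \<beta> q m X XX
                (\<lambda>t. a *\<^sub>R Y t + b *\<^sub>R Z t) (\<lambda>t. a *\<^sub>R Y' t + b *\<^sub>R Z' t) t =
              a *\<^sub>R rough_integral T \<alpha> \<beta> q m X XX Y Y' t +
              b *\<^sub>R rough_integral T \<alpha> \<beta> q m X XX Z Z' t)))"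
proof -
  obtain k where "rough_setup \<alpha> \<beta> q k" using exists_rough_setup[OF assms(1,3,4)] by blast
  then interpret rough_setup \<alpha> \<beta> q k .
  obtain C1 where C1: "0 < C1" and H1: "\<forall>T m n X XX Y Y' x xx y y' r. rough_data \<alpha> \<beta> q T m n X XX Y Y' x xx y y' r \<longrightarrow>
    besov3_norm T (3 * \<alpha>) (\<beta> / 3) (q / 3) (incr2 (germ X XX Y Y')) \<le> ennreal (C1 * (r * x + y' * xx)) \<and>
    besov3_norm T (2 * \<alpha> + \<eta>) (\<beta> / 2) (q / 2) (incr2 (germ X XX Y Y')) \<le> ennreal (C1 * (r * x + y' * xx)) \<and>
    besov3_norm T (\<alpha> + 2 * \<eta>) \<beta> q (incr2 (germ X XX Y Y')) \<le> ennreal (C1 * ((r + y' * x) * x + (x\<^sup>2 + xx) * y'))"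
    using defect_norms by (elim exE conjE)
  obtain C2 where C2: "0 < C2" and H2: "\<forall>T m n X XX Y Y' x xx y y' r I. rough_data \<alpha> \<beta> q T m n X XX Y Y' x xx y y' r \<longrightarrow>
    sewn T (germ X XX Y Y') I \<longrightarrow>
    besov2_norm T (3 * \<alpha>) (\<beta> / 3) (q / 3) (\<lambda>s t. incr I s t - germ X XX Y Y' s t) \<le>
      ennreal C2 * besov3_norm T (3 * \<alpha>) (\<beta> / 3) (q / 3) (incr2 (germ X XX Y Y')) \<and>
    besov2_norm T (2 * \<alpha> + \<eta>) (\<beta> / 2) (q / 2) (\<lambda>s t. incr I s t - germ X XX Y Y' s t) \<le>
      ennreal C2 * besov3_norm T (2 * \<alpha> + \<eta>) (\<beta> / 2) (q / 2) (incr2 (germ X XX Y Y')) \<and>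
    besov2_norm T (\<alpha> + 2 * \<eta>) \<beta> q (\<lambda>s t. incr I s t - germ X XX Y Y' s t) \<le>
      ennreal C2 * besov3_norm T (\<alpha> + 2 * \<eta>) \<beta> q (incr2 (germ X XX Y Y'))"
    using sewn_estimates by (elim exE conjE)
  \<comment> \<open>P, and Q below, name the properties of the constants depending on T or on p, so
    that \<open>C3\<close>, \<open>C4\<close> and \<open>e\<close> can be obtained as choice
    functions.\<close>
  define P where "P T C \<longleftrightarrow> 0 < C \<and> (\<forall>m n X XX Y Y' x xx y y' r I. rough_data \<alpha> \<beta> q T m n X XX Y Y' x xx y y' r \<longrightarrow>
    sewn T (germ X XX Y Y') I \<longrightarrow>
    besov_seminorm T \<alpha> \<beta> q I \<le>
      ennreal (C * ((norm (Y 0) + y + r) * x + (norm (Y' 0) + y') * (x\<^sup>2 + xx))))" for T C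
  have "\<forall>T>0. \<exists>C. P T C" using seminorm_estimate unfolding P_def by blast
  then obtain C3 where C3: "\<And>T. 0 < T \<Longrightarrow> P T (C3 T)" by metis
  define Q where "Q p C e \<longleftrightarrow> 0 < C \<and> 0 \<le> e \<and> (\<forall>T m n X XX Y Y' x xx y y' r I.
    rough_data \<alpha> \<beta> q T m n X XX Y Y' x xx y y' r \<longrightarrow>
    is_sewing T \<alpha> \<beta> q (euclid {..<m}) (germ X XX Y Y') I \<longrightarrow>
    besov2_norm T (2 * \<alpha>) (\<beta> / 2) (q / 2) (remainder X I Y) \<le>
      ennreal (C * (1 + T powr e) * (norm (Y' 0) * xx + T powr (\<alpha> - 1 / p) * (r * x + y' * xx))))" for p C e
  have p0: "0 < p" if "3 / \<alpha> < p" for p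
    using that \<alpha> by (intro less_trans[OF _ that]) auto
  have "\<forall>p>3 / \<alpha>. \<exists>C e. Q p C e" using remainder_bound[OF \<alpha> \<beta> q p0] unfolding Q_def by blast
  then obtain C4 e where C4: "\<And>p. 3 / \<alpha> < p \<Longrightarrow> Q p (C4 p) (e p)" by metis
  have K: "0 < C4 p * (1 + T powr e p)" if "3 / \<alpha> < p" for p T
    using C4[OF that] by (auto simp: Q_def intro!: mult_pos_pos add_pos_nonneg)
  show ?thesis
    unfolding Let_def
  \<comment> \<open>C and C' are constant in T. C'' is a choice function of T, for which no
    monotonicity is claimed. K is explicit, and nondecreasing in T because e p \<ge> 0.\<close>
  proof (rule exI[of _ "\<lambda>_. C2"], rule exI[of _ "\<lambda>_. C2 * C1"], rule exI[of _ C3],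
      rule exI[of _ "\<lambda>p T. C4 p * (1 + T powr e p)"], intro conjI allI impI)
    show "0 < C3 T" if "0 < T" for T using C3[OF that] by (simp add: P_def)
    show "mono_on {0<..} (\<lambda>T. C4 p * (1 + T powr e p))" if "3 / \<alpha> < p" for p
      using C4[OF that] by (auto simp: Q_def intro!: mono_onI mult_left_mono powr_mono2)
  next
    fix T :: real and m n :: nat and X XX Y Y'
    assume T: "0 < T" and XX: "(X, XX) \<in> rough_paths T \<alpha> \<beta> q n"
      and Y: "(Y, Y') \<in> controlled T \<alpha> \<beta> q n X ({..<m} \<times> {..<n})"
    let ?I = "rough_integral T \<alpha> \<beta> q m X XX Y Y'"
    obtain x xx y y' r where data: "rough_data \<alpha> \<beta> q T m n X XX Y Y' x xx y y' r"
      using controlled_rough_data[OF T XX Y] by blast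
    then interpret rough_data \<alpha> \<beta> q T m n X XX Y Y' x xx y y' r .
    have I: "is_sewing T \<alpha> \<beta> q (euclid {..<m}) \<Xi> ?I" by (rule rough_integral_is_sewing[OF data])
    note sewn = is_sewing_sewn[OF data I]
    show "\<exists>!J. is_sewing T \<alpha> \<beta> q (euclid {..<m}) \<Xi> J" by (rule is_sewing_ex1[OF data])
    show "is_sewing T \<alpha> \<beta> q (euclid {..<m}) \<Xi> ?I" by (rule I)
    show "(?I, Y) \<in> controlled T \<alpha> \<beta> q n X {..<m}"
      using Y by (intro rough_integral_controlled[OF data]) (auto simp: controlled_def)
    show "besov2_norm T (3 * \<alpha>) (\<beta> / 3) (q / 3) (\<lambda>s t. incr ?I s t - \<Xi> s t)
        \<le> ennreal C2 * besov3_norm T (3 * \<alpha>) (\<beta> / 3) (q / 3) (incr2 \<Xi>)"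
      using H2[rule_format, OF data sewn] by blast
    show "ennreal C2 * besov3_norm T (3 * \<alpha>) (\<beta> / 3) (q / 3) (incr2 \<Xi>) \<le>
      ennreal (C2 * C1) * (besov2_norm T (2 * \<alpha>) (\<beta> / 2) (q / 2) R * besov_seminorm T \<alpha> \<beta> q X +
        besov_seminorm T \<alpha> \<beta> q Y' * rough_path_norm T \<alpha> \<beta> q X XX ^ 2)"
      using H1[rule_format, OF data] by (intro defect_bound C1 C2) blast
    show "besov_seminorm T \<alpha> \<beta> q ?I \<le> ennreal (C3 T) * ((ennreal (norm (Y 0)) + besov_seminorm T \<alpha> \<beta> q Y +
          besov2_norm T (2 * \<alpha>) (\<beta> / 2) (q / 2) R) * besov_seminorm T \<alpha> \<beta> q X +
        (ennreal (norm (Y' 0)) + besov_seminorm T \<alpha> \<beta> q Y') * rough_path_norm T \<alpha> \<beta> q X XX ^ 2)"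
      using C3[OF T, unfolded P_def] data sewn by (intro seminorm_bound) auto
    show "besov2_norm T (2 * \<alpha>) (\<beta> / 2) (q / 2) (remainder X ?I Y) \<le>
        ennreal (C4 p * (1 + T powr e p)) *
          (ennreal (norm (Y' 0)) * besov2_norm T (2 * \<alpha>) (\<beta> / 2) (q / 2) XX +
           ennreal (T powr (\<alpha> - 1 / p)) * max (rough_path_norm T \<alpha> \<beta> q X XX) (rough_path_norm T \<alpha> \<beta> q X XX ^ 2) *
             controlled_seminorm T \<alpha> \<beta> q X Y Y')"
      if p: "3 / \<alpha> < p" for p
      using C4[OF p, unfolded Q_def] data I by (intro remainder_norm_bound K p) auto
    fix \<rho> \<pi>
    assume "ennreal (1 / (3 * \<alpha>)) < \<rho> \<and> q / 3 \<le> \<rho> \<and> (\<forall>N. is_partition (\<pi> N)) \<and> (\<lambda>N. mesh (\<pi> N)) \<longlonglongrightarrow> 0"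
    moreover have "continuous_on (simplex2 T) (\<lambda>(s, t). incr ?I s t - \<Xi> s t)"
      using continuous_on_diff[OF continuous_on_incr cGerm, of ?I] I by (simp add: case_prod_unfold is_sewing_def)
    ultimately show "(\<lambda>N. besov2_norm T (3 * \<alpha>) (\<beta> / 3) \<rho> (\<lambda>s t. incr ?I s t - riemann_sum (\<pi> N) \<Xi> s t)) \<longlonglongrightarrow> 0"
      using I \<alpha> by (intro riemann_sums_converge[OF T \<beta>_pos(2) _ q_pos(2)]) (auto simp: is_sewing_def besov2_def)
  next
    fix T a b :: real and m n :: nat and X XX Y Y' Z Z'
    assume T: "0 < T" and XX: "(X, XX) \<in> rough_paths T \<alpha> \<beta> q n"
      and YZ: "(Y, Y') \<in> controlled T \<alpha> \<beta> q n X ({..<m} \<times> {..<n}) \<and> (Z, Z') \<in> controlled T \<alpha> \<beta> q n X ({..<m} \<times> {..<n})"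
    have "continuous_on {0..T} X" using XX by (auto simp: rough_paths_def besov_def)
    then show "(\<lambda>t. a *\<^sub>R Y t + b *\<^sub>R Z t, \<lambda>t. a *\<^sub>R Y' t + b *\<^sub>R Z' t) \<in> controlled T \<alpha> \<beta> q n X ({..<m} \<times> {..<n})"
      using YZ by (intro controlled_combination T) auto
    show "\<forall>t\<in>{0..T}. rough_integral T \<alpha> \<beta> q m X XX
          (\<lambda>t. a *\<^sub>R Y t + b *\<^sub>R Z t) (\<lambda>t. a *\<^sub>R Y' t + b *\<^sub>R Z' t) t =
        a *\<^sub>R rough_integral T \<alpha> \<beta> q m X XX Y Y' t + b *\<^sub>R rough_integral T \<alpha> \<beta> q m X XX Z Z' t"
      using YZ by (intro ballI rough_integral_combination[OF T XX]) auto
  qed (use C1 C2 K in \<open>auto intro: mono_onI\<close>)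
qed

end
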